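(* Let $n\ge 1$, let $A:\mathbb{R}^n\to\mathbb{M}_n$ be a bounded and elliptic (measurable) matrix-valued function with constants $0<\lambda\le 1\le\Lambda<\infty$, let $p\in[\frac n2,\infty]$ with $p>1$, let $V\in RH_p$ with uniform $RH_p$ constant $C_V$, and let $d_V:\mathbb{R}^n\times\mathbb{R}^n\to\mathbb{R}_{\ge 0}$ denote the Agmon distance function associated to $V$. There exists a constant $\gamma_0=\gamma_0(n,\lambda,\Lambda,p,C_V)>0$, depending only on the indicated quantities, such that the following holds. If $u:\mathbb{R}^n\to\mathbb{R}$ is a weak solution to $-\operatorname{div}(A\nabla u)+Vu=0$ in $\mathbb{R}^n$ and there is an increasing, unbounded sequence $\{R_j\}_{j=1}^\infty\subset\mathbb{R}_+$ for which $$\lim_{j\to\infty}\int_{A(R_j,R_j+1)}|u(x)|^2e^{-2\gamma d_V(x,0)}\,dx=0$$ for some $\gamma<\gamma_0$, then $u\equiv 0$.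
   Context: Bounded and elliptic: $\mathbb{M}_n$ is the set of real $n\times n$ matrices, and for a.e. $x\in\mathbb{R}^n$ and all $\xi,\zeta\in\mathbb{R}^n$, $|A(x)\xi\cdot\zeta|\le\Lambda|\xi||\zeta|$ and $A(x)\xi\cdot\xi\ge\lambda|\xi|^2$ ($A$ need not be symmetric). Annuli: $A(r_1,r_2)=B_{r_2}(0)\setminus\overline{B_{r_1}(0)}$ is the open annulus centered at the origin, where $B_r(x)$ is the ball of radius $r$ centered at $x$. Reverse Hölder class: for $1<p\le\infty$, $V\in RH_p$ means $V\in L^p_{\mathrm{loc}}(\mathbb{R}^n)$, $V>0$ a.e., and there is a constant $C_V$ such that for every ball $B\subset\mathbb{R}^n$, $\left(\frac1{|B|}\int_B V^p\right)^{1/p}\le C_V\frac1{|B|}\int_B V$ (for $p=\infty$ the left side is $\|V\|_{L^\infty(B)}$); $C_V$ is called the uniform $RH_p$ constant. Weak solution: $u\in H^1_{\mathrm{loc}}(\mathbb{R}^n)$ such that $\int_{\mathbb{R}^n}A\nabla u\cdot\nabla\varphi+Vu\varphi=0$ for every $\varphi\in H^1_0(\mathbb{R}^n)$ with compact support. Agmon distance: set $\psi_V(x,r)=r^2\frac1{|B_r(x)|}\int_{B_r(x)}V(y)\,dy$ and define $m_V:\mathbb{R}^n\to(0,\infty)$ by $\frac1{m_V(x)}=\sup\{r>0:\psi_V(x,r)\le1\}$. (If $p=\frac n2$, Gehring's lemma gives $V\in RH_q$ for some $q>\frac n2$, so $m_V$ is well defined.) Then $d_V(x,y)=\inf_{\sigma}\int_0^1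 m_V(\sigma(t))|\sigma'(t)|\,dt$, the infimum being over all absolutely continuous $\sigma:[0,1]\to\mathbb{R}^n$ with $\sigma(0)=x$, $\sigma(1)=y$. *)

theory Defs
  imports "HOL-Analysis.Analysis" "HOL-Probability.Essential_Supremum"
begin

text \<open>Everything is taken with respect to (complete) Lebesgue measure; functions stand for
their almost-everywhere classes. Exponents \<open>p\<close> are extended reals, \<open>p = \<infinity>\<close> included.\<close>

section \<open>Lebesgue and Sobolev spaces on \<open>\<real>\<^sup>n\<close>\<close>

definition Lp_on :: "ereal \<Rightarrow> (real^'n) set \<Rightarrow> (real^'n \<Rightarrow> 'b::euclidean_space) \<Rightarrow> bool" where
  "Lp_on p S f \<longleftrightarrow> f \<in> borel_measurable (lebesgue_on S) \<and>
     (if p = \<infinity> then esssup (lebesgue_on S) (\<lambda>x. ereal (norm (f x))) < \<infinity>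
      else integrable (lebesgue_on S) (\<lambda>x. norm (f x) powr real_of_ereal p))"

definition Lp_loc :: "ereal \<Rightarrow> (real^'n \<Rightarrow> 'b::euclidean_space) \<Rightarrow> bool" where
  "Lp_loc p f \<longleftrightarrow> (\<forall>K. compact K \<longrightarrow> Lp_on p K f)"

definition partial_deriv :: "'n \<Rightarrow> (real^'n \<Rightarrow> real) \<Rightarrow> real^'n \<Rightarrow> real" where
  "partial_deriv i f x = frechet_derivative f (at x) (axis i 1)"

primrec Ck :: "nat \<Rightarrow> (real^'n \<Rightarrow> real) \<Rightarrow> bool" where
  "Ck 0 f = continuous_on UNIV f"
| "Ck (Suc k) f = ((\<forall>x. f differentiable (at x)) \<and> (\<forall>i. Ck k (partial_deriv i f)))"

definition test_function :: "(real^'n \<Rightarrow> real) \<Rightarrow> bool" where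
  "test_function f \<longleftrightarrow> (\<forall>k. Ck k f) \<and> compact (closure {x. f x \<noteq> 0})"

definition has_weak_gradient :: "(real^'n \<Rightarrow> real) \<Rightarrow> (real^'n \<Rightarrow> real^'n) \<Rightarrow> bool" where
  "has_weak_gradient u G \<longleftrightarrow> Lp_loc 1 u \<and> Lp_loc 1 G \<and>
     (\<forall>\<phi> i. test_function \<phi> \<longrightarrow>
        (LINT x|lebesgue. u x * partial_deriv i \<phi> x) = - (LINT x|lebesgue. G x $ i * \<phi> x))"

text \<open>A weak gradient is unique up to null sets, and \<open>weak_grad\<close> picks a representative. All
conditions below in which it occurs are insensitive to the choice.\<close>

definition weak_grad :: "(real^'n \<Rightarrow> real) \<Rightarrow> real^'n \<Rightarrow> real^'n" where
  "weak_grad u = (SOME G. has_weak_gradient u G)"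

definition H1 :: "(real^'n \<Rightarrow> real) \<Rightarrow> bool" where
  "H1 u \<longleftrightarrow> Lp_on 2 UNIV u \<and> (\<exists>G. has_weak_gradient u G \<and> Lp_on 2 UNIV G)"

definition H1_loc :: "(real^'n \<Rightarrow> real) \<Rightarrow> bool" where
  "H1_loc u \<longleftrightarrow> Lp_loc 2 u \<and> (\<exists>G. has_weak_gradient u G \<and> Lp_loc 2 G)"

definition H1_norm :: "(real^'n \<Rightarrow> real) \<Rightarrow> real" where
  "H1_norm u = sqrt (LINT x|lebesgue. (u x)\<^sup>2 + (norm (weak_grad u x))\<^sup>2)"

text \<open>The closure of the test functions in \<open>H1\<close>.\<close>

definition H1_0 :: "(real^'n \<Rightarrow> real) \<Rightarrow> bool" where
  "H1_0 u \<longleftrightarrow> H1 u \<and>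
     (\<exists>\<psi>. (\<forall>k. test_function (\<psi> k)) \<and> (\<lambda>k::nat. H1_norm (\<lambda>x. u x - \<psi> k x)) \<longlonglongrightarrow> 0)"

definition compactly_supported :: "(real^'n \<Rightarrow> real) \<Rightarrow> bool" where
  "compactly_supported u \<longleftrightarrow> (\<exists>K. compact K \<and> (AE x in lebesgue. x \<notin> K \<longrightarrow> u x = 0))"

section \<open>The equation\<close>

definition bounded_elliptic :: "real \<Rightarrow> real \<Rightarrow> (real^'n \<Rightarrow> real^'n^'n) \<Rightarrow> bool" where
  "bounded_elliptic lam Lam A \<longleftrightarrow> A \<in> borel_measurable lebesgue \<and>
     (AE x in lebesgue. \<forall>\<xi> \<zeta>. \<bar>(A x *v \<xi>) \<bullet> \<zeta>\<bar> \<le> Lam * norm \<xi> * norm \<zeta> \<and>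
                              (A x *v \<xi>) \<bullet> \<xi> \<ge> lam * (norm \<xi>)\<^sup>2)"

definition weak_solution ::
    "(real^'n \<Rightarrow> real^'n^'n) \<Rightarrow> (real^'n \<Rightarrow> real) \<Rightarrow> (real^'n \<Rightarrow> real) \<Rightarrow> bool" where
  "weak_solution A V u \<longleftrightarrow> H1_loc u \<and>
     (\<forall>\<phi>. H1_0 \<phi> \<and> compactly_supported \<phi> \<longrightarrow>
        (LINT x|lebesgue. (A x *v weak_grad u x) \<bullet> weak_grad \<phi> x + V x * u x * \<phi> x) = 0)"

section \<open>Reverse Hoelder potentials and the Agmon distance\<close>

definition average :: "(real^'n) set \<Rightarrow> (real^'n \<Rightarrow> real) \<Rightarrow> real" where
  "average B f = (LINT x:B|lebesgue. f x) / measure lebesgue B"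

definition Lp_average :: "ereal \<Rightarrow> (real^'n) set \<Rightarrow> (real^'n \<Rightarrow> real) \<Rightarrow> ereal" where
  "Lp_average p B V =
     (if p = \<infinity> then esssup (lebesgue_on B) (\<lambda>x. ereal \<bar>V x\<bar>)
      else ereal (average B (\<lambda>x. \<bar>V x\<bar> powr real_of_ereal p) powr (1 / real_of_ereal p)))"

text \<open>\<open>reverse_holder p C V\<close>: \<open>V\<close> is in the class \<open>RH\<^sub>p\<close>, with uniform constant \<open>C\<close>.\<close>

definition reverse_holder :: "ereal \<Rightarrow> real \<Rightarrow> (real^'n \<Rightarrow> real) \<Rightarrow> bool" where
  "reverse_holder p C V \<longleftrightarrow> Lp_loc p V \<and> (AE x in lebesgue. V x > 0) \<and>
     (\<forall>x r. r > 0 \<longrightarrow> Lp_average p (ball x r) V \<le> ereal (C * average (ball x r) V))"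

definition agmon_psi :: "(real^'n \<Rightarrow> real) \<Rightarrow> real^'n \<Rightarrow> real \<Rightarrow> real" where
  "agmon_psi V x r = r\<^sup>2 * average (ball x r) V"

text \<open>For \<open>V\<close> in \<open>RH\<^sub>p\<close> with \<open>p \<ge> n/2\<close> and \<open>p > 1\<close>, the set below is nonempty and bounded.\<close>

definition agmon_m :: "(real^'n \<Rightarrow> real) \<Rightarrow> real^'n \<Rightarrow> real" where
  "agmon_m V x = 1 / Sup {r. r > 0 \<and> agmon_psi V x r \<le> 1}"

text \<open>Finite families of non-overlapping subintervals of \<open>[a, b]\<close> are given as divisions of
their unions; a member \<open>I\<close> of such a family is \<open>[Inf I, Sup I]\<close>.\<close>

definition abs_continuous_on_interval :: "real \<Rightarrow> real \<Rightarrow> (real \<Rightarrow> 'a::euclidean_space) \<Rightarrow> bool" where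
  "abs_continuous_on_interval a b f \<longleftrightarrow>
     (\<forall>e>0. \<exists>d>0. \<forall>\<D>. \<D> division_of \<Union>\<D> \<and> \<Union>\<D> \<subseteq> {a..b} \<and> (\<Sum>I\<in>\<D>. Sup I - Inf I) < d \<longrightarrow>
        (\<Sum>I\<in>\<D>. norm (f (Sup I) - f (Inf I))) < e)"

definition agmon_length :: "(real^'n \<Rightarrow> real) \<Rightarrow> (real \<Rightarrow> real^'n) \<Rightarrow> ennreal" where
  "agmon_length V \<sigma> = (\<integral>\<^sup>+t. ennreal (agmon_m V (\<sigma> t) *
       norm (vector_derivative \<sigma> (at t within {0..1}))) \<partial>lebesgue_on {0..1})"

text \<open>The infimum is taken in \<open>[0, \<infinity>]\<close>; it is finite for the potentials considered here, since
\<open>m\<^sub>V\<close> is then locally bounded.\<close>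

definition agmon_dist :: "(real^'n \<Rightarrow> real) \<Rightarrow> real^'n \<Rightarrow> real^'n \<Rightarrow> real" where
  "agmon_dist V x y = enn2real
     (INF \<sigma>\<in>{\<sigma>. abs_continuous_on_interval 0 1 \<sigma> \<and> \<sigma> 0 = x \<and> \<sigma> 1 = y}. agmon_length V \<sigma>)"

definition annulus :: "real \<Rightarrow> real \<Rightarrow> (real^'n) set" where
  "annulus r1 r2 = ball 0 r2 - closure (ball 0 r1)"

end

theory Submission
  imports Defs "HOL-Computational_Algebra.Polynomial"
begin

text \<open>Let \<open>r(x) = 1 / m\<^sub>V(x)\<close> be the critical radius. Choose a smooth \<open>g\<close> with
\<open>|\<gamma> g - \<gamma> d\<^sub>V(\<cdot>, 0)| \<le> 1\<close> and \<open>|\<nabla>g| \<le> \<Gamma> / r\<close> on a large ball, which is possible since \<open>r\<close> varies slowly, and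
a cutoff \<open>\<eta>\<close> that equals 1 on \<open>B\<^sub>R\<close> and vanishes outside \<open>B\<^sub>R\<^sub>+\<^sub>1\<close>. Testing the equation with
\<open>\<psi>\<^sup>2 u\<close>, where \<open>\<psi> = \<eta> e^(-\<gamma> g)\<close>, bounds the energy \<open>\<integral> |\<nabla>(\<psi> u)|\<^sup>2 + V (\<psi> u)\<^sup>2\<close> by a multiple of
\<open>\<integral> u\<^sup>2 |\<nabla>\<psi>|\<^sup>2\<close>, hence by the integral over the annulus plus a multiple of \<open>\<gamma>\<^sup>2 \<integral> (\<psi> u)\<^sup>2 / r\<^sup>2\<close>. The
Fefferman--Phong inequality \<open>\<integral> f\<^sup>2 / r\<^sup>2 \<le> K \<integral> |\<nabla>f|\<^sup>2 + V f\<^sup>2\<close> absorbs the last term for small \<open>\<gamma>\<close>, and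
letting \<open>R = R\<^sub>j\<close> tend to infinity gives \<open>u = 0\<close>. Gehring's lemma is not needed: the decay of
\<open>\<psi>\<^sub>V(x, r)\<close> as \<open>r\<close> tends to 0 follows directly from the reverse Hoelder inequality.\<close>

section \<open>Smooth functions\<close>

text \<open>Since \<gamma>0 may depend only on n, \<lambda>, \<Lambda>, p and C_V, the
  slow-variation constant \<Gamma> and the Fefferman-Phong constant K must be fixed before V is
  known. All that is known of V is the reverse Hoelder inequality. It forces V^p to spread out, so
  each shrinking of a ball by \<open>rh_L\<close> loses a factor \<open>rh_theta\<close> < 1 of its
  integral; at the endpoint p = n/2 the powers of r cancel and this loss is the whole source of
  decay. The Fefferman-Phong inequality is proved without a covering: every x carries its own
  averaging ball of radius comparable to r(x), and slow variation permits Tonelli over these balls.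
  Two qualitative facts guard against the integral 0 of a non-integrable function and against
  absorbing an infinite quantity: V u^2 is locally integrable, and r is locally bounded below. Their
  constants may depend on V, as they never enter \<gamma>0. Tonelli and translations work best for
  Borel functions on \<open>lborel\<close>, so potential and solution are replaced by Borel
  representatives; p = \<infinity> is lowered to n + 1, and a negative \<gamma> is raised to
  0.\<close>

definition smooth :: "(real^'n \<Rightarrow> real) \<Rightarrow> bool" where
  "smooth f \<longleftrightarrow> (\<forall>k. Ck k f)"

definition grad :: "(real^'n \<Rightarrow> real) \<Rightarrow> real^'n \<Rightarrow> real^'n" where
  "grad f x = (\<chi> i. partial_deriv i f x)"

lemma grad_nth [simp]: "grad f x $ i = partial_deriv i f x"
  by (simp add: grad_def)

lemma partial_deriv_eq: "(f has_derivative f') (at x) \<Longrightarrow> partial_deriv i f x = f' (axis i 1)"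
  unfolding partial_deriv_def by (metis frechet_derivative_at)

lemma has_derivative_grad:
  fixes f :: "real^'n \<Rightarrow> real"
  assumes "f differentiable (at x)"
  shows "(f has_derivative (\<lambda>h. grad f x \<bullet> h)) (at x)"
proof -
  obtain f' where f': "(f has_derivative f') (at x)"
    using assms by (auto simp: differentiable_def)
  interpret bounded_linear f' using f' by (rule has_derivative_bounded_linear)
  have "f' h = grad f x \<bullet> h" for h
  proof -
    have "f' h = f' (\<Sum>i\<in>UNIV. h $ i *\<^sub>R axis i 1)"
      by (metis (no_types, lifting) basis_expansion scalar_mult_eq_scaleR sum.cong)
    also have "\<dots> = (\<Sum>i\<in>UNIV. h $ i * f' (axis i 1))"
      by (simp add: sum scaleR)
    also have "\<dots> = grad f x \<bullet> h"
      by (simp add: inner_vec_def partial_deriv_eq[OF f'] mult.commute)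
    finally show ?thesis .
  qed
  then have "f' = (\<lambda>h. grad f x \<bullet> h)" by (rule ext)
  with f' show ?thesis by simp
qed

lemma grad_unique:
  assumes "(f has_derivative (\<lambda>h. v \<bullet> h)) (at x)"
  shows "grad f x = v"
  by (simp add: vec_eq_iff partial_deriv_eq[OF assms] inner_axis)

lemma Ck_Suc_imp: "Ck (Suc k) f \<Longrightarrow> Ck k f"
proof (induction k arbitrary: f)
  case 0
  then show ?case
    by (auto simp: continuous_on_eq_continuous_at differentiable_imp_continuous_within)
next
  case (Suc k)
  then have "Ck (Suc k) (partial_deriv i f)" for i by (simp add: Suc.prems)
  then have "Ck k (partial_deriv i f)" for i by (rule Suc.IH)
  then show ?case using Suc.prems by simp
qed

lemma Ck_imp_diff: "Ck (Suc k) f \<Longrightarrow> f differentiable (at x)"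
  by simp

section \<open>Algebra, composition and affine substitution for \<open>Ck\<close>\<close>

lemma Ck_const [simp]: "Ck k (\<lambda>x::real^'n. c)"
proof (induction k arbitrary: c)
  case (Suc k)
  have "partial_deriv i (\<lambda>x::real^'n. c) = (\<lambda>x. 0)" for i
    by (rule ext) (subst partial_deriv_eq[of _ "\<lambda>_. 0"]; simp)
  with Suc show ?case by simp
qed simp

lemma Ck_add: "Ck k f \<Longrightarrow> Ck k g \<Longrightarrow> Ck k (\<lambda>x. f x + g x)"
proof (induction k arbitrary: f g)
  case 0
  then show ?case by (auto intro: continuous_intros)
next
  case (Suc k)
  have "partial_deriv i (\<lambda>x. f x + g x) = (\<lambda>x. partial_deriv i f x + partial_deriv i g x)" for i
  proof
    fix x
    have "((\<lambda>x. f x + g x) has_derivative (\<lambda>h. grad f x \<bullet> h + grad g x \<bullet> h)) (at x)"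
      using Suc.prems by (intro has_derivative_add has_derivative_grad Ck_imp_diff)
    from partial_deriv_eq[OF this, of i]
    show "partial_deriv i (\<lambda>x. f x + g x) x = partial_deriv i f x + partial_deriv i g x"
      by (simp add: inner_axis)
  qed
  with Suc show ?case by (auto intro: differentiable_add)
qed

lemma partial_deriv_mult:
  assumes "f differentiable (at x)" "g differentiable (at x)"
  shows "partial_deriv i (\<lambda>x. f x * g x) x = f x * partial_deriv i g x + partial_deriv i f x * g x"
proof -
  have "((\<lambda>x. f x * g x) has_derivative (\<lambda>h. f x * (grad g x \<bullet> h) + (grad f x \<bullet> h) * g x)) (at x)"
    using assms by (intro has_derivative_mult has_derivative_grad)
  from partial_deriv_eq[OF this, of i] show ?thesis by (simp add: inner_axis)
qed

lemma Ck_mult: "Ck k f \<Longrightarrow> Ck k g \<Longrightarrow> Ck k (\<lambda>x. f x * g x)"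
proof (induction k arbitrary: f g)
  case 0
  then show ?case by (auto intro: continuous_intros)
next
  case (Suc k)
  have "partial_deriv i (\<lambda>x. f x * g x) = (\<lambda>x. f x * partial_deriv i g x + partial_deriv i f x * g x)" for i
    using Suc.prems by (auto simp: partial_deriv_mult)
  moreover have "Ck k f" "Ck k g" using Suc.prems Ck_Suc_imp by blast+
  ultimately show ?case using Suc by (auto intro!: differentiable_mult Ck_add)
qed

lemma Ck_nth: "Ck k (\<lambda>x::real^'n. x $ j)"
proof (cases k)
  case 0
  then show ?thesis by (auto intro: continuous_intros)
next
  case (Suc m)
  have d: "((\<lambda>x::real^'n. x $ j) has_derivative (\<lambda>h. h $ j)) (at x)" for x
    by (intro bounded_linear_imp_has_derivative bounded_linear_vec_nth)
  have "partial_deriv i (\<lambda>x::real^'n. x $ j) = (\<lambda>x. axis i 1 $ j)" for i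
    using partial_deriv_eq[OF d] by auto
  then show ?thesis using d Suc by (auto simp: differentiable_def)
qed

text \<open>The outer function enters as a whole sequence of successive derivatives, because the
  induction on k passes from \<open>h m\<close> to \<open>h (Suc m)\<close>. The instances are the
  constant sequence \<open>exp\<close> and the sequence \<open>flat_exp\<close> behind the bump
  function.\<close>

lemma Ck_chain:
  assumes h: "\<And>m t. (h m has_real_derivative h (Suc m) t) (at t)"
  shows "Ck k f \<Longrightarrow> Ck k (\<lambda>x. h m (f x))"
proof (induction k arbitrary: f m)
  case 0
  have "continuous_on UNIV (h m)"
    using h by (meson DERIV_continuous_on DERIV_subset top_greatest)
  with 0 show ?case by (auto intro: continuous_on_compose2)
next
  case (Suc k)
  have d: "((\<lambda>x. h m (f x)) has_derivative (\<lambda>v. h (Suc m) (f x) * (grad f x \<bullet> v))) (at x)" for x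
  proof -
    have "(h m has_derivative (\<lambda>y. h (Suc m) (f x) * y)) (at (f x))"
      using h by (simp add: has_field_derivative_def)
    from has_derivative_compose[OF has_derivative_grad[OF Ck_imp_diff[OF Suc.prems]] this]
    show ?thesis .
  qed
  have "partial_deriv i (\<lambda>x. h m (f x)) = (\<lambda>x. h (Suc m) (f x) * partial_deriv i f x)" for i
    using partial_deriv_eq[OF d] by (auto simp: inner_axis)
  moreover have "Ck k f" using Suc.prems Ck_Suc_imp by blast
  moreover have "(\<lambda>x. h m (f x)) differentiable (at x)" for x using d by (auto simp: differentiable_def)
  ultimately show ?case using Suc by (auto intro!: Ck_mult)
qed

lemma partial_deriv_affine:
  assumes "f differentiable (at (a + c *\<^sub>R x))"
  shows "partial_deriv i (\<lambda>x. f (a + c *\<^sub>R x)) x = c * partial_deriv i f (a + c *\<^sub>R x)"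
    and "(\<lambda>x. f (a + c *\<^sub>R x)) differentiable (at x)"
proof -
  have *: "((\<lambda>x. a + c *\<^sub>R x) has_derivative (\<lambda>h. c *\<^sub>R h)) (at x)"
    by (auto intro!: derivative_eq_intros)
  have d: "((\<lambda>x. f (a + c *\<^sub>R x)) has_derivative (\<lambda>h. grad f (a + c *\<^sub>R x) \<bullet> (c *\<^sub>R h))) (at x)"
    by (rule has_derivative_compose[OF * has_derivative_grad[OF assms]])
  from partial_deriv_eq[OF this, of i]
  show "partial_deriv i (\<lambda>x. f (a + c *\<^sub>R x)) x = c * partial_deriv i f (a + c *\<^sub>R x)"
    by (simp add: inner_axis)
  show "(\<lambda>x. f (a + c *\<^sub>R x)) differentiable (at x)" using d by (auto simp: differentiable_def)
qed

lemma Ck_affine: "Ck k f \<Longrightarrow> Ck k (\<lambda>x. f (a + c *\<^sub>R x))"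
proof (induction k arbitrary: f)
  case 0
  then show ?case by (auto intro!: continuous_on_compose2[of UNIV f] continuous_intros)
next
  case (Suc k)
  have "partial_deriv i (\<lambda>x. f (a + c *\<^sub>R x)) = (\<lambda>x. c * partial_deriv i f (a + c *\<^sub>R x))" for i
    using Suc.prems by (auto simp: partial_deriv_affine)
  moreover have "Ck k (\<lambda>x. c * partial_deriv i f (a + c *\<^sub>R x))" for i
    using Suc by (intro Ck_mult[of k "\<lambda>x. c"]) auto
  ultimately show ?case using Suc.prems by (simp add: partial_deriv_affine(2))
qed

lemma smooth_const [simp]: "smooth (\<lambda>x. c)"
  and smooth_add: "smooth f \<Longrightarrow> smooth g \<Longrightarrow> smooth (\<lambda>x. f x + g x)"
  and smooth_mult: "smooth f \<Longrightarrow> smooth g \<Longrightarrow> smooth (\<lambda>x. f x * g x)"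
  and smooth_affine: "smooth f \<Longrightarrow> smooth (\<lambda>x. f (a + c *\<^sub>R x))"
  by (auto simp: smooth_def intro: Ck_add Ck_mult Ck_affine)

lemma smooth_exp: "smooth f \<Longrightarrow> smooth (\<lambda>x. exp (f x))"
  unfolding smooth_def using Ck_chain[of "\<lambda>_. exp"] DERIV_exp by blast

lemma smooth_sum: "(\<And>i. i \<in> I \<Longrightarrow> smooth (f i)) \<Longrightarrow> smooth (\<lambda>x. \<Sum>i\<in>I. f i x)"
  by (induction I rule: infinite_finite_induct) (auto intro: smooth_add)

lemma smooth_norm2: "smooth (\<lambda>x::real^'n. (norm x)\<^sup>2)"
proof -
  have "(norm x)\<^sup>2 = (\<Sum>i\<in>UNIV. x $ i * x $ i)" for x :: "real^'n"
    unfolding power2_norm_eq_inner by (simp add: inner_vec_def)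
  moreover have "smooth (\<lambda>x::real^'n. \<Sum>i\<in>UNIV. x $ i * x $ i)"
    by (intro smooth_sum smooth_mult) (simp_all add: smooth_def Ck_nth)
  ultimately show ?thesis by simp
qed

lemma smooth_partial: "smooth f \<Longrightarrow> smooth (partial_deriv i f)"
  by (metis Ck.simps(2) smooth_def)

lemma smooth_differentiable: "smooth f \<Longrightarrow> f differentiable (at x)"
  by (metis Ck.simps(2) smooth_def)

lemma smooth_continuous: "smooth f \<Longrightarrow> continuous_on S f"
  by (metis Ck.simps(1) continuous_on_subset smooth_def top_greatest)

lemma smooth_continuous_grad: "smooth f \<Longrightarrow> continuous_on S (grad f)"
  unfolding grad_def by (intro continuous_on_vec_lambda smooth_continuous smooth_partial)

lemma smooth_borel: "smooth f \<Longrightarrow> f \<in> borel_measurable borel"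
  and smooth_grad_borel: "smooth f \<Longrightarrow> grad f \<in> borel_measurable borel"
  by (simp_all add: borel_measurable_continuous_onI smooth_continuous smooth_continuous_grad)

lemma smooth_has_derivative: "smooth f \<Longrightarrow> (f has_derivative (\<lambda>h. grad f x \<bullet> h)) (at x)"
  by (simp add: has_derivative_grad smooth_differentiable)

lemma grad_mult: "smooth f \<Longrightarrow> smooth g \<Longrightarrow> grad (\<lambda>x. f x * g x) x = f x *\<^sub>R grad g x + g x *\<^sub>R grad f x"
  by (simp add: vec_eq_iff partial_deriv_mult smooth_differentiable)

lemma grad_exp:
  assumes "smooth f" shows "grad (\<lambda>x. exp (f x)) x = exp (f x) *\<^sub>R grad f x"
proof (rule grad_unique)
  show "((\<lambda>x. exp (f x)) has_derivative (\<bullet>) (exp (f x) *\<^sub>R grad f x)) (at x)"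
    by (rule derivative_eq_intros smooth_has_derivative assms)+ (auto simp: mult.commute)
qed

section \<open>Test functions\<close>

lemma test_functionI:
  assumes "smooth f" "\<And>x. norm x > M \<Longrightarrow> f x = 0"
  shows "test_function f"
proof -
  have "{x. f x \<noteq> 0} \<subseteq> cball 0 M" using assms(2) by force
  then have "bounded (closure {x. f x \<noteq> 0})"
    by (meson bounded_cball bounded_closure bounded_subset)
  then show ?thesis using assms(1) by (simp add: test_function_def smooth_def compact_eq_bounded_closed)
qed

lemma test_function_smooth: "test_function f \<Longrightarrow> smooth f"
  by (simp add: test_function_def smooth_def)

lemma test_function_support:
  fixes f :: "real^'n \<Rightarrow> real"
  assumes "test_function f"
  obtains M where "M > 0" "\<And>x. norm x \<ge> M \<Longrightarrow> f x = 0" "\<And>x. norm x \<ge> M \<Longrightarrow> grad f x = 0"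
proof -
  have "bounded {x. f x \<noteq> 0}"
    using assms unfolding test_function_def
    by (meson bounded_subset closure_subset compact_imp_bounded)
  then obtain M where M: "M > 0" "\<And>x. f x \<noteq> 0 \<Longrightarrow> norm x \<le> M"
    by (auto simp: bounded_pos)
  have "grad f x = 0" if "norm x \<ge> M + 1" for x
  proof (rule grad_unique)
    have "(\<bullet>) (0::real^'n) = (\<lambda>_. 0)" by auto
    then have "((\<lambda>x::real^'n. 0::real) has_derivative (\<bullet>) (0::real^'n)) (at x)" for x by simp
    moreover have "open (- cball 0 M)" "x \<in> - cball 0 M" using that by auto
    ultimately show "(f has_derivative (\<bullet>) 0) (at x)"
      by (rule has_derivative_transform_within_open) (use M in force)
  qed
  moreover have "f x = 0" if "norm x \<ge> M + 1" for x using M(2)[of x] that by auto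
  ultimately show ?thesis using that[of "M + 1"] M(1) by auto
qed

lemma test_function_partial: "test_function f \<Longrightarrow> test_function (partial_deriv i f)"
proof -
  assume f: "test_function f"
  obtain M where M: "M > 0" "\<And>x. norm x \<ge> M \<Longrightarrow> f x = 0" "\<And>x. norm x \<ge> M \<Longrightarrow> grad f x = 0"
      using test_function_support[OF f] by blast
  have "partial_deriv i f x = 0" if "norm x > M" for x
    using M(3)[of x] that grad_nth[of f x i] by simp
  then show ?thesis by (rule test_functionI[OF smooth_partial[OF test_function_smooth[OF f]]])
qed

lemma test_function_mult:
  assumes "test_function f" "smooth g"
  shows "test_function (\<lambda>x. f x * g x)"
proof -
  obtain M where M: "M > 0" "\<And>x. norm x \<ge> M \<Longrightarrow> f x = 0" "\<And>x. norm x \<ge> M \<Longrightarrow> grad f x = 0"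
      using test_function_support[OF assms(1)] by blast
  then show ?thesis
    by (intro test_functionI[OF smooth_mult[OF test_function_smooth[OF assms(1)] assms(2)], of M]) simp
qed

lemma test_function_mult': "smooth g \<Longrightarrow> test_function f \<Longrightarrow> test_function (\<lambda>x. g x * f x)"
  using test_function_mult[of f g] by (simp add: mult.commute)

lemma test_function_affine:
  fixes f :: "real^'n \<Rightarrow> real"
  assumes "test_function f" "c \<noteq> 0"
  shows "test_function (\<lambda>x. f (a + c *\<^sub>R x))"
proof -
  obtain M where M: "M > 0" "\<And>x. norm x \<ge> M \<Longrightarrow> f x = 0" "\<And>x. norm x \<ge> M \<Longrightarrow> grad f x = 0"
      using test_function_support[OF assms(1)] by blast
  show ?thesis
  proof (rule test_functionI[of _ "(M + norm a) / \<bar>c\<bar>"])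
    fix x :: "real^'n" assume "norm x > (M + norm a) / \<bar>c\<bar>"
    then have "M + norm a < norm (c *\<^sub>R x)" using assms(2) by (simp add: field_simps)
    also have "\<dots> \<le> norm (a + c *\<^sub>R x) + norm a"
      by (metis add_diff_cancel_left' norm_triangle_ineq4)
    finally show "f (a + c *\<^sub>R x) = 0" by (intro M) simp
  qed (rule smooth_affine[OF test_function_smooth[OF assms(1)]])
qed

text \<open>Points closer than 1 either both lie where the function vanishes or both lie in the ball
  enlarged by 1, which is compact.\<close>

lemma continuous_compact_support_uniform:
  fixes f :: "real^'n \<Rightarrow> 'b::euclidean_space"
  assumes c: "continuous_on UNIV f" and z: "\<And>x. norm x \<ge> M \<Longrightarrow> f x = 0"
  shows "uniformly_continuous_on UNIV f"
proof -
  have uc: "uniformly_continuous_on (cball 0 (M + 1)) f"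
    by (intro compact_uniformly_continuous continuous_on_subset[OF c]) auto
  show ?thesis unfolding uniformly_continuous_on_def
  proof (intro allI impI)
    fix e :: real assume e: "e > 0"
    obtain d where d: "d > 0"
      "\<And>x x'. x \<in> cball 0 (M+1) \<Longrightarrow> x' \<in> cball 0 (M+1) \<Longrightarrow> dist x' x < d \<Longrightarrow> dist (f x') (f x) < e"
      using uc e unfolding uniformly_continuous_on_def by metis
    show "\<exists>d>0. \<forall>x\<in>UNIV. \<forall>x'\<in>UNIV. dist x' x < d \<longrightarrow> dist (f x') (f x) < e"
    proof (intro exI[of _ "min d 1"] conjI ballI impI)
      fix x x' :: "real^'n" assume l: "dist x' x < min d 1"
      show "dist (f x') (f x) < e"
      proof (cases "norm x \<ge> M \<and> norm x' \<ge> M")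
        case True then show ?thesis using z e by simp
      next
        case False
        have "\<bar>norm x - norm x'\<bar> < 1"
          using l norm_triangle_ineq3[of x x'] by (simp add: dist_norm norm_minus_commute)
        with False have "norm x \<le> M + 1" "norm x' \<le> M + 1" by linarith+
        then show ?thesis using d l by simp
      qed
    qed (use d in auto)
  qed
qed

lemma continuous_compact_support_bounded:
  fixes f :: "real^'n \<Rightarrow> 'b::euclidean_space"
  assumes c: "continuous_on UNIV f" and z: "\<And>x. norm x \<ge> M \<Longrightarrow> f x = 0"
  obtains B where "B > 0" "\<And>x. norm (f x) \<le> B"
proof -
  have "bounded (f ` cball 0 M)"
    by (intro compact_imp_bounded compact_continuous_image continuous_on_subset[OF c]) auto
  then obtain B where B: "B > 0" "\<And>x. norm x \<le> M \<Longrightarrow> norm (f x) \<le> B" by (auto simp: bounded_pos)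
  have "norm (f x) \<le> B" for x using B z[of x] by (cases "norm x \<le> M") auto
  then show ?thesis using that B by blast
qed

lemma test_function_bounded:
  assumes "test_function f"
  obtains B where "B > 0" "\<And>x. \<bar>f x\<bar> \<le> B" "\<And>x. norm (grad f x) \<le> B"
proof -
  note s = test_function_smooth[OF assms]
  obtain M where M: "M > 0" "\<And>x. norm x \<ge> M \<Longrightarrow> f x = 0" "\<And>x. norm x \<ge> M \<Longrightarrow> grad f x = 0"
      using test_function_support[OF assms] by blast
  obtain B1 where B1: "B1 > 0" "\<And>x. norm (f x) \<le> B1"
    using continuous_compact_support_bounded[OF smooth_continuous[OF s] M(2)] by blast
  obtain B2 where B2: "B2 > 0" "\<And>x. norm (grad f x) \<le> B2"
    using continuous_compact_support_bounded[OF smooth_continuous_grad[OF s] M(3)] by blast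
  have "\<bar>f x\<bar> \<le> max B1 B2" "norm (grad f x) \<le> max B1 B2" for x
    using B1(2)[of x] B2(2)[of x] by auto
  moreover have "max B1 B2 > 0" using B1 by simp
  ultimately show ?thesis using that by blast
qed

text \<open>The linearization error is uniform in x because the gradient, continuous with compact
  support, is uniformly continuous. This uniformity is what lets derivatives pass through integrals
  below.\<close>

lemma test_function_taylor:
  assumes "test_function f" "e > 0"
  obtains d where "d > 0" "\<And>x h. norm h < d \<Longrightarrow> \<bar>f (x + h) - f x - grad f x \<bullet> h\<bar> \<le> e * norm h"
proof -
  note s = test_function_smooth[OF assms(1)]
  obtain M where M: "M > 0" "\<And>x. norm x \<ge> M \<Longrightarrow> f x = 0" "\<And>x. norm x \<ge> M \<Longrightarrow> grad f x = 0"
      using test_function_support[OF assms(1)] by blast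
  have "uniformly_continuous_on UNIV (grad f)"
    using continuous_compact_support_uniform[OF smooth_continuous_grad[OF s] M(3)] .
  then obtain d where d: "d > 0" "\<And>x x'. dist x' x < d \<Longrightarrow> dist (grad f x') (grad f x) < e"
    using assms(2) unfolding uniformly_continuous_on_def by (metis UNIV_I)
  have "\<bar>f (x + h) - f x - grad f x \<bullet> h\<bar> \<le> e * norm h" if h: "norm h < d" for x h
  proof -
    have "norm (f (x+h) - f x - grad f x \<bullet> ((x+h) - x)) \<le> norm ((x+h) - x) * e"
    proof (rule differentiable_bound_linearization[where S = "ball x d" and f' = "\<lambda>y v. grad f y \<bullet> v"])
      fix t :: real assume "t \<in> {0..1}"
      then have "t * norm h < d" using h
        using \<open>t \<in> {0..1}\<close> mult_left_le_one_le[of "norm h" t] by simp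
      then show "x + t *\<^sub>R (x + h - x) \<in> ball x d" using \<open>t \<in> {0..1}\<close> by (simp add: dist_norm)
    next
      fix y assume y: "y \<in> ball x d"
      have "onorm ((\<bullet>) (grad f y - grad f x)) \<le> e"
      proof (rule onorm_le)
        fix v
        have "norm ((grad f y - grad f x) \<bullet> v) \<le> norm (grad f y - grad f x) * norm v"
          by (simp add: Cauchy_Schwarz_ineq2)
        also have "\<dots> \<le> e * norm v"
          using d(2)[of y x] y by (intro mult_right_mono) (auto simp: dist_norm norm_minus_commute)
        finally show "norm ((grad f y - grad f x) \<bullet> v) \<le> e * norm v" .
      qed
      moreover have "(\<bullet>) (grad f y - grad f x) = (\<bullet>) (grad f y) - (\<bullet>) (grad f x)"
        by (auto simp: inner_diff_left)
      ultimately show "onorm ((\<bullet>) (grad f y) - (\<bullet>) (grad f x)) \<le> e" by simp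
    qed (use d s in \<open>auto intro: has_derivative_at_withinI smooth_has_derivative\<close>)
    then show ?thesis by (simp add: mult.commute)
  qed
  with d(1) that show ?thesis by blast
qed

lemma continuous_compact_support_integrable:
  fixes f :: "real^'n \<Rightarrow> 'b::euclidean_space"
  assumes c: "continuous_on UNIV f" and z: "\<And>x. norm x \<ge> M \<Longrightarrow> f x = 0"
  shows "integrable lborel f"
proof -
  have "set_integrable lborel (cball 0 M) f"
    unfolding set_integrable_def
    by (rule borel_integrable_compact[OF _ continuous_on_subset[OF c]]) auto
  moreover have "indicator (cball 0 M) x *\<^sub>R f x = f x" for x
    using z[of x] by (auto simp: indicator_def)
  ultimately show ?thesis by (simp add: set_integrable_def)
qed

lemma test_function_integrable: "test_function f \<Longrightarrow> integrable lborel f"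
proof -
  assume f: "test_function f"
  obtain M where M: "M > 0" "\<And>x. norm x \<ge> M \<Longrightarrow> f x = 0" "\<And>x. norm x \<ge> M \<Longrightarrow> grad f x = 0"
    using test_function_support[OF f] by blast
  show ?thesis
    by (rule continuous_compact_support_integrable[OF smooth_continuous[OF test_function_smooth[OF f]] M(2)])
qed

text \<open>By translation invariance the integral of f(x + t v) - f(x) is 0 for the coordinate
  vector v, while this difference is t times the partial derivative up to a uniform error \<epsilon>
  t on a fixed ball. No iterated integration along coordinate lines is involved.\<close>

lemma integral_partial_deriv_eq_0:
  fixes f :: "real^'n \<Rightarrow> real"
  assumes "test_function f"
  shows "integral\<^sup>L lborel (partial_deriv i f) = 0"
proof -
  note s = test_function_smooth[OF assms]
  let ?e = "axis i 1 :: real^'n"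
  obtain M where M: "M > 0" "\<And>x. norm x \<ge> M \<Longrightarrow> f x = 0" "\<And>x. norm x \<ge> M \<Longrightarrow> grad f x = 0"
      using test_function_support[OF assms] by blast
  have int: "integrable lborel f" "integrable lborel (partial_deriv i f)"
    using assms by (auto intro: test_function_integrable test_function_partial)
  have shift: "integrable lborel (\<lambda>x. f (x + a))" "integral\<^sup>L lborel (\<lambda>x. f (x + a)) = integral\<^sup>L lborel f" for a
  proof -
    have *: "distr lborel borel ((+) a) = (lborel :: (real^'n) measure)" by (rule lborel_distr_plus)
    have "integrable (distr lborel borel ((+) a)) f" unfolding * by (rule int)
    then show "integrable lborel (\<lambda>x. f (x + a))"
      by (subst (asm) integrable_distr_eq) (use s in \<open>auto simp: add.commute smooth_borel\<close>)
    have "integral\<^sup>L lborel f = integral\<^sup>L (distr lborel borel ((+) a)) f" unfolding * ..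
    also have "\<dots> = integral\<^sup>L lborel (\<lambda>x. f (x + a))"
      by (subst integral_distr) (use s in \<open>auto simp: add.commute smooth_borel\<close>)
    finally show "integral\<^sup>L lborel (\<lambda>x. f (x + a)) = integral\<^sup>L lborel f" ..
  qed
  \<comment> \<open>A ball of radius M + 1 holds the supports of f and of all its translates by t
    \<le> 1.\<close>
  define W where "W = measure lborel (cball 0 (M + 1) :: (real^'n) set)"
  have "\<bar>integral\<^sup>L lborel (partial_deriv i f)\<bar> \<le> e * W" if e: "e > 0" for e
  proof -
    obtain d where d: "d > 0" "\<And>x h. norm h < d \<Longrightarrow> \<bar>f (x + h) - f x - grad f x \<bullet> h\<bar> \<le> e * norm h"
      using test_function_taylor[OF assms e] by blast
    define t where "t = min (d / 2) 1"
    have t: "t > 0" "t < d" "t \<le> 1" using d(1) by (auto simp: t_def)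
    let ?g = "\<lambda>x. f (x + t *\<^sub>R ?e) - f x - t * partial_deriv i f x"
    have gi: "integrable lborel ?g" using int shift by simp
    have "integral\<^sup>L lborel ?g = - t * integral\<^sup>L lborel (partial_deriv i f)"
      using int shift by simp
    then have "t * \<bar>integral\<^sup>L lborel (partial_deriv i f)\<bar> = \<bar>integral\<^sup>L lborel ?g\<bar>"
      using t by (simp add: abs_mult)
    also have "\<dots> \<le> integral\<^sup>L lborel (\<lambda>x. \<bar>?g x\<bar>)" by simp
    also have "\<dots> \<le> integral\<^sup>L lborel (\<lambda>x::real^'n. (e * t) * indicator (cball 0 (M+1)) x)"
    proof (rule Bochner_Integration.integral_mono)
      fix x :: "real^'n"
      show "\<bar>?g x\<bar> \<le> (e * t) * indicator (cball 0 (M+1)) x"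
      proof (cases "norm x \<le> M + 1")
        case True
        have "\<bar>f (x + t *\<^sub>R ?e) - f x - grad f x \<bullet> (t *\<^sub>R ?e)\<bar> \<le> e * norm (t *\<^sub>R ?e)"
          using t by (intro d) simp
        then show ?thesis using True t by (simp add: inner_axis)
      next
        case False
        have "norm x \<le> norm (x + t *\<^sub>R ?e) + norm (t *\<^sub>R ?e)"
          by (metis add_diff_cancel_right' norm_triangle_ineq4)
        then have "norm (x + t *\<^sub>R ?e) \<ge> M" using False t by simp
        moreover have "grad f x = 0" using False by (intro M) simp
        then have "partial_deriv i f x = 0" using grad_nth[of f x i] by simp
        ultimately show ?thesis using False M by simp
      qed
    next
      show "integrable lborel (\<lambda>x. \<bar>?g x\<bar>)" using gi by (rule integrable_abs)
      have "integrable lborel (indicator (cball 0 (M+1)) :: real^'n \<Rightarrow> real)"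
        by (rule integrable_real_indicator, simp, rule emeasure_lborel_cball_finite)
      then show "integrable lborel (\<lambda>x. (e * t) * indicator (cball 0 (M+1)) (x::real^'n))" by (rule integrable_mult_right)
    qed
    also have "\<dots> = e * t * W" by (simp add: W_def)
    finally show ?thesis using t by (simp add: field_simps)
  qed
  note * = this
  have "\<bar>integral\<^sup>L lborel (partial_deriv i f)\<bar> \<le> 0"
  proof (rule field_le_epsilon)
    fix e :: real assume "e > 0"
    have W0: "W \<ge> 0" by (simp add: W_def)
    have "e / (W + 1) * W \<le> e" using W0 \<open>e > 0\<close> by (simp add: field_simps)
    then show "\<bar>integral\<^sup>L lborel (partial_deriv i f)\<bar> \<le> 0 + e"
      using *[of "e / (W + 1)"] \<open>e > 0\<close> W0 by simp
  qed
  then show ?thesis by simp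
qed

lemma integration_by_parts:
  assumes "smooth f" "test_function g"
  shows "integral\<^sup>L lborel (\<lambda>x. f x * partial_deriv i g x) = - integral\<^sup>L lborel (\<lambda>x. partial_deriv i f x * g x)"
proof -
  have t: "test_function (\<lambda>x. f x * g x)" using assms by (rule test_function_mult')
  have 1: "integrable lborel (\<lambda>x. f x * partial_deriv i g x)" "integrable lborel (\<lambda>x. partial_deriv i f x * g x)"
    using assms by (auto intro!: test_function_integrable test_function_mult' test_function_partial smooth_partial)
  have "0 = integral\<^sup>L lborel (partial_deriv i (\<lambda>x. f x * g x))" using integral_partial_deriv_eq_0[OF t] by simp
  also have "partial_deriv i (\<lambda>x. f x * g x) = (\<lambda>x. f x * partial_deriv i g x + partial_deriv i f x * g x)"
    using assms by (auto simp: partial_deriv_mult smooth_differentiable test_function_smooth)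
  finally show ?thesis using 1 by simp
qed

section \<open>A smooth bump function\<close>

text \<open>\<open>flat_exp m\<close> is the \<open>m\<close>-th derivative of \<open>exp (- 1 / t)\<close>, extended by \<open>0\<close>.\<close>

primrec bump_poly :: "nat \<Rightarrow> real poly" where
  "bump_poly 0 = 1"
| "bump_poly (Suc m) = [:0, 0, 1:] * (bump_poly m - pderiv (bump_poly m))"

definition flat_exp :: "nat \<Rightarrow> real \<Rightarrow> real" where
  "flat_exp m t = (if t > 0 then poly (bump_poly m) (1 / t) * exp (- (1 / t)) else 0)"

lemma poly_exp_decay: "((\<lambda>s. poly P s * exp (- s)) \<longlongrightarrow> 0) at_top" for P :: "real poly"
proof (induction P)
  case 0
  then show ?case by simp
next
  case (pCons a P)
  have *: "(\<lambda>s. poly Q s * exp (- s)) = (\<lambda>s. \<Sum>i\<le>degree Q. coeff Q i * (s ^ i / exp s))" for Q :: "real poly"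
    by (rule ext) (simp add: poly_altdef sum_distrib_right exp_minus divide_inverse mult.assoc)
  have "((\<lambda>s. \<Sum>i\<le>degree (pCons a P). coeff (pCons a P) i * (s ^ i / exp s)) \<longlongrightarrow> (\<Sum>i\<le>degree (pCons a P). coeff (pCons a P) i * 0)) at_top"
    by (intro tendsto_intros tendsto_power_div_exp_0)
  then show ?case unfolding * by simp
qed

lemma flat_exp_deriv: "(flat_exp m has_real_derivative flat_exp (Suc m) t) (at t)"
proof -
  consider "t > 0" | "t < 0" | "t = 0" by linarith
  then show ?thesis
  proof cases
    case 1
    let ?P = "bump_poly m"
    have a: "((\<lambda>t. 1 / t) has_real_derivative - (1 / t\<^sup>2)) (at t)"
      using 1 by (auto intro!: derivative_eq_intros simp: power2_eq_square)
    have c: "((\<lambda>t. exp (- (1 / t))) has_real_derivative exp (- (1 / t)) * (1 / t\<^sup>2)) (at t)"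
      using DERIV_chain2[OF DERIV_exp DERIV_minus[OF a]] by simp
    \<comment> \<open>With s = 1/t the derivative is s^2 (P(s) - P'(s)) exp(-s), which is the
      recursion of \<open>bump_poly\<close>.\<close>
    from DERIV_mult[OF DERIV_chain2[OF poly_DERIV a] c, of ?P]
    have "((\<lambda>t. poly ?P (1 / t) * exp (- (1 / t))) has_real_derivative
        poly (bump_poly (Suc m)) (1 / t) * exp (- (1 / t))) (at t)"
      by (rule DERIV_cong) (simp add: algebra_simps power2_eq_square)
    then have "(flat_exp m has_real_derivative poly (bump_poly (Suc m)) (1 / t) * exp (- (1 / t))) (at t)"
      by (rule has_field_derivative_transform_within_open[where S = "{0::real<..}"]) (use 1 in \<open>auto simp: flat_exp_def\<close>)
    then show ?thesis using 1 by (simp add: flat_exp_def)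
  next
    case 2
    have "((\<lambda>t. 0) has_real_derivative 0) (at t)" by simp
    then have "(flat_exp m has_real_derivative 0) (at t)"
      by (rule has_field_derivative_transform_within_open[where S = "{..<0}"]) (use 2 in \<open>auto simp: flat_exp_def\<close>)
    then show ?thesis using 2 by (simp add: flat_exp_def)
  next
    case 3
    \<comment> \<open>For h > 0 the difference quotient at 0 is s P(s) exp(-s) with s = 1/h;
      \<open>pCons 0\<close> supplies the factor s.\<close>
    have "((\<lambda>s. poly (pCons 0 (bump_poly m)) s * exp (- s)) \<longlongrightarrow> 0) at_top" by (rule poly_exp_decay)
    then have "((\<lambda>h. poly (pCons 0 (bump_poly m)) (inverse h) * exp (- (inverse h))) \<longlongrightarrow> 0) (at_right 0)"
      by (rule filterlim_compose[OF _ filterlim_inverse_at_top_right])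
    then have r: "((\<lambda>h. flat_exp m h / h) \<longlongrightarrow> 0) (at_right 0)"
      by (rule Lim_transform_eventually)
        (use eventually_at_right_less[of "0::real"] in \<open>eventually_elim; simp add: flat_exp_def divide_inverse ac_simps\<close>)
    have l: "((\<lambda>h. flat_exp m h / h) \<longlongrightarrow> 0) (at_left 0)"
      by (rule Lim_transform_eventually[of "\<lambda>_. 0"]) (auto simp: eventually_at_filter flat_exp_def)
    have "((\<lambda>h. flat_exp m h / h) \<longlongrightarrow> 0) (at 0)" by (rule filterlim_split_at[OF l r])
    moreover have "flat_exp k 0 = 0" for k by (simp add: flat_exp_def)
    ultimately show ?thesis using 3 by (simp add: DERIV_def)
  qed
qed

definition mollifier :: "real \<Rightarrow> (real^'n \<Rightarrow> real) \<Rightarrow> bool" where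
  "mollifier a \<rho> \<longleftrightarrow> smooth \<rho> \<and> (\<forall>x. \<rho> x \<ge> 0) \<and> (\<forall>x. norm x \<ge> a \<longrightarrow> \<rho> x = 0) \<and> integral\<^sup>L lborel \<rho> = 1"

text \<open>The profile exp(-1/t) is composed with a^2 - |x|^2, a polynomial, and normalized by its
  positive integral. Each radius gets its own bump; no family is obtained by rescaling.\<close>

lemma mollifier_exists:
  assumes "a > 0"
  obtains \<rho> :: "real^'n \<Rightarrow> real" where "mollifier a \<rho>"
proof -
  define b where "b = (\<lambda>x::real^'n. flat_exp 0 (a\<^sup>2 + (-1) * (norm x)\<^sup>2))"
  have sb: "smooth b"
    unfolding smooth_def b_def
  proof
    fix k
    have "smooth (\<lambda>x::real^'n. a\<^sup>2 + (-1) * (norm x)\<^sup>2)"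
      by (intro smooth_add smooth_mult smooth_norm2) auto
    then show "Ck k (\<lambda>x::real^'n. flat_exp 0 (a\<^sup>2 + (-1) * (norm x)\<^sup>2))"
      using Ck_chain[of flat_exp k, OF flat_exp_deriv] by (auto simp: smooth_def)
  qed
  have b0: "b x \<ge> 0" for x by (simp add: b_def flat_exp_def)
  have bz: "b x = 0" if "norm x \<ge> a" for x
  proof -
    have "a\<^sup>2 + (-1) * (norm x)\<^sup>2 \<le> 0" using power_mono[OF that, of 2] assms by simp
    then show ?thesis by (simp add: b_def flat_exp_def)
  qed
  have tb: "test_function b" by (rule test_functionI[of _ a]) (use sb bz in auto)
  have ib: "integrable lborel b" using tb by (rule test_function_integrable)
  have "integral\<^sup>L lborel b \<noteq> 0"
  proof
    assume "integral\<^sup>L lborel b = 0"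
    then have "AE x in lborel. b x = 0" using integral_nonneg_eq_0_iff_AE[OF ib] b0 by simp
    then have "AE x in lborel. x \<notin> ball (0::real^'n) a"
    proof eventually_elim
      case (elim x)
      have "(norm x)\<^sup>2 < a\<^sup>2" if "norm x < a" using power_strict_mono[OF that, of 2] by simp
      then show ?case using elim by (auto simp: b_def flat_exp_def)
    qed
    then have "emeasure lborel (ball (0::real^'n) a) = 0"
      by (subst (asm) AE_iff_measurable[where N = "ball 0 a"]) auto
    then show False using content_ball_pos[of a "0::real^'n"] assms by (simp add: measure_def)
  qed
  then have pos: "integral\<^sup>L lborel b > 0" using b0 Bochner_Integration.integral_nonneg[of lborel b] by (simp add: order_less_le)
  define \<rho> where "\<rho> = (\<lambda>x. inverse (integral\<^sup>L lborel b) * b x)"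
  have "smooth \<rho>" unfolding \<rho>_def using sb by (intro smooth_mult) auto
  then have "mollifier a \<rho>" using pos b0 bz ib by (auto simp: mollifier_def \<rho>_def)
  then show ?thesis by (rule that)
qed

section \<open>Mollification\<close>

lemma lborel_reflect: "distr lborel borel (\<lambda>y. x - y) = (lborel :: 'a::euclidean_space measure)"
proof -
  have "lborel = density (distr lborel borel (\<lambda>y. x + (-1) *\<^sub>R y)) (\<lambda>_. \<bar>-1\<bar> ^ DIM('a) :: real)"
    by (rule lborel_affine) simp
  then show ?thesis by (simp add: density_1)
qed

lemma nn_integral_shift:
  fixes f :: "'a::euclidean_space \<Rightarrow> ennreal"
  assumes [measurable]: "f \<in> borel_measurable borel"
  shows "(\<integral>\<^sup>+y. f (y + x) \<partial>lborel) = (\<integral>\<^sup>+y. f y \<partial>lborel)"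
proof -
  have "(\<integral>\<^sup>+y. f y \<partial>lborel) = (\<integral>\<^sup>+y. f y \<partial>distr lborel borel ((+) x))"
    by (simp only: lborel_distr_plus)
  also have "\<dots> = (\<integral>\<^sup>+y. f (x + y) \<partial>lborel)" by (subst nn_integral_distr) auto
  finally show ?thesis by (simp add: add.commute)
qed

lemma integral_reflect:
  fixes f :: "'a::euclidean_space \<Rightarrow> real"
  assumes [measurable]: "f \<in> borel_measurable borel"
  shows "(LINT y|lborel. f (x - y)) = (LINT y|lborel. f y)"
proof -
  have "(LINT y|lborel. f y) = (LINT y|distr lborel borel (\<lambda>y. x - y). f y)"
    by (simp only: lborel_reflect)
  also have "\<dots> = (LINT y|lborel. f (x - y))" by (subst integral_distr) auto
  finally show ?thesis ..
qed

lemma integrable_reflect: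
  fixes f :: "'a::euclidean_space \<Rightarrow> real"
  assumes "integrable lborel f"
  shows "integrable lborel (\<lambda>y. f (x - y))"
proof -
  have [measurable]: "f \<in> borel_measurable borel" using assms by auto
  have "integrable (distr lborel borel (\<lambda>y. x - y)) f" using assms by (simp only: lborel_reflect)
  then show ?thesis by (subst (asm) integrable_distr_eq) auto
qed

text \<open>Convolution with an arbitrary kernel: derivatives of mollifications have the same form,
  with \<open>partial_deriv i \<rho>\<close> as the kernel.\<close>

definition mollify :: "(real^'n \<Rightarrow> real) \<Rightarrow> (real^'n \<Rightarrow> real) \<Rightarrow> real^'n \<Rightarrow> real" where
  "mollify \<rho> w x = (LINT y|lborel. \<rho> (x - y) * w y)"

lemma mollifier_test_function: "mollifier a \<rho> \<Longrightarrow> test_function \<rho>"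
proof -
  assume m: "mollifier a \<rho>"
  then have s: "smooth \<rho>" by (simp add: mollifier_def)
  show ?thesis by (rule test_functionI[OF s, of a]) (use m in \<open>auto simp: mollifier_def\<close>)
qed

lemma integrable_bounded_mult:
  fixes f w :: "'a \<Rightarrow> real"
  assumes w: "integrable M w" and f: "f \<in> borel_measurable M" and B: "\<And>x. \<bar>f x\<bar> \<le> B"
  shows "integrable M (\<lambda>x. f x * w x)"
proof (rule Bochner_Integration.integrable_bound)
  show "integrable M (\<lambda>x. B * w x)" using w by simp
  have "\<bar>f x\<bar> * \<bar>w x\<bar> \<le> \<bar>B\<bar> * \<bar>w x\<bar>" for x
    using B[of x] by (intro mult_right_mono) auto
  then show "AE x in M. norm (f x * w x) \<le> norm (B * w x)" by (simp add: abs_mult)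
qed (use w f in auto)

lemma mollify_integrable:
  fixes \<rho> w :: "real^'n \<Rightarrow> real"
  assumes r: "test_function \<rho>" and w: "integrable lborel w"
  shows "integrable lborel (\<lambda>y. \<rho> (x - y) * w y)"
proof -
  obtain B where B: "B > 0" "\<And>x. \<bar>\<rho> x\<bar> \<le> B" "\<And>x. norm (grad \<rho> x) \<le> B"
    using test_function_bounded[OF r] by blast
  have [measurable]: "\<rho> \<in> borel_measurable borel" using r test_function_smooth smooth_borel by blast
  show ?thesis by (rule integrable_bounded_mult[OF w _ B(2)]) measurable
qed

text \<open>Inserting the uniform Taylor estimate of the kernel under the integral leaves an error
  of at most \<epsilon> |h| times the L^1 norm of w, so integrability of w suffices.\<close>

lemma mollify_has_derivative:
  fixes \<rho> w :: "real^'n \<Rightarrow> real"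
  assumes r: "test_function \<rho>" and w: "integrable lborel w"
  shows "(mollify \<rho> w has_derivative (\<lambda>h. (\<chi> i. mollify (partial_deriv i \<rho>) w x) \<bullet> h)) (at x)"
  unfolding has_derivative_at_alt
proof (intro conjI allI impI)
  show "bounded_linear ((\<bullet>) (\<chi> i. mollify (partial_deriv i \<rho>) w x))" by (rule bounded_linear_inner_right)
  fix e :: real assume e: "e > 0"
  define I where "I = (LINT y|lborel. \<bar>w y\<bar>)"
  have I0: "I \<ge> 0" by (simp add: I_def)
  \<comment> \<open>Dividing by I + 1 rather than I covers w = 0; the factor I / (I + 1) \<le> 1 is
    dropped at the end.\<close>
  have "e / (I + 1) > 0" using e I0 by simp
  then obtain d where d: "d > 0" "\<And>x h. norm h < d \<Longrightarrow> \<bar>\<rho> (x + h) - \<rho> x - grad \<rho> x \<bullet> h\<bar> \<le> e / (I + 1) * norm h"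
    using test_function_taylor[OF r] by blast
  note s = test_function_smooth[OF r]
  have "norm (mollify \<rho> w y - mollify \<rho> w x - (\<chi> i. mollify (partial_deriv i \<rho>) w x) \<bullet> (y - x)) \<le> e * norm (y - x)"
    if y: "norm (y - x) < d" for y
  proof -
    define h where "h = y - x"
    have ip: "integrable lborel (\<lambda>z. partial_deriv i \<rho> (x - z) * w z)" for i
      by (rule mollify_integrable[OF test_function_partial[OF r] w])
    have ig: "integrable lborel (\<lambda>z. (grad \<rho> (x - z) \<bullet> h) * w z)"
      "(LINT z|lborel. (grad \<rho> (x - z) \<bullet> h) * w z) = (\<chi> i. mollify (partial_deriv i \<rho>) w x) \<bullet> h"
    proof -
      have *: "(grad \<rho> (x - z) \<bullet> h) * w z = (\<Sum>i\<in>UNIV. h $ i * (partial_deriv i \<rho> (x - z) * w z))" for z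
        unfolding inner_vec_def sum_distrib_right by (intro sum.cong) simp_all
      show "integrable lborel (\<lambda>z. (grad \<rho> (x - z) \<bullet> h) * w z)"
        unfolding * using ip by (intro Bochner_Integration.integrable_sum integrable_mult_right)
      show "(LINT z|lborel. (grad \<rho> (x - z) \<bullet> h) * w z) = (\<chi> i. mollify (partial_deriv i \<rho>) w x) \<bullet> h"
        unfolding * using ip by (subst Bochner_Integration.integral_sum)
          (auto simp: inner_vec_def mollify_def mult.commute intro!: integrable_mult_right)
    qed
    have i1: "integrable lborel (\<lambda>z. \<rho> (y - z) * w z)" "integrable lborel (\<lambda>z. \<rho> (x - z) * w z)"
      by (rule mollify_integrable[OF r w])+
    let ?E = "\<lambda>z. \<rho> (y - z) * w z - \<rho> (x - z) * w z - (grad \<rho> (x - z) \<bullet> h) * w z"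
    have eq: "mollify \<rho> w y - mollify \<rho> w x - (\<chi> i. mollify (partial_deriv i \<rho>) w x) \<bullet> h = (LINT z|lborel. ?E z)"
      using i1 ig by (simp add: mollify_def)
    have "\<bar>LINT z|lborel. ?E z\<bar> \<le> (LINT z|lborel. \<bar>?E z\<bar>)" by simp
    also have "\<dots> \<le> (LINT z|lborel. (e / (I + 1) * norm h) * \<bar>w z\<bar>)"
    proof (rule Bochner_Integration.integral_mono)
      show "integrable lborel (\<lambda>z. \<bar>?E z\<bar>)" using i1 ig by (intro integrable_abs Bochner_Integration.integrable_diff)
      show "integrable lborel (\<lambda>z. (e / (I + 1) * norm h) * \<bar>w z\<bar>)" using w by simp
      fix z
      have "?E z = (\<rho> ((x - z) + h) - \<rho> (x - z) - grad \<rho> (x - z) \<bullet> h) * w z"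
        by (simp add: h_def algebra_simps)
      then have "\<bar>?E z\<bar> = \<bar>\<rho> ((x - z) + h) - \<rho> (x - z) - grad \<rho> (x - z) \<bullet> h\<bar> * \<bar>w z\<bar>" by (simp only: abs_mult)
      also have "\<dots> \<le> (e / (I + 1) * norm h) * \<bar>w z\<bar>"
        using y by (intro mult_right_mono d) (auto simp: h_def)
      finally show "\<bar>?E z\<bar> \<le> (e / (I + 1) * norm h) * \<bar>w z\<bar>" .
    qed
    also have "\<dots> = e * norm h * (I / (I + 1))" by (simp add: I_def)
    also have "\<dots> \<le> e * norm h * 1" using e I0 by (intro mult_left_mono) auto
    finally show ?thesis using eq by (simp add: h_def)
  qed
  then show "\<exists>d>0. \<forall>y. norm (y - x) < d \<longrightarrow> norm (mollify \<rho> w y - mollify \<rho> w x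
      - (\<chi> i. mollify (partial_deriv i \<rho>) w x) \<bullet> (y - x)) \<le> e * norm (y - x)"
    using d(1) by blast
qed

lemma grad_mollify:
  assumes "test_function \<rho>" "integrable lborel w"
  shows "grad (mollify \<rho> w) x = (\<chi> i. mollify (partial_deriv i \<rho>) w x)"
  by (rule grad_unique[OF mollify_has_derivative[OF assms]])

lemma partial_deriv_mollify:
  assumes "test_function \<rho>" "integrable lborel w"
  shows "partial_deriv i (mollify \<rho> w) x = mollify (partial_deriv i \<rho>) w x"
  by (metis grad_mollify[OF assms] grad_nth vec_lambda_beta)

lemma smooth_mollify:
  assumes "test_function \<rho>" "integrable lborel w"
  shows "smooth (mollify \<rho> w)"
  unfolding smooth_def
proof
  fix k show "Ck k (mollify \<rho> w)"
    using assms(1)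
  proof (induction k arbitrary: \<rho>)
    case 0
    have "continuous (at x) (mollify \<rho> w)" for x
      using mollify_has_derivative[OF 0 assms(2)] has_derivative_continuous by blast
    then show ?case by (simp add: continuous_on_eq_continuous_at)
  next
    case (Suc k)
    have "mollify \<rho> w differentiable (at x)" for x
      using mollify_has_derivative[OF Suc.prems assms(2)] by (auto simp: differentiable_def)
    moreover have "partial_deriv i (mollify \<rho> w) = mollify (partial_deriv i \<rho>) w" for i
      using partial_deriv_mollify[OF Suc.prems assms(2)] by auto
    ultimately show ?case using Suc.IH test_function_partial[OF Suc.prems] by simp
  qed
qed

lemma mollify_support:
  assumes "mollifier a \<rho>" "\<And>y. norm y > M \<Longrightarrow> w y = 0" "norm x > M + a"
  shows "mollify \<rho> w x = 0"
proof -
  have "\<rho> (x - y) * w y = 0" for y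
  proof (cases "norm y > M")
    case False
    then have "norm (x - y) \<ge> a" using assms(3) norm_triangle_ineq2[of x y] by linarith
    then show ?thesis using assms(1) by (simp add: mollifier_def)
  qed (use assms(2) in simp)
  then have "(\<lambda>y. \<rho> (x - y) * w y) = (\<lambda>_. 0)" by (rule ext)
  then show ?thesis by (simp only: mollify_def) simp
qed

lemma test_function_mollify:
  assumes "mollifier a \<rho>" "integrable lborel w" "\<And>y. norm y > M \<Longrightarrow> w y = 0"
  shows "test_function (mollify \<rho> w)"
  by (rule test_functionI[OF smooth_mollify[OF mollifier_test_function[OF assms(1)] assms(2)]])
    (rule mollify_support[OF assms(1,3)])

lemma mollify_diff:
  assumes "test_function \<rho>" "integrable lborel w" "integrable lborel v"
  shows "mollify \<rho> (\<lambda>y. w y - v y) x = mollify \<rho> w x - mollify \<rho> v x"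
  using mollify_integrable[OF assms(1,2), of x] mollify_integrable[OF assms(1,3), of x]
  by (simp add: mollify_def algebra_simps)

lemma mollifier_integral:
  assumes "mollifier a \<rho>"
  shows "integrable lborel (\<lambda>y. \<rho> (x - y))" "(LINT y|lborel. \<rho> (x - y)) = 1"
proof -
  have s: "\<rho> \<in> borel_measurable borel" using assms by (simp add: mollifier_def smooth_borel)
  show "integrable lborel (\<lambda>y. \<rho> (x - y))"
    by (rule integrable_reflect[OF test_function_integrable[OF mollifier_test_function[OF assms]]])
  show "(LINT y|lborel. \<rho> (x - y)) = 1"
    using assms by (subst integral_reflect[OF s]) (simp add: mollifier_def)
qed

text \<open>The mollified value is a weighted mean of values at distance less than a. Bounds are
  asked for only there, which keeps all later estimates local.\<close>

lemma mollify_bounds: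
  assumes m: "mollifier a \<rho>" and w: "integrable lborel w"
    and b: "\<And>y. norm (x - y) < a \<Longrightarrow> l \<le> w y" "\<And>y. norm (x - y) < a \<Longrightarrow> w y \<le> u"
  shows "l \<le> mollify \<rho> w x" "mollify \<rho> w x \<le> u"
proof -
  note i = mollify_integrable[OF mollifier_test_function[OF m] w, of x]
  note j = mollifier_integral[OF m, of x]
  have p: "\<rho> (x - y) * l \<le> \<rho> (x - y) * w y" "\<rho> (x - y) * w y \<le> \<rho> (x - y) * u" for y
    using b[of y] m by (cases "norm (x - y) < a"; auto simp: mollifier_def intro: mult_left_mono)+
  have "l = (LINT y|lborel. \<rho> (x - y) * l)" using j by simp
  also have "\<dots> \<le> mollify \<rho> w x" unfolding mollify_def
    by (rule Bochner_Integration.integral_mono[OF _ i]) (use p j in auto)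
  finally show "l \<le> mollify \<rho> w x" .
  have "mollify \<rho> w x \<le> (LINT y|lborel. \<rho> (x - y) * u)" unfolding mollify_def
    by (rule Bochner_Integration.integral_mono[OF i]) (use p j in auto)
  also have "\<dots> = u" using j by simp
  finally show "mollify \<rho> w x \<le> u" .
qed

section \<open>Convergence of mollifications in the mean\<close>

lemma integrable_of_square:
  fixes w :: "real^'n \<Rightarrow> real"
  assumes w: "w \<in> borel_measurable borel" and i: "integrable lborel (\<lambda>x. (w x)\<^sup>2)" and z: "\<And>x. norm x > M \<Longrightarrow> w x = 0"
  shows "integrable lborel w"
proof (rule Bochner_Integration.integrable_bound)
  have "integrable lborel (indicator (cball 0 M) :: real^'n \<Rightarrow> real)"
    by (rule integrable_real_indicator, simp, rule emeasure_lborel_cball_finite)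
  then show "integrable lborel (\<lambda>x. indicator (cball 0 M) x + (w x)\<^sup>2)" using i by simp
  have "\<bar>w x\<bar> \<le> 1 + (w x)\<^sup>2" for x
    using zero_le_power2[of "\<bar>w x\<bar> - 1"] by (simp add: power2_eq_square algebra_simps)
  then have "\<bar>w x\<bar> \<le> indicator (cball 0 M) x + (w x)\<^sup>2" for x
    using z[of x] by (cases "norm x \<le> M") auto
  then show "AE x in lborel. norm (w x) \<le> norm (indicator (cball 0 M) x + (w x)\<^sup>2)"
    by (auto intro: order_trans)
qed (use w in simp)

text \<open>Jensen's inequality for the probability density \<rho>(x - y), then Tonelli: integrating
  in x first gives 1 for every y.\<close>

lemma mollify_contraction:
  assumes m: "mollifier a \<rho>" and w: "w \<in> borel_measurable borel" "integrable lborel (\<lambda>x. (w x)\<^sup>2)"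
    "\<And>x. norm x > M \<Longrightarrow> w x = 0"
  shows "(LINT x|lborel. (mollify \<rho> w x)\<^sup>2) \<le> (LINT x|lborel. (w x)\<^sup>2)"
    and "integrable lborel (\<lambda>x. (mollify \<rho> w x)\<^sup>2)"
proof -
  note t = mollifier_test_function[OF m]
  have iw: "integrable lborel w" by (rule integrable_of_square[OF w])
  have [measurable]: "w \<in> borel_measurable borel" "\<rho> \<in> borel_measurable borel"
    using w m by (simp_all add: mollifier_def smooth_borel)
  have r0: "\<rho> x \<ge> 0" for x using m by (simp add: mollifier_def)
  have iw2: "integrable lborel (\<lambda>y. \<rho> (x - y) * (w y)\<^sup>2)" for x by (rule mollify_integrable[OF t w(2)])
  have jensen: "(mollify \<rho> w x)\<^sup>2 \<le> (LINT y|lborel. \<rho> (x - y) * (w y)\<^sup>2)" for x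
  proof -
    let ?a = "mollify \<rho> w x"
    note i = mollify_integrable[OF t iw, of x] iw2[of x] mollifier_integral[OF m, of x]
    \<comment> \<open>Jensen's inequality as nonnegativity of the variance of w around its mean
      \<open>?a\<close>.\<close>
    have "0 \<le> (LINT y|lborel. \<rho> (x - y) * (w y - ?a)\<^sup>2)"
      by (intro Bochner_Integration.integral_nonneg) (simp add: r0)
    also have "(\<lambda>y. \<rho> (x - y) * (w y - ?a)\<^sup>2)
        = (\<lambda>y. \<rho> (x - y) * (w y)\<^sup>2 - (2 * ?a) * (\<rho> (x - y) * w y) + ?a\<^sup>2 * \<rho> (x - y))"
      by (auto simp: power2_eq_square algebra_simps)
    also have "(LINT y|lborel. \<dots> y) = (LINT y|lborel. \<rho> (x - y) * (w y)\<^sup>2) - (2 * ?a) * ?a + ?a\<^sup>2"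
      using i by (simp add: mollify_def)
    finally show ?thesis by (simp add: power2_eq_square)
  qed
  have ti: "test_function (mollify \<rho> w)" by (rule test_function_mollify[OF m iw w(3)])
  have [measurable]: "mollify \<rho> w \<in> borel_measurable borel"
    using test_function_smooth[OF ti] by (rule smooth_borel)
  show i2: "integrable lborel (\<lambda>x. (mollify \<rho> w x)\<^sup>2)"
    unfolding power2_eq_square
    by (intro test_function_integrable test_function_mult ti test_function_smooth[OF ti])
  have "(\<integral>\<^sup>+x. ennreal ((mollify \<rho> w x)\<^sup>2) \<partial>lborel) \<le> (\<integral>\<^sup>+x. \<integral>\<^sup>+y. ennreal (\<rho> (x - y) * (w y)\<^sup>2) \<partial>lborel \<partial>lborel)"
  proof (rule nn_integral_mono)
    fix x
    have "ennreal ((mollify \<rho> w x)\<^sup>2) \<le> ennreal (LINT y|lborel. \<rho> (x - y) * (w y)\<^sup>2)"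
      using jensen by (rule ennreal_leI)
    also have "\<dots> = (\<integral>\<^sup>+y. ennreal (\<rho> (x - y) * (w y)\<^sup>2) \<partial>lborel)"
      by (subst nn_integral_eq_integral[OF iw2]) (auto simp: r0)
    finally show "ennreal ((mollify \<rho> w x)\<^sup>2) \<le> (\<integral>\<^sup>+y. ennreal (\<rho> (x - y) * (w y)\<^sup>2) \<partial>lborel)" .
  qed
  also have "\<dots> = (\<integral>\<^sup>+y. \<integral>\<^sup>+x. ennreal (\<rho> (x - y) * (w y)\<^sup>2) \<partial>lborel \<partial>lborel)"
    by (rule lborel_pair.Fubini') measurable
  also have "\<dots> = (\<integral>\<^sup>+y. ennreal ((w y)\<^sup>2) \<partial>lborel)"
  proof (rule nn_integral_cong)
    fix y
    have "(\<integral>\<^sup>+x. ennreal (\<rho> (x - y) * (w y)\<^sup>2) \<partial>lborel) = (\<integral>\<^sup>+x. ennreal ((w y)\<^sup>2) * ennreal (\<rho> (x + (- y))) \<partial>lborel)"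
      by (intro nn_integral_cong) (simp add: r0 ennreal_mult' mult.commute)
    also have "\<dots> = ennreal ((w y)\<^sup>2) * (\<integral>\<^sup>+x. ennreal (\<rho> (x + (- y))) \<partial>lborel)"
      by (rule nn_integral_cmult) measurable
    also have "(\<integral>\<^sup>+x. ennreal (\<rho> (x + (- y))) \<partial>lborel) = (\<integral>\<^sup>+x. ennreal (\<rho> x) \<partial>lborel)"
      by (rule nn_integral_shift[where f = "\<lambda>x. ennreal (\<rho> x)"]) measurable
    also have "\<dots> = ennreal (LINT x|lborel. \<rho> x)"
      by (rule nn_integral_eq_integral[OF test_function_integrable[OF t]]) (simp add: r0)
    also have "\<dots> = 1" using m by (simp add: mollifier_def)
    finally show "(\<integral>\<^sup>+x. ennreal (\<rho> (x - y) * (w y)\<^sup>2) \<partial>lborel) = ennreal ((w y)\<^sup>2)" by simp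
  qed
  finally have "ennreal (LINT x|lborel. (mollify \<rho> w x)\<^sup>2) \<le> ennreal (LINT x|lborel. (w x)\<^sup>2)"
    using i2 w(2) by (simp add: nn_integral_eq_integral)
  then show "(LINT x|lborel. (mollify \<rho> w x)\<^sup>2) \<le> (LINT x|lborel. (w x)\<^sup>2)"
    by (subst (asm) ennreal_le_iff) auto
qed

text \<open>A measurable function is an almost everywhere limit of continuous ones, by the
  definition of \<open>measurable_on\<close>. Clipping their values and supports gives a common
  bound for dominated convergence.\<close>

lemma continuous_dense_bounded:
  fixes w :: "real^'n \<Rightarrow> real"
  assumes w: "w \<in> borel_measurable borel" "\<And>x. norm x > M \<Longrightarrow> w x = 0" and B: "\<And>x. \<bar>w x\<bar> \<le> B"
    and e: "e > 0"
  obtains g where "continuous_on UNIV g" "\<And>x. norm x > M + 1 \<Longrightarrow> g x = 0"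
    "(LINT x|lborel. (w x - g x)\<^sup>2) \<le> e"
proof -
  have B0: "B \<ge> 0" using B[of 0] by linarith
  have "w \<in> borel_measurable lebesgue" using w(1) by (simp add: measurable_completion)
  then have "w measurable_on UNIV" by (intro lebesgue_measurable_imp_measurable_on_real) auto
  then obtain N g where N: "negligible N" and g: "\<And>n. continuous_on UNIV (g n)"
    and lim: "\<And>x. x \<notin> N \<Longrightarrow> (\<lambda>n. g n x) \<longlonglongrightarrow> w x"
    by (auto simp: measurable_on_def)
  \<comment> \<open>Clamping to [-B, B] and cutting off between radius M and M + 1 leaves the limit
    w unchanged.\<close>
  define k where "k = (\<lambda>n x. max (- B) (min B (g n x)) * max 0 (min 1 (M + 1 - norm x)))"
  have ck: "continuous_on UNIV (k n)" for n
    unfolding k_def by (intro continuous_intros g)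
  have kz: "k n x = 0" if "norm x > M + 1" for n x using that by (simp add: k_def)
  have kb: "\<bar>k n x\<bar> \<le> B" for n x
  proof -
    have "\<bar>k n x\<bar> \<le> B * 1" unfolding k_def abs_mult by (intro mult_mono) (use B0 in auto)
    then show ?thesis by simp
  qed
  have kl: "(\<lambda>n. k n x) \<longlonglongrightarrow> w x" if "x \<notin> N" for x
  proof -
    have "(\<lambda>n. k n x) \<longlonglongrightarrow> max (- B) (min B (w x)) * max 0 (min 1 (M + 1 - norm x))"
      unfolding k_def by (intro tendsto_intros lim that)
    moreover have "max (- B) (min B (w x)) = w x" using B[of x] by auto
    moreover have "w x * max 0 (min 1 (M + 1 - norm x)) = w x"
      using w(2)[of x] by (cases "norm x > M") auto
    ultimately show ?thesis by simp
  qed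
  have [measurable]: "k n \<in> borel_measurable borel" "w \<in> borel_measurable borel" for n
    using ck w by (auto intro: borel_measurable_continuous_onI)
  have "AE x in lebesgue. x \<notin> N" using N by (intro AE_not_in) (simp add: negligible_iff_null_sets)
  have "(\<lambda>n. LINT x|lebesgue. (w x - k n x)\<^sup>2) \<longlonglongrightarrow> (LINT x::real^'n|lebesgue. (0::real))"
  proof (rule integral_dominated_convergence)
    have "integrable lborel (\<lambda>x::real^'n. (2 * B)\<^sup>2 * indicator (cball 0 (M + 1)) x :: real)"
      by (intro integrable_mult_right, rule integrable_real_indicator, simp, rule emeasure_lborel_cball_finite)
    then show "integrable lebesgue (\<lambda>x::real^'n. (2 * B)\<^sup>2 * indicator (cball 0 (M + 1)) x :: real)"
      by (subst integrable_completion) auto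
    show "AE x in lebesgue. (\<lambda>n. (w x - k n x)\<^sup>2) \<longlonglongrightarrow> 0"
      using \<open>AE x in lebesgue. x \<notin> N\<close>
    proof eventually_elim
      case (elim x)
      have "(\<lambda>n. (w x - k n x)\<^sup>2) \<longlonglongrightarrow> (w x - w x)\<^sup>2" by (intro tendsto_intros kl elim)
      then show ?case by simp
    qed
    show "AE x in lebesgue. norm ((w x - k n x)\<^sup>2) \<le> (2 * B)\<^sup>2 * indicator (cball 0 (M + 1)) x" for n
    proof (rule AE_I2)
      fix x
      have "\<bar>w x - k n x\<bar> \<le> 2 * B" using B[of x] kb[of n x] by linarith
      then have "(w x - k n x)\<^sup>2 \<le> (2 * B)\<^sup>2" by (rule abs_le_square_iff[THEN iffD1, OF order_trans]) simp
      then show "norm ((w x - k n x)\<^sup>2) \<le> (2 * B)\<^sup>2 * indicator (cball 0 (M + 1)) x"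
        using w(2)[of x] kz[of x n] by (cases "norm x \<le> M + 1") auto
    qed
  qed (simp_all add: measurable_completion)
  then have "(\<lambda>n. LINT x|lborel. (w x - k n x)\<^sup>2) \<longlonglongrightarrow> 0"
    by (simp add: integral_completion)
  then have "eventually (\<lambda>n. (LINT x|lborel. (w x - k n x)\<^sup>2) < e) sequentially"
    using e by (rule order_tendstoD)
  then obtain n where "(LINT x|lborel. (w x - k n x)\<^sup>2) < e"
    by (meson eventually_sequentially order_refl)
  then show ?thesis using that[of "k n"] ck kz by force
qed

lemma square_add_le: "(a + b)\<^sup>2 \<le> 2 * a\<^sup>2 + 2 * (b::real)\<^sup>2"
  using zero_le_power2[of "a - b"] by (simp add: power2_eq_square algebra_simps)

lemma integrable_square_diff:
  fixes f g :: "'a \<Rightarrow> real"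
  assumes "f \<in> borel_measurable M" "g \<in> borel_measurable M"
    "integrable M (\<lambda>x. (f x)\<^sup>2)" "integrable M (\<lambda>x. (g x)\<^sup>2)"
  shows "integrable M (\<lambda>x. (f x - g x)\<^sup>2)"
proof (rule Bochner_Integration.integrable_bound)
  show "integrable M (\<lambda>x. 2 * (f x)\<^sup>2 + 2 * (g x)\<^sup>2)" using assms by simp
  show "AE x in M. norm ((f x - g x)\<^sup>2) \<le> norm (2 * (f x)\<^sup>2 + 2 * (g x)\<^sup>2)"
    using square_add_le[of "f x" "- g x" for x] by simp
qed (use assms in auto)

text \<open>Truncation at height n reduces to the bounded case: the squared error is dominated by
  w^2 and is eventually 0 at each point.\<close>

lemma continuous_dense:
  fixes w :: "real^'n \<Rightarrow> real"
  assumes w: "w \<in> borel_measurable borel" "integrable lborel (\<lambda>x. (w x)\<^sup>2)" "\<And>x. norm x > M \<Longrightarrow> w x = 0"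
    and e: "e > 0"
  obtains g where "continuous_on UNIV g" "\<And>x. norm x > M + 1 \<Longrightarrow> g x = 0"
    "(LINT x|lborel. (w x - g x)\<^sup>2) \<le> e"
proof -
  define v where "v = (\<lambda>n x. max (- real n) (min (real n) (w x)))"
  have [measurable]: "w \<in> borel_measurable borel" "v n \<in> borel_measurable borel" for n
    using w by (auto simp: v_def)
  have dv: "\<bar>w x - v n x\<bar> \<le> \<bar>w x\<bar>" for n x by (auto simp: v_def)
  have "(\<lambda>n. LINT x|lborel. (w x - v n x)\<^sup>2) \<longlonglongrightarrow> (LINT x::real^'n|lborel. (0::real))"
  proof (rule integral_dominated_convergence[OF _ _ w(2)])
    show "AE x in lborel. (\<lambda>n. (w x - v n x)\<^sup>2) \<longlonglongrightarrow> 0"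
    proof (rule AE_I2)
      fix x
      obtain m where m: "\<bar>w x\<bar> \<le> real m" using real_arch_simple by blast
      have "eventually (\<lambda>n. (w x - v n x)\<^sup>2 = 0) sequentially"
        unfolding eventually_sequentially
      proof (intro exI[of _ m] allI impI)
        fix n assume "n \<ge> m"
        then have "real m \<le> real n" by simp
        with m show "(w x - v n x)\<^sup>2 = 0" by (auto simp: v_def)
      qed
      then show "(\<lambda>n. (w x - v n x)\<^sup>2) \<longlonglongrightarrow> 0" by (rule tendsto_eventually)
    qed
    show "AE x in lborel. norm ((w x - v n x)\<^sup>2) \<le> (w x)\<^sup>2" for n
      using dv by (auto simp: abs_le_square_iff)
  qed auto
  then have "(\<lambda>n. LINT x|lborel. (w x - v n x)\<^sup>2) \<longlonglongrightarrow> 0" by simp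
  then have "eventually (\<lambda>n. (LINT x|lborel. (w x - v n x)\<^sup>2) < e / 4) sequentially"
    using e by (intro order_tendstoD) auto
  then obtain n where n: "(LINT x|lborel. (w x - v n x)\<^sup>2) < e / 4"
    by (meson eventually_sequentially order_refl)
  have vz: "v n x = 0" if "norm x > M" for x using w(3)[OF that] by (simp add: v_def)
  have vb: "\<bar>v n x\<bar> \<le> real n" for x by (auto simp: v_def)
  have "e / 4 > 0" using e by simp
  then obtain g where g: "continuous_on UNIV g" "\<And>x. norm x > M + 1 \<Longrightarrow> g x = 0"
    "(LINT x|lborel. (v n x - g x)\<^sup>2) \<le> e / 4"
    using continuous_dense_bounded[OF \<open>v n \<in> borel_measurable borel\<close> vz vb] by blast
  have [measurable]: "g \<in> borel_measurable borel" using g by (auto intro: borel_measurable_continuous_onI)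
  have ig: "integrable lborel (\<lambda>x. (g x)\<^sup>2)"
    by (rule continuous_compact_support_integrable[of _ "M + 2"]) (use g in \<open>auto intro!: continuous_intros\<close>)
  have iv: "integrable lborel (\<lambda>x. (v n x)\<^sup>2)"
  proof (rule Bochner_Integration.integrable_bound[OF w(2)])
    have "\<bar>v n x\<bar> \<le> \<bar>w x\<bar>" for x by (auto simp: v_def)
    then show "AE x in lborel. norm ((v n x)\<^sup>2) \<le> norm ((w x)\<^sup>2)" by (auto simp: abs_le_square_iff)
  qed simp
  have i: "integrable lborel (\<lambda>x. (w x - v n x)\<^sup>2)" "integrable lborel (\<lambda>x. (v n x - g x)\<^sup>2)"
    "integrable lborel (\<lambda>x. (w x - g x)\<^sup>2)"
    by (rule integrable_square_diff[OF _ _ w(2) iv] integrable_square_diff[OF _ _ iv ig] integrable_square_diff[OF _ _ w(2) ig]; simp)+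
  have "(LINT x|lborel. (w x - g x)\<^sup>2) \<le> (LINT x|lborel. 2 * (w x - v n x)\<^sup>2 + 2 * (v n x - g x)\<^sup>2)"
    by (rule Bochner_Integration.integral_mono) (use i square_add_le[of "w x - v n x" "v n x - g x" for x] in auto)
  also have "\<dots> \<le> e" using i n g(3) by simp
  finally show ?thesis using that g by blast
qed

lemma mollify_uniform:
  fixes g :: "real^'n \<Rightarrow> real"
  assumes g: "continuous_on UNIV g" "\<And>x. norm x > M \<Longrightarrow> g x = 0" and e: "e > 0"
  obtains d where "d > 0" "\<And>a \<rho> x. mollifier a \<rho> \<Longrightarrow> a \<le> d \<Longrightarrow> \<bar>mollify \<rho> g x - g x\<bar> \<le> e"
proof -
  have "uniformly_continuous_on UNIV g"
    by (rule continuous_compact_support_uniform[OF g(1), of "M + 1"]) (use g in auto)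
  then obtain d where d: "d > 0" "\<And>x y. dist y x < d \<Longrightarrow> dist (g y) (g x) < e"
    using e unfolding uniformly_continuous_on_def by (metis UNIV_I)
  have ig: "integrable lborel g"
    by (rule continuous_compact_support_integrable[OF g(1), of "M + 1"]) (use g in auto)
  have "\<bar>mollify \<rho> g x - g x\<bar> \<le> e" if m: "mollifier a \<rho>" "a \<le> d" for a \<rho> x
  proof -
    have "g x - e \<le> g y \<and> g y \<le> g x + e" if "norm (x - y) < a" for y
    proof -
      have "dist y x < d" using that m(2) by (simp add: dist_norm norm_minus_commute)
      from d(2)[OF this] show ?thesis by (simp add: dist_real_def abs_if split: if_splits)
    qed
    then have "g x - e \<le> mollify \<rho> g x" "mollify \<rho> g x \<le> g x + e"
      by (intro mollify_bounds[OF m(1) ig]; blast)+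
    then show ?thesis by linarith
  qed
  then show ?thesis using that d(1) by blast
qed

text \<open>A continuous g close to w is mollified with uniform convergence, and the contraction
  property controls the mollification of w - g. The threshold d serves all mollifiers of smaller
  radius, so that a function and the components of its gradient can later share one.\<close>

lemma mollify_L2_convergence:
  fixes w :: "real^'n \<Rightarrow> real"
  assumes w: "w \<in> borel_measurable borel" "integrable lborel (\<lambda>x. (w x)\<^sup>2)" "\<And>x. norm x > M \<Longrightarrow> w x = 0"
    and e: "e > 0"
  obtains d where "d > 0"
    "\<And>a \<rho>. mollifier a \<rho> \<Longrightarrow> a \<le> d \<Longrightarrow> (LINT x|lborel. (mollify \<rho> w x - w x)\<^sup>2) \<le> e"
proof -
  \<comment> \<open>The final split uses e/16 twice with weight 4 and the uniform part e/4 once with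
    weight 2, which adds up to e.\<close>
  have "e / 16 > 0" using e by simp
  then obtain g where g: "continuous_on UNIV g" "\<And>x. norm x > M + 1 \<Longrightarrow> g x = 0"
    "(LINT x|lborel. (w x - g x)\<^sup>2) \<le> e / 16"
    using continuous_dense[OF w] by blast
  define W where "W = measure lborel (cball (0::real^'n) (M + 2))"
  have W0: "W \<ge> 0" by (simp add: W_def)
  \<comment> \<open>A uniform error \<open>e2\<close> on the ball of measure W contributes at most
    \<open>e2\<^sup>2 * W\<close> \<le> e/4; W + 1 avoids a division by 0.\<close>
  define e2 where "e2 = sqrt (e / (4 * (W + 1)))"
  have e2: "e2 > 0" "e2\<^sup>2 = e / (4 * (W + 1))" using e W0 by (auto simp: e2_def)
  obtain d where d: "d > 0" "\<And>a \<rho> x. mollifier a \<rho> \<Longrightarrow> a \<le> d \<Longrightarrow> \<bar>mollify \<rho> g x - g x\<bar> \<le> e2"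
    using mollify_uniform[OF g(1,2) e2(1)] by blast
  have [measurable]: "w \<in> borel_measurable borel" "g \<in> borel_measurable borel"
    using g w by (auto intro: borel_measurable_continuous_onI)
  have ig2: "integrable lborel (\<lambda>x. (g x)\<^sup>2)"
    by (rule continuous_compact_support_integrable[of _ "M + 2"]) (use g in \<open>auto intro!: continuous_intros\<close>)
  have gi: "integrable lborel g"
    by (rule continuous_compact_support_integrable[OF g(1), of "M + 2"]) (use g in auto)
  have wi: "integrable lborel w" by (rule integrable_of_square[OF w])
  have iwg: "integrable lborel (\<lambda>x. (w x - g x)\<^sup>2)"
    by (rule integrable_square_diff[OF _ _ w(2) ig2]) simp_all
  have "(LINT x|lborel. (mollify \<rho> w x - w x)\<^sup>2) \<le> e" if m: "mollifier a \<rho>" "a \<le> min d 1" for a \<rho>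
  proof -
    note t = mollifier_test_function[OF m(1)]
    have wz: "w x - g x = 0" if "norm x > M + 1" for x using w(3)[of x] g(2)[of x] that by auto
    have c: "(LINT x|lborel. (mollify \<rho> (\<lambda>y. w y - g y) x)\<^sup>2) \<le> e / 16"
      "integrable lborel (\<lambda>x. (mollify \<rho> (\<lambda>y. w y - g y) x)\<^sup>2)"
      using order_trans[OF mollify_contraction(1)[OF m(1) _ iwg wz, of "M + 1"] g(3)]
        mollify_contraction(2)[OF m(1) _ iwg wz, of "M + 1"] by simp_all
    have tg: "test_function (mollify \<rho> g)" by (rule test_function_mollify[OF m(1) gi g(2)])
    have [measurable]: "mollify \<rho> g \<in> borel_measurable borel"
      using test_function_smooth[OF tg] by (rule smooth_borel)
    have mg: "integrable lborel (\<lambda>x. (mollify \<rho> g x)\<^sup>2)" by (rule mollify_contraction(2)[OF m(1) _ ig2 g(2)]) auto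
    have imgg: "integrable lborel (\<lambda>x. (mollify \<rho> g x - g x)\<^sup>2)"
      by (rule integrable_square_diff[OF _ _ mg ig2]) simp_all
    have "(LINT x|lborel. (mollify \<rho> g x - g x)\<^sup>2) \<le> (LINT x|lborel. e2\<^sup>2 * indicator (cball (0::real^'n) (M + 2)) x)"
    proof (rule Bochner_Integration.integral_mono[OF imgg])
      show "integrable lborel (\<lambda>x. e2\<^sup>2 * indicator (cball (0::real^'n) (M + 2)) x :: real)"
        by (intro integrable_mult_right, rule integrable_real_indicator, simp, rule emeasure_lborel_cball_finite)
      fix x :: "real^'n"
      show "(mollify \<rho> g x - g x)\<^sup>2 \<le> e2\<^sup>2 * indicator (cball 0 (M + 2)) x"
      proof (cases "norm x \<le> M + 2")
        case True
        have "\<bar>mollify \<rho> g x - g x\<bar> \<le> \<bar>e2\<bar>" using d(2)[OF m(1), of x] m(2) e2(1) by simp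
        then show ?thesis using True by (simp add: abs_le_square_iff)
      next
        case False
        then have "mollify \<rho> g x = 0" using m(2) by (intro mollify_support[OF m(1) g(2)]) auto
        then show ?thesis using False g(2)[of x] by simp
      qed
    qed
    also have "\<dots> = e / 4 * (W / (W + 1))" using W0 by (simp add: e2(2) W_def)
    also have "\<dots> \<le> e / 4 * 1" using e W0 by (intro mult_left_mono) auto
    finally have c2: "(LINT x|lborel. (mollify \<rho> g x - g x)\<^sup>2) \<le> e / 4" by simp
    have pt: "(mollify \<rho> w x - w x)\<^sup>2 \<le> 4 * (mollify \<rho> (\<lambda>y. w y - g y) x)\<^sup>2 + 4 * (w x - g x)\<^sup>2 + 2 * (mollify \<rho> g x - g x)\<^sup>2" for x
    proof -
      have "mollify \<rho> w x - w x = (mollify \<rho> (\<lambda>y. w y - g y) x + (- (w x - g x))) + (mollify \<rho> g x - g x)"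
        by (simp add: mollify_diff[OF t wi gi])
      moreover have "(p + (- q) + r)\<^sup>2 \<le> 4 * p\<^sup>2 + 4 * q\<^sup>2 + 2 * r\<^sup>2" for p q r :: real
        using square_add_le[of "p + (- q)" r] square_add_le[of p "- q"] unfolding power2_minus by linarith
      ultimately show ?thesis by metis
    qed
    have mw: "integrable lborel (\<lambda>x. (mollify \<rho> w x)\<^sup>2)" by (rule mollify_contraction(2)[OF m(1) w])
    have [measurable]: "mollify \<rho> w \<in> borel_measurable borel"
      using smooth_mollify[OF t wi] by (rule smooth_borel)
    have imw: "integrable lborel (\<lambda>x. (mollify \<rho> w x - w x)\<^sup>2)"
      by (rule integrable_square_diff[OF _ _ mw w(2)]) simp_all
    have "(LINT x|lborel. (mollify \<rho> w x - w x)\<^sup>2) \<le> (LINT x|lborel. 4 * (mollify \<rho> (\<lambda>y. w y - g y) x)\<^sup>2 + 4 * (w x - g x)\<^sup>2 + 2 * (mollify \<rho> g x - g x)\<^sup>2)"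
      by (rule Bochner_Integration.integral_mono[OF imw]) (use c iwg imgg pt in auto)
    also have "\<dots> = 4 * (LINT x|lborel. (mollify \<rho> (\<lambda>y. w y - g y) x)\<^sup>2) + 4 * (LINT x|lborel. (w x - g x)\<^sup>2) + 2 * (LINT x|lborel. (mollify \<rho> g x - g x)\<^sup>2)"
      using c iwg imgg by simp
    also have "\<dots> \<le> e" using c(1) c2 g(3) by linarith
    finally show ?thesis .
  qed
  then show ?thesis using that[of "min d 1"] d(1) by simp
qed

section \<open>Weak gradients\<close>

lemma lebesgue_measurable_borel: "f \<in> borel_measurable borel \<Longrightarrow> f \<in> borel_measurable lebesgue"
  by (simp add: measurable_completion)

lemma lebesgue_cball [measurable, simp]: "cball (a::'a::euclidean_space) r \<in> sets lebesgue"
  by simp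

lemma indicator_cball_scaleR_measurable:
  fixes f :: "'a::euclidean_space \<Rightarrow> 'b::euclidean_space"
  shows "f \<in> borel_measurable lebesgue \<Longrightarrow> (\<lambda>x. indicator (cball a r) x *\<^sub>R f x) \<in> borel_measurable lebesgue"
  by (intro borel_measurable_scaleR borel_measurable_indicator lebesgue_cball)

lemma vec_nth_borel: "(\<lambda>x::real^'n. x $ i) \<in> borel_measurable borel"
  by (intro borel_measurable_continuous_onI continuous_intros)

lemma lebesgue_vec_nth:
  fixes G :: "'a::euclidean_space \<Rightarrow> real^'n"
  assumes "G \<in> borel_measurable lebesgue" shows "(\<lambda>x. G x $ i) \<in> borel_measurable lebesgue"
  using assms vec_nth_borel[of i] by (rule measurable_compose)

text \<open>\<open>Lp_loc\<close> gives measurability on each compact set separately; exhausting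
  space by balls of integer radius makes it global.\<close>

lemma lebesgue_measurable_local:
  fixes f :: "real^'n \<Rightarrow> 'b::euclidean_space"
  assumes "\<And>M. f \<in> borel_measurable (lebesgue_on (cball 0 M))"
  shows "f \<in> borel_measurable lebesgue"
proof (rule borel_measurable_LIMSEQ_metric)
  show "(\<lambda>x. if x \<in> cball 0 (real n) then f x else 0) \<in> borel_measurable lebesgue" for n
    by (rule borel_measurable_if_I[OF assms]) auto
  show "(\<lambda>n. if x \<in> cball 0 (real n) then f x else 0) \<longlonglongrightarrow> f x" for x
  proof -
    obtain m where "norm x \<le> real m" using real_arch_simple by blast
    then have "eventually (\<lambda>n. (if x \<in> cball 0 (real n) then f x else 0) = f x) sequentially"
      unfolding eventually_sequentially by (intro exI[of _ m]) auto
    then show ?thesis by (rule tendsto_eventually)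
  qed
qed

text \<open>Every compact set lies in a ball around the origin, so local conditions can be phrased
  with these balls alone.\<close>

lemma Lp_loc_ereal_iff:
  fixes f :: "real^'n \<Rightarrow> 'b::euclidean_space"
  shows "Lp_loc (ereal p) f \<longleftrightarrow> f \<in> borel_measurable lebesgue \<and>
    (\<forall>M. set_integrable lebesgue (cball 0 M) (\<lambda>x. norm (f x) powr p))"
proof
  assume L: "Lp_loc (ereal p) f"
  then have K: "f \<in> borel_measurable (lebesgue_on (cball 0 M))"
    "integrable (lebesgue_on (cball 0 M)) (\<lambda>x. norm (f x) powr p)" for M
    by (auto simp: Lp_loc_def Lp_on_def)
  have "f \<in> borel_measurable lebesgue" by (rule lebesgue_measurable_local[OF K(1)])
  moreover have "set_integrable lebesgue (cball 0 M) (\<lambda>x. norm (f x) powr p)" for M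
    using K(2)[of M] by (subst (asm) integrable_restrict_space) (auto simp: set_integrable_def)
  ultimately show "f \<in> borel_measurable lebesgue \<and>
    (\<forall>M. set_integrable lebesgue (cball 0 M) (\<lambda>x. norm (f x) powr p))" by blast
next
  assume R: "f \<in> borel_measurable lebesgue \<and>
    (\<forall>M. set_integrable lebesgue (cball 0 M) (\<lambda>x. norm (f x) powr p))"
  show "Lp_loc (ereal p) f"
    unfolding Lp_loc_def
  proof (intro allI impI)
    fix K :: "(real^'n) set" assume K: "compact K"
    then obtain M where M: "K \<subseteq> cball 0 M" using compact_imp_bounded bounded_subset_ballD[of K 0] by (metis ball_subset_cball order_trans)
    have KL: "K \<in> sets lebesgue" using K by (simp add: compact_imp_closed)
    have "set_integrable lebesgue K (\<lambda>x. norm (f x) powr p)"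
      by (rule set_integrable_subset[OF _ KL M]) (use R in simp)
    then have "integrable (lebesgue_on K) (\<lambda>x. norm (f x) powr p)"
      using KL by (subst integrable_restrict_space) (auto simp: set_integrable_def)
    then show "Lp_on (ereal p) K f"
      using R by (simp add: Lp_on_def measurable_restrict_space1)
  qed
qed

lemma Lp_loc_1_iff:
  fixes f :: "real^'n \<Rightarrow> 'b::euclidean_space"
  shows "Lp_loc 1 f \<longleftrightarrow> f \<in> borel_measurable lebesgue \<and> (\<forall>M. set_integrable lebesgue (cball 0 M) f)"
proof -
  have *: "set_integrable lebesgue (cball 0 M) (\<lambda>x. norm (f x)) = set_integrable lebesgue (cball 0 M) f"
    if "f \<in> borel_measurable lebesgue" for M
  proof -
    have "(\<lambda>x. indicator (cball 0 M) x *\<^sub>R norm (f x)) = (\<lambda>x. norm (indicator (cball 0 M) x *\<^sub>R f x))"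
      by (auto simp: indicator_def)
    then show ?thesis unfolding set_integrable_def
      by (simp only: integrable_norm_iff[OF indicator_cball_scaleR_measurable[OF that]])
  qed
  show ?thesis
  proof (cases "f \<in> borel_measurable lebesgue")
    case True
    then show ?thesis unfolding one_ereal_def Lp_loc_ereal_iff by (simp add: *[OF True])
  qed (simp add: one_ereal_def Lp_loc_ereal_iff)
qed

lemma Lp_loc_2_iff:
  fixes f :: "real^'n \<Rightarrow> 'b::euclidean_space"
  shows "Lp_loc 2 f \<longleftrightarrow> f \<in> borel_measurable lebesgue \<and> (\<forall>M. set_integrable lebesgue (cball 0 M) (\<lambda>x. (norm (f x))\<^sup>2))"
  by (simp add: Lp_loc_ereal_iff)

lemma Lp_on_2_UNIV_iff:
  fixes f :: "real^'n \<Rightarrow> 'b::euclidean_space"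
  shows "Lp_on 2 UNIV f \<longleftrightarrow> f \<in> borel_measurable lebesgue \<and> integrable lebesgue (\<lambda>x. (norm (f x))\<^sup>2)"
  by (simp add: Lp_on_def lebesgue_on_UNIV_eq)

lemma borel_representative:
  fixes f :: "'a::euclidean_space \<Rightarrow> real"
  assumes "f \<in> borel_measurable lebesgue"
  obtains g where "g \<in> borel_measurable borel" "AE x in lebesgue. f x = g x"
  using completion_ex_borel_measurable_real[OF assms] AE_completion by auto

lemma borel_representative_vec:
  fixes f :: "'a::euclidean_space \<Rightarrow> real^'n"
  assumes "f \<in> borel_measurable lebesgue"
  obtains g where "g \<in> borel_measurable borel" "AE x in lebesgue. f x = g x"
proof -
  have "\<exists>g. g \<in> borel_measurable borel \<and> (AE x in lebesgue. f x $ i = g x)" for i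
  proof -
    have "(\<lambda>x. f x $ i) \<in> borel_measurable lebesgue"
      by (rule lebesgue_vec_nth[OF assms])
    then show ?thesis using borel_representative by blast
  qed
  then have "\<forall>i. \<exists>g. g \<in> borel_measurable borel \<and> (AE x in lebesgue. f x $ i = g x)" by (rule allI)
  from choice[OF this] obtain g where
    g': "\<forall>i. g i \<in> borel_measurable borel \<and> (AE x in lebesgue. f x $ i = g i x)" by (rule exE)
  then have g: "g i \<in> borel_measurable borel" "AE x in lebesgue. f x $ i = g i x" for i by simp_all
  have "(\<lambda>x. \<chi> i. g i x) \<in> borel_measurable borel"
  proof (rule borel_measurable_euclidean_space[THEN iffD2], rule ballI)
    fix b :: "real^'n" assume "b \<in> Basis"
    then obtain i where "b = axis i 1" by (auto simp: Basis_vec_def)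
    then show "(\<lambda>x. (\<chi> i. g i x) \<bullet> b) \<in> borel_measurable borel" using g by (simp add: inner_axis)
  qed
  moreover have "AE x in lebesgue. f x = (\<chi> i. g i x)"
  proof -
    have "AE x in lebesgue. \<forall>i\<in>UNIV. f x $ i = g i x" by (rule AE_finite_allI) (use g in auto)
    then show ?thesis by eventually_elim (simp add: vec_eq_iff)
  qed
  ultimately show ?thesis using that by blast
qed

text \<open>D is merely locally integrable, so it is not D that is approximated but its sign, cut
  off to a ball: mollified, it becomes a sequence of test functions bounded by 1. In the limit the
  hypothesis says that |D| has integral 0 over the ball.\<close>

lemma fundamental_lemma:
  fixes D :: "real^'n \<Rightarrow> real"
  assumes D: "D \<in> borel_measurable borel" "\<And>M. set_integrable lborel (cball 0 M) D"
    and z: "\<And>\<phi>. test_function \<phi> \<Longrightarrow> (LINT x|lborel. D x * \<phi> x) = 0"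
  shows "AE x in lborel. D x = 0"
proof -
  have *: "AE x in lborel. norm x \<le> M \<longrightarrow> D x = 0" if M: "M > 0" for M
  proof -
    define s where "s = (\<lambda>x. (if D x > 0 then 1 else if D x < 0 then -1 else 0) * indicator (cball 0 M) x :: real)"
    have [measurable]: "D \<in> borel_measurable borel" by (rule D(1))
    have [measurable]: "s \<in> borel_measurable borel"
      unfolding s_def by (intro borel_measurable_times borel_measurable_indicator measurable_If) auto
    have sb: "\<bar>s x\<bar> \<le> 1" for x by (auto simp: s_def indicator_def)
    have iabs: "integrable lborel (\<lambda>x. indicator (cball 0 K) x * \<bar>D x\<bar>)" for K
      using integrable_abs[OF D(2)[of K, unfolded set_integrable_def]] by (simp add: abs_mult)
    have sz: "s x = 0" if "norm x > M" for x using that by (simp add: s_def)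
    have is2: "integrable lborel (\<lambda>x. (s x)\<^sup>2)"
    proof (rule Bochner_Integration.integrable_bound)
      show "integrable lborel (indicator (cball 0 M) :: real^'n \<Rightarrow> real)"
        by (rule integrable_real_indicator, simp, rule emeasure_lborel_cball_finite)
      show "AE x in lborel. norm ((s x)\<^sup>2) \<le> norm (indicator (cball 0 M) x :: real)"
        by (intro AE_I2) (auto simp: s_def indicator_def)
    qed simp
    have si: "integrable lborel s" by (rule integrable_of_square[OF _ is2 sz]) simp
    have "\<exists>p. mollifier (snd p) (fst p) \<and> snd p \<le> 1 \<and> (LINT x|lborel. (mollify (fst p) s x - s x)\<^sup>2) \<le> 1 / real (Suc n)" for n
    proof -
      have "(0::real) < 1 / real (Suc n)" by simp
      then obtain d where d: "d > 0"
        "\<And>a \<rho>. mollifier a \<rho> \<Longrightarrow> a \<le> d \<Longrightarrow> (LINT x|lborel. (mollify \<rho> s x - s x)\<^sup>2) \<le> 1 / real (Suc n)"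
        using mollify_L2_convergence[OF \<open>s \<in> borel_measurable borel\<close> is2 sz] by blast
      have "min d 1 > 0" using d(1) by simp
      from mollifier_exists[OF this] obtain \<rho> :: "real^'n \<Rightarrow> real" where "mollifier (min d 1) \<rho>" by blast
      then show ?thesis using d(2)[of "min d 1" \<rho>] by (intro exI[of _ "(\<rho>, min d 1)"]) simp
    qed
    then have "\<forall>n. \<exists>p. mollifier (snd p) (fst p) \<and> snd p \<le> 1 \<and> (LINT x|lborel. (mollify (fst p) s x - s x)\<^sup>2) \<le> 1 / real (Suc n)"
      by (rule allI)
    from choice[OF this] obtain p where p: "\<forall>n. mollifier (snd (p n)) (fst (p n)) \<and> snd (p n) \<le> 1
      \<and> (LINT x|lborel. (mollify (fst (p n)) s x - s x)\<^sup>2) \<le> 1 / real (Suc n)" by (rule exE)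
    define \<rho> a where "\<rho> = (\<lambda>n. fst (p n))" and "a = (\<lambda>n. snd (p n))"
    have \<rho>: "mollifier (a n) (\<rho> n)" "a n \<le> 1"
      "(LINT x|lborel. (mollify (\<rho> n) s x - s x)\<^sup>2) \<le> 1 / real (Suc n)" for n
      using p by (simp_all add: \<rho>_def a_def)
    define m where "m = (\<lambda>n. mollify (\<rho> n) s)"
    have tm: "test_function (m n)" for n unfolding m_def by (rule test_function_mollify[OF \<rho>(1) si sz])
    have [measurable]: "m n \<in> borel_measurable borel" for n by (rule smooth_borel[OF test_function_smooth[OF tm]])
    have mb: "\<bar>m n x\<bar> \<le> 1" for n x
    proof -
      have "-1 \<le> s y" "s y \<le> 1" for y using sb[of y] by linarith+
      then have "-1 \<le> m n x" "m n x \<le> 1" unfolding m_def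
        by (rule mollify_bounds[where l = "-1" and u = 1, OF \<rho>(1) si])+
      then show ?thesis by linarith
    qed
    have mz: "m n x = 0" if "norm x > M + 1" for n x
      unfolding m_def by (rule mollify_support[where M = M, OF \<rho>(1) sz]) (use that \<rho>(2)[of n] in auto)
    have mc: "integrable lborel (\<lambda>x. (m n x)\<^sup>2)" for n
      unfolding m_def by (rule mollify_contraction(2)[where M = M, OF \<rho>(1) _ is2 sz]) simp_all
    have im: "integrable lborel (\<lambda>x. (m n x - s x)\<^sup>2)" for n
      by (rule integrable_square_diff[OF _ _ mc is2]) simp_all
    have "(\<lambda>n. LINT x|lborel. norm ((m n x - s x)\<^sup>2)) \<longlonglongrightarrow> 0"
    proof (rule tendsto_sandwich[of "\<lambda>_. 0" _ _ "\<lambda>n. 1 / real (Suc n)"])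
      show "(\<lambda>n. 1 / real (Suc n)) \<longlonglongrightarrow> 0" using LIMSEQ_inverse_real_of_nat by (simp add: divide_inverse)
    next
      show "eventually (\<lambda>n. 0 \<le> (LINT x|lborel. norm ((m n x - s x)\<^sup>2))) sequentially" by simp
      show "eventually (\<lambda>n. (LINT x|lborel. norm ((m n x - s x)\<^sup>2)) \<le> 1 / real (Suc n)) sequentially"
        using \<rho>(3) by (intro always_eventually allI) (simp add: m_def)
    qed simp
    \<comment> \<open>Dominated convergence against |D| wants pointwise convergence, which
      mean-square convergence provides along a subsequence.\<close>
    from tendsto_L1_AE_subseq[where u = "\<lambda>n x. (m n x - s x)\<^sup>2", OF im this] obtain r where r: "strict_mono r"
      "AE x in lborel. (\<lambda>n. (m (r n) x - s x)\<^sup>2) \<longlonglongrightarrow> 0" by blast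
    have "(\<lambda>n. LINT x|lborel. D x * m (r n) x) \<longlonglongrightarrow> (LINT x|lborel. D x * s x)"
    proof (rule integral_dominated_convergence)
      show "integrable lborel (\<lambda>x. indicator (cball 0 (M + 1)) x * \<bar>D x\<bar>)"
        by (rule iabs)
      show "AE x in lborel. (\<lambda>n. D x * m (r n) x) \<longlonglongrightarrow> D x * s x"
        using r(2)
      proof eventually_elim
        case (elim x)
        then have "(\<lambda>n. sqrt ((m (r n) x - s x)\<^sup>2)) \<longlonglongrightarrow> sqrt 0" by (rule tendsto_real_sqrt)
        then have "(\<lambda>n. m (r n) x - s x) \<longlonglongrightarrow> 0" by (simp add: tendsto_rabs_zero_iff)
        then have "(\<lambda>n. m (r n) x) \<longlonglongrightarrow> s x" by (simp add: LIM_zero_iff)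
        then show ?case by (intro tendsto_intros)
      qed
      show "AE x in lborel. norm (D x * m (r n) x) \<le> indicator (cball 0 (M + 1)) x * \<bar>D x\<bar>" for n
      proof (rule AE_I2)
        fix x
        show "norm (D x * m (r n) x) \<le> indicator (cball 0 (M + 1)) x * \<bar>D x\<bar>"
          using mb[of "r n" x] mz[of x "r n"] by (cases "norm x \<le> M + 1") (auto simp: abs_mult mult_left_le)
      qed
    qed auto
    moreover have "(LINT x|lborel. D x * m (r n) x) = 0" for n by (rule z[OF tm])
    ultimately have s0: "(LINT x|lborel. D x * s x) = 0" by (simp add: LIMSEQ_const_iff)
    have eq: "D x * s x = indicator (cball 0 M) x * \<bar>D x\<bar>" for x by (simp add: s_def)
    have "integrable lborel (\<lambda>x. indicator (cball 0 M) x * \<bar>D x\<bar>)"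
      by (rule iabs)
    then have "AE x in lborel. indicator (cball 0 M) x * \<bar>D x\<bar> = 0"
      using s0 unfolding eq by (subst (asm) integral_nonneg_eq_0_iff_AE) auto
    then show ?thesis by eventually_elim (auto simp: indicator_def split: if_splits)
  qed
  have "AE x in lborel. norm x \<le> real (Suc n) \<longrightarrow> D x = 0" for n by (rule *) simp
  then have "AE x in lborel. \<forall>n. norm x \<le> real (Suc n) \<longrightarrow> D x = 0" unfolding AE_all_countable by (rule allI)
  then show ?thesis
  proof eventually_elim
    case (elim x)
    obtain n where "norm x \<le> real n" using real_arch_simple by blast
    then show ?case using elim[rule_format, of n] by simp
  qed
qed

lemma set_integrable_bounded_mult:
  fixes f g :: "real^'n \<Rightarrow> real"
  assumes f: "set_integrable lebesgue (cball 0 M) f" and g: "continuous_on UNIV g"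
  shows "set_integrable lebesgue (cball 0 M) (\<lambda>x. g x * f x)"
proof -
  have "bounded (g ` cball 0 M)"
    by (intro compact_imp_bounded compact_continuous_image continuous_on_subset[OF g]) auto
  then obtain B where B': "\<forall>y\<in>g ` cball 0 M. norm y \<le> B" unfolding bounded_iff by blast
  have B: "\<bar>g x\<bar> \<le> B" if "norm x \<le> M" for x using B' that by auto
  define h where "h = (\<lambda>x. indicator (cball 0 M) x * g x)"
  have gm: "g \<in> borel_measurable lebesgue"
    using borel_measurable_continuous_onI[OF g] by (simp add: measurable_completion)
  have "integrable lebesgue (\<lambda>x. h x * (indicator (cball 0 M) x *\<^sub>R f x))"
  proof (rule integrable_bounded_mult)
    show "integrable lebesgue (\<lambda>x. indicator (cball 0 M) x *\<^sub>R f x)" using f by (simp add: set_integrable_def)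
    show "h \<in> borel_measurable lebesgue" unfolding h_def using gm by measurable
    show "\<bar>h x\<bar> \<le> \<bar>B\<bar>" for x using B[of x] by (auto simp: h_def indicator_def)
  qed
  moreover have "(\<lambda>x. h x * (indicator (cball 0 M) x *\<^sub>R f x)) = (\<lambda>x. indicator (cball 0 M) x *\<^sub>R (g x * f x))"
    by (auto simp: h_def indicator_def)
  ultimately show ?thesis by (simp only: set_integrable_def)
qed

lemma integrable_test_mult:
  fixes f \<phi> :: "real^'n \<Rightarrow> real"
  assumes f: "\<And>M. set_integrable lebesgue (cball 0 M) f" and \<phi>: "test_function \<phi>"
  shows "integrable lebesgue (\<lambda>x. f x * \<phi> x)"
proof -
  obtain M where M: "M > 0" "\<And>x. norm x \<ge> M \<Longrightarrow> \<phi> x = 0" "\<And>x. norm x \<ge> M \<Longrightarrow> grad \<phi> x = 0"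
    using test_function_support[OF \<phi>] by blast
  have "set_integrable lebesgue (cball 0 M) (\<lambda>x. \<phi> x * f x)"
    by (rule set_integrable_bounded_mult[OF f smooth_continuous[OF test_function_smooth[OF \<phi>]]])
  moreover have "(\<lambda>x. indicator (cball 0 M) x *\<^sub>R (\<phi> x * f x)) = (\<lambda>x. f x * \<phi> x)"
  proof
    fix x show "indicator (cball 0 M) x *\<^sub>R (\<phi> x * f x) = f x * \<phi> x"
      using M(2)[of x] by (cases "norm x \<le> M") auto
  qed
  ultimately show ?thesis by (simp only: set_integrable_def)
qed

lemma set_integrable_nth:
  fixes G :: "real^'n \<Rightarrow> real^'m"
  assumes "set_integrable M A G" shows "set_integrable M A (\<lambda>x. G x $ i)"
proof -
  have "integrable M (\<lambda>x. (indicator A x *\<^sub>R G x) $ i)"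
    by (rule integrable_bounded_linear[OF bounded_linear_vec_nth]) (use assms in \<open>simp add: set_integrable_def\<close>)
  then show ?thesis by (simp add: set_integrable_def)
qed

lemma has_weak_gradient_iff:
  "has_weak_gradient u G \<longleftrightarrow> u \<in> borel_measurable lebesgue \<and> G \<in> borel_measurable lebesgue \<and>
     (\<forall>M. set_integrable lebesgue (cball 0 M) u) \<and> (\<forall>M. set_integrable lebesgue (cball 0 M) G) \<and>
     (\<forall>\<phi> i. test_function \<phi> \<longrightarrow>
        (LINT x|lebesgue. u x * partial_deriv i \<phi> x) = - (LINT x|lebesgue. G x $ i * \<phi> x))"
  unfolding has_weak_gradient_def Lp_loc_1_iff by auto

text \<open>Each component of G - H is orthogonal to all test functions. The Borel representative
  \<open>D'\<close> moves the question from \<open>lebesgue\<close> to \<open>lborel\<close>, where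
  the fundamental lemma lives.\<close>

lemma weak_gradient_unique:
  fixes u :: "real^'n \<Rightarrow> real"
  assumes "has_weak_gradient u G" "has_weak_gradient u H"
  shows "AE x in lebesgue. G x = H x"
proof -
  have "AE x in lebesgue. G x $ i = H x $ i" for i
  proof -
    define D where "D = (\<lambda>x. G x $ i - H x $ i)"
    have GH: "set_integrable lebesgue (cball 0 M) (\<lambda>x. G x $ i)" "set_integrable lebesgue (cball 0 M) (\<lambda>x. H x $ i)" for M
      using assms by (auto simp: has_weak_gradient_iff intro: set_integrable_nth)
    have Dm: "D \<in> borel_measurable lebesgue"
      unfolding D_def using assms by (intro borel_measurable_diff lebesgue_vec_nth) (auto simp: has_weak_gradient_iff)
    obtain D' where D': "D' \<in> borel_measurable borel" "AE x in lebesgue. D x = D' x"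
      using borel_representative[OF Dm] by blast
    have iD: "set_integrable lebesgue (cball 0 M) D" for M
      unfolding D_def using GH by (rule set_integral_diff)
    have "AE x in lborel. D' x = 0"
    proof (rule fundamental_lemma[OF D'(1)])
      fix M
      have "integrable lebesgue (\<lambda>x. indicator (cball 0 M) x *\<^sub>R D' x)"
      proof (rule integrable_cong_AE_imp[OF iD[of M, unfolded set_integrable_def]])
        show "(\<lambda>x. indicator (cball 0 M) x *\<^sub>R D' x) \<in> borel_measurable lebesgue"
          by (rule indicator_cball_scaleR_measurable[OF lebesgue_measurable_borel[OF D'(1)]])
        show "AE x in lebesgue. indicator (cball 0 M) x *\<^sub>R D x = indicator (cball 0 M) x *\<^sub>R D' x"
          using D'(2) by eventually_elim simp
      qed
      then show "set_integrable lborel (cball 0 M) D'"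
        unfolding set_integrable_def
        by (subst (asm) integrable_completion)
          (simp_all del: real_scaleR_def, intro borel_measurable_scaleR borel_measurable_indicator D'(1), simp)
    next
      fix \<phi> :: "real^'n \<Rightarrow> real" assume t: "test_function \<phi>"
      have [measurable]: "\<phi> \<in> borel_measurable borel" by (rule smooth_borel[OF test_function_smooth[OF t]])
      have i: "integrable lebesgue (\<lambda>x. G x $ i * \<phi> x)" "integrable lebesgue (\<lambda>x. H x $ i * \<phi> x)"
        using integrable_test_mult[OF GH(1) t] integrable_test_mult[OF GH(2) t] .
      have "(LINT x|lborel. D' x * \<phi> x) = (LINT x|lebesgue. D' x * \<phi> x)"
        by (subst integral_completion) (use D'(1) in auto)
      also have "\<dots> = (LINT x|lebesgue. D x * \<phi> x)"
      proof (rule integral_cong_AE)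
        show "AE x in lebesgue. D' x * \<phi> x = D x * \<phi> x" using D'(2) by eventually_elim simp
        show "(\<lambda>x. D' x * \<phi> x) \<in> borel_measurable lebesgue" "(\<lambda>x. D x * \<phi> x) \<in> borel_measurable lebesgue"
          using lebesgue_measurable_borel[OF D'(1)] Dm lebesgue_measurable_borel[of \<phi>]
          by (auto intro!: borel_measurable_times)
      qed
      also have "\<dots> = (LINT x|lebesgue. G x $ i * \<phi> x) - (LINT x|lebesgue. H x $ i * \<phi> x)"
        unfolding D_def using i by (subst Bochner_Integration.integral_diff[symmetric]) (auto simp: algebra_simps)
      also have "\<dots> = 0" using assms t by (auto simp: has_weak_gradient_iff)
      finally show "(LINT x|lborel. D' x * \<phi> x) = 0" .
    qed
    then have "AE x in lebesgue. D' x = 0" by (rule AE_completion)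
    with D'(2) show ?thesis by eventually_elim (simp add: D_def)
  qed
  then have "AE x in lebesgue. \<forall>i\<in>UNIV. G x $ i = H x $ i" by (intro AE_finite_allI) auto
  then show ?thesis by eventually_elim (simp add: vec_eq_iff)
qed

text \<open>Through this fact, integrals that contain the chosen \<open>weak_grad\<close> are
  rewritten with an explicit gradient.\<close>

lemma weak_grad_eq:
  assumes "has_weak_gradient u G"
  shows "AE x in lebesgue. weak_grad u x = G x"
  unfolding weak_grad_def by (rule weak_gradient_unique[OF someI[where P = "has_weak_gradient u", OF assms] assms])

lemma has_weak_gradient_cong_AE:
  assumes h: "has_weak_gradient u G" and u: "v \<in> borel_measurable lebesgue" "AE x in lebesgue. u x = v x"
    and G: "H \<in> borel_measurable lebesgue" "AE x in lebesgue. G x = H x"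
  shows "has_weak_gradient v H"
  unfolding has_weak_gradient_iff
proof (intro conjI allI impI)
  fix M
  show "set_integrable lebesgue (cball 0 M) v" unfolding set_integrable_def
    by (rule integrable_cong_AE_imp[of _ "\<lambda>x. indicator (cball 0 M) x *\<^sub>R u x"])
      (use h u indicator_cball_scaleR_measurable[OF u(1)] in \<open>auto simp: has_weak_gradient_iff set_integrable_def\<close>)
  show "set_integrable lebesgue (cball 0 M) H" unfolding set_integrable_def
    by (rule integrable_cong_AE_imp[of _ "\<lambda>x. indicator (cball 0 M) x *\<^sub>R G x"])
      (use h G indicator_cball_scaleR_measurable[OF G(1)] in \<open>auto simp: has_weak_gradient_iff set_integrable_def\<close>)
next
  fix \<phi> :: "real^'a \<Rightarrow> real" and i assume t: "test_function \<phi>"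
  have m: "\<phi> \<in> borel_measurable lebesgue" "partial_deriv i \<phi> \<in> borel_measurable lebesgue"
    by (intro lebesgue_measurable_borel smooth_borel test_function_smooth test_function_partial t)+
  have "(LINT x|lebesgue. v x * partial_deriv i \<phi> x) = (LINT x|lebesgue. u x * partial_deriv i \<phi> x)"
  proof (rule integral_cong_AE)
    show "(\<lambda>x. v x * partial_deriv i \<phi> x) \<in> borel_measurable lebesgue" by (intro borel_measurable_times u m)
    show "(\<lambda>x. u x * partial_deriv i \<phi> x) \<in> borel_measurable lebesgue"
      using h by (intro borel_measurable_times m) (simp add: has_weak_gradient_iff)
    show "AE x in lebesgue. v x * partial_deriv i \<phi> x = u x * partial_deriv i \<phi> x"
      using u(2) by eventually_elim simp
  qed
  moreover have "(LINT x|lebesgue. H x $ i * \<phi> x) = (LINT x|lebesgue. G x $ i * \<phi> x)"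
  proof (rule integral_cong_AE)
    show "(\<lambda>x. H x $ i * \<phi> x) \<in> borel_measurable lebesgue" by (intro borel_measurable_times lebesgue_vec_nth G m)
    show "(\<lambda>x. G x $ i * \<phi> x) \<in> borel_measurable lebesgue"
      using h by (intro borel_measurable_times lebesgue_vec_nth m) (simp add: has_weak_gradient_iff)
    show "AE x in lebesgue. H x $ i * \<phi> x = G x $ i * \<phi> x"
      using G(2) by eventually_elim simp
  qed
  ultimately show "(LINT x|lebesgue. v x * partial_deriv i \<phi> x) = - (LINT x|lebesgue. H x $ i * \<phi> x)"
    using h t by (simp add: has_weak_gradient_iff)
qed (use u G in auto)

section \<open>Localized Sobolev functions\<close>

text \<open>H^1_loc with an explicit gradient and Borel representatives of both. Tonelli,
  translation and scaling on \<open>lborel\<close> apply to them directly, and no choice of a weak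
  gradient intervenes.\<close>

definition sobolev_loc :: "(real^'n \<Rightarrow> real) \<Rightarrow> (real^'n \<Rightarrow> real^'n) \<Rightarrow> bool" where
  "sobolev_loc u G \<longleftrightarrow> u \<in> borel_measurable borel \<and> G \<in> borel_measurable borel \<and>
    (\<forall>M. set_integrable lborel (cball 0 M) (\<lambda>x. (u x)\<^sup>2)) \<and>
    (\<forall>M. set_integrable lborel (cball 0 M) (\<lambda>x. (norm (G x))\<^sup>2)) \<and>
    (\<forall>\<phi> i. test_function \<phi> \<longrightarrow>
       (LINT x|lborel. u x * partial_deriv i \<phi> x) = - (LINT x|lborel. G x $ i * \<phi> x))"

definition sobolev_compact :: "real \<Rightarrow> (real^'n \<Rightarrow> real) \<Rightarrow> (real^'n \<Rightarrow> real^'n) \<Rightarrow> bool" where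
  "sobolev_compact M f F \<longleftrightarrow> f \<in> borel_measurable borel \<and> F \<in> borel_measurable borel \<and>
    integrable lborel (\<lambda>x. (f x)\<^sup>2) \<and> integrable lborel (\<lambda>x. (norm (F x))\<^sup>2) \<and>
    (\<forall>x. norm x > M \<longrightarrow> f x = 0 \<and> F x = 0) \<and>
    (\<forall>\<phi> i. test_function \<phi> \<longrightarrow>
       (LINT x|lborel. f x * partial_deriv i \<phi> x) = - (LINT x|lborel. F x $ i * \<phi> x))"

lemma norm_power2_vec: "(norm (v :: real^'n))\<^sup>2 = (\<Sum>i\<in>UNIV. (v $ i)\<^sup>2)"
  unfolding power2_norm_eq_inner by (simp add: inner_vec_def power2_eq_square)

lemma vec_nth_square_le: "((v :: real^'n) $ i)\<^sup>2 \<le> (norm v)\<^sup>2"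
  by (metis abs_le_square_iff abs_norm_cancel component_le_norm_cart)

lemma borel_nth: "G \<in> borel_measurable borel \<Longrightarrow> (\<lambda>x. G x $ i :: real) \<in> borel_measurable borel"
  for G :: "'a::euclidean_space \<Rightarrow> real^'n"
  using vec_nth_borel[of i] measurable_compose by blast

lemma set_integrable_of_square:
  fixes f :: "real^'n \<Rightarrow> real"
  assumes f: "f \<in> borel_measurable borel" and i: "set_integrable lborel (cball 0 M) (\<lambda>x. (f x)\<^sup>2)"
  shows "set_integrable lborel (cball 0 M) f"
  unfolding set_integrable_def
proof (rule Bochner_Integration.integrable_bound)
  have "integrable lborel (indicator (cball 0 M) :: real^'n \<Rightarrow> real)"
    by (rule integrable_real_indicator, simp, rule emeasure_lborel_cball_finite)
  then show "integrable lborel (\<lambda>x. indicator (cball 0 M) x + indicator (cball 0 M) x *\<^sub>R (f x)\<^sup>2)"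
    using i by (intro Bochner_Integration.integrable_add) (auto simp: set_integrable_def)
  have "\<bar>f x\<bar> \<le> 1 + (f x)\<^sup>2" for x
    using zero_le_power2[of "\<bar>f x\<bar> - 1"] by (simp add: power2_eq_square algebra_simps)
  then have "norm (indicator (cball 0 M) x *\<^sub>R f x) \<le> indicator (cball 0 M) x + indicator (cball 0 M) x *\<^sub>R (f x)\<^sup>2" for x
    by (auto simp: indicator_def)
  then show "AE x in lborel. norm (indicator (cball 0 M) x *\<^sub>R f x)
      \<le> norm (indicator (cball 0 M) x + indicator (cball 0 M) x *\<^sub>R (f x)\<^sup>2)"
    by (intro AE_I2) (auto intro: order_trans)
qed (intro borel_measurable_scaleR borel_measurable_indicator; use f in simp)

lemma integrable_test_mult_lborel:
  fixes f \<phi> :: "real^'n \<Rightarrow> real"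
  assumes f: "\<And>M. set_integrable lborel (cball 0 M) f" and t: "test_function \<phi>"
  shows "integrable lborel (\<lambda>x. \<phi> x * f x)"
proof -
  obtain M where M: "M > 0" "\<And>x. norm x \<ge> M \<Longrightarrow> \<phi> x = 0" "\<And>x. norm x \<ge> M \<Longrightarrow> grad \<phi> x = 0"
    using test_function_support[OF t] by blast
  obtain B where B: "B > 0" "\<And>x. \<bar>\<phi> x\<bar> \<le> B" "\<And>x. norm (grad \<phi> x) \<le> B"
    using test_function_bounded[OF t] by blast
  have "integrable lborel (\<lambda>x. \<phi> x * (indicator (cball 0 M) x *\<^sub>R f x))"
    by (rule integrable_bounded_mult[OF _ _ B(2)])
      (use f smooth_borel[OF test_function_smooth[OF t]] in \<open>auto simp: set_integrable_def\<close>)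
  moreover have "(\<lambda>x. \<phi> x * (indicator (cball 0 M) x *\<^sub>R f x)) = (\<lambda>x. \<phi> x * f x)"
  proof
    fix x show "\<phi> x * (indicator (cball 0 M) x *\<^sub>R f x) = \<phi> x * f x"
      using M(2)[of x] by (cases "norm x \<le> M") auto
  qed
  ultimately show ?thesis by simp
qed

lemma set_integrable_square_nth:
  fixes G :: "real^'n \<Rightarrow> real^'n"
  assumes G: "G \<in> borel_measurable borel" and i: "set_integrable lborel S (\<lambda>x. (norm (G x))\<^sup>2)" and S: "S \<in> sets borel"
  shows "set_integrable lborel S (\<lambda>x. (G x $ i)\<^sup>2)"
  unfolding set_integrable_def
proof (rule Bochner_Integration.integrable_bound[OF i[unfolded set_integrable_def]])
  show "(\<lambda>x. indicator S x *\<^sub>R (G x $ i)\<^sup>2) \<in> borel_measurable lborel"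
    using borel_nth[OF G] S by (intro borel_measurable_scaleR borel_measurable_indicator borel_measurable_power) auto
  show "AE x in lborel. norm (indicator S x *\<^sub>R (G x $ i)\<^sup>2) \<le> norm (indicator S x *\<^sub>R (norm (G x))\<^sup>2)"
    using vec_nth_square_le by (intro AE_I2) (auto simp: indicator_def)
qed

lemma sobolev_loc_integrable:
  assumes "sobolev_loc u G"
  shows "set_integrable lborel (cball 0 M) u" "set_integrable lborel (cball 0 M) (\<lambda>x. G x $ i)"
proof -
  show "set_integrable lborel (cball 0 M) u"
    by (rule set_integrable_of_square) (use assms in \<open>simp_all add: sobolev_loc_def\<close>)
  have "set_integrable lborel (cball 0 M) (\<lambda>x. (G x $ i)\<^sup>2)"
    by (rule set_integrable_square_nth) (use assms in \<open>simp_all add: sobolev_loc_def\<close>)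
  then show "set_integrable lborel (cball 0 M) (\<lambda>x. G x $ i)"
    by (rule set_integrable_of_square[OF borel_nth, rotated]) (use assms in \<open>simp add: sobolev_loc_def\<close>)
qed

lemma norm_add_square_le: "(norm (a + b :: 'a::real_normed_vector))\<^sup>2 \<le> 2 * (norm a)\<^sup>2 + 2 * (norm b)\<^sup>2"
proof -
  have "(norm (a + b))\<^sup>2 \<le> (norm a + norm b)\<^sup>2" by (intro power_mono norm_triangle_ineq) auto
  also have "\<dots> \<le> 2 * (norm a)\<^sup>2 + 2 * (norm b)\<^sup>2" by (rule square_add_le)
  finally show ?thesis .
qed

text \<open>The product rule comes from testing the weak gradient of u with \<psi> \<phi>, again a
  test function. Boundedness of \<psi> and of its gradient gives square integrability.\<close>

lemma sobolev_loc_mult: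
  fixes u \<psi> :: "real^'n \<Rightarrow> real"
  assumes u: "sobolev_loc u G" and t: "test_function \<psi>" and M: "\<And>x. norm x > M \<Longrightarrow> \<psi> x = 0" "\<And>x. norm x > M \<Longrightarrow> grad \<psi> x = 0"
  shows "sobolev_compact M (\<lambda>x. \<psi> x * u x) (\<lambda>x. \<psi> x *\<^sub>R G x + u x *\<^sub>R grad \<psi> x)"
  unfolding sobolev_compact_def
proof (intro conjI allI impI)
  note s = test_function_smooth[OF t]
  have m: "u \<in> borel_measurable borel" "G \<in> borel_measurable borel" using u by (auto simp: sobolev_loc_def)
  note ms = smooth_borel[OF s] smooth_grad_borel[OF s]
  show fm: "(\<lambda>x. \<psi> x * u x) \<in> borel_measurable borel" using m ms by (intro borel_measurable_times)
  show Fm: "(\<lambda>x. \<psi> x *\<^sub>R G x + u x *\<^sub>R grad \<psi> x) \<in> borel_measurable borel"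
    using m ms by (intro borel_measurable_add borel_measurable_scaleR)
  obtain B where B: "B > 0" "\<And>x. \<bar>\<psi> x\<bar> \<le> B" "\<And>x. norm (grad \<psi> x) \<le> B"
    using test_function_bounded[OF t] by blast
  have iu: "set_integrable lborel (cball 0 M) (\<lambda>x. (u x)\<^sup>2)" "set_integrable lborel (cball 0 M) (\<lambda>x. (norm (G x))\<^sup>2)"
    using u by (auto simp: sobolev_loc_def)
  show "integrable lborel (\<lambda>x. (\<psi> x * u x)\<^sup>2)"
  proof (rule Bochner_Integration.integrable_bound)
    show "integrable lborel (\<lambda>x. B\<^sup>2 * (indicator (cball 0 M) x *\<^sub>R (u x)\<^sup>2))"
      using iu by (intro integrable_mult_right) (simp add: set_integrable_def)
    show "(\<lambda>x. (\<psi> x * u x)\<^sup>2) \<in> borel_measurable lborel" using fm by simp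
    show "AE x in lborel. norm ((\<psi> x * u x)\<^sup>2) \<le> norm (B\<^sup>2 * (indicator (cball 0 M) x *\<^sub>R (u x)\<^sup>2))"
    proof (rule AE_I2)
      fix x
      have "(\<psi> x)\<^sup>2 \<le> B\<^sup>2" using B(1) B(2)[of x] by (simp add: abs_le_square_iff[symmetric])
      then show "norm ((\<psi> x * u x)\<^sup>2) \<le> norm (B\<^sup>2 * (indicator (cball 0 M) x *\<^sub>R (u x)\<^sup>2))"
        using M(1)[of x] by (cases "norm x \<le> M") (auto simp: power_mult_distrib intro: mult_right_mono)
    qed
  qed
  show "integrable lborel (\<lambda>x. (norm (\<psi> x *\<^sub>R G x + u x *\<^sub>R grad \<psi> x))\<^sup>2)"
  proof (rule Bochner_Integration.integrable_bound)
    show "integrable lborel (\<lambda>x. (2 * B\<^sup>2) * (indicator (cball 0 M) x *\<^sub>R (norm (G x))\<^sup>2) + (2 * B\<^sup>2) * (indicator (cball 0 M) x *\<^sub>R (u x)\<^sup>2))"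
      using iu by (intro Bochner_Integration.integrable_add integrable_mult_right) (simp_all add: set_integrable_def)
    show "(\<lambda>x. (norm (\<psi> x *\<^sub>R G x + u x *\<^sub>R grad \<psi> x))\<^sup>2) \<in> borel_measurable lborel" using Fm by simp
    show "AE x in lborel. norm ((norm (\<psi> x *\<^sub>R G x + u x *\<^sub>R grad \<psi> x))\<^sup>2)
      \<le> norm ((2 * B\<^sup>2) * (indicator (cball 0 M) x *\<^sub>R (norm (G x))\<^sup>2) + (2 * B\<^sup>2) * (indicator (cball 0 M) x *\<^sub>R (u x)\<^sup>2))"
    proof (rule AE_I2)
      fix x
      have b: "(\<psi> x)\<^sup>2 \<le> B\<^sup>2" "(norm (grad \<psi> x))\<^sup>2 \<le> B\<^sup>2"
        using B(1) B(2)[of x] B(3)[of x] by (simp_all add: abs_le_square_iff[symmetric])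
      have "(norm (\<psi> x *\<^sub>R G x + u x *\<^sub>R grad \<psi> x))\<^sup>2 \<le> 2 * ((\<psi> x)\<^sup>2 * (norm (G x))\<^sup>2) + 2 * ((u x)\<^sup>2 * (norm (grad \<psi> x))\<^sup>2)"
        using norm_add_square_le[of "\<psi> x *\<^sub>R G x" "u x *\<^sub>R grad \<psi> x"] by (simp add: power_mult_distrib)
      also have "\<dots> \<le> 2 * (B\<^sup>2 * (norm (G x))\<^sup>2) + 2 * ((u x)\<^sup>2 * B\<^sup>2)"
        using b by (intro add_mono mult_left_mono mult_right_mono) auto
      finally show "norm ((norm (\<psi> x *\<^sub>R G x + u x *\<^sub>R grad \<psi> x))\<^sup>2)
        \<le> norm ((2 * B\<^sup>2) * (indicator (cball 0 M) x *\<^sub>R (norm (G x))\<^sup>2) + (2 * B\<^sup>2) * (indicator (cball 0 M) x *\<^sub>R (u x)\<^sup>2))"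
        using M[of x] by (cases "norm x \<le> M") (auto simp: algebra_simps)
    qed
  qed
  show "\<psi> x * u x = 0" "\<psi> x *\<^sub>R G x + u x *\<^sub>R grad \<psi> x = 0" if "norm x > M" for x using M that by auto
  fix \<phi> :: "real^'n \<Rightarrow> real" and i assume p: "test_function \<phi>"
  note sp = test_function_smooth[OF p]
  have tp: "test_function (\<lambda>x. \<psi> x * \<phi> x)" by (rule test_function_mult[OF t sp])
  have t2: "test_function (\<lambda>x. partial_deriv i \<psi> x * \<phi> x)" by (rule test_function_mult[OF test_function_partial[OF t] sp])
  have i1: "integrable lborel (\<lambda>x. partial_deriv i (\<lambda>x. \<psi> x * \<phi> x) x * u x)" "integrable lborel (\<lambda>x. (partial_deriv i \<psi> x * \<phi> x) * u x)"
      "integrable lborel (\<lambda>x. (\<psi> x * \<phi> x) * G x $ i)"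
    by (rule integrable_test_mult_lborel[OF sobolev_loc_integrable(1)[OF u] test_function_partial[OF tp]]
        integrable_test_mult_lborel[OF sobolev_loc_integrable(1)[OF u] t2]
        integrable_test_mult_lborel[OF sobolev_loc_integrable(2)[OF u] tp])+
  have pd: "partial_deriv i (\<lambda>x. \<psi> x * \<phi> x) x = \<psi> x * partial_deriv i \<phi> x + partial_deriv i \<psi> x * \<phi> x" for x
    by (rule partial_deriv_mult[OF smooth_differentiable[OF s] smooth_differentiable[OF sp]])
  have "(LINT x|lborel. \<psi> x * u x * partial_deriv i \<phi> x)
      = (LINT x|lborel. partial_deriv i (\<lambda>x. \<psi> x * \<phi> x) x * u x - (partial_deriv i \<psi> x * \<phi> x) * u x)"
    unfolding pd by (intro Bochner_Integration.integral_cong) (auto simp: algebra_simps)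
  also have "\<dots> = (LINT x|lborel. u x * partial_deriv i (\<lambda>x. \<psi> x * \<phi> x) x) - (LINT x|lborel. (partial_deriv i \<psi> x * \<phi> x) * u x)"
    using i1 by (simp add: mult.commute)
  also have "(LINT x|lborel. u x * partial_deriv i (\<lambda>x. \<psi> x * \<phi> x) x) = - (LINT x|lborel. G x $ i * (\<psi> x * \<phi> x))"
    using u tp by (simp add: sobolev_loc_def)
  also have "- (LINT x|lborel. G x $ i * (\<psi> x * \<phi> x)) - (LINT x|lborel. (partial_deriv i \<psi> x * \<phi> x) * u x)
     = - (LINT x|lborel. (\<psi> x * \<phi> x) * G x $ i + (partial_deriv i \<psi> x * \<phi> x) * u x)"
    using i1 by (simp add: mult.commute)
  also have "\<dots> = - (LINT x|lborel. (\<psi> x *\<^sub>R G x + u x *\<^sub>R grad \<psi> x) $ i * \<phi> x)"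
    by (intro arg_cong[of _ _ uminus] Bochner_Integration.integral_cong) (auto simp: algebra_simps)
  finally show "(LINT x|lborel. \<psi> x * u x * partial_deriv i \<phi> x) = - (LINT x|lborel. (\<psi> x *\<^sub>R G x + u x *\<^sub>R grad \<psi> x) $ i * \<phi> x)" .
qed

lemma sobolev_compact_test:
  fixes f :: "real^'n \<Rightarrow> real"
  assumes t: "test_function f" and M: "\<And>x. norm x > M \<Longrightarrow> f x = 0" "\<And>x. norm x > M \<Longrightarrow> grad f x = 0"
  shows "sobolev_compact M f (grad f)"
  unfolding sobolev_compact_def
proof (intro conjI allI impI)
  note s = test_function_smooth[OF t]
  show "f \<in> borel_measurable borel" "grad f \<in> borel_measurable borel" using s by (rule smooth_borel smooth_grad_borel)+
  show "integrable lborel (\<lambda>x. (f x)\<^sup>2)" unfolding power2_eq_square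
    by (rule test_function_integrable[OF test_function_mult[OF t s]])
  show "integrable lborel (\<lambda>x. (norm (grad f x))\<^sup>2)"
    by (rule continuous_compact_support_integrable[of _ "M + 1"])
      (use M smooth_continuous_grad[OF s] in \<open>auto intro!: continuous_intros\<close>)
  show "(LINT x|lborel. f x * partial_deriv i \<phi> x) = - (LINT x|lborel. grad f x $ i * \<phi> x)" if "test_function \<phi>" for \<phi> i
    using integration_by_parts[OF s that] by simp
qed (use M in auto)

lemma integrable_square_norm_diff:
  fixes f g :: "'a \<Rightarrow> real^'n"
  assumes "f \<in> borel_measurable M" "g \<in> borel_measurable M"
    "integrable M (\<lambda>x. (norm (f x))\<^sup>2)" "integrable M (\<lambda>x. (norm (g x))\<^sup>2)"
  shows "integrable M (\<lambda>x. (norm (f x - g x))\<^sup>2)"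
proof (rule Bochner_Integration.integrable_bound)
  show "integrable M (\<lambda>x. 2 * (norm (f x))\<^sup>2 + 2 * (norm (g x))\<^sup>2)" using assms by simp
  show "AE x in M. norm ((norm (f x - g x))\<^sup>2) \<le> norm (2 * (norm (f x))\<^sup>2 + 2 * (norm (g x))\<^sup>2)"
    using norm_add_square_le[of "f x" "- g x" for x] by simp
qed (use assms in auto)

lemma sobolev_compact_integrable:
  fixes f :: "real^'n \<Rightarrow> real"
  assumes "sobolev_compact M f F"
  shows "integrable lborel f" "integrable lborel (\<lambda>x. F x $ i)" "integrable lborel (\<lambda>x. (F x $ i)\<^sup>2)"
proof -
  show "integrable lborel f"
    by (rule integrable_of_square[where M = M]) (use assms in \<open>auto simp: sobolev_compact_def\<close>)
  have "set_integrable lborel UNIV (\<lambda>x. (F x $ i)\<^sup>2)"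
    by (rule set_integrable_square_nth) (use assms in \<open>auto simp: sobolev_compact_def set_integrable_def\<close>)
  then show 2: "integrable lborel (\<lambda>x. (F x $ i)\<^sup>2)" by (simp add: set_integrable_def)
  have m: "(\<lambda>x. F x $ i) \<in> borel_measurable borel" using assms by (intro borel_nth) (simp add: sobolev_compact_def)
  show "integrable lborel (\<lambda>x. F x $ i)"
    by (rule integrable_of_square[where M = M, OF m 2]) (use assms in \<open>auto simp: sobolev_compact_def\<close>)
qed

lemma integrable_mult_test:
  fixes f \<phi> :: "real^'n \<Rightarrow> real"
  assumes "integrable lborel f" "test_function \<phi>"
  shows "integrable lborel (\<lambda>x. f x * \<phi> x)"
proof -
  obtain B where B: "B > 0" "\<And>x. \<bar>\<phi> x\<bar> \<le> B" "\<And>x. norm (grad \<phi> x) \<le> B"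
    using test_function_bounded[OF assms(2)] by blast
  have "integrable lborel (\<lambda>x. \<phi> x * f x)"
    by (rule integrable_bounded_mult[OF assms(1) _ B(2)]) (simp add: smooth_borel[OF test_function_smooth[OF assms(2)]])
  then show ?thesis by (simp add: mult.commute)
qed

lemma sobolev_compact_diff:
  assumes f: "sobolev_compact M f F" and g: "sobolev_compact M g H"
  shows "sobolev_compact M (\<lambda>x. f x - g x) (\<lambda>x. F x - H x)"
  unfolding sobolev_compact_def
proof (intro conjI allI impI)
  show "integrable lborel (\<lambda>x. (f x - g x)\<^sup>2)"
    using f g by (intro integrable_square_diff) (auto simp: sobolev_compact_def)
  show "integrable lborel (\<lambda>x. (norm (F x - H x))\<^sup>2)"
    using f g by (intro integrable_square_norm_diff) (auto simp: sobolev_compact_def)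
  fix \<phi> :: "real^'a \<Rightarrow> real" and i assume t: "test_function \<phi>"
  note p = test_function_partial[OF t]
  show "(LINT x|lborel. (f x - g x) * partial_deriv i \<phi> x) = - (LINT x|lborel. (F x - H x) $ i * \<phi> x)"
    using integrable_mult_test[OF sobolev_compact_integrable(1)[OF f] p] integrable_mult_test[OF sobolev_compact_integrable(1)[OF g] p]
      integrable_mult_test[OF sobolev_compact_integrable(2)[OF f] t] integrable_mult_test[OF sobolev_compact_integrable(2)[OF g] t] f g t
    by (simp add: left_diff_distrib sobolev_compact_def)
qed (use f g in \<open>auto simp: sobolev_compact_def\<close>)

lemma sobolev_compact_weak_gradient:
  assumes f: "sobolev_compact M f F"
  shows "has_weak_gradient f F" "H1 f"
proof -
  have m: "f \<in> borel_measurable borel" "F \<in> borel_measurable borel" using f by (auto simp: sobolev_compact_def)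
  have il: "integrable lborel f" "integrable lborel F"
  proof -
    show "integrable lborel f" by (rule sobolev_compact_integrable[OF f])
    show "integrable lborel F"
    proof (rule Bochner_Integration.integrable_bound)
      show "integrable lborel (\<lambda>x. \<Sum>i\<in>UNIV. \<bar>F x $ i\<bar>)"
        by (intro Bochner_Integration.integrable_sum integrable_abs sobolev_compact_integrable[OF f])
      show "AE x in lborel. norm (F x) \<le> norm (\<Sum>i\<in>UNIV. \<bar>F x $ i\<bar>)"
        by (intro AE_I2) (simp add: norm_le_l1_cart sum_nonneg)
    qed (use m in simp)
  qed
  show w: "has_weak_gradient f F"
    unfolding has_weak_gradient_iff
  proof (intro conjI allI impI)
    show "f \<in> borel_measurable lebesgue" "F \<in> borel_measurable lebesgue" using m by (auto intro: lebesgue_measurable_borel)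
    show "set_integrable lebesgue (cball 0 K) f" "set_integrable lebesgue (cball 0 K) F" for K
      using il m integrable_mult_indicator[of "cball 0 K" lebesgue f] integrable_mult_indicator[of "cball 0 K" lebesgue F]
      by (auto simp: set_integrable_def integrable_completion)
    fix \<phi> :: "real^'a \<Rightarrow> real" and i assume t: "test_function \<phi>"
    have mm: "(\<lambda>x. f x * partial_deriv i \<phi> x) \<in> borel_measurable lborel" "(\<lambda>x. F x $ i * \<phi> x) \<in> borel_measurable lborel"
      using m smooth_borel[OF test_function_smooth[OF t]] smooth_borel[OF test_function_smooth[OF test_function_partial[OF t]]] borel_nth[OF m(2)]
      by auto
    show "(LINT x|lebesgue. f x * partial_deriv i \<phi> x) = - (LINT x|lebesgue. F x $ i * \<phi> x)"
      using f t by (simp add: integral_completion[OF mm(1)] integral_completion[OF mm(2)] sobolev_compact_def)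
  qed
  have "integrable lebesgue (\<lambda>x. (f x)\<^sup>2)" "integrable lebesgue (\<lambda>x. (norm (F x))\<^sup>2)"
    using f m by (auto simp: sobolev_compact_def integrable_completion)
  then show "H1 f" unfolding H1_def Lp_on_2_UNIV_iff using w m by (auto intro: lebesgue_measurable_borel)
qed

text \<open>Mollification commutes with the weak gradient, so one mollifier approximates f and all
  components of F in the mean at once.\<close>

lemma sobolev_compact_approx:
  fixes f :: "real^'n \<Rightarrow> real"
  assumes f: "sobolev_compact M f F" and e: "e > 0"
  obtains \<phi> where "test_function \<phi>" "sobolev_compact (M + 1) \<phi> (grad \<phi>)"
    "(LINT x|lborel. (f x - \<phi> x)\<^sup>2) \<le> e" "(LINT x|lborel. (norm (F x - grad \<phi> x))\<^sup>2) \<le> e"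
proof -
  have m: "f \<in> borel_measurable borel" "F \<in> borel_measurable borel"
    and z: "\<And>x. norm x > M \<Longrightarrow> f x = 0" "\<And>x i. norm x > M \<Longrightarrow> F x $ i = 0"
    and f2: "integrable lborel (\<lambda>x. (f x)\<^sup>2)"
    using f by (auto simp: sobolev_compact_def)
  obtain d0 where d0: "d0 > 0" "\<And>a \<rho>. mollifier a \<rho> \<Longrightarrow> a \<le> d0 \<Longrightarrow> (LINT x|lborel. (mollify \<rho> f x - f x)\<^sup>2) \<le> e"
    using mollify_L2_convergence[OF m(1) f2 z(1) e] by blast
  \<comment> \<open>The squared norm is a sum over the n coordinates, each granted an equal share of
    e.\<close>
  define c where "c = e / real CARD('n)"
  have c: "c > 0" using e by (simp add: c_def)
  have "\<exists>d>0. \<forall>a \<rho>. mollifier a \<rho> \<longrightarrow> a \<le> d \<longrightarrow> (LINT x|lborel. (mollify \<rho> (\<lambda>x. F x $ i) x - F x $ i)\<^sup>2) \<le> c" for i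
    using mollify_L2_convergence[OF borel_nth[OF m(2)] sobolev_compact_integrable(3)[OF f] z(2) c] by blast
  then have "\<forall>i. \<exists>d>0. \<forall>a \<rho>. mollifier a \<rho> \<longrightarrow> a \<le> d \<longrightarrow> (LINT x|lborel. (mollify \<rho> (\<lambda>x. F x $ i) x - F x $ i)\<^sup>2) \<le> c" by (rule allI)
  from choice[OF this] obtain d where d: "\<forall>i. d i > 0 \<and> (\<forall>a \<rho>. mollifier a \<rho> \<longrightarrow> a \<le> d i \<longrightarrow> (LINT x|lborel. (mollify \<rho> (\<lambda>x. F x $ i) x - F x $ i)\<^sup>2) \<le> c)"
    by (rule exE)
  \<comment> \<open>The minimum over finitely many directions serves all components; a \<le> 1 keeps
    the support within radius M + 1.\<close>
  define a where "a = min (min d0 1) (Min (range d))"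
  have a: "a > 0" "a \<le> d0" "a \<le> 1" "\<And>i. a \<le> d i" using d0(1) d by (auto simp: a_def min_le_iff_disj)
  obtain \<rho> :: "real^'n \<Rightarrow> real" where r: "mollifier a \<rho>" using mollifier_exists[OF a(1)] by blast
  note t = mollifier_test_function[OF r]
  define \<phi> where "\<phi> = mollify \<rho> f"
  note fi = sobolev_compact_integrable[OF f]
  have tp: "test_function \<phi>" unfolding \<phi>_def by (rule test_function_mollify[where M = M, OF r fi(1) z(1)])
  have pd: "partial_deriv i \<phi> x = mollify \<rho> (\<lambda>x. F x $ i) x" for i x
  proof -
    \<comment> \<open>As a function of y the kernel \<rho>(x - y) is a test function. The sign from
      reflecting it cancels the sign in the weak gradient, and the derivative moves from \<rho> to
      f.\<close>
    define \<eta> where "\<eta> = (\<lambda>y. \<rho> (x + (-1) *\<^sub>R y))"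
    have te: "test_function \<eta>" unfolding \<eta>_def by (rule test_function_affine[OF t]) simp
    have pe: "partial_deriv i \<eta> y = - partial_deriv i \<rho> (x - y)" for y
      unfolding \<eta>_def by (subst partial_deriv_affine) (auto simp: smooth_differentiable[OF test_function_smooth[OF t]])
    have "partial_deriv i \<phi> x = mollify (partial_deriv i \<rho>) f x" unfolding \<phi>_def by (rule partial_deriv_mollify[OF t fi(1)])
    also have "\<dots> = - (LINT y|lborel. f y * partial_deriv i \<eta> y)"
      by (simp add: mollify_def pe mult.commute)
    also have "\<dots> = (LINT y|lborel. F y $ i * \<eta> y)" using f te by (simp add: sobolev_compact_def)
    also have "\<dots> = mollify \<rho> (\<lambda>x. F x $ i) x" by (simp add: mollify_def \<eta>_def mult.commute)
    finally show ?thesis .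
  qed
  have s: "sobolev_compact (M + 1) \<phi> (grad \<phi>)"
  proof (rule sobolev_compact_test[OF tp])
    fix x :: "real^'n" assume x: "norm x > M + 1"
    then have x': "norm x > M + a" using a by simp
    show "\<phi> x = 0" unfolding \<phi>_def by (rule mollify_support[where M = M, OF r z(1) x'])
    have "mollify \<rho> (\<lambda>x. F x $ i) x = 0" for i by (rule mollify_support[where M = M, OF r z(2) x'])
    then show "grad \<phi> x = 0" by (simp add: vec_eq_iff pd)
  qed
  have "(LINT x|lborel. (f x - \<phi> x)\<^sup>2) \<le> e" using d0(2)[OF r a(2)] by (simp add: \<phi>_def power2_commute)
  moreover have "(LINT x|lborel. (norm (F x - grad \<phi> x))\<^sup>2) \<le> e"
  proof -
    have ip: "integrable lborel (\<lambda>x. (F x $ i - partial_deriv i \<phi> x)\<^sup>2)" for i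
      using sobolev_compact_integrable(3)[OF s, of i] fi(3)[of i] borel_nth[OF m(2)] smooth_borel[OF test_function_smooth[OF test_function_partial[OF tp]]]
      by (intro integrable_square_diff) auto
    have "(LINT x|lborel. (norm (F x - grad \<phi> x))\<^sup>2) = (LINT x|lborel. (\<Sum>i\<in>UNIV. (F x $ i - partial_deriv i \<phi> x)\<^sup>2))"
      by (simp add: norm_power2_vec)
    also have "\<dots> = (\<Sum>i\<in>UNIV. LINT x|lborel. (F x $ i - partial_deriv i \<phi> x)\<^sup>2)"
      using ip by (rule Bochner_Integration.integral_sum)
    also have "\<dots> \<le> (\<Sum>i\<in>(UNIV::'n set). c)"
    proof (rule sum_mono)
      fix i
      have "(LINT x|lborel. (mollify \<rho> (\<lambda>x. F x $ i) x - F x $ i)\<^sup>2) \<le> c" using d r a(4) by blast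
      then show "(LINT x|lborel. (F x $ i - partial_deriv i \<phi> x)\<^sup>2) \<le> c" by (simp add: pd power2_commute)
    qed
    also have "\<dots> = e" by (simp add: c_def)
    finally show ?thesis .
  qed
  ultimately show ?thesis using that tp s by blast
qed

section \<open>Localized functions as admissible test functions\<close>

lemma sobolev_compact_mono: "sobolev_compact M f F \<Longrightarrow> M \<le> N \<Longrightarrow> sobolev_compact N f F"
  by (auto simp: sobolev_compact_def)

text \<open>This makes localized functions admissible in \<open>weak_solution\<close>.
  \<open>H1_norm\<close> is built on the chosen \<open>weak_grad\<close> of the difference, which is
  first replaced by F - grad \<phi>; function and gradient then contribute 1/(k+1) each under the
  root.\<close>

lemma sobolev_compact_H1_0:
  fixes f :: "real^'n \<Rightarrow> real"
  assumes f: "sobolev_compact M f F"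
  shows "H1_0 f" "compactly_supported f"
proof -
  show "compactly_supported f" unfolding compactly_supported_def
    by (rule exI[of _ "cball 0 M"]) (use f in \<open>auto simp: sobolev_compact_def intro!: AE_I2\<close>)
  have "\<exists>\<phi>. test_function \<phi> \<and> H1_norm (\<lambda>x. f x - \<phi> x) \<le> sqrt (2 / real (Suc k))" for k
  proof -
    have "1 / real (Suc k) > 0" by simp
    then obtain \<phi> where p: "test_function \<phi>" "sobolev_compact (M + 1) \<phi> (grad \<phi>)"
      "(LINT x|lborel. (f x - \<phi> x)\<^sup>2) \<le> 1 / real (Suc k)" "(LINT x|lborel. (norm (F x - grad \<phi> x))\<^sup>2) \<le> 1 / real (Suc k)"
      using sobolev_compact_approx[OF f] by blast
    have d: "sobolev_compact (M + 1) (\<lambda>x. f x - \<phi> x) (\<lambda>x. F x - grad \<phi> x)"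
      by (rule sobolev_compact_diff[OF sobolev_compact_mono[OF f] p(2)]) simp
    note w = sobolev_compact_weak_gradient(1)[OF d]
    have dm: "(\<lambda>x. (f x - \<phi> x)\<^sup>2) \<in> borel_measurable lborel" "(\<lambda>x. (norm (F x - grad \<phi> x))\<^sup>2) \<in> borel_measurable lborel"
      using d by (auto simp: sobolev_compact_def)
    have wm: "weak_grad (\<lambda>x. f x - \<phi> x) \<in> borel_measurable lebesgue"
      using someI[where P = "has_weak_gradient (\<lambda>x. f x - \<phi> x)", OF w] unfolding weak_grad_def by (simp add: has_weak_gradient_iff)
    have "(LINT x|lebesgue. (f x - \<phi> x)\<^sup>2 + (norm (weak_grad (\<lambda>x. f x - \<phi> x) x))\<^sup>2)
        = (LINT x|lebesgue. (f x - \<phi> x)\<^sup>2 + (norm (F x - grad \<phi> x))\<^sup>2)"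
    proof (rule integral_cong_AE)
      show "AE x in lebesgue. (f x - \<phi> x)\<^sup>2 + (norm (weak_grad (\<lambda>x. f x - \<phi> x) x))\<^sup>2 = (f x - \<phi> x)\<^sup>2 + (norm (F x - grad \<phi> x))\<^sup>2"
        using weak_grad_eq[OF w] by eventually_elim simp
      show "(\<lambda>x. (f x - \<phi> x)\<^sup>2 + (norm (F x - grad \<phi> x))\<^sup>2) \<in> borel_measurable lebesgue"
        using dm by (intro lebesgue_measurable_borel borel_measurable_add) simp_all
      show "(\<lambda>x. (f x - \<phi> x)\<^sup>2 + (norm (weak_grad (\<lambda>x. f x - \<phi> x) x))\<^sup>2) \<in> borel_measurable lebesgue"
        using lebesgue_measurable_borel[of "\<lambda>x. (f x - \<phi> x)\<^sup>2"] dm(1)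
        by (intro borel_measurable_add measurable_compose[OF wm, of "\<lambda>v. (norm v)\<^sup>2"]) simp_all
    qed
    also have "\<dots> = (LINT x|lborel. (f x - \<phi> x)\<^sup>2 + (norm (F x - grad \<phi> x))\<^sup>2)"
      by (rule integral_completion) (use dm in simp)
    also have "\<dots> = (LINT x|lborel. (f x - \<phi> x)\<^sup>2) + (LINT x|lborel. (norm (F x - grad \<phi> x))\<^sup>2)"
      using d by (simp add: sobolev_compact_def)
    also have "\<dots> \<le> 2 / real (Suc k)" using p by (simp add: field_simps)
    finally show ?thesis using p(1) unfolding H1_norm_def by (auto intro: real_sqrt_le_mono)
  qed
  then have "\<forall>k. \<exists>\<phi>. test_function \<phi> \<and> H1_norm (\<lambda>x. f x - \<phi> x) \<le> sqrt (2 / real (Suc k))" by (rule allI)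
  from choice[OF this] obtain \<psi> where p: "\<forall>k. test_function (\<psi> k) \<and> H1_norm (\<lambda>x. f x - \<psi> k x) \<le> sqrt (2 / real (Suc k))"
    by (rule exE)
  have "(\<lambda>k. H1_norm (\<lambda>x. f x - \<psi> k x)) \<longlonglongrightarrow> 0"
  proof (rule tendsto_sandwich)
    show "eventually (\<lambda>k. 0 \<le> H1_norm (\<lambda>x. f x - \<psi> k x)) sequentially"
      unfolding H1_norm_def by (intro always_eventually allI real_sqrt_ge_zero Bochner_Integration.integral_nonneg) simp
    show "eventually (\<lambda>k. H1_norm (\<lambda>x. f x - \<psi> k x) \<le> sqrt (2 / real (Suc k))) sequentially"
      using p by simp
    have "(\<lambda>k. sqrt (2 * inverse (real (Suc k)))) \<longlonglongrightarrow> sqrt (2 * 0)"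
      by (intro tendsto_intros LIMSEQ_inverse_real_of_nat)
    then show "(\<lambda>k. sqrt (2 / real (Suc k))) \<longlonglongrightarrow> 0" by (simp add: divide_inverse)
  qed simp
  then show "H1_0 f" unfolding H1_0_def using p sobolev_compact_weak_gradient(2)[OF f] by blast
qed

lemma H1_loc_representative:
  fixes u :: "real^'n \<Rightarrow> real"
  assumes "H1_loc u"
  obtains v G where "sobolev_loc v G" "AE x in lebesgue. u x = v x" "AE x in lebesgue. weak_grad u x = G x"
    "weak_grad u \<in> borel_measurable lebesgue"
proof -
  obtain G0 where G0: "Lp_loc 2 u" "has_weak_gradient u G0" "Lp_loc 2 G0" using assms by (auto simp: H1_loc_def)
  have um: "u \<in> borel_measurable lebesgue" "G0 \<in> borel_measurable lebesgue" using G0 by (auto simp: has_weak_gradient_iff)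
  obtain v where v: "v \<in> borel_measurable borel" "AE x in lebesgue. u x = v x" using borel_representative[OF um(1)] by blast
  obtain G where G: "G \<in> borel_measurable borel" "AE x in lebesgue. G0 x = G x" using borel_representative_vec[OF um(2)] by blast
  have w: "has_weak_gradient v G"
    by (rule has_weak_gradient_cong_AE[OF G0(2) lebesgue_measurable_borel[OF v(1)] v(2) lebesgue_measurable_borel[OF G(1)] G(2)])
  have "sobolev_loc v G"
    unfolding sobolev_loc_def
  proof (intro conjI allI impI v G)
    fix M
    have "integrable lebesgue (\<lambda>x. indicator (cball 0 M) x *\<^sub>R (v x)\<^sup>2)"
    proof (rule integrable_cong_AE_imp)
      show "integrable lebesgue (\<lambda>x. indicator (cball 0 M) x *\<^sub>R (norm (u x))\<^sup>2)" using G0(1)[unfolded Lp_loc_2_iff set_integrable_def] by blast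
      show "(\<lambda>x. indicator (cball 0 M) x *\<^sub>R (v x)\<^sup>2) \<in> borel_measurable lebesgue"
        using v(1) by (intro indicator_cball_scaleR_measurable lebesgue_measurable_borel) simp
      show "AE x in lebesgue. indicator (cball 0 M) x *\<^sub>R (norm (u x))\<^sup>2 = indicator (cball 0 M) x *\<^sub>R (v x)\<^sup>2"
        using v(2) by eventually_elim simp
    qed
    moreover have "(\<lambda>x. indicator (cball 0 M) x *\<^sub>R (v x)\<^sup>2) \<in> borel_measurable lborel"
      using v(1) by (intro borel_measurable_scaleR borel_measurable_indicator) auto
    ultimately show "set_integrable lborel (cball 0 M) (\<lambda>x. (v x)\<^sup>2)"
      unfolding set_integrable_def by (simp only: integrable_completion)
    have "integrable lebesgue (\<lambda>x. indicator (cball 0 M) x *\<^sub>R (norm (G x))\<^sup>2)"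
    proof (rule integrable_cong_AE_imp)
      show "integrable lebesgue (\<lambda>x. indicator (cball 0 M) x *\<^sub>R (norm (G0 x))\<^sup>2)" using G0(3)[unfolded Lp_loc_2_iff set_integrable_def] by blast
      show "(\<lambda>x. indicator (cball 0 M) x *\<^sub>R (norm (G x))\<^sup>2) \<in> borel_measurable lebesgue"
        using G(1) by (intro indicator_cball_scaleR_measurable lebesgue_measurable_borel) simp
      show "AE x in lebesgue. indicator (cball 0 M) x *\<^sub>R (norm (G0 x))\<^sup>2 = indicator (cball 0 M) x *\<^sub>R (norm (G x))\<^sup>2"
        using G(2) by eventually_elim simp
    qed
    moreover have "(\<lambda>x. indicator (cball 0 M) x *\<^sub>R (norm (G x))\<^sup>2) \<in> borel_measurable lborel"
      using G(1) by (intro borel_measurable_scaleR borel_measurable_indicator) auto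
    ultimately show "set_integrable lborel (cball 0 M) (\<lambda>x. (norm (G x))\<^sup>2)"
      unfolding set_integrable_def by (simp only: integrable_completion)
    fix \<phi> :: "real^'n \<Rightarrow> real" and i assume t: "test_function \<phi>"
    have mm: "(\<lambda>x. v x * partial_deriv i \<phi> x) \<in> borel_measurable lborel" "(\<lambda>x. G x $ i * \<phi> x) \<in> borel_measurable lborel"
      using v(1) smooth_borel[OF test_function_smooth[OF t]] smooth_borel[OF test_function_smooth[OF test_function_partial[OF t]]] borel_nth[OF G(1)]
      by auto
    show "(LINT x|lborel. v x * partial_deriv i \<phi> x) = - (LINT x|lborel. G x $ i * \<phi> x)"
      using w[unfolded has_weak_gradient_iff] t
      unfolding integral_completion[OF mm(1), symmetric] integral_completion[OF mm(2), symmetric] by blast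
  qed
  moreover have "has_weak_gradient u (weak_grad u)"
    using someI[where P = "has_weak_gradient u", OF G0(2)] unfolding weak_grad_def .
  moreover have "AE x in lebesgue. weak_grad u x = G x"
    using weak_grad_eq[OF G0(2)] G(2) by eventually_elim simp
  ultimately show ?thesis using that v(2) by (auto simp: has_weak_gradient_iff)
qed

section \<open>The equation tested with a localized solution\<close>

lemma lebesgue_matrix_form:
  fixes A :: "real^'n \<Rightarrow> real^'n^'n"
  assumes A: "A \<in> borel_measurable lebesgue" and g: "g \<in> borel_measurable lebesgue" "h \<in> borel_measurable lebesgue"
  shows "(\<lambda>x. (A x *v g x) \<bullet> h x) \<in> borel_measurable lebesgue"
proof -
  have 1: "(\<lambda>x. A x $ i) \<in> borel_measurable lebesgue" for i
    by (rule measurable_compose[OF A]) (intro borel_measurable_continuous_onI continuous_intros)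
  have 2: "(\<lambda>x. A x $ i $ j) \<in> borel_measurable lebesgue" for i j by (rule lebesgue_vec_nth[OF 1])
  show ?thesis unfolding inner_vec_def matrix_vector_mult_def
    using lebesgue_vec_nth[OF g(1)] lebesgue_vec_nth[OF g(2)] 2
    by (simp add: borel_measurable_sum borel_measurable_times)
qed

text \<open>The test function is \<psi>^2 u, the product of u with the test function \<psi>^2. The
  two integrals agree because their integrands agree almost everywhere; integrability is not claimed
  here and is established in \<open>energy_inequality\<close>.\<close>

lemma weak_solution_localized:
  fixes A :: "real^'n \<Rightarrow> real^'n^'n"
  assumes sol: "weak_solution A V u" and A: "A \<in> borel_measurable lebesgue" and V: "V \<in> borel_measurable lebesgue"
    and v: "sobolev_loc v G" "AE x in lebesgue. u x = v x" "AE x in lebesgue. weak_grad u x = G x"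
    "weak_grad u \<in> borel_measurable lebesgue"
    and t: "test_function \<psi>"
  shows "(LINT x|lebesgue. (A x *v G x) \<bullet> ((\<psi> x)\<^sup>2 *\<^sub>R G x + (2 * \<psi> x * v x) *\<^sub>R grad \<psi> x) + V x * (\<psi> x * v x)\<^sup>2) = 0"
proof -
  note s = test_function_smooth[OF t]
  define \<eta> where "\<eta> = (\<lambda>x. \<psi> x * \<psi> x)"
  have te: "test_function \<eta>" unfolding \<eta>_def by (rule test_function_mult[OF t s])
  have ge: "grad \<eta> x = (2 * \<psi> x) *\<^sub>R grad \<psi> x" for x
    unfolding \<eta>_def grad_mult[OF s s] by (simp add: scaleR_add_left[symmetric])
  obtain M where M: "M > 0" "\<And>x. norm x \<ge> M \<Longrightarrow> \<eta> x = 0" "\<And>x. norm x \<ge> M \<Longrightarrow> grad \<eta> x = 0"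
    using test_function_support[OF te] by blast
  define \<phi> F where "\<phi> = (\<lambda>x. \<eta> x * v x)" and "F = (\<lambda>x. \<eta> x *\<^sub>R G x + v x *\<^sub>R grad \<eta> x)"
  have sc: "sobolev_compact M \<phi> F" unfolding \<phi>_def F_def
    by (rule sobolev_loc_mult[OF v(1) te]) (use M in auto)
  note w = sobolev_compact_weak_gradient(1)[OF sc]
  have z: "(LINT x|lebesgue. (A x *v weak_grad u x) \<bullet> weak_grad \<phi> x + V x * u x * \<phi> x) = 0"
    using sol sobolev_compact_H1_0[OF sc] by (simp add: weak_solution_def)
  have "has_weak_gradient \<phi> (weak_grad \<phi>)"
    using someI[where P = "has_weak_gradient \<phi>", OF w] unfolding weak_grad_def .
  then have wm: "weak_grad \<phi> \<in> borel_measurable lebesgue" by (simp add: has_weak_gradient_iff)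
  have bm: "v \<in> borel_measurable lebesgue" "G \<in> borel_measurable lebesgue" "\<phi> \<in> borel_measurable lebesgue" "F \<in> borel_measurable lebesgue"
    using v(1) sc by (auto simp: sobolev_loc_def sobolev_compact_def intro: lebesgue_measurable_borel)
  have "Lp_loc 2 u" using sol unfolding weak_solution_def H1_loc_def by blast
  then have "u \<in> borel_measurable lebesgue" unfolding Lp_loc_2_iff by blast
  have "(LINT x|lebesgue. (A x *v weak_grad u x) \<bullet> weak_grad \<phi> x + V x * u x * \<phi> x)
      = (LINT x|lebesgue. (A x *v G x) \<bullet> F x + V x * v x * \<phi> x)"
  proof (rule integral_cong_AE)
    show "(\<lambda>x. (A x *v weak_grad u x) \<bullet> weak_grad \<phi> x + V x * u x * \<phi> x) \<in> borel_measurable lebesgue"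
      by (intro borel_measurable_add borel_measurable_times lebesgue_matrix_form A V wm v(4) bm) fact
    show "(\<lambda>x. (A x *v G x) \<bullet> F x + V x * v x * \<phi> x) \<in> borel_measurable lebesgue"
      by (intro borel_measurable_add borel_measurable_times lebesgue_matrix_form A V bm)
    show "AE x in lebesgue. (A x *v weak_grad u x) \<bullet> weak_grad \<phi> x + V x * u x * \<phi> x = (A x *v G x) \<bullet> F x + V x * v x * \<phi> x"
      using v(2,3) weak_grad_eq[OF w] by eventually_elim simp
  qed
  also have "\<dots> = (LINT x|lebesgue. (A x *v G x) \<bullet> ((\<psi> x)\<^sup>2 *\<^sub>R G x + (2 * \<psi> x * v x) *\<^sub>R grad \<psi> x) + V x * (\<psi> x * v x)\<^sup>2)"
    by (intro Bochner_Integration.integral_cong) (auto simp: F_def \<phi>_def \<eta>_def ge[unfolded \<eta>_def] power2_eq_square algebra_simps)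
  finally show ?thesis using z by simp
qed

section \<open>Reverse Hoelder weights\<close>

lemma measure_ball_eq:
  fixes x :: "real^'n"
  assumes "r \<ge> 0"
  shows "measure lborel (ball x r) = r ^ CARD('n) * measure lborel (ball (0::real^'n) 1)"
  using content_ball_conv_unit_ball[OF assms, of x] by simp

lemma measure_unit_ball_pos: "measure lborel (ball (0::real^'n) 1) > 0"
  using content_ball_pos[of 1 "0::real^'n"] by simp

lemma measure_ball_pos: "r > 0 \<Longrightarrow> measure lborel (ball (x::real^'n) r) > 0"
  by (rule content_ball_pos)

lemma measure_bounded_finite:
  fixes E :: "(real^'n) set"
  assumes "E \<subseteq> ball x r"
  shows "emeasure lborel E < \<infinity>"
  by (rule order_le_less_trans[OF emeasure_mono[OF assms] emeasure_lborel_ball_finite]) simp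

lemma set_integral_subset_mono:
  fixes f :: "'a \<Rightarrow> real"
  assumes f: "set_integrable M B f" "\<And>x. 0 \<le> f x" and E: "E \<subseteq> B" "E \<in> sets M"
  shows "(LINT x:E|M. f x) \<le> (LINT x:B|M. f x)"
  unfolding set_lebesgue_integral_def
proof (rule Bochner_Integration.integral_mono)
  show "integrable M (\<lambda>x. indicator E x *\<^sub>R f x)"
    using set_integrable_subset[OF f(1) E(2,1)] by (simp add: set_integrable_def)
  show "integrable M (\<lambda>x. indicator B x *\<^sub>R f x)" using f by (simp add: set_integrable_def)
  show "indicator E x *\<^sub>R f x \<le> indicator B x *\<^sub>R f x" for x using f(2)[of x] E(1) by (auto simp: indicator_def)
qed

lemma set_integral_const_bounded:
  fixes E :: "(real^'n) set"
  assumes "E \<in> sets borel" "E \<subseteq> ball x r"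
  shows "set_integrable lborel E (\<lambda>_. c::real)" "(LINT y:E|lborel. c::real) = c * measure lborel E"
proof -
  have "integrable lborel (indicator E :: real^'n \<Rightarrow> real)"
    using assms measure_bounded_finite[OF assms(2)] by (intro integrable_real_indicator) auto
  then have "integrable lborel (\<lambda>y. indicator E y * c)" by (rule integrable_mult_left)
  then show "set_integrable lborel E (\<lambda>_. c)" by (simp add: set_integrable_def)
  show "(LINT y:E|lborel. c::real) = c * measure lborel E"
    using assms by (simp add: set_lebesgue_integral_def)
qed

definition avg :: "(real^'n \<Rightarrow> real) \<Rightarrow> real^'n \<Rightarrow> real \<Rightarrow> real" where
  "avg V x r = (LINT y:ball x r|lborel. V y) / measure lborel (ball x r)"

definition psi :: "(real^'n \<Rightarrow> real) \<Rightarrow> real^'n \<Rightarrow> real \<Rightarrow> real" where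
  "psi V x r = r\<^sup>2 * avg V x r"

text \<open>The working form of RH_p: a finite exponent, a Borel and everywhere nonnegative V, and
  the inequality raised to the power p. Positivity almost everywhere is recorded as positivity of
  the ball averages.\<close>

definition rh_weight :: "real \<Rightarrow> real \<Rightarrow> (real^'n \<Rightarrow> real) \<Rightarrow> bool" where
  "rh_weight p C V \<longleftrightarrow> p > 1 \<and> C \<ge> 1 \<and> V \<in> borel_measurable borel \<and> (\<forall>x. 0 \<le> V x) \<and>
     (\<forall>x r. set_integrable lborel (ball x r) (\<lambda>y. V y powr p)) \<and>
     (\<forall>x r. r > 0 \<longrightarrow> 0 < avg V x r \<and>
        (LINT y:ball x r|lborel. V y powr p) \<le> measure lborel (ball x r) * (C * avg V x r) powr p)"

text \<open>A truncation height in units of the mean: values of V above \<tau> times the mean carry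
  at most a quarter of the mass of a ball, by \<tau>^(1-p) C^p = 1/4.\<close>

definition rh_tau :: "real \<Rightarrow> real \<Rightarrow> real" where
  "rh_tau p C = (4 * C powr p) powr (1 / (p - 1))"

text \<open>A volume fraction on which the values below the truncation height contribute at most
  another quarter, since \<kappa> \<tau> = 1/4.\<close>

definition rh_kappa :: "real \<Rightarrow> real \<Rightarrow> real" where
  "rh_kappa p C = 1 / (4 * rh_tau p C)"

text \<open>Dividing a radius by this factor multiplies the volume by \<kappa>^n \<le>
  \<kappa>.\<close>

definition rh_L :: "real \<Rightarrow> real \<Rightarrow> real" where
  "rh_L p C = 1 / rh_kappa p C"

text \<open>The complement (4C)^(-p) is the share of the integral of V^p that must lie outside the
  shrunk ball.\<close>

definition rh_theta :: "real \<Rightarrow> real \<Rightarrow> real" where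
  "rh_theta p C = 1 - (4 * C) powr (- p)"

lemma rh_constants:
  assumes "p > 1" "C \<ge> 1"
  shows "rh_tau p C \<ge> 1" "0 < rh_kappa p C" "rh_kappa p C \<le> 1/4" "rh_L p C \<ge> 4"
    "0 < rh_theta p C" "rh_theta p C < 1" "rh_tau p C powr (1 - p) * C powr p = 1/4"
proof -
  have c: "C powr p \<ge> 1" using assms by (intro ge_one_powr_ge_zero) auto
  show t: "rh_tau p C \<ge> 1" unfolding rh_tau_def using c assms by (intro ge_one_powr_ge_zero) auto
  show k: "0 < rh_kappa p C" "rh_kappa p C \<le> 1/4" using t by (simp_all add: rh_kappa_def field_simps)
  show "rh_L p C \<ge> 4" unfolding rh_L_def rh_kappa_def using t by simp
  have "(4 * C) powr (- p) < (4 * C) powr 0" using assms by (intro powr_less_mono) auto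
  then show "0 < rh_theta p C" using assms by (simp add: rh_theta_def)
  show "rh_theta p C < 1" using assms by (simp add: rh_theta_def)
  have "rh_tau p C powr (1 - p) = (4 * C powr p) powr (- 1)"
    unfolding rh_tau_def powr_powr using assms by (intro arg_cong2[where f = "(powr)"] refl) (simp add: field_simps)
  also have "\<dots> = 1 / (4 * C powr p)" using c by (subst powr_minus) (simp add: field_simps)
  finally show "rh_tau p C powr (1 - p) * C powr p = 1/4" using assms by (simp add: field_simps)
qed

text \<open>Above K the factor v^(1-p) is at most K^(1-p), as p > 1. Integrated, this takes the
  place of Hoelder's inequality on small sets.\<close>

lemma truncation_bound:
  fixes v K p :: real
  assumes "v \<ge> 0" "K > 0" "p > 1"
  shows "v \<le> K + K powr (1 - p) * v powr p"
proof (cases "v \<le> K")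
  case True
  then show ?thesis by (simp add: add_increasing2)
next
  case False
  then have v: "v > 0" using assms by simp
  have "v = v powr (1 - p) * v powr p" using v by (simp add: powr_add[symmetric])
  also have "\<dots> \<le> K powr (1 - p) * v powr p" using assms False by (intro mult_right_mono powr_mono2') auto
  finally show ?thesis using assms by linarith
qed

text \<open>For v > t one has v^(p-1) \<ge> t^(p-1), and for v \<le> t the left side is at most 0.
  Integrated, this takes the place of Jensen's inequality at the cost of a constant.\<close>

lemma power_tangent_bound:
  fixes v t p :: real
  assumes "v \<ge> 0" "t > 0" "p > 1"
  shows "t powr (p - 1) * (v - t) \<le> v powr p"
proof (cases "v \<le> t")
  case True
  then have "t powr (p - 1) * (v - t) \<le> 0" by (simp add: mult_nonneg_nonpos)
  then show ?thesis using powr_ge_zero[of v p] by linarith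
next
  case False
  have "t powr (p - 1) * (v - t) \<le> v powr (p - 1) * v" using assms False by (intro mult_mono powr_mono2) auto
  also have "\<dots> = v powr p" using False assms by (simp add: powr_diff)
  finally show ?thesis .
qed

context
  fixes p C :: real and V :: "real^'n \<Rightarrow> real"
  assumes rh: "rh_weight p C V"
begin

lemma rh_p: "p > 1" and rh_C: "C \<ge> 1" and rh_borel: "V \<in> borel_measurable borel" and rh_nonneg: "0 \<le> V x"
  and rh_powr_integrable: "set_integrable lborel (ball x r) (\<lambda>y. V y powr p)"
  and rh_avg_pos: "r > 0 \<Longrightarrow> 0 < avg V x r"
  and rh_ineq: "r > 0 \<Longrightarrow> (LINT y:ball x r|lborel. V y powr p) \<le> measure lborel (ball x r) * (C * avg V x r) powr p"
  using rh by (auto simp: rh_weight_def)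

lemmas rh_const = rh_constants[OF rh_p rh_C]

lemma rh_integrable: "set_integrable lborel (ball x r) V"
  unfolding set_integrable_def
proof (rule Bochner_Integration.integrable_bound)
  have "set_integrable lborel (ball x r) (\<lambda>y. 1 + V y powr p)"
    by (intro set_integral_add(1) rh_powr_integrable set_integral_const_bounded(1)[of _ x r]) auto
  then show "integrable lborel (\<lambda>y. indicator (ball x r) y *\<^sub>R (1 + V y powr p))" by (simp only: set_integrable_def)
  show "(\<lambda>y. indicator (ball x r) y *\<^sub>R V y) \<in> borel_measurable lborel"
    using rh_borel by (intro borel_measurable_scaleR borel_measurable_indicator) auto
  have "V y \<le> 1 + V y powr p" for y using truncation_bound[OF rh_nonneg, of 1 p y] rh_p by simp
  then show "AE y in lborel. norm (indicator (ball x r) y *\<^sub>R V y) \<le> norm (indicator (ball x r) y *\<^sub>R (1 + V y powr p))"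
    using rh_nonneg by (intro AE_I2) (auto simp: indicator_def)
qed

lemma rh_integral_eq: "r > 0 \<Longrightarrow> (LINT y:ball x r|lborel. V y) = avg V x r * measure lborel (ball x r)"
  using measure_ball_pos[of r x] by (simp add: avg_def)

text \<open>Values below the height K contribute a quarter of the mass, by smallness of E; values
  above it contribute another quarter, by the reverse Hoelder inequality on the whole ball. This is
  a quantitative A_infinity property.\<close>

lemma rh_small_set:
  assumes r: "r > 0" and E: "E \<in> sets borel" "E \<subseteq> ball x r" "measure lborel E \<le> rh_kappa p C * measure lborel (ball x r)"
  shows "(LINT y:E|lborel. V y) \<le> (LINT y:ball x r|lborel. V y) / 2"
proof -
  define a where "a = avg V x r"
  define v where "v = measure lborel (ball x r)"
  define K where "K = rh_tau p C * a"
  have a: "a > 0" and v: "v > 0" using rh_avg_pos[OF r] measure_ball_pos[OF r] by (auto simp: a_def v_def)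
  have K: "K > 0" using a rh_const(1) by (simp add: K_def)
  have iE: "set_integrable lborel E V" "set_integrable lborel E (\<lambda>y. V y powr p)"
    using set_integrable_subset[OF rh_integrable _ E(2)] set_integrable_subset[OF rh_powr_integrable _ E(2)] E(1) by auto
  note cE = set_integral_const_bounded[OF E(1,2)]
  have i2: "set_integrable lborel E (\<lambda>y. K powr (1 - p) * V y powr p)" using iE(2) by (rule set_integrable_mult_right[rotated]) 
  have "(LINT y:E|lborel. V y) \<le> (LINT y:E|lborel. K + K powr (1 - p) * V y powr p)"
    by (intro set_integral_mono set_integral_add iE cE i2 truncation_bound rh_nonneg K rh_p)
  also have "\<dots> = K * measure lborel E + K powr (1 - p) * (LINT y:E|lborel. V y powr p)"
    using cE i2 by (subst set_integral_add) auto
  also have "\<dots> \<le> K * (rh_kappa p C * v) + K powr (1 - p) * (v * (C * a) powr p)"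
  proof (intro add_mono mult_left_mono)
    have "(LINT y:E|lborel. V y powr p) \<le> (LINT y:ball x r|lborel. V y powr p)"
      using E by (intro set_integral_subset_mono rh_powr_integrable) auto
    also have "\<dots> \<le> v * (C * a) powr p" using rh_ineq[OF r] by (simp add: v_def a_def)
    finally show "(LINT y:E|lborel. V y powr p) \<le> v * (C * a) powr p" .
  qed (use E(3) K in \<open>auto simp: v_def\<close>)
  also have "K * (rh_kappa p C * v) = a * v / 4" using rh_const(1) by (simp add: K_def rh_kappa_def)
  also have "K powr (1 - p) * (v * (C * a) powr p) = (rh_tau p C powr (1 - p) * C powr p) * (a powr (1 - p) * a powr p) * v"
    by (simp add: K_def powr_mult mult_ac)
  also have "\<dots> = a * v / 4" using rh_const(7) a by (simp add: powr_add[symmetric])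
  finally show ?thesis using rh_integral_eq[OF r, of x] by (simp add: a_def v_def)
qed

lemma rh_power_mean_lower:
  assumes D: "D \<in> sets borel" "D \<subseteq> ball x r" and t: "t > 0"
  shows "t powr (p - 1) * ((LINT y:D|lborel. V y) - t * measure lborel D) \<le> (LINT y:D|lborel. V y powr p)"
proof -
  have iD: "set_integrable lborel D V" "set_integrable lborel D (\<lambda>y. V y powr p)"
    using set_integrable_subset[OF rh_integrable _ D(2)] set_integrable_subset[OF rh_powr_integrable _ D(2)] D(1) by auto
  note cD = set_integral_const_bounded[OF D]
  have "t powr (p - 1) * ((LINT y:D|lborel. V y) - t * measure lborel D) = (LINT y:D|lborel. t powr (p - 1) * (V y - t))"
    using cD iD by (subst set_integral_mult_right, subst set_integral_diff) auto
  also have "\<dots> \<le> (LINT y:D|lborel. V y powr p)"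
  proof (rule set_integral_mono[OF _ iD(2)])
    show "set_integrable lborel D (\<lambda>y. t powr (p - 1) * (V y - t))"
      by (rule set_integrable_mult_right[rotated], rule set_integral_diff[OF iD(1) cD(1)])
    show "t powr (p - 1) * (V y - t) \<le> V y powr p" for y by (rule power_tangent_bound[OF rh_nonneg t rh_p])
  qed
  finally show ?thesis .
qed

text \<open>Jensen's inequality up to the factor 2^p: with threshold a/2, half of the mass remains
  after the subtraction.\<close>

lemma rh_power_mean_ball:
  assumes r: "r > 0"
  shows "measure lborel (ball x r) * (avg V x r / 2) powr p \<le> (LINT y:ball x r|lborel. V y powr p)"
proof -
  define a where "a = avg V x r"
  have a: "a > 0" using rh_avg_pos[OF r] by (simp add: a_def)
  have "measure lborel (ball x r) * (a / 2) powr p = (a/2) powr (p - 1) * (a * measure lborel (ball x r) - (a/2) * measure lborel (ball x r))"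
    using a by (simp add: powr_diff field_simps)
  also have "\<dots> \<le> (LINT y:ball x r|lborel. V y powr p)"
    using rh_power_mean_lower[of "ball x r" x r "a/2"] a rh_integral_eq[OF r, of x] by (simp add: a_def)
  finally show ?thesis by (simp add: a_def)
qed

text \<open>A fixed proportion of the mass of \<open>V\<close>, hence of \<open>V\<^sup>p\<close>, lives outside the concentric ball
shrunk by \<open>rh_L\<close>. This replaces the self-improvement of the exponent by Gehring's lemma.\<close>

lemma rh_growth_step:
  assumes R: "R > 0"
  shows "(LINT y:ball x (R / rh_L p C)|lborel. V y powr p) \<le> rh_theta p C * (LINT y:ball x R|lborel. V y powr p)"
proof -
  define E D where "E = ball x (R / rh_L p C)" and "D = ball x R - ball x (R / rh_L p C)"
  define a where "a = avg V x R"
  define v where "v = measure lborel (ball x R)"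
  have a: "a > 0" and v: "v > 0" using rh_avg_pos[OF R] measure_ball_pos[OF R] by (auto simp: a_def v_def)
  have L: "rh_L p C \<ge> 4" by (rule rh_const)
  have ED: "E \<in> sets borel" "D \<in> sets borel" "E \<subseteq> ball x R" "D \<subseteq> ball x R" "ball x R = E \<union> D" "E \<inter> D = {}"
  proof -
    have "R / rh_L p C \<le> R" using L R by (simp add: field_simps)
    then show "E \<subseteq> ball x R" "ball x R = E \<union> D" using subset_ball[of "R / rh_L p C" R x] by (auto simp: E_def D_def)
  qed (auto simp: E_def D_def)
  have int: "set_integrable lborel S V" "set_integrable lborel S (\<lambda>y. V y powr p)" if "S \<in> sets borel" "S \<subseteq> ball x R" for S
    using set_integrable_subset[OF rh_integrable _ that(2)] set_integrable_subset[OF rh_powr_integrable _ that(2)] that(1) by auto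
  have mE: "measure lborel E \<le> rh_kappa p C * v"
  proof -
    have k: "rh_kappa p C > 0" "rh_kappa p C \<le> 1" using rh_const by auto
    have "measure lborel E = (R * rh_kappa p C) ^ CARD('n) * measure lborel (ball (0::real^'n) 1)"
      unfolding E_def using R k by (subst measure_ball_eq) (auto simp: rh_L_def)
    also have "\<dots> = rh_kappa p C ^ CARD('n) * v"
      unfolding v_def using R by (subst measure_ball_eq) (auto simp: power_mult_distrib)
    also have "\<dots> \<le> rh_kappa p C ^ 1 * v"
      using k v by (intro mult_right_mono power_decreasing) auto
    finally show ?thesis by simp
  qed
  have "(LINT y:E|lborel. V y) \<le> a * v / 2"
    using rh_small_set[OF R ED(1,3)] mE rh_integral_eq[OF R, of x] by (simp add: a_def v_def)
  moreover have "a * v = (LINT y:E|lborel. V y) + (LINT y:D|lborel. V y)"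
    using rh_integral_eq[OF R, of x] set_integral_Un[OF ED(6) int(1)[OF ED(1,3)] int(1)[OF ED(2,4)]]
    by (simp only: ED(5)[symmetric] a_def v_def)
  ultimately have D1: "(LINT y:D|lborel. V y) \<ge> a * v / 2" by simp
  have mD: "measure lborel D \<le> v"
    unfolding v_def
    by (rule measure_mono_fmeasurable[OF ED(4)]) (use ED(2) emeasure_lborel_ball_finite[of x R] in \<open>auto simp: fmeasurable_def\<close>)
  have S: "(LINT y:ball x R|lborel. V y powr p) = (LINT y:E|lborel. V y powr p) + (LINT y:D|lborel. V y powr p)"
    unfolding ED(5) by (rule set_integral_Un[OF ED(6) int(2)[OF ED(1,3)] int(2)[OF ED(2,4)]])
  \<comment> \<open>D carries mass at least a v / 2, and the threshold a/4 removes at most half of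
    that. Measured against the reverse Hoelder bound v (C a)^p, the remainder is the share
    (4C)^(-p).\<close>
  have "(a / 4) powr p * v = (a/4) powr (p - 1) * (a * v / 2 - (a/4) * v)"
    using a by (simp add: powr_diff field_simps)
  also have "\<dots> \<le> (a/4) powr (p - 1) * ((LINT y:D|lborel. V y) - (a/4) * measure lborel D)"
    using D1 mD a by (intro mult_left_mono diff_mono) auto
  also have "\<dots> \<le> (LINT y:D|lborel. V y powr p)"
    using rh_power_mean_lower[OF ED(2,4), of "a/4"] a by simp
  finally have D2: "(a / 4) powr p * v \<le> (LINT y:D|lborel. V y powr p)" .
  have "(4 * C) powr (- p) * (LINT y:ball x R|lborel. V y powr p) \<le> (4 * C) powr (- p) * (v * (C * a) powr p)"
    using rh_ineq[OF R, of x] by (intro mult_left_mono) (auto simp: a_def v_def)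
  also have "\<dots> = (a / 4) powr p * v"
    using rh_C a by (simp add: powr_minus powr_mult powr_divide field_simps)
  finally have "(4 * C) powr (- p) * (LINT y:ball x R|lborel. V y powr p) \<le> (LINT y:D|lborel. V y powr p)"
    using D2 by linarith
  then show ?thesis using S by (simp add: rh_theta_def E_def algebra_simps)
qed

lemma rh_growth_iterated:
  assumes R: "R > 0"
  shows "(LINT y:ball x (R / rh_L p C ^ k)|lborel. V y powr p) \<le> rh_theta p C ^ k * (LINT y:ball x R|lborel. V y powr p)"
proof (induction k)
  case (Suc k)
  have L: "rh_L p C > 0" using rh_const(4) by linarith
  have "(LINT y:ball x (R / rh_L p C ^ Suc k)|lborel. V y powr p) \<le> rh_theta p C * (LINT y:ball x (R / rh_L p C ^ k)|lborel. V y powr p)"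
    using rh_growth_step[of "R / rh_L p C ^ k" x] R L by (simp add: mult.commute)
  also have "\<dots> \<le> rh_theta p C * (rh_theta p C ^ k * (LINT y:ball x R|lborel. V y powr p))"
    using rh_const Suc by (intro mult_left_mono) auto
  finally show ?case by simp
qed simp

lemma psi_pos: "r > 0 \<Longrightarrow> psi V x r > 0"
  using rh_avg_pos by (simp add: psi_def)

text \<open>Up to the factors 2 and C, the p-th power of psi at radius s is s^(2p-n) times the
  integral of V^p over the ball of radius s, divided by the volume of the unit ball. The integral
  gains \<open>rh_theta\<close> with every factor \<open>rh_L\<close> in the radius.\<close>

lemma psi_growth:
  assumes np: "real CARD('n) \<le> 2 * p" and s: "0 < s" "s \<le> R / rh_L p C ^ k"
  shows "psi V x s \<le> 2 * C * (rh_theta p C powr (1 / p)) ^ k * psi V x R"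
proof -
  have L: "rh_L p C ^ k \<ge> 1" using rh_const(4) by (intro one_le_power) auto
  have R: "R > 0" proof -
    have "R / rh_L p C ^ k > 0" using s by linarith
    then show ?thesis using L rh_const(4) by (auto simp: zero_less_divide_iff)
  qed
  have sR: "s \<le> R" proof -
    have "R / rh_L p C ^ k \<le> R / 1" using L R by (intro divide_left_mono) auto
    then show ?thesis using s by simp
  qed
  define w where "w = measure lborel (ball (0::real^'n) 1)"
  have w: "w > 0" unfolding w_def by (rule measure_unit_ball_pos)
  define n where "n = real CARD('n)"
  have v: "measure lborel (ball x t) = t powr n * w" if "t > 0" for t
    using that measure_ball_eq[of t x] by (simp add: w_def n_def powr_realpow)
  define a b where "a = avg V x s" and "b = avg V x R"
  have ab: "a > 0" "b > 0" using rh_avg_pos s R by (auto simp: a_def b_def)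
  have th: "rh_theta p C > 0" by (rule rh_const)
  have "s powr n * w * (a / 2) powr p \<le> (LINT y:ball x s|lborel. V y powr p)"
    using rh_power_mean_ball[OF s(1), of x] v[OF s(1)] by (simp add: a_def)
  also have "\<dots> \<le> (LINT y:ball x (R / rh_L p C ^ k)|lborel. V y powr p)"
    by (rule set_integral_subset_mono[OF rh_powr_integrable]) (use s(2) in auto)
  also have "\<dots> \<le> rh_theta p C ^ k * (LINT y:ball x R|lborel. V y powr p)" by (rule rh_growth_iterated[OF R])
  also have "\<dots> \<le> rh_theta p C ^ k * (R powr n * w * (C * b) powr p)"
    using rh_ineq[OF R, of x] v[OF R] th by (intro mult_left_mono) (auto simp: b_def)
  finally have 1: "s powr n * (a / 2) powr p \<le> rh_theta p C ^ k * (R powr n * (C * b) powr p)"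
    using w by (simp add: field_simps)
  \<comment> \<open>Here n \<le> 2p enters, through s^(2p-n) \<le> R^(2p-n).\<close>
  have "s powr (2 * p - n) * (s powr n * (a / 2) powr p) \<le> R powr (2 * p - n) * (rh_theta p C ^ k * (R powr n * (C * b) powr p))"
    by (rule mult_mono[OF powr_mono2 1]) (use np s sR in \<open>auto simp: n_def\<close>)
  then have main: "s powr (2 * p) * (a / 2) powr p \<le> rh_theta p C ^ k * (R powr (2 * p) * (C * b) powr p)"
    using s R by (simp add: powr_diff mult_ac)
  have sq: "t powr (2 * p) = (t\<^sup>2) powr p" if "t > 0" for t :: real
  proof -
    have "(t powr 2) powr p = t powr (2 * p)" by (rule powr_powr)
    then show ?thesis using that by simp
  qed
  moreover have "s powr (2 * p) * (a / 2) powr p = (s\<^sup>2 * (a / 2)) powr p"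
    unfolding sq[OF s(1)] by (rule powr_mult[symmetric])
  moreover have "rh_theta p C ^ k * (R powr (2 * p) * (C * b) powr p) = ((rh_theta p C powr (1/p)) ^ k * (R\<^sup>2 * (C * b))) powr p"
  proof -
    have "((rh_theta p C powr (1/p)) ^ k) powr p = ((rh_theta p C powr (1/p)) powr real k) powr p"
      by (subst powr_realpow) (use th in auto)
    also have "\<dots> = rh_theta p C powr real k" unfolding powr_powr using rh_p by simp
    also have "\<dots> = rh_theta p C ^ k" using th by (rule powr_realpow)
    finally show ?thesis unfolding sq[OF R] by (simp only: powr_mult mult.assoc)
  qed
  ultimately have "(s\<^sup>2 * (a / 2)) powr p \<le> ((rh_theta p C powr (1/p)) ^ k * (R\<^sup>2 * (C * b))) powr p" using main by linarith
  then have "s\<^sup>2 * (a / 2) \<le> (rh_theta p C powr (1/p)) ^ k * (R\<^sup>2 * (C * b))"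
  proof (rule contrapos_pp)
    assume "\<not> s\<^sup>2 * (a / 2) \<le> (rh_theta p C powr (1/p)) ^ k * (R\<^sup>2 * (C * b))"
    then show "\<not> (s\<^sup>2 * (a / 2)) powr p \<le> ((rh_theta p C powr (1/p)) ^ k * (R\<^sup>2 * (C * b))) powr p"
      using rh_p rh_C ab by (simp add: not_le powr_less_mono2)
  qed
  then show ?thesis by (simp add: psi_def a_def b_def mult_ac)
qed

end

section \<open>The critical radius\<close>

text \<open>The critical radius, reciprocal to the Agmon weight m_V.\<close>

definition crad :: "(real^'n \<Rightarrow> real) \<Rightarrow> real^'n \<Rightarrow> real" where
  "crad V x = Sup {r. r > 0 \<and> psi V x r \<le> 1}"

lemma exists_power_small:
  fixes b c :: real
  assumes "0 \<le> b" "b < 1" "c > 0"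
  obtains k where "c * b ^ k < 1"
proof -
  have "(\<lambda>k. c * b ^ k) \<longlonglongrightarrow> c * 0" using assms by (intro tendsto_intros LIMSEQ_realpow_zero)
  then have "eventually (\<lambda>k. c * b ^ k < 1) sequentially" by (intro order_tendstoD(2)[where y = "c * 0"]) auto
  then show ?thesis using that by (auto simp: eventually_sequentially)
qed

text \<open>The decay factor of \<open>psi\<close> per division of the radius by
  \<open>rh_L\<close>; the root undoes the p-th powers in which the mass was measured.\<close>

definition gbeta :: "real \<Rightarrow> real \<Rightarrow> real" where
  "gbeta p C = rh_theta p C powr (1 / p)"

context
  fixes p C :: real and V :: "real^'n \<Rightarrow> real"
  assumes rh: "rh_weight p C V" and np: "real CARD('n) \<le> 2 * p"
begin

lemmas rhp = rh_p[OF rh] and rhC = rh_C[OF rh] and rhb = rh_borel[OF rh] and rhn = rh_nonneg[OF rh]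
  and rhi = rh_integrable[OF rh] and rhk = rh_const[OF rh]

lemma gbeta: "0 < gbeta p C" "gbeta p C < 1"
proof -
  show "0 < gbeta p C" using rhk by (simp add: gbeta_def)
  have "rh_theta p C powr (1 / p) < 1 powr (1 / p)" using rhk rhp by (intro powr_less_mono2) auto
  then show "gbeta p C < 1" by (simp add: gbeta_def)
qed

lemma growth:
  assumes "0 < s" "s * rh_L p C ^ k \<le> R"
  shows "psi V x s \<le> 2 * C * gbeta p C ^ k * psi V x R"
  unfolding gbeta_def
  by (rule psi_growth[OF rh np assms(1)]) (use assms rhk(4) in \<open>simp add: pos_le_divide_eq\<close>)

text \<open>The indicators of the moving balls converge away from the limiting sphere, a null set.
  Joint continuity in centre and radius later yields closed superlevel sets of
  \<open>crad\<close>.\<close>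

lemma ball_integral_tendsto:
  assumes x: "X \<longlonglongrightarrow> x" and r: "\<rho> \<longlonglongrightarrow> r"
  shows "(\<lambda>k. LINT y:ball (X k) (\<rho> k)|lborel. V y) \<longlonglongrightarrow> (LINT y:ball x r|lborel. V y)"
proof -
  have "bounded (range X)" using x by (rule convergent_imp_bounded)
  then obtain B1 where B1': "\<forall>y\<in>range X. norm y \<le> B1" unfolding bounded_iff by blast
  then have B1: "norm (X k) \<le> B1" for k by simp
  have "bounded (range \<rho>)" using r by (rule convergent_imp_bounded)
  then obtain B2 where B2': "\<forall>y\<in>range \<rho>. norm y \<le> B2" unfolding bounded_iff by blast
  then have B2: "\<bar>\<rho> k\<bar> \<le> B2" for k by simp
  have m: "(\<lambda>y. indicator (ball z s) y *\<^sub>R V y) \<in> borel_measurable lborel" for z s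
    using rhb by (intro borel_measurable_scaleR borel_measurable_indicator) auto
  have N: "AE y in lborel. y \<notin> sphere x r"
  proof -
    have "AE y in lebesgue. y \<notin> sphere x r"
      by (intro AE_not_in) (use negligible_sphere[of x r] in \<open>simp add: negligible_iff_null_sets\<close>)
    then show ?thesis by (simp only: AE_completion_iff)
  qed
  show ?thesis
    unfolding set_lebesgue_integral_def
  proof (rule integral_dominated_convergence)
    show "integrable lborel (\<lambda>y. indicator (ball 0 (B1 + B2 + 1)) y *\<^sub>R V y)"
      using rhi[of 0 "B1 + B2 + 1"] by (simp only: set_integrable_def)
    show "AE y in lborel. (\<lambda>k. indicator (ball (X k) (\<rho> k)) y *\<^sub>R V y) \<longlonglongrightarrow> indicator (ball x r) y *\<^sub>R V y"
      using N
    proof eventually_elim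
      case (elim y)
      have d: "(\<lambda>k. dist (X k) y - \<rho> k) \<longlonglongrightarrow> dist x y - r" by (intro tendsto_intros x r)
      have "eventually (\<lambda>k. (y \<in> ball (X k) (\<rho> k)) = (y \<in> ball x r)) sequentially"
      proof (cases "dist x y < r")
        case True
        then have "eventually (\<lambda>k. dist (X k) y - \<rho> k < 0) sequentially" by (intro order_tendstoD(2)[OF d]) simp
        then show ?thesis by eventually_elim (use True in auto)
      next
        case False
        then have "dist x y - r > 0" using elim by auto
        then have "eventually (\<lambda>k. dist (X k) y - \<rho> k > 0) sequentially" by (rule order_tendstoD(1)[OF d])
        then show ?thesis by eventually_elim (use False in auto)
      qed
      then have "eventually (\<lambda>k. indicator (ball (X k) (\<rho> k)) y *\<^sub>R V y = indicator (ball x r) y *\<^sub>R V y) sequentially"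
        by eventually_elim (auto simp: indicator_def)
      then show ?case by (rule tendsto_eventually)
    qed
    show "AE y in lborel. norm (indicator (ball (X k) (\<rho> k)) y *\<^sub>R V y) \<le> indicator (ball 0 (B1 + B2 + 1)) y *\<^sub>R V y" for k
    proof (rule AE_I2)
      fix y
      have "y \<in> ball 0 (B1 + B2 + 1)" if "y \<in> ball (X k) (\<rho> k)"
      proof -
        have "norm y \<le> norm (X k) + dist (X k) y" using norm_triangle_sub[of y "X k"] by (simp add: dist_norm norm_minus_commute)
        then show ?thesis using that B1[of k] B2[of k] by auto
      qed
      then show "norm (indicator (ball (X k) (\<rho> k)) y *\<^sub>R V y) \<le> indicator (ball 0 (B1 + B2 + 1)) y *\<^sub>R V y"
        using rhn[of y] by (auto simp: indicator_def)
    qed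
  qed (rule m)+
qed

lemma psi_eq:
  "r > 0 \<Longrightarrow> psi V x r = r\<^sup>2 * (LINT y:ball x r|lborel. V y) / (r ^ CARD('n) * measure lborel (ball (0::real^'n) 1))"
  by (simp add: psi_def avg_def measure_ball_eq[of r x])

lemma psi_tendsto:
  assumes x: "X \<longlonglongrightarrow> x" and r: "\<rho> \<longlonglongrightarrow> r" and pos: "r > 0" "\<And>k. \<rho> k > 0"
  shows "(\<lambda>k. psi V (X k) (\<rho> k)) \<longlonglongrightarrow> psi V x r"
proof -
  have "(\<lambda>k. (\<rho> k)\<^sup>2 * (LINT y:ball (X k) (\<rho> k)|lborel. V y) / (\<rho> k ^ CARD('n) * measure lborel (ball (0::real^'n) 1)))
     \<longlonglongrightarrow> r\<^sup>2 * (LINT y:ball x r|lborel. V y) / (r ^ CARD('n) * measure lborel (ball (0::real^'n) 1))"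
    by (intro tendsto_intros ball_integral_tendsto x r) (use pos measure_unit_ball_pos[where 'n = 'n] in auto)
  then show ?thesis using pos by (simp add: psi_eq)
qed

lemma crad_set_nonempty: "{r. r > 0 \<and> psi V x r \<le> 1} \<noteq> {}"
proof -
  have p1: "2 * C * psi V x 1 > 0" using rhC psi_pos[OF rh, of 1 x] by simp
  obtain k where k: "(2 * C * psi V x 1) * gbeta p C ^ k < 1"
    using exists_power_small[OF less_imp_le[OF gbeta(1)] gbeta(2) p1] by blast
  have L: "rh_L p C ^ k > 0" using rhk(4) by simp
  have "psi V x (1 / rh_L p C ^ k) \<le> 2 * C * gbeta p C ^ k * psi V x 1" by (rule growth) (use L in auto)
  also have "\<dots> \<le> 1" using k by (simp add: mult_ac)
  finally show ?thesis using L by (auto intro!: exI[of _ "1 / rh_L p C ^ k"])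
qed

text \<open>The growth estimate read backwards: psi at radius 1 is a fixed positive number and at
  most 2 C \<beta>^k times psi at r.\<close>

lemma psi_large:
  obtains T where "T > 0" "\<And>r. r \<ge> T \<Longrightarrow> psi V x r > 1"
proof -
  have p1: "psi V x 1 > 0" using psi_pos[OF rh, of 1 x] by simp
  have p2: "2 * C / psi V x 1 > 0" using rhC p1 by simp
  obtain k where k: "(2 * C / psi V x 1) * gbeta p C ^ k < 1"
    using exists_power_small[OF less_imp_le[OF gbeta(1)] gbeta(2) p2] by blast
  have L: "rh_L p C ^ k > 0" using rhk(4) by simp
  have "psi V x r > 1" if "r \<ge> rh_L p C ^ k" for r
  proof -
    have "psi V x 1 \<le> 2 * C * gbeta p C ^ k * psi V x r" by (rule growth) (use that in auto)
    moreover have "2 * C * gbeta p C ^ k < psi V x 1" using k p1 by (simp add: field_simps)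
    ultimately have "(2 * C * gbeta p C ^ k) * 1 < (2 * C * gbeta p C ^ k) * psi V x r" by linarith
    moreover have "2 * C * gbeta p C ^ k > 0" using rhC gbeta(1) by simp
    ultimately show ?thesis by (simp only: mult_less_cancel_left_pos)
  qed
  then show ?thesis using that L by blast
qed

lemma crad_set_bdd: "bdd_above {r. r > 0 \<and> psi V x r \<le> 1}"
proof -
  obtain T where T: "T > 0" "\<And>r. r \<ge> T \<Longrightarrow> psi V x r > 1" using psi_large by blast
  show ?thesis
  proof (rule bdd_aboveI)
    fix r assume "r \<in> {r. r > 0 \<and> psi V x r \<le> 1}"
    then show "r \<le> T" using T(2)[of r] by force
  qed
qed

lemma crad_upper: "r > 0 \<Longrightarrow> psi V x r \<le> 1 \<Longrightarrow> r \<le> crad V x"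
  unfolding crad_def by (rule cSup_upper) (auto intro: crad_set_bdd)

lemma crad_pos: "crad V x > 0"
proof -
  obtain r where "r > 0" "psi V x r \<le> 1" using crad_set_nonempty by blast
  then show ?thesis using crad_upper by fastforce
qed

lemma psi_gt_1: "s > crad V x \<Longrightarrow> psi V x s > 1"
  using crad_upper[of s x] crad_pos[of x] by linarith

lemma crad_leI:
  assumes "t > 0" "\<And>s. s \<ge> t \<Longrightarrow> psi V x s > 1"
  shows "crad V x \<le> t"
  unfolding crad_def
proof (rule cSup_least[OF crad_set_nonempty])
  fix r assume "r \<in> {r. r > 0 \<and> psi V x r \<le> 1}"
  then show "r \<le> t" using assms(2)[of r] by force
qed

text \<open>Radii beyond the supremum have psi > 1, admissible radii approach it with psi \<le> 1,
  and psi is continuous. Since psi need not be monotone, the set under the supremum is not treated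
  as an interval.\<close>

lemma psi_crad: "psi V x (crad V x) = 1"
proof (rule antisym)
  let ?r = "crad V x"
  note r = crad_pos[of x]
  show "1 \<le> psi V x ?r"
  proof (rule LIMSEQ_le_const)
    have "(\<lambda>k. ?r + inverse (real (Suc k))) \<longlonglongrightarrow> ?r + 0" by (intro tendsto_intros LIMSEQ_inverse_real_of_nat)
    then have "(\<lambda>k. ?r + inverse (real (Suc k))) \<longlonglongrightarrow> ?r" by simp
    then show "(\<lambda>k. psi V x (?r + inverse (real (Suc k)))) \<longlonglongrightarrow> psi V x ?r"
      by (intro psi_tendsto tendsto_const) (use r in \<open>auto intro: add_pos_pos\<close>)
    show "\<exists>N. \<forall>n\<ge>N. 1 \<le> psi V x (?r + inverse (real (Suc n)))"
      using psi_gt_1 by (intro exI[of _ 0] allI impI less_imp_le psi_gt_1) simp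
  qed
  show "psi V x ?r \<le> 1"
  proof -
    have "\<exists>s. s > 0 \<and> psi V x s \<le> 1 \<and> ?r - inverse (real (Suc k)) < s" for k
    proof -
      have "?r - inverse (real (Suc k)) < Sup {r. r > 0 \<and> psi V x r \<le> 1}" by (simp add: crad_def[symmetric])
      then show ?thesis using less_cSup_iff[OF crad_set_nonempty crad_set_bdd] by auto
    qed
    then have "\<forall>k. \<exists>s. s > 0 \<and> psi V x s \<le> 1 \<and> ?r - inverse (real (Suc k)) < s" by (rule allI)
    from choice[OF this] obtain s where s: "\<forall>k. s k > 0 \<and> psi V x (s k) \<le> 1 \<and> ?r - inverse (real (Suc k)) < s k"
      by (rule exE)
    have sr: "s k \<le> ?r" for k using s crad_upper by blast
    have "s \<longlonglongrightarrow> ?r"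
    proof (rule tendsto_sandwich)
      have "(\<lambda>k. ?r - inverse (real (Suc k))) \<longlonglongrightarrow> ?r - 0" by (intro tendsto_intros LIMSEQ_inverse_real_of_nat)
      then show "(\<lambda>k. ?r - inverse (real (Suc k))) \<longlonglongrightarrow> ?r" by simp
      show "eventually (\<lambda>k. ?r - inverse (real (Suc k)) \<le> s k) sequentially"
        using s by (intro always_eventually allI less_imp_le) blast
      show "eventually (\<lambda>k. s k \<le> ?r) sequentially" using sr by simp
    qed simp
    then have "(\<lambda>k. psi V x (s k)) \<longlonglongrightarrow> psi V x ?r"
      by (intro psi_tendsto tendsto_const) (use r s in auto)
    then show ?thesis by (rule LIMSEQ_le_const2) (use s in blast)
  qed
qed

end

section \<open>Slow variation of the critical radius\<close>

text \<open>A radius factor c < 1 with c^n \<ge> 1 - \<kappa>/2 by Bernoulli's inequality, so that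
  the shell between radius c r and r has volume fraction at most \<kappa>/2. The type argument
  carries the dimension n.\<close>

definition shell :: "'n::finite itself \<Rightarrow> real \<Rightarrow> real \<Rightarrow> real" where
  "shell _ p C = 1 - rh_kappa p C / (2 * real CARD('n))"

lemma shell_bounds:
  assumes "p > 1" "C \<ge> 1"
  shows "0 < shell TYPE('n::finite) p C" "shell TYPE('n) p C < 1" "1 - rh_kappa p C / 2 \<le> shell TYPE('n) p C ^ CARD('n)"
proof -
  note k = rh_constants[OF assms]
  have n: "real CARD('n) \<ge> 1" using zero_less_card_finite[where 'a = 'n] by linarith
  have h: "rh_kappa p C / (2 * real CARD('n)) \<le> rh_kappa p C / 2"
    using k n by (intro divide_left_mono) auto
  have h0: "rh_kappa p C / (2 * real CARD('n)) > 0" using k n by simp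
  show "0 < shell TYPE('n) p C" "shell TYPE('n) p C < 1" using h h0 k unfolding shell_def by linarith+
  have "1 + real CARD('n) * (- (rh_kappa p C / (2 * real CARD('n)))) \<le> (1 + - (rh_kappa p C / (2 * real CARD('n)))) ^ CARD('n)"
    by (rule Bernoulli_inequality) (use h k in linarith)
  then show "1 - rh_kappa p C / 2 \<le> shell TYPE('n) p C ^ CARD('n)" using n by (simp add: shell_def)
qed

text \<open>Nested balls compare psi at x and z; the dimensional factor lost in this is beaten by
  sufficiently many steps of the growth estimate. Staying \<epsilon> r away from the critical sphere
  leaves z a ball of its own inside B(x, r).\<close>

lemma crad_slow_variation:
  fixes p C :: real
  assumes pC: "p > 1" "C \<ge> 1" and np: "real CARD('n::finite) \<le> 2 * p"
  obtains \<Gamma> where "\<Gamma> \<ge> 1"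
    "\<And>V x z. rh_weight p C (V :: real^'n \<Rightarrow> real) \<Longrightarrow> dist x z \<le> shell TYPE('n) p C * crad V x \<Longrightarrow>
       crad V z \<le> \<Gamma> * crad V x \<and> crad V x \<le> \<Gamma> * crad V z"
proof -
  define c where "c = shell TYPE('n) p C"
  define \<epsilon> where "\<epsilon> = 1 - c"
  have c: "0 < c" "c < 1" using shell_bounds[OF pC, where 'n = 'n] by (auto simp: c_def)
  then have e: "0 < \<epsilon>" "\<epsilon> < 1" by (auto simp: \<epsilon>_def)
  define L where "L = rh_L p C"
  have L: "L \<ge> 4" using rh_constants[OF pC] by (simp add: L_def)
  define \<beta> where "\<beta> = gbeta p C"
  have th: "0 < rh_theta p C" "rh_theta p C < 1" using rh_constants[OF pC] by auto
  have "rh_theta p C powr (1 / p) < 1 powr (1 / p)" using th pC by (intro powr_less_mono2) auto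
  then have b: "0 < \<beta>" "\<beta> < 1" using th by (auto simp: \<beta>_def gbeta_def)
  \<comment> \<open>2^n is the volume ratio of B(z, 2r) to B(x, r), and \<epsilon>^(-n) that of B(x,
    r) to B(z, \<epsilon> r); \<open>k1\<close> and \<open>k2\<close> are step numbers for which
    powers of \<beta> beat these ratios.\<close>
  have pos: "2 * C * 2 ^ CARD('n) > 0" "2 * C * (1 / \<epsilon>) ^ CARD('n) > 0" using pC e by auto
  obtain k1 where k1: "(2 * C * 2 ^ CARD('n)) * \<beta> ^ k1 < 1"
    using exists_power_small[OF less_imp_le[OF b(1)] b(2) pos(1)] by blast
  obtain k2 where k2: "(2 * C * (1 / \<epsilon>) ^ CARD('n)) * \<beta> ^ k2 < 1"
    using exists_power_small[OF less_imp_le[OF b(1)] b(2) pos(2)] by blast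
  define \<Gamma> where "\<Gamma> = max (2 * L ^ k1) (L ^ k2 / \<epsilon>)"
  have Lk: "L ^ k \<ge> 1" for k using L by (intro one_le_power) auto
  have G1: "\<Gamma> \<ge> 2 * L ^ k1" "\<Gamma> \<ge> L ^ k2 / \<epsilon>" by (auto simp: \<Gamma>_def)
  have G: "\<Gamma> \<ge> 1" using G1(1) Lk[of k1] by linarith
  have "crad V z \<le> \<Gamma> * crad V x \<and> crad V x \<le> \<Gamma> * crad V z"
    if rh: "rh_weight p C V" and d: "dist x z \<le> c * crad V x" for V :: "real^'n \<Rightarrow> real" and x z
  proof
    define r where "r = crad V x"
    define w where "w = measure lborel (ball (0::real^'n) 1)"
    have w: "w > 0" unfolding w_def by (rule measure_unit_ball_pos)
    have r: "r > 0" unfolding r_def by (rule crad_pos[OF rh np])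
    have pr: "psi V x r = 1" unfolding r_def by (rule psi_crad[OF rh np])
    note psi_eq' = psi_eq[OF rh np, folded w_def]
    have dr: "dist x z \<le> c * r" using d by (simp add: r_def)
    have dr1: "dist x z < r" proof -
      have "c * r < 1 * r" using c r by (intro mult_strict_right_mono) auto
      then show ?thesis using dr by simp
    qed
    have int_mono: "(LINT y:ball a s|lborel. V y) \<le> (LINT y:ball b t|lborel. V y)" if "ball a s \<subseteq> ball b t" for a b s t
      by (rule set_integral_subset_mono[OF rh_integrable[OF rh] rh_nonneg[OF rh] that]) simp
    \<comment> \<open>Every radius s \<ge> \<Gamma> r around z has to be excluded: B(z, 2r) contains
      B(x, r), where psi is 1, and psi grows from radius 2r to s.\<close>
    show "crad V z \<le> \<Gamma> * crad V x"
    proof (rule crad_leI[OF rh np])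
      show "\<Gamma> * crad V x > 0" using G r by (simp add: r_def)
      fix s assume s: "s \<ge> \<Gamma> * crad V x"
      have "2 * r * L ^ k1 \<le> \<Gamma> * r" using mult_right_mono[OF G1(1), of r] r by (simp add: mult_ac)
      then have "2 * r * L ^ k1 \<le> s" using s by (simp add: r_def)
      then have g: "psi V z (2 * r) \<le> 2 * C * \<beta> ^ k1 * psi V z s"
        unfolding \<beta>_def by (intro growth[OF rh np]) (use r in \<open>auto simp: L_def\<close>)
      have "ball x r \<subseteq> ball z (2 * r)"
      proof
        fix y assume "y \<in> ball x r"
        then show "y \<in> ball z (2 * r)" using dist_triangle[of z y x] dr1 by (auto simp: dist_commute)
      qed
      then have i: "(LINT y:ball x r|lborel. V y) \<le> (LINT y:ball z (2*r)|lborel. V y)" by (rule int_mono)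
      have i0: "0 \<le> (LINT y:ball x r|lborel. V y)"
        unfolding set_lebesgue_integral_def using rh_nonneg[OF rh] by (intro Bochner_Integration.integral_nonneg) (simp add: indicator_def)
      have "1 = r\<^sup>2 * (LINT y:ball x r|lborel. V y) / (r ^ CARD('n) * w)" by (simp only: psi_eq'[OF r, symmetric] pr)
      also have "\<dots> \<le> (2 * r)\<^sup>2 * (LINT y:ball z (2*r)|lborel. V y) / (r ^ CARD('n) * w)"
        using r w i i0 by (intro divide_right_mono mult_mono) (auto simp: power_mono)
      also have "\<dots> = 2 ^ CARD('n) * psi V z (2 * r)"
        using r w by (simp add: psi_eq' power_mult_distrib)
      also have "\<dots> \<le> 2 ^ CARD('n) * (2 * C * \<beta> ^ k1 * psi V z s)" using g by (intro mult_left_mono) auto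
      finally have "1 \<le> (2 * C * 2 ^ CARD('n) * \<beta> ^ k1) * psi V z s" by (simp add: mult_ac)
      moreover have "s > 0" proof -
        have "\<Gamma> * r > 0" using G r by simp
        then show ?thesis using s by (simp add: r_def)
      qed
      then have "psi V z s > 0" by (rule psi_pos[OF rh])
      then have "(2 * C * 2 ^ CARD('n) * \<beta> ^ k1) * psi V z s < 1 * psi V z s" using k1 by (intro mult_strict_right_mono) auto
      ultimately show "psi V z s > 1" by simp
    qed
    \<comment> \<open>Here one radius suffices: psi around z is at most 1 at \<epsilon> r /
      L^k2.\<close>
    show "crad V x \<le> \<Gamma> * crad V z"
    proof -
      have "ball z (\<epsilon> * r) \<subseteq> ball x r"
      proof
        fix y assume "y \<in> ball z (\<epsilon> * r)"
        then show "y \<in> ball x r" using dist_triangle[of x y z] dr by (auto simp: \<epsilon>_def algebra_simps)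
      qed
      then have i: "(LINT y:ball z (\<epsilon> * r)|lborel. V y) \<le> (LINT y:ball x r|lborel. V y)" by (rule int_mono)
      have er: "\<epsilon> * r > 0" using e r by simp
      have i0: "0 \<le> (LINT y:ball z (\<epsilon> * r)|lborel. V y)"
        unfolding set_lebesgue_integral_def using rh_nonneg[OF rh] by (intro Bochner_Integration.integral_nonneg) (simp add: indicator_def)
      have "psi V z (\<epsilon> * r) = (\<epsilon> * r)\<^sup>2 * (LINT y:ball z (\<epsilon> * r)|lborel. V y) / ((\<epsilon> * r) ^ CARD('n) * w)"
        by (rule psi_eq'[OF er])
      also have "\<dots> \<le> r\<^sup>2 * (LINT y:ball x r|lborel. V y) / ((\<epsilon> * r) ^ CARD('n) * w)"
        using er w i i0 e r by (intro divide_right_mono mult_mono power_mono) auto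
      also have "\<dots> = (1 / \<epsilon>) ^ CARD('n) * psi V x r"
        using r w e by (simp add: psi_eq' power_mult_distrib power_one_over)
      finally have p1: "psi V z (\<epsilon> * r) \<le> (1 / \<epsilon>) ^ CARD('n)" using pr by simp
      have Lp: "L ^ k2 > 0" using Lk[of k2] by linarith
      have "psi V z (\<epsilon> * r / L ^ k2) \<le> 2 * C * \<beta> ^ k2 * psi V z (\<epsilon> * r)"
        unfolding \<beta>_def by (intro growth[OF rh np]) (use er Lp in \<open>auto simp: L_def\<close>)
      also have "\<dots> \<le> 2 * C * \<beta> ^ k2 * (1 / \<epsilon>) ^ CARD('n)" using p1 pC b by (intro mult_left_mono) auto
      also have "\<dots> \<le> 1" using k2 by (simp add: mult_ac)
      finally have "\<epsilon> * r / L ^ k2 \<le> crad V z" using er Lp by (intro crad_upper[OF rh np]) auto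
      then have "r \<le> L ^ k2 / \<epsilon> * crad V z" using e Lp by (simp add: field_simps)
      also have "\<dots> \<le> \<Gamma> * crad V z" using G1(2) crad_pos[OF rh np, of z] by (intro mult_right_mono) auto
      finally show ?thesis by (simp add: r_def)
    qed
  qed
  then show ?thesis using that[OF G] by (simp add: c_def)
qed

text \<open>Two sets are discarded from the critical ball, the outer shell and the points where V
  exceeds K / r^2. Each has at most the fraction \<kappa>/2 of the volume, so by
  \<open>rh_small_set\<close> half of the mass survives, and there V equals its truncation.\<close>

lemma crad_truncated_mass:
  fixes V :: "real^'n \<Rightarrow> real"
  assumes rh: "rh_weight p C V" and np: "real CARD('n) \<le> 2 * p"
  shows "measure lborel (ball x (crad V x)) / (2 * (crad V x)\<^sup>2)
    \<le> (LINT y:ball x (shell TYPE('n) p C * crad V x)|lborel. min (V y) (2 / rh_kappa p C / (crad V x)\<^sup>2))"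
proof -
  define r where "r = crad V x"
  define c where "c = shell TYPE('n) p C"
  define \<kappa> where "\<kappa> = rh_kappa p C"
  define v where "v = measure lborel (ball x r)"
  define a where "a = 1 / r\<^sup>2"
  \<comment> \<open>By Markov's inequality V exceeds K times its mean on at most the fraction 1/K =
    \<kappa>/2 of the ball.\<close>
  define K where "K = 2 / \<kappa>"
  note pC = rh_p[OF rh] rh_C[OF rh]
  have c: "0 < c" "c < 1" "1 - \<kappa> / 2 \<le> c ^ CARD('n)" using shell_bounds[OF pC, where 'n = 'n] by (auto simp: c_def \<kappa>_def)
  have k: "\<kappa> > 0" using rh_constants[OF pC] by (simp add: \<kappa>_def)
  have r: "r > 0" unfolding r_def by (rule crad_pos[OF rh np])
  have v: "v > 0" unfolding v_def using r by (rule measure_ball_pos)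
  have a: "a > 0" using r by (simp add: a_def)
  have K: "K > 0" using k by (simp add: K_def)
  have "psi V x r = 1" unfolding r_def by (rule psi_crad[OF rh np])
  then have av: "avg V x r = a" using r by (simp add: psi_def a_def field_simps)
  have tot: "(LINT y:ball x r|lborel. V y) = a * v" using rh_integral_eq[OF rh r, of x] by (simp add: av v_def)
  have [measurable]: "V \<in> borel_measurable borel" by (rule rh_borel[OF rh])
  define E1 where "E1 = {y \<in> ball x r. V y > K * a}"
  define E2 where "E2 = ball x r - ball x (c * r)"
  have sub: "ball x (c * r) \<subseteq> ball x r" using c r by (intro subset_ball) (simp add: mult_left_le_one_le)
  have E1b: "E1 \<in> sets borel" unfolding E1_def by measurable
  have E2b: "E2 \<in> sets borel" unfolding E2_def by simp
  have E1s: "E1 \<subseteq> ball x r" and E2s: "E2 \<subseteq> ball x r" by (auto simp: E1_def E2_def)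
  have int: "set_integrable lborel S V" if "S \<in> sets borel" "S \<subseteq> ball x r" for S
    using set_integrable_subset[OF rh_integrable[OF rh] _ that(2)] that(1) by auto
  have m1: "measure lborel E1 \<le> \<kappa> / 2 * v"
  proof -
    have "K * a * measure lborel E1 = (LINT y:E1|lborel. K * a)" using set_integral_const_bounded(2)[OF E1b E1s] by simp
    also have "\<dots> \<le> (LINT y:E1|lborel. V y)"
      by (rule set_integral_mono[OF set_integral_const_bounded(1)[OF E1b E1s] int[OF E1b E1s]]) (simp add: E1_def)
    also have "\<dots> \<le> a * v" unfolding tot[symmetric]
      by (rule set_integral_subset_mono[OF rh_integrable[OF rh] rh_nonneg[OF rh] E1s]) (use E1b in simp)
    finally have "K * measure lborel E1 \<le> v" using a by (simp add: mult_ac)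
    then show ?thesis using k by (simp add: K_def field_simps)
  qed
  have m2: "measure lborel E2 \<le> \<kappa> / 2 * v"
  proof -
    have "measure lborel E2 = v - measure lborel (ball x (c * r))"
      unfolding E2_def v_def by (rule measure_Diff) (use sub emeasure_lborel_ball_finite[of x r] in auto)
    also have "measure lborel (ball x (c * r)) = c ^ CARD('n) * v"
      unfolding v_def using c r by (simp add: measure_ball_eq[of "c * r" x] measure_ball_eq[of r x] power_mult_distrib)
    also have "v - c ^ CARD('n) * v = (1 - c ^ CARD('n)) * v" by (simp add: algebra_simps)
    also have "\<dots> \<le> \<kappa> / 2 * v" using c v by (intro mult_right_mono) auto
    finally show ?thesis .
  qed
  define E where "E = E1 \<union> E2"
  have Eb: "E \<in> sets borel" "E \<subseteq> ball x r" using E1b E2b E1s E2s by (auto simp: E_def)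
  have fin: "S \<in> fmeasurable lborel" if "S \<in> sets borel" "S \<subseteq> ball x r" for S
    using that measure_bounded_finite[OF that(2)] by (auto simp: fmeasurable_def)
  have "measure lborel E \<le> measure lborel E1 + measure lborel E2"
    unfolding E_def by (rule measure_Un_le) (use E1b E2b in auto)
  then have "measure lborel E \<le> \<kappa> * v" using m1 m2 by linarith
  then have h: "(LINT y:E|lborel. V y) \<le> a * v / 2"
    using rh_small_set[OF rh r Eb] tot by (simp add: v_def \<kappa>_def)
  define D where "D = ball x r - E"
  have Db: "D \<in> sets borel" "D \<subseteq> ball x r" "D \<subseteq> ball x (c * r)" using Eb by (auto simp: D_def E_def E2_def)
  have "a * v = (LINT y:E|lborel. V y) + (LINT y:D|lborel. V y)"
  proof -
    have "ball x r = E \<union> D" using Eb by (auto simp: D_def)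
    then show ?thesis using tot set_integral_Un[OF _ int[OF Eb] int[OF Db(1,2)]] by (simp add: D_def)
  qed
  then have "a * v / 2 \<le> (LINT y:D|lborel. V y)" using h by linarith
  also have "\<dots> = (LINT y:D|lborel. min (V y) (K * a))"
  proof (rule set_lebesgue_integral_cong)
    show "\<forall>y. y \<in> D \<longrightarrow> V y = min (V y) (K * a)" by (auto simp: D_def E_def E1_def min_def)
  qed (use Db in simp)
  also have "\<dots> \<le> (LINT y:ball x (c * r)|lborel. min (V y) (K * a))"
  proof (rule set_integral_subset_mono)
    have "set_integrable lborel (ball x (c * r)) V" by (rule rh_integrable[OF rh])
    then show "set_integrable lborel (ball x (c * r)) (\<lambda>y. min (V y) (K * a))"
    proof (rule set_integrable_bound)
      show "set_borel_measurable lborel (ball x (c * r)) (\<lambda>y. min (V y) (K * a))"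
        unfolding set_borel_measurable_def by (intro borel_measurable_scaleR borel_measurable_indicator) auto
      show "AE y in lborel. y \<in> ball x (c * r) \<longrightarrow> norm (min (V y) (K * a)) \<le> norm (V y)"
        using rh_nonneg[OF rh] K a by (intro AE_I2) auto
    qed
    show "0 \<le> min (V y) (K * a)" for y using rh_nonneg[OF rh] K a by simp
  qed (use Db in auto)
  finally show ?thesis using r by (simp add: a_def K_def r_def v_def c_def \<kappa>_def field_simps)
qed

text \<open>Superlevel sets are closed: along a convergent sequence of points slow variation keeps
  the critical radii bounded, a limit l of them satisfies psi = 1 at the limit point, and hence l is
  at most its critical radius.\<close>

lemma crad_borel:
  fixes V :: "real^'n \<Rightarrow> real"
  assumes rh: "rh_weight p C V" and np: "real CARD('n) \<le> 2 * p"
  shows "crad V \<in> borel_measurable borel"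
proof -
  note pC = rh_p[OF rh] rh_C[OF rh]
  obtain \<Gamma> where G: "\<Gamma> \<ge> 1" "\<And>V x z. rh_weight p C (V :: real^'n \<Rightarrow> real) \<Longrightarrow> dist x z \<le> shell TYPE('n) p C * crad V x \<Longrightarrow>
       crad V z \<le> \<Gamma> * crad V x \<and> crad V x \<le> \<Gamma> * crad V z"
    using crad_slow_variation[OF pC np] by blast
  have "closed {x. t \<le> crad V x}" if t: "t > 0" for t
    unfolding closed_sequential_limits
  proof (intro allI impI, elim conjE)
    fix X x assume X: "\<forall>n. X n \<in> {x. t \<le> crad V x}" and lim: "X \<longlonglongrightarrow> x"
    have "shell TYPE('n) p C * crad V x > 0" using shell_bounds(1)[OF pC, where 'n = 'n] crad_pos[OF rh np] by simp
    then obtain N where N: "\<And>n. n \<ge> N \<Longrightarrow> dist (X n) x < shell TYPE('n) p C * crad V x"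
      using lim unfolding LIMSEQ_def by blast
    define Y where "Y = (\<lambda>n. X (n + N))"
    have Y: "Y \<longlonglongrightarrow> x" unfolding Y_def by (rule LIMSEQ_ignore_initial_segment[OF lim])
    have b: "crad V (Y n) \<in> {t..\<Gamma> * crad V x}" for n
    proof -
      have "dist x (Y n) \<le> shell TYPE('n) p C * crad V x" using N[of "n + N"] by (simp add: Y_def dist_commute)
      then show ?thesis using G(2)[OF rh] X by (simp add: Y_def)
    qed
    have "seq_compact {t..\<Gamma> * crad V x}" by (simp add: compact_imp_seq_compact)
    moreover have "\<forall>n. crad V (Y n) \<in> {t..\<Gamma> * crad V x}" using b by (rule allI)
    ultimately obtain l \<sigma> where l: "l \<in> {t..\<Gamma> * crad V x}" "strict_mono \<sigma>" "((\<lambda>n. crad V (Y n)) \<circ> \<sigma>) \<longlonglongrightarrow> l"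
      by (rule seq_compactE)
    have "(\<lambda>n. psi V ((Y \<circ> \<sigma>) n) (((\<lambda>n. crad V (Y n)) \<circ> \<sigma>) n)) \<longlonglongrightarrow> psi V x l"
      by (rule psi_tendsto[OF rh np LIMSEQ_subseq_LIMSEQ[OF Y l(2)] l(3)])
        (use l(1) t crad_pos[OF rh np] in auto)
    then have "(\<lambda>n. 1) \<longlonglongrightarrow> psi V x l" by (simp add: psi_crad[OF rh np])
    then have "psi V x l = 1" by (simp add: LIMSEQ_const_iff)
    then have "l \<le> crad V x" using l(1) t by (intro crad_upper[OF rh np]) auto
    then show "x \<in> {x. t \<le> crad V x}" using l(1) by simp
  qed
  then have *: "{x. t \<le> crad V x} \<in> sets borel" if "t > 0" for t using that by (intro borel_closed)
  have "{x. t \<le> crad V x} \<in> sets borel" for t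
  proof (cases "t > 0")
    case False
    then have "t \<le> crad V x" for x using crad_pos[OF rh np, of x] by linarith
    then show ?thesis by simp
  qed (rule *)
  then show ?thesis by (simp add: borel_measurable_iff_ge)
qed

text \<open>Upper semicontinuity alone gives no lower bound. Slow variation does: radii tending to 0
  along a convergent sequence would force critical radius 0 at its limit.\<close>

lemma crad_locally_bounded_below:
  fixes V :: "real^'n \<Rightarrow> real"
  assumes rh: "rh_weight p C V" and np: "real CARD('n) \<le> 2 * p"
  obtains b where "b > 0" "\<And>x. norm x \<le> M \<Longrightarrow> crad V x \<ge> b"
proof -
  note pC = rh_p[OF rh] rh_C[OF rh]
  obtain \<Gamma> where G: "\<Gamma> \<ge> 1" "\<And>V x z. rh_weight p C (V :: real^'n \<Rightarrow> real) \<Longrightarrow> dist x z \<le> shell TYPE('n) p C * crad V x \<Longrightarrow>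
       crad V z \<le> \<Gamma> * crad V x \<and> crad V x \<le> \<Gamma> * crad V z"
    using crad_slow_variation[OF pC np] by blast
  have "\<exists>n. \<forall>x. norm x \<le> M \<longrightarrow> crad V x \<ge> inverse (real (Suc n))"
  proof (rule ccontr)
    assume "\<not> ?thesis"
    then have "\<forall>n. \<exists>x. norm x \<le> M \<and> crad V x < inverse (real (Suc n))" by (auto simp: not_le)
    from choice[OF this] obtain X where X: "\<forall>n. norm (X n) \<le> M \<and> crad V (X n) < inverse (real (Suc n))" by (rule exE)
    have "seq_compact (cball (0::real^'n) M)" by (simp add: compact_imp_seq_compact)
    moreover have "\<forall>n. X n \<in> cball 0 M" using X by simp
    ultimately obtain x \<sigma> where x: "strict_mono \<sigma>" "(X \<circ> \<sigma>) \<longlonglongrightarrow> x"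
      unfolding seq_compact_def by blast
    have "shell TYPE('n) p C * crad V x > 0" using shell_bounds(1)[OF pC, where 'n = 'n] crad_pos[OF rh np] by simp
    then obtain N where N: "\<And>n. n \<ge> N \<Longrightarrow> dist ((X \<circ> \<sigma>) n) x < shell TYPE('n) p C * crad V x"
      using x(2) unfolding LIMSEQ_def by blast
    have le: "crad V x \<le> \<Gamma> * inverse (real (Suc n))" if "n \<ge> N" for n
    proof -
      have "crad V x \<le> \<Gamma> * crad V ((X \<circ> \<sigma>) n)"
        using G(2)[OF rh, of x "(X \<circ> \<sigma>) n"] N[OF that] by (simp add: dist_commute)
      also have "crad V ((X \<circ> \<sigma>) n) \<le> inverse (real (Suc (\<sigma> n)))" using X by (simp add: less_imp_le)
      also have "\<dots> \<le> inverse (real (Suc n))" using seq_suble[OF x(1), of n] by (intro le_imp_inverse_le) auto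
      finally show ?thesis using G(1) by simp
    qed
    have "(\<lambda>n. \<Gamma> * inverse (real (Suc n))) \<longlonglongrightarrow> \<Gamma> * 0" by (intro tendsto_intros LIMSEQ_inverse_real_of_nat)
    then have "crad V x \<le> \<Gamma> * 0" by (rule LIMSEQ_le_const) (use le in blast)
    then show False using crad_pos[OF rh np, of x] by simp
  qed
  then obtain n where "\<forall>x. norm x \<le> M \<longrightarrow> crad V x \<ge> inverse (real (Suc n))" by blast
  then show ?thesis using that[of "inverse (real (Suc n))"] by simp
qed

section \<open>The Fefferman--Phong inequality\<close>

text \<open>Cauchy-Schwarz on [0, 1], again as nonnegativity of the variance of g' about its
  mean.\<close>

lemma square_increment_le:
  fixes g g' :: "real \<Rightarrow> real"
  assumes d: "\<And>t. (g has_real_derivative g' t) (at t)" and c: "continuous_on UNIV g'"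
  shows "ennreal ((g 1 - g 0)\<^sup>2) \<le> (\<integral>\<^sup>+t. ennreal ((g' t)\<^sup>2) * indicator {0..1} t \<partial>lborel)"
proof -
  have ic: "isCont g' t" for t using c by (simp add: continuous_on_eq_continuous_at)
  have i1: "has_bochner_integral lborel (\<lambda>t. g' t * indicator {0..1} t) (g 1 - g 0)"
    by (rule has_bochner_integral_FTC_Icc_real) (use d ic in auto)
  define a where "a = g 1 - g 0"
  have i2: "set_integrable lborel {0..1} (\<lambda>t. (g' t)\<^sup>2)"
    unfolding set_integrable_def by (rule borel_integrable_compact) (use c in \<open>auto intro!: continuous_intros intro: continuous_on_subset\<close>)
  have i2': "integrable lborel (\<lambda>t. (g' t)\<^sup>2 * indicator {0..1} t)"
    using i2 by (simp add: set_integrable_def mult.commute)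
  have i3: "integrable lborel (indicator {0..1} :: real \<Rightarrow> real)" by (rule integrable_real_indicator) auto
  have ih: "integrable lborel (\<lambda>t. g' t * indicator {0..1} t)" "(LINT t|lborel. g' t * indicator {0..1} t) = a"
    using i1 by (auto simp: has_bochner_integral_iff a_def)
  have "0 \<le> (LINT t|lborel. (g' t - a)\<^sup>2 * indicator {0..1} t)"
    by (rule Bochner_Integration.integral_nonneg) (simp add: indicator_def)
  also have "(\<lambda>t. (g' t - a)\<^sup>2 * indicator {0..1} t)
      = (\<lambda>t. (g' t)\<^sup>2 * indicator {0..1} t - (2 * a) * (g' t * indicator {0..1} t) + a\<^sup>2 * indicator {0..1} t)"
    by (auto simp: power2_eq_square algebra_simps)
  also have "(LINT t|lborel. \<dots> t) = (LINT t|lborel. (g' t)\<^sup>2 * indicator {0..1} t) - (2 * a) * a + a\<^sup>2"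
    using ih i2' i3 by simp
  finally have "a\<^sup>2 \<le> (LINT t|lborel. (g' t)\<^sup>2 * indicator {0..1} t)" by (simp add: power2_eq_square)
  then have "ennreal (a\<^sup>2) \<le> ennreal (LINT t|lborel. (g' t)\<^sup>2 * indicator {0..1} t)" by (rule ennreal_leI)
  also have "\<dots> = (\<integral>\<^sup>+t. ennreal ((g' t)\<^sup>2 * indicator {0..1} t) \<partial>lborel)"
    by (rule nn_integral_eq_integral[symmetric, OF i2']) simp
  also have "\<dots> = (\<integral>\<^sup>+t. ennreal ((g' t)\<^sup>2) * indicator {0..1} t \<partial>lborel)"
    by (intro nn_integral_cong) (simp add: indicator_def)
  finally show ?thesis by (simp add: a_def)
qed

text \<open>The gradient is kept under an integral along the segment instead of being bounded by a
  supremum, so that Tonelli can integrate it over all segments.\<close>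

lemma smooth_segment_increment:
  fixes f :: "real^'n \<Rightarrow> real"
  assumes s: "smooth f"
  shows "ennreal ((f (x + h) - f x)\<^sup>2) \<le> ennreal ((norm h)\<^sup>2) * (\<integral>\<^sup>+t. ennreal ((norm (grad f (x + t *\<^sub>R h)))\<^sup>2) * indicator {0..1} t \<partial>lborel)"
proof -
  have [measurable]: "grad f \<in> borel_measurable borel" by (rule smooth_grad_borel[OF s])
  have d: "((\<lambda>t. f (x + t *\<^sub>R h)) has_real_derivative grad f (x + t *\<^sub>R h) \<bullet> h) (at t)" for t
  proof -
    have "((\<lambda>t. x + t *\<^sub>R h) has_derivative (\<lambda>u. u *\<^sub>R h)) (at t)" by (auto intro!: derivative_eq_intros)
    from has_derivative_compose[OF this smooth_has_derivative[OF s]]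
    have "((\<lambda>t. f (x + t *\<^sub>R h)) has_derivative (\<lambda>u. grad f (x + t *\<^sub>R h) \<bullet> (u *\<^sub>R h))) (at t)" .
    then show ?thesis by (simp add: has_field_derivative_def mult_commute_abs)
  qed
  have c: "continuous_on UNIV (\<lambda>t. grad f (x + t *\<^sub>R h) \<bullet> h)"
    by (intro continuous_on_inner continuous_on_compose2[OF smooth_continuous_grad[OF s, of UNIV]] continuous_intros) auto
  have "ennreal ((f (x + h) - f x)\<^sup>2) \<le> (\<integral>\<^sup>+t. ennreal ((grad f (x + t *\<^sub>R h) \<bullet> h)\<^sup>2) * indicator {0..1} t \<partial>lborel)"
    using square_increment_le[OF d c] by simp
  also have "\<dots> \<le> (\<integral>\<^sup>+t. ennreal ((norm h)\<^sup>2) * (ennreal ((norm (grad f (x + t *\<^sub>R h)))\<^sup>2) * indicator {0..1} t) \<partial>lborel)"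
  proof (rule nn_integral_mono)
    fix t :: real
    have "\<bar>grad f (x + t *\<^sub>R h) \<bullet> h\<bar> \<le> norm h * norm (grad f (x + t *\<^sub>R h))"
      using Cauchy_Schwarz_ineq2[of "grad f (x + t *\<^sub>R h)" h] by (simp add: mult.commute)
    then have "\<bar>grad f (x + t *\<^sub>R h) \<bullet> h\<bar>\<^sup>2 \<le> (norm h * norm (grad f (x + t *\<^sub>R h)))\<^sup>2" by (rule power_mono) simp
    then have "ennreal ((grad f (x + t *\<^sub>R h) \<bullet> h)\<^sup>2) \<le> ennreal ((norm h)\<^sup>2) * ennreal ((norm (grad f (x + t *\<^sub>R h)))\<^sup>2)"
      by (subst ennreal_mult'[symmetric]) (auto simp: power_mult_distrib intro: ennreal_leI)
    then show "ennreal ((grad f (x + t *\<^sub>R h) \<bullet> h)\<^sup>2) * indicator {0..1} t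
        \<le> ennreal ((norm h)\<^sup>2) * (ennreal ((norm (grad f (x + t *\<^sub>R h)))\<^sup>2) * indicator {0..1} t)"
      by (simp add: indicator_def)
  qed
  also have "\<dots> = ennreal ((norm h)\<^sup>2) * (\<integral>\<^sup>+t. ennreal ((norm (grad f (x + t *\<^sub>R h)))\<^sup>2) * indicator {0..1} t \<partial>lborel)"
    by (rule nn_integral_cmult) measurable
  finally show ?thesis .
qed

lemma emeasure_ball_power:
  fixes x :: "real^'n"
  assumes "r \<ge> 0"
  shows "emeasure lborel (ball x r) = ennreal (r ^ CARD('n) * measure lborel (ball (0::real^'n) 1))"
  using emeasure_lborel_ball_finite[of x r] measure_ball_eq[OF assms, of x]
  by (subst emeasure_eq_ennreal_measure) auto

text \<open>The radius is taken at x while q is evaluated at z = x + s h. Slow variation exchanges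
  r(x) for r(z), once in the weight and once in the ball, each at the cost of \<Gamma>^n; then
  Tonelli integrates h for fixed z. Writing the ball through the sign of c r(x) - |h| makes joint
  measurability a matter of composition.\<close>

lemma crad_averaging:
  fixes V :: "real^'n \<Rightarrow> real" and q :: "real^'n \<Rightarrow> ennreal"
  assumes rh: "rh_weight p C V" and np: "real CARD('n) \<le> 2 * p" and G: "\<Gamma> \<ge> 1"
    and sv: "\<And>x z. dist x z \<le> shell TYPE('n) p C * crad V x \<Longrightarrow> crad V z \<le> \<Gamma> * crad V x \<and> crad V x \<le> \<Gamma> * crad V z"
    and q[measurable]: "q \<in> borel_measurable borel" and s: "0 \<le> s" "s \<le> 1"
  shows "(\<integral>\<^sup>+x. \<integral>\<^sup>+h. ennreal (1 / crad V x ^ CARD('n)) * indicator {0<..} (shell TYPE('n) p C * crad V x - norm h) * q (x + s *\<^sub>R h) \<partial>lborel \<partial>lborel)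
    \<le> ennreal (\<Gamma> ^ CARD('n) * \<Gamma> ^ CARD('n) * measure lborel (ball (0::real^'n) 1)) * (\<integral>\<^sup>+z. q z \<partial>lborel)"
proof -
  define c where "c = shell TYPE('n) p C"
  define w where "w = measure lborel (ball (0::real^'n) 1)"
  have c: "0 < c" "c < 1" using shell_bounds[OF rh_p[OF rh] rh_C[OF rh], where 'n = 'n] by (auto simp: c_def)
  have w: "w > 0" unfolding w_def by (rule measure_unit_ball_pos)
  have [measurable]: "crad V \<in> borel_measurable borel" by (rule crad_borel[OF rh np])
  note rp = crad_pos[OF rh np]
  \<comment> \<open>The majorant has every radius taken at z; the enlarged ball |h| < \<Gamma> r(z)
    contains all h that occurred.\<close>
  define \<Phi> where "\<Phi> = (\<lambda>(h::real^'n) (z::real^'n). ennreal (\<Gamma> ^ CARD('n) / crad V z ^ CARD('n)) * indicator {0<..} (\<Gamma> * crad V z - norm h) * q z)"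
  have le: "ennreal (1 / crad V x ^ CARD('n)) * indicator {0<..} (c * crad V x - norm h) * q (x + s *\<^sub>R h) \<le> \<Phi> h (x + s *\<^sub>R h)" for x h
  proof (cases "norm h < c * crad V x")
    case True
    have "norm (s *\<^sub>R h) \<le> norm h" using s by (simp add: mult_left_le_one_le)
    then have "dist x (x + s *\<^sub>R h) \<le> c * crad V x" using True by (simp add: dist_norm)
    then have sv1: "crad V (x + s *\<^sub>R h) \<le> \<Gamma> * crad V x" "crad V x \<le> \<Gamma> * crad V (x + s *\<^sub>R h)"
      using sv by (auto simp: c_def)
    have "c * crad V x \<le> 1 * crad V x" using c rp[of x] by (intro mult_right_mono) auto
    then have h: "norm h < \<Gamma> * crad V (x + s *\<^sub>R h)" using True sv1 by linarith
    have "crad V (x + s *\<^sub>R h) ^ CARD('n) \<le> (\<Gamma> * crad V x) ^ CARD('n)"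
      using sv1 rp[of "x + s *\<^sub>R h"] by (intro power_mono) auto
    then have "1 / crad V x ^ CARD('n) \<le> \<Gamma> ^ CARD('n) / crad V (x + s *\<^sub>R h) ^ CARD('n)"
      using rp[of x] rp[of "x + s *\<^sub>R h"] by (simp add: field_simps power_mult_distrib)
    then show ?thesis using True h unfolding \<Phi>_def by (auto intro!: mult_right_mono ennreal_leI)
  qed (simp add: \<Phi>_def)
  have [measurable]: "case_prod \<Phi> \<in> borel_measurable (lborel \<Otimes>\<^sub>M lborel)" unfolding \<Phi>_def by measurable
  have "(\<integral>\<^sup>+x. \<integral>\<^sup>+h. ennreal (1 / crad V x ^ CARD('n)) * indicator {0<..} (c * crad V x - norm h) * q (x + s *\<^sub>R h) \<partial>lborel \<partial>lborel)
     \<le> (\<integral>\<^sup>+x. \<integral>\<^sup>+h. \<Phi> h (x + s *\<^sub>R h) \<partial>lborel \<partial>lborel)"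
    by (intro nn_integral_mono le)
  also have "\<dots> = (\<integral>\<^sup>+h. \<integral>\<^sup>+x. \<Phi> h (x + s *\<^sub>R h) \<partial>lborel \<partial>lborel)"
    by (rule lborel_pair.Fubini') (unfold \<Phi>_def, measurable)
  also have "\<dots> = (\<integral>\<^sup>+h. \<integral>\<^sup>+z. \<Phi> h z \<partial>lborel \<partial>lborel)"
  proof (rule nn_integral_cong)
    fix h :: "real^'n"
    have m: "\<Phi> h \<in> borel_measurable borel" unfolding \<Phi>_def by measurable
    show "(\<integral>\<^sup>+x. \<Phi> h (x + s *\<^sub>R h) \<partial>lborel) = (\<integral>\<^sup>+z. \<Phi> h z \<partial>lborel)" by (rule nn_integral_shift[OF m])
  qed
  also have "\<dots> = (\<integral>\<^sup>+z. \<integral>\<^sup>+h. \<Phi> h z \<partial>lborel \<partial>lborel)"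
    by (rule lborel_pair.Fubini'[symmetric]) (unfold \<Phi>_def, measurable)
  also have "\<dots> = (\<integral>\<^sup>+z. ennreal (\<Gamma> ^ CARD('n) * \<Gamma> ^ CARD('n) * w) * q z \<partial>lborel)"
  proof (rule nn_integral_cong)
    fix z
    have "(\<integral>\<^sup>+h. \<Phi> h z \<partial>lborel) = (\<integral>\<^sup>+h. (ennreal (\<Gamma> ^ CARD('n) / crad V z ^ CARD('n)) * q z) * indicator (ball (0::real^'n) (\<Gamma> * crad V z)) h \<partial>lborel)"
      unfolding \<Phi>_def by (intro nn_integral_cong) (auto simp: indicator_def)
    also have "\<dots> = (ennreal (\<Gamma> ^ CARD('n) / crad V z ^ CARD('n)) * q z) * ennreal ((\<Gamma> * crad V z) ^ CARD('n) * w)"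
      using G rp[of z] unfolding w_def by (subst nn_integral_cmult_indicator) (auto simp: emeasure_ball_power)
    also have "\<dots> = ennreal (\<Gamma> ^ CARD('n) / crad V z ^ CARD('n) * ((\<Gamma> * crad V z) ^ CARD('n) * w)) * q z"
      using G rp[of z] w by (subst ennreal_mult) (auto simp: mult_ac)
    also have "\<Gamma> ^ CARD('n) / crad V z ^ CARD('n) * ((\<Gamma> * crad V z) ^ CARD('n) * w) = \<Gamma> ^ CARD('n) * \<Gamma> ^ CARD('n) * w"
      using rp[of z] by (simp add: power_mult_distrib)
    finally show "(\<integral>\<^sup>+h. \<Phi> h z \<partial>lborel) = ennreal (\<Gamma> ^ CARD('n) * \<Gamma> ^ CARD('n) * w) * q z" .
  qed
  also have "\<dots> = ennreal (\<Gamma> ^ CARD('n) * \<Gamma> ^ CARD('n) * w) * (\<integral>\<^sup>+z. q z \<partial>lborel)"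
    by (rule nn_integral_cmult) measurable
  finally show ?thesis by (simp add: c_def w_def)
qed

lemma truncated_mass_pointwise:
  fixes a b v k :: real
  assumes "v \<ge> 0" "k \<ge> 0"
  shows "a\<^sup>2 * min v k \<le> 2 * k * (b - a)\<^sup>2 + 2 * (v * b\<^sup>2)"
proof -
  have "a\<^sup>2 \<le> 2 * (b - a)\<^sup>2 + 2 * b\<^sup>2"
    using square_add_le[of "a - b" b] by (simp add: power2_commute)
  then have "a\<^sup>2 * min v k \<le> (2 * (b - a)\<^sup>2 + 2 * b\<^sup>2) * min v k" using assms by (intro mult_right_mono) auto
  also have "\<dots> = 2 * (b - a)\<^sup>2 * min v k + 2 * b\<^sup>2 * min v k" by (simp add: algebra_simps)
  also have "\<dots> \<le> 2 * (b - a)\<^sup>2 * k + 2 * b\<^sup>2 * v" using assms by (intro add_mono mult_left_mono) auto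
  finally show ?thesis by (simp add: mult_ac)
qed

text \<open>With \<open>r\<close> the critical radius at \<open>x\<close>, the pointwise bound
\<open>f(x)\<^sup>2 min(V(y), k r^(-2)) \<le> 2 k r^(-2) (f(y) - f(x))\<^sup>2 + 2 V(y) f(y)\<^sup>2\<close> is averaged over \<open>y\<close> in a slightly shrunk
critical ball; the left side then dominates \<open>f(x)\<^sup>2 / r\<^sup>2\<close>.\<close>

lemma fefferman_phong:
  fixes p C :: real
  assumes pC: "p > 1" "C \<ge> 1" and np: "real CARD('n::finite) \<le> 2 * p"
  obtains K where "K \<ge> 1" "\<And>V f. rh_weight p C (V :: real^'n \<Rightarrow> real) \<Longrightarrow> test_function f \<Longrightarrow>
    (\<integral>\<^sup>+x. ennreal ((f x)\<^sup>2 / (crad V x)\<^sup>2) \<partial>lborel)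
      \<le> ennreal K * ((\<integral>\<^sup>+x. ennreal ((norm (grad f x))\<^sup>2) \<partial>lborel) + (\<integral>\<^sup>+x. ennreal (V x * (f x)\<^sup>2) \<partial>lborel))"
proof -
  obtain \<Gamma> where G: "\<Gamma> \<ge> 1" and sv: "\<And>V x z. rh_weight p C (V :: real^'n \<Rightarrow> real) \<Longrightarrow> dist x z \<le> shell TYPE('n) p C * crad V x \<Longrightarrow>
       crad V z \<le> \<Gamma> * crad V x \<and> crad V x \<le> \<Gamma> * crad V z"
    using crad_slow_variation[OF pC np] by blast
  define w where "w = measure lborel (ball (0::real^'n) 1)"
  have w: "w > 0" unfolding w_def by (rule measure_unit_ball_pos)
  define c where "c = shell TYPE('n) p C"
  have c: "0 < c" "c < 1" using shell_bounds[OF pC, where 'n = 'n] by (auto simp: c_def)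
  define K where "K = 2 / rh_kappa p C"
  have K: "K > 1" using rh_constants[OF pC] by (simp add: K_def field_simps)
  define A where "A = \<Gamma> ^ CARD('n) * \<Gamma> ^ CARD('n)"
  have A: "A \<ge> 1"
  proof -
    have "\<Gamma> ^ CARD('n) \<ge> 1" using G by (rule one_le_power)
    then show ?thesis unfolding A_def using mult_mono[of 1 "\<Gamma> ^ CARD('n)" 1 "\<Gamma> ^ CARD('n)"] by simp
  qed
  have main: "(\<integral>\<^sup>+x. ennreal ((f x)\<^sup>2 / (crad V x)\<^sup>2) \<partial>lborel)
      \<le> ennreal (4 * K * A) * ((\<integral>\<^sup>+x. ennreal ((norm (grad f x))\<^sup>2) \<partial>lborel) + (\<integral>\<^sup>+x. ennreal (V x * (f x)\<^sup>2) \<partial>lborel))"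
    if rh: "rh_weight p C V" and tf: "test_function f" for V f :: "real^'n \<Rightarrow> real"
  proof -
    note s = test_function_smooth[OF tf]
    have [measurable]: "f \<in> borel_measurable borel" "grad f \<in> borel_measurable borel" "V \<in> borel_measurable borel" "crad V \<in> borel_measurable borel"
      by (rule smooth_borel[OF s] smooth_grad_borel[OF s] rh_borel[OF rh] crad_borel[OF rh np])+
    define r where "r = crad V"
    have [measurable]: "r \<in> borel_measurable borel" unfolding r_def by (rule crad_borel[OF rh np])
    have r: "r x > 0" for x unfolding r_def by (rule crad_pos[OF rh np])
    \<comment> \<open>The factor r(x)^(-n) turns integration over the ball of radius c r(x) into an
      average, up to constants.\<close>
    define J where "J = (\<lambda>(x::real^'n) (h::real^'n). ennreal (1 / r x ^ CARD('n)) * indicator {0<..} (c * r x - norm h))"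
    have Jm: "case_prod J \<in> borel_measurable (lborel \<Otimes>\<^sub>M lborel)" unfolding J_def by measurable
    define g where "g = (\<lambda>z. ennreal ((norm (grad f z))\<^sup>2))"
    define q where "q = (\<lambda>z. ennreal (V z * (f z)\<^sup>2))"
    have [measurable]: "g \<in> borel_measurable borel" "q \<in> borel_measurable borel" unfolding g_def q_def by measurable
    have av: "(\<integral>\<^sup>+x. \<integral>\<^sup>+h. J x h * Q (x + t *\<^sub>R h) \<partial>lborel \<partial>lborel) \<le> ennreal (A * w) * (\<integral>\<^sup>+z. Q z \<partial>lborel)"
      if "Q \<in> borel_measurable borel" "0 \<le> t" "t \<le> 1" for Q t
      using crad_averaging[OF rh np G sv[OF rh] that] by (simp add: J_def r_def c_def w_def A_def)
    have claim1: "ennreal (w / 2 * ((f x)\<^sup>2 / (r x)\<^sup>2))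
       \<le> (\<integral>\<^sup>+h. J x h * ennreal ((f x)\<^sup>2 * min (V (x + h)) (K / (r x)\<^sup>2)) \<partial>lborel)" for x
    proof -
      define m where "m = (\<lambda>y. min (V y) (K / (r x)\<^sup>2))"
      have m0: "m y \<ge> 0" for y using rh_nonneg[OF rh] K by (simp add: m_def)
      have [measurable]: "m \<in> borel_measurable borel" unfolding m_def by measurable
      have tm: "w * r x ^ CARD('n) / (2 * (r x)\<^sup>2) \<le> (LINT y:ball x (c * r x)|lborel. m y)"
        using crad_truncated_mass[OF rh np, of x] r[of x] measure_ball_eq[of "r x" x]
        by (simp add: m_def r_def c_def w_def K_def mult.commute)
      have mi: "set_integrable lborel (ball x (c * r x)) m"
      proof (rule set_integrable_bound[OF rh_integrable[OF rh]])
        show "set_borel_measurable lborel (ball x (c * r x)) m"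
          unfolding set_borel_measurable_def by (intro borel_measurable_scaleR borel_measurable_indicator) auto
        show "AE y in lborel. y \<in> ball x (c * r x) \<longrightarrow> norm (m y) \<le> norm (V y)"
          using m0 rh_nonneg[OF rh] by (intro AE_I2) (auto simp: m_def)
      qed
      have "ennreal (w * r x ^ CARD('n) / (2 * (r x)\<^sup>2)) \<le> ennreal (LINT y|lborel. indicator (ball x (c * r x)) y *\<^sub>R m y)"
        using tm unfolding set_lebesgue_integral_def by (rule ennreal_leI)
      also have "\<dots> = (\<integral>\<^sup>+y. ennreal (indicator (ball x (c * r x)) y *\<^sub>R m y) \<partial>lborel)"
        using mi m0 unfolding set_integrable_def by (intro nn_integral_eq_integral[symmetric]) (auto simp: indicator_def)
      also have "\<dots> = (\<integral>\<^sup>+h. ennreal (indicator (ball x (c * r x)) (h + x) *\<^sub>R m (h + x)) \<partial>lborel)"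
        by (rule nn_integral_shift[where f = "\<lambda>y. ennreal (indicator (ball x (c * r x)) y *\<^sub>R m y)", symmetric])
          (intro measurable_compose[OF _ measurable_ennreal] borel_measurable_scaleR borel_measurable_indicator, auto)
      also have "\<dots> = (\<integral>\<^sup>+h. indicator {0<..} (c * r x - norm h) * ennreal (m (x + h)) \<partial>lborel)"
        by (intro nn_integral_cong) (auto simp: indicator_def dist_norm add.commute)
      finally have 1: "ennreal (w * r x ^ CARD('n) / (2 * (r x)\<^sup>2)) \<le> (\<integral>\<^sup>+h. indicator {0<..} (c * r x - norm h) * ennreal (m (x + h)) \<partial>lborel)" .
      have "ennreal (w / 2 * ((f x)\<^sup>2 / (r x)\<^sup>2)) = ennreal ((f x)\<^sup>2 / r x ^ CARD('n)) * ennreal (w * r x ^ CARD('n) / (2 * (r x)\<^sup>2))"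
        using r[of x] w by (subst ennreal_mult[symmetric]) (auto simp: field_simps)
      also have "\<dots> \<le> ennreal ((f x)\<^sup>2 / r x ^ CARD('n)) * (\<integral>\<^sup>+h. indicator {0<..} (c * r x - norm h) * ennreal (m (x + h)) \<partial>lborel)"
        using 1 by (rule mult_left_mono) simp
      also have "\<dots> = (\<integral>\<^sup>+h. ennreal ((f x)\<^sup>2 / r x ^ CARD('n)) * (indicator {0<..} (c * r x - norm h) * ennreal (m (x + h))) \<partial>lborel)"
        by (rule nn_integral_cmult[symmetric]) measurable
      also have "\<dots> = (\<integral>\<^sup>+h. J x h * ennreal ((f x)\<^sup>2 * m (x + h)) \<partial>lborel)"
      proof (rule nn_integral_cong)
        fix h
        have "ennreal ((f x)\<^sup>2 / r x ^ CARD('n)) * ennreal (m (x + h)) = ennreal (1 / r x ^ CARD('n)) * ennreal ((f x)\<^sup>2 * m (x + h))"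
          using r[of x] m0 by (simp add: ennreal_mult[symmetric] field_simps)
        then show "ennreal ((f x)\<^sup>2 / r x ^ CARD('n)) * (indicator {0<..} (c * r x - norm h) * ennreal (m (x + h))) = J x h * ennreal ((f x)\<^sup>2 * m (x + h))"
          unfolding J_def by (auto simp: indicator_def)
      qed
      finally show ?thesis unfolding m_def .
    qed
    \<comment> \<open>The squared increment f(x + h) - f(x) carries K / r^2 and is bounded by |h|^2
      times a gradient integral; |h| < r cancels the radius.\<close>
    have claim2: "J x h * ennreal ((f x)\<^sup>2 * min (V (x + h)) (K / (r x)\<^sup>2))
       \<le> ennreal (2 * K) * (\<integral>\<^sup>+t. J x h * g (x + t *\<^sub>R h) * indicator {0..1} t \<partial>lborel) + 2 * (J x h * q (x + 1 *\<^sub>R h))" for x h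
    proof (cases "norm h < c * r x")
      case True
      have "c * r x \<le> 1 * r x" using c r[of x] by (intro mult_right_mono) auto
      then have hr: "norm h \<le> r x" using True by simp
      have I: "ennreal ((f (x + h) - f x)\<^sup>2) \<le> ennreal ((r x)\<^sup>2) * (\<integral>\<^sup>+t. g (x + t *\<^sub>R h) * indicator {0..1} t \<partial>lborel)"
      proof -
        have "ennreal ((norm h)\<^sup>2) \<le> ennreal ((r x)\<^sup>2)" using hr by (intro ennreal_leI power_mono) auto
        then show ?thesis using smooth_segment_increment[OF s, of x h] unfolding g_def
          by (elim order_trans) (intro mult_right_mono, auto)
      qed
      have "ennreal ((f x)\<^sup>2 * min (V (x + h)) (K / (r x)\<^sup>2)) \<le> ennreal (2 * (K / (r x)\<^sup>2) * (f (x + h) - f x)\<^sup>2 + 2 * (V (x + h) * (f (x + h))\<^sup>2))"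
        using rh_nonneg[OF rh] K by (intro ennreal_leI truncated_mass_pointwise) auto
      also have "\<dots> = ennreal (2 * (K / (r x)\<^sup>2)) * ennreal ((f (x + h) - f x)\<^sup>2) + 2 * q (x + h)"
      proof -
        have "ennreal (2 * (K / (r x)\<^sup>2) * (f (x + h) - f x)\<^sup>2) = ennreal (2 * (K / (r x)\<^sup>2)) * ennreal ((f (x + h) - f x)\<^sup>2)"
          using K by (intro ennreal_mult) auto
        moreover have "ennreal (2 * (V (x + h) * (f (x + h))\<^sup>2)) = ennreal 2 * q (x + h)"
          unfolding q_def using rh_nonneg[OF rh, of "x + h"] by (intro ennreal_mult) auto
        moreover have "ennreal (2 * (K / (r x)\<^sup>2) * (f (x + h) - f x)\<^sup>2 + 2 * (V (x + h) * (f (x + h))\<^sup>2))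
            = ennreal (2 * (K / (r x)\<^sup>2) * (f (x + h) - f x)\<^sup>2) + ennreal (2 * (V (x + h) * (f (x + h))\<^sup>2))"
          using rh_nonneg[OF rh, of "x + h"] K by (intro ennreal_plus) auto
        ultimately show ?thesis by simp
      qed
      also have "\<dots> \<le> ennreal (2 * (K / (r x)\<^sup>2)) * (ennreal ((r x)\<^sup>2) * (\<integral>\<^sup>+t. g (x + t *\<^sub>R h) * indicator {0..1} t \<partial>lborel)) + 2 * q (x + h)"
        using I by (intro add_mono mult_left_mono) auto
      also have "ennreal (2 * (K / (r x)\<^sup>2)) * (ennreal ((r x)\<^sup>2) * (\<integral>\<^sup>+t. g (x + t *\<^sub>R h) * indicator {0..1} t \<partial>lborel))
          = ennreal (2 * K) * (\<integral>\<^sup>+t. g (x + t *\<^sub>R h) * indicator {0..1} t \<partial>lborel)"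
      proof -
        have "ennreal (2 * (K / (r x)\<^sup>2)) * ennreal ((r x)\<^sup>2) = ennreal (2 * K)"
          using r[of x] K by (subst ennreal_mult[symmetric]) auto
        then show ?thesis by (simp add: mult.assoc[symmetric])
      qed
      finally have "J x h * ennreal ((f x)\<^sup>2 * min (V (x + h)) (K / (r x)\<^sup>2))
        \<le> J x h * (ennreal (2 * K) * (\<integral>\<^sup>+t. g (x + t *\<^sub>R h) * indicator {0..1} t \<partial>lborel) + 2 * q (x + h))"
        by (rule mult_left_mono) simp
      also have "\<dots> = ennreal (2 * K) * (J x h * (\<integral>\<^sup>+t. g (x + t *\<^sub>R h) * indicator {0..1} t \<partial>lborel)) + 2 * (J x h * q (x + 1 *\<^sub>R h))"
        by (simp add: distrib_left mult.left_commute)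
      also have "J x h * (\<integral>\<^sup>+t. g (x + t *\<^sub>R h) * indicator {0..1} t \<partial>lborel) = (\<integral>\<^sup>+t. J x h * (g (x + t *\<^sub>R h) * indicator {0..1} t) \<partial>lborel)"
        by (rule nn_integral_cmult[symmetric]) measurable
      finally show ?thesis by (simp add: mult.assoc)
    qed (simp add: J_def)
    have "ennreal (w / 2) * (\<integral>\<^sup>+x. ennreal ((f x)\<^sup>2 / (r x)\<^sup>2) \<partial>lborel) = (\<integral>\<^sup>+x. ennreal (w / 2) * ennreal ((f x)\<^sup>2 / (r x)\<^sup>2) \<partial>lborel)"
      by (rule nn_integral_cmult[symmetric]) measurable
    also have "\<dots> \<le> (\<integral>\<^sup>+x. \<integral>\<^sup>+h. J x h * ennreal ((f x)\<^sup>2 * min (V (x + h)) (K / (r x)\<^sup>2)) \<partial>lborel \<partial>lborel)"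
      using claim1 w by (intro nn_integral_mono) (simp add: ennreal_mult'[symmetric])
    also have "\<dots> \<le> (\<integral>\<^sup>+x. \<integral>\<^sup>+h. ennreal (2 * K) * (\<integral>\<^sup>+t. J x h * g (x + t *\<^sub>R h) * indicator {0..1} t \<partial>lborel) + 2 * (J x h * q (x + 1 *\<^sub>R h)) \<partial>lborel \<partial>lborel)"
      by (intro nn_integral_mono claim2)
    also have "\<dots> = ennreal (2 * K) * (\<integral>\<^sup>+x. \<integral>\<^sup>+h. \<integral>\<^sup>+t. J x h * g (x + t *\<^sub>R h) * indicator {0..1} t \<partial>lborel \<partial>lborel \<partial>lborel)
        + 2 * (\<integral>\<^sup>+x. \<integral>\<^sup>+h. J x h * q (x + 1 *\<^sub>R h) \<partial>lborel \<partial>lborel)"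
      unfolding J_def by (simp add: nn_integral_add nn_integral_cmult)
    also have "(\<integral>\<^sup>+x. \<integral>\<^sup>+h. \<integral>\<^sup>+t. J x h * g (x + t *\<^sub>R h) * indicator {0..1} t \<partial>lborel \<partial>lborel \<partial>lborel)
      = (\<integral>\<^sup>+x. \<integral>\<^sup>+t. \<integral>\<^sup>+h. J x h * g (x + t *\<^sub>R h) * indicator {0..1} t \<partial>lborel \<partial>lborel \<partial>lborel)"
      unfolding J_def by (intro nn_integral_cong lborel_pair.Fubini') measurable
    \<comment> \<open>With the segment parameter t outermost, the averaging bound applies at each
      fixed t in [0, 1], with a constant independent of t.\<close>
    also have "\<dots> = (\<integral>\<^sup>+t. \<integral>\<^sup>+x. \<integral>\<^sup>+h. J x h * g (x + t *\<^sub>R h) * indicator {0..1} t \<partial>lborel \<partial>lborel \<partial>lborel)"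
      unfolding J_def by (rule lborel_pair.Fubini') measurable
    also have "\<dots> \<le> (\<integral>\<^sup>+t. ennreal (A * w) * (\<integral>\<^sup>+z. g z \<partial>lborel) * indicator {0..1} t \<partial>(lborel :: real measure))"
    proof (rule nn_integral_mono)
      fix t :: real
      show "(\<integral>\<^sup>+x. \<integral>\<^sup>+h. J x h * g (x + t *\<^sub>R h) * indicator {0..1} t \<partial>lborel \<partial>lborel) \<le> ennreal (A * w) * (\<integral>\<^sup>+z. g z \<partial>lborel) * indicator {0..1} t"
        using av[of g t] by (cases "t \<in> {0..1}") auto
    qed
    also have "\<dots> = ennreal (A * w) * (\<integral>\<^sup>+z. g z \<partial>lborel)"
      by (subst nn_integral_cmult_indicator) auto
    also have "(\<integral>\<^sup>+x. \<integral>\<^sup>+h. J x h * q (x + 1 *\<^sub>R h) \<partial>lborel \<partial>lborel) \<le> ennreal (A * w) * (\<integral>\<^sup>+z. q z \<partial>lborel)"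
      by (rule av) auto
    finally have "ennreal (w / 2) * (\<integral>\<^sup>+x. ennreal ((f x)\<^sup>2 / (r x)\<^sup>2) \<partial>lborel)
       \<le> ennreal (2 * K) * (ennreal (A * w) * (\<integral>\<^sup>+z. g z \<partial>lborel)) + 2 * (ennreal (A * w) * (\<integral>\<^sup>+z. q z \<partial>lborel))"
      by (simp add: mult_left_mono add_mono)
    \<comment> \<open>The factor 2 of the potential term is enlarged to 2K, as K > 1, so that both
      terms share the constant 4 K A after division by w/2.\<close>
    also have "\<dots> \<le> ennreal (2 * K) * (ennreal (A * w) * (\<integral>\<^sup>+z. g z \<partial>lborel)) + ennreal (2 * K) * (ennreal (A * w) * (\<integral>\<^sup>+z. q z \<partial>lborel))"
    proof (intro add_mono mult_right_mono order_refl)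
      have "ennreal 2 \<le> ennreal (2 * K)" using K by (intro ennreal_leI) simp
      then show "2 \<le> ennreal (2 * K)" by simp
    qed simp_all
    also have "\<dots> = ennreal (w / 2) * (ennreal (4 * K * A) * ((\<integral>\<^sup>+z. g z \<partial>lborel) + (\<integral>\<^sup>+z. q z \<partial>lborel)))"
    proof -
      have e: "ennreal (2 * K) * (ennreal (A * w) * X) = ennreal (w / 2) * (ennreal (4 * K * A) * X)" for X
      proof -
        have "ennreal (2 * K) * ennreal (A * w) = ennreal (w / 2) * ennreal (4 * K * A)"
          using K A w by (simp add: ennreal_mult[symmetric] mult_ac)
        then show ?thesis by (simp add: mult.assoc[symmetric])
      qed
      show ?thesis unfolding e by (simp add: distrib_left)
    qed
    finally have "ennreal (2 / w) * (ennreal (w / 2) * (\<integral>\<^sup>+x. ennreal ((f x)\<^sup>2 / (r x)\<^sup>2) \<partial>lborel))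
       \<le> ennreal (2 / w) * (ennreal (w / 2) * (ennreal (4 * K * A) * ((\<integral>\<^sup>+z. g z \<partial>lborel) + (\<integral>\<^sup>+z. q z \<partial>lborel))))"
      by (rule mult_left_mono) simp
    moreover have "ennreal (2 / w) * (ennreal (w / 2) * X) = X" for X
    proof -
      have "ennreal (2 / w) * ennreal (w / 2) = 1" using w by (simp add: ennreal_mult[symmetric])
      then show ?thesis by (simp add: mult.assoc[symmetric])
    qed
    ultimately show ?thesis by (simp add: r_def g_def q_def)
  qed
  have "4 * K * A \<ge> 1" using K A mult_mono[of 1 "4 * K" 1 A] by simp
  then show ?thesis using that main by blast
qed

section \<open>The trace inequality\<close>

text \<open>The growth estimate amounts to an unspecified positive power of the radius ratio. If L^2
  \<beta>^k < 1, the ratio t^k makes psi decay at least like t^2.\<close>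

lemma psi_power_decay:
  fixes V :: "real^'n \<Rightarrow> real"
  assumes rh: "rh_weight p C V" and np: "real CARD('n) \<le> 2 * p"
  obtains k B where "k \<ge> 1" "B > 0"
    "\<And>z t R. 0 < t \<Longrightarrow> t \<le> 1 \<Longrightarrow> R > 0 \<Longrightarrow> psi V z (R * t ^ k) \<le> B * t\<^sup>2 * psi V z R"
proof -
  note pC = rh_p[OF rh] rh_C[OF rh]
  define \<beta> where "\<beta> = gbeta p C"
  define L where "L = rh_L p C"
  have b: "0 < \<beta>" "\<beta> < 1" using gbeta[OF rh np] by (auto simp: \<beta>_def)
  have L: "L \<ge> 4" using rh_constants[OF pC] by (simp add: L_def)
  have L2: "L\<^sup>2 > 0" using L by simp
  obtain k where k: "L\<^sup>2 * \<beta> ^ k < 1" using exists_power_small[OF less_imp_le[OF b(1)] b(2) L2] by blast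
  have "L * L \<ge> 4 * 4" using L by (intro mult_mono) auto
  then have k1: "k \<ge> 1" using k by (cases k) (auto simp: power2_eq_square)
  have bk: "\<beta> ^ k \<le> 1 / L\<^sup>2" using k L2 by (simp add: field_simps)
  have "psi V z (R * t ^ k) \<le> 2 * C / \<beta> * t\<^sup>2 * psi V z R" if t: "0 < t" "t \<le> 1" and R: "R > 0" for z t R
  proof -
    have tk: "t ^ k > 0" "t ^ k \<le> 1" using t by (auto simp: power_le_one)
    obtain i0 where "1 / t ^ k < L ^ i0" using real_arch_pow[of L "1 / t ^ k"] L by auto
    then have ex: "\<exists>i. 1 < t ^ k * L ^ i" using tk by (intro exI[of _ i0]) (simp add: field_simps)
    \<comment> \<open>The first number of steps with L^i > t^(-k); one step fewer still fits between
      the radii R t^k and R.\<close>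
    define i where "i = (LEAST i. 1 < t ^ k * L ^ i)"
    have i: "1 < t ^ k * L ^ i" unfolding i_def by (rule LeastI_ex[OF ex])
    have "i \<noteq> 0" using i tk by (intro notI) simp
    then obtain j where j: "i = Suc j" using not0_implies_Suc by blast
    have "\<not> 1 < t ^ k * L ^ j" using not_less_Least[of j "\<lambda>i. 1 < t ^ k * L ^ i"] j by (simp add: i_def)
    then have tj: "R * t ^ k * L ^ j \<le> R" using R by (simp add: mult.assoc)
    have g: "psi V z (R * t ^ k) \<le> 2 * C * \<beta> ^ j * psi V z R"
      unfolding \<beta>_def by (rule growth[OF rh np]) (use R tk tj in \<open>auto simp: L_def\<close>)
    \<comment> \<open>With i = j + 1, the bound \<beta>^i < t^2 follows by comparing k-th powers:
      \<beta>^(k i) \<le> L^(-2i) < t^(2k). The missing step costs the factor 1/\<beta>.\<close>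
    have "(\<beta> ^ Suc j) ^ k = (\<beta> ^ k) ^ Suc j" by (simp only: power_mult[symmetric] mult.commute)
    also have "\<dots> \<le> (1 / L\<^sup>2) ^ Suc j" using bk b by (intro power_mono) auto
    also have "\<dots> = (1 / L ^ Suc j)\<^sup>2" by (simp add: power_divide power_mult_distrib flip: power_mult) (simp add: mult.commute power_mult)
    also have "\<dots> < (t ^ k)\<^sup>2" using i L tk by (intro power_strict_mono) (auto simp: j field_simps)
    also have "\<dots> = (t\<^sup>2) ^ k" by (simp only: power_mult[symmetric] mult.commute)
    finally have "\<beta> ^ Suc j < t\<^sup>2" by (rule power_less_imp_less_base) simp
    then have "\<beta> ^ j \<le> t\<^sup>2 / \<beta>" using b by (simp add: field_simps)
    then have "2 * C * \<beta> ^ j * psi V z R \<le> 2 * C * (t\<^sup>2 / \<beta>) * psi V z R"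
      using pC psi_pos[OF rh R, of z] by (intro mult_right_mono mult_left_mono) auto
    then show ?thesis using g by (simp add: field_simps)
  qed
  moreover have "2 * C / \<beta> > 0" using pC b by simp
  ultimately show ?thesis using that k1 by blast
qed

text \<open>The substitution y = z - \<sigma> h has Jacobian \<sigma>^n and sends |h| < 2 to the
  ball of radius 2 \<sigma>.\<close>

lemma nn_integral_scaled_ball:
  fixes V :: "real^'n \<Rightarrow> real"
  assumes rh: "rh_weight p C V" and \<sigma>: "\<sigma> > 0"
  shows "(\<integral>\<^sup>+h. ennreal (V (z - \<sigma> *\<^sub>R h)) * indicator {..<2} (norm h) \<partial>lborel) = ennreal ((LINT y:ball z (2 * \<sigma>)|lborel. V y) / \<sigma> ^ CARD('n))"
proof -
  have [measurable]: "V \<in> borel_measurable borel" by (rule rh_borel[OF rh])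
  define F where "F = (\<lambda>y. ennreal (indicator (ball z (2 * \<sigma>)) y *\<^sub>R V y))"
  have Fm: "F \<in> borel_measurable borel" unfolding F_def
    by (intro measurable_compose[OF _ measurable_ennreal] borel_measurable_scaleR borel_measurable_indicator) auto
  have "ennreal (LINT y:ball z (2 * \<sigma>)|lborel. V y) = (\<integral>\<^sup>+y. F y \<partial>lborel)"
    unfolding set_lebesgue_integral_def F_def
    by (rule nn_integral_eq_integral[symmetric])
      (use rh_integrable[OF rh, of z "2 * \<sigma>"] rh_nonneg[OF rh] in \<open>auto simp: set_integrable_def indicator_def\<close>)
  also have "\<dots> = (\<integral>\<^sup>+y. F y \<partial>density (distr lborel borel (\<lambda>h. z + (- \<sigma>) *\<^sub>R h)) (\<lambda>_. ennreal (\<bar>- \<sigma>\<bar> ^ DIM(real^'n))))"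
    using \<sigma> by (subst lborel_affine[of "- \<sigma>" z]) auto
  also have "\<dots> = (\<integral>\<^sup>+h. ennreal (\<sigma> ^ CARD('n)) * F (z + (- \<sigma>) *\<^sub>R h) \<partial>lborel)"
    using \<sigma> Fm by (subst nn_integral_density) (auto simp: nn_integral_distr)
  also have "\<dots> = ennreal (\<sigma> ^ CARD('n)) * (\<integral>\<^sup>+h. F (z + (- \<sigma>) *\<^sub>R h) \<partial>lborel)"
    using Fm by (intro nn_integral_cmult) auto
  also have "(\<integral>\<^sup>+h. F (z + (- \<sigma>) *\<^sub>R h) \<partial>lborel) = (\<integral>\<^sup>+h. ennreal (V (z - \<sigma> *\<^sub>R h)) * indicator {..<2} (norm h) \<partial>lborel)"
    using \<sigma> by (intro nn_integral_cong) (auto simp: F_def indicator_def dist_norm)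
  finally have "ennreal (1 / \<sigma> ^ CARD('n)) * ennreal (LINT y:ball z (2 * \<sigma>)|lborel. V y)
    = ennreal (1 / \<sigma> ^ CARD('n)) * ennreal (\<sigma> ^ CARD('n)) * (\<integral>\<^sup>+h. ennreal (V (z - \<sigma> *\<^sub>R h)) * indicator {..<2} (norm h) \<partial>lborel)"
    by (simp add: mult.assoc)
  moreover have "ennreal (1 / \<sigma> ^ CARD('n)) * ennreal (\<sigma> ^ CARD('n)) = 1" using \<sigma> by (simp add: ennreal_mult[symmetric])
  moreover have "0 \<le> (LINT y:ball z (2 * \<sigma>)|lborel. V y)"
    unfolding set_lebesgue_integral_def using rh_nonneg[OF rh] by (intro Bochner_Integration.integral_nonneg) (simp add: indicator_def)
  ultimately show ?thesis using \<sigma> by (simp add: ennreal_mult[symmetric])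
qed

text \<open>The path \<open>y + t\<^sup>k T h\<close> turns the decay of \<open>psi\<close> at an unknown positive rate into
quadratic decay in \<open>t\<close>.\<close>

lemma power_path_increment:
  fixes f :: "real^'n \<Rightarrow> real"
  assumes s: "smooth f" and k: "k \<ge> 1" and T: "T > 0"
  shows "ennreal ((f (y + T *\<^sub>R h) - f y)\<^sup>2) \<le> (\<integral>\<^sup>+t. ennreal ((real k * T * norm h)\<^sup>2) *
    (ennreal ((t ^ (k - 1))\<^sup>2) * indicator {0..1} t * ennreal ((norm (grad f (y + (t ^ k * T) *\<^sub>R h)))\<^sup>2)) \<partial>lborel)"
proof -
  define g' where "g' = (\<lambda>t. real k * t ^ (k - 1) * (T * (grad f (y + (t ^ k * T) *\<^sub>R h) \<bullet> h)))"
  have d: "((\<lambda>t. f (y + (t ^ k * T) *\<^sub>R h)) has_real_derivative g' t) (at t)" for t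
  proof -
    have "((\<lambda>t. t ^ k * T) has_real_derivative (real k * t ^ (k - 1) * T)) (at t)"
      using k by (auto intro!: derivative_eq_intros)
    then have "((\<lambda>t. t ^ k * T) has_derivative (\<lambda>u. (real k * t ^ (k - 1) * T) * u)) (at t)" by (simp add: has_field_derivative_def)
    then have "((\<lambda>t. y + (t ^ k * T) *\<^sub>R h) has_derivative (\<lambda>u. ((real k * t ^ (k - 1) * T) * u) *\<^sub>R h)) (at t)"
      by (auto intro!: derivative_eq_intros)
    from has_derivative_compose[OF this smooth_has_derivative[OF s]]
    have "((\<lambda>t. f (y + (t ^ k * T) *\<^sub>R h)) has_derivative (\<lambda>u. grad f (y + (t ^ k * T) *\<^sub>R h) \<bullet> (((real k * t ^ (k - 1) * T) * u) *\<^sub>R h))) (at t)" .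
    then show ?thesis unfolding has_field_derivative_def
      by (rule has_derivative_eq_rhs) (auto simp: g'_def mult_ac)
  qed
  have c: "continuous_on UNIV g'"
    unfolding g'_def
    by (intro continuous_on_mult continuous_on_inner continuous_on_compose2[OF smooth_continuous_grad[OF s, of UNIV]] continuous_intros) auto
  have "ennreal ((f (y + T *\<^sub>R h) - f y)\<^sup>2) \<le> (\<integral>\<^sup>+t. ennreal ((g' t)\<^sup>2) * indicator {0..1} t \<partial>lborel)"
    using square_increment_le[OF d c] k by (simp add: zero_power)
  also have "\<dots> \<le> (\<integral>\<^sup>+t. ennreal ((real k * T * norm h)\<^sup>2) *
    (ennreal ((t ^ (k - 1))\<^sup>2) * indicator {0..1} t * ennreal ((norm (grad f (y + (t ^ k * T) *\<^sub>R h)))\<^sup>2)) \<partial>lborel)"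
  proof (rule nn_integral_mono)
    fix t :: real
    let ?G = "grad f (y + (t ^ k * T) *\<^sub>R h)"
    have "(?G \<bullet> h)\<^sup>2 \<le> (norm ?G * norm h)\<^sup>2"
      using Cauchy_Schwarz_ineq2[of ?G h] by (metis abs_le_square_iff abs_mult abs_norm_cancel)
    then have "(real k * t ^ (k - 1) * T)\<^sup>2 * (?G \<bullet> h)\<^sup>2 \<le> (real k * t ^ (k - 1) * T)\<^sup>2 * (norm ?G * norm h)\<^sup>2"
      by (rule mult_left_mono) simp
    then have "(g' t)\<^sup>2 \<le> (real k * T * norm h)\<^sup>2 * ((t ^ (k - 1))\<^sup>2 * (norm ?G)\<^sup>2)"
      by (simp add: g'_def power_mult_distrib mult_ac)
    then have "ennreal ((g' t)\<^sup>2) \<le> ennreal ((real k * T * norm h)\<^sup>2) * (ennreal ((t ^ (k - 1))\<^sup>2) * ennreal ((norm ?G)\<^sup>2))"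
      by (simp add: ennreal_mult[symmetric] ennreal_leI)
    then show "ennreal ((g' t)\<^sup>2) * indicator {0..1} t \<le> ennreal ((real k * T * norm h)\<^sup>2) *
        (ennreal ((t ^ (k - 1))\<^sup>2) * indicator {0..1} t * ennreal ((norm ?G)\<^sup>2))"
      by (simp add: indicator_def)
  qed
  finally show ?thesis .
qed

text \<open>This makes \<open>V u\<^sup>2\<close> locally integrable for \<open>u\<close> in \<open>H\<^sup>1\<close>; otherwise the integral in
\<open>weak_solution\<close> could be the junk value \<open>0\<close>.\<close>

lemma trace_inequality:
  fixes V :: "real^'n \<Rightarrow> real"
  assumes rh: "rh_weight p C V" and np: "real CARD('n) \<le> 2 * p" and M: "M > 0"
  obtains K where "K \<ge> 0" "\<And>f. test_function f \<Longrightarrow> (\<And>x. norm x \<ge> M \<Longrightarrow> f x = 0) \<Longrightarrow> (\<And>x. norm x \<ge> M \<Longrightarrow> grad f x = 0) \<Longrightarrow>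
    (\<integral>\<^sup>+x. ennreal (V x * (f x)\<^sup>2) \<partial>lborel) \<le> ennreal K * (\<integral>\<^sup>+x. ennreal ((norm (grad f x))\<^sup>2) \<partial>lborel)"
proof -
  define w where "w = measure lborel (ball (0::real^'n) 1)"
  have w: "w > 0" unfolding w_def by (rule measure_unit_ball_pos)
  obtain k B where k: "k \<ge> 1" and B: "B > 0"
    and dec: "\<And>z t R. 0 < t \<Longrightarrow> t \<le> 1 \<Longrightarrow> R > 0 \<Longrightarrow> psi V z (R * t ^ k) \<le> B * t\<^sup>2 * psi V z R"
    using psi_power_decay[OF rh np] by blast
  \<comment> \<open>For |y| < M and |h| \<ge> 1 the endpoint y + T h lies where f vanishes, so f(y)
    is a pure increment. The radius R = 2T makes room for all |h| < 2.\<close>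
  define T where "T = 2 * M"
  define R where "R = 2 * T"
  have T: "T > 0" and R: "R > 0" using M by (auto simp: T_def R_def)
  define P where "P = R\<^sup>2 * (LINT y:ball 0 (M + R)|lborel. V y) / (R ^ CARD('n) * w)"
  note psi_eq' = psi_eq[OF rh np, folded w_def]
  have I0: "0 \<le> (LINT y:ball a s|lborel. V y)" for a s
    unfolding set_lebesgue_integral_def using rh_nonneg[OF rh] by (intro Bochner_Integration.integral_nonneg) (simp add: indicator_def)
  have P: "psi V z R \<le> P" if z: "norm z \<le> M" for z
  proof -
    have "ball z R \<subseteq> ball 0 (M + R)"
    proof
      fix y assume "y \<in> ball z R"
      then show "y \<in> ball 0 (M + R)" using norm_triangle_sub[of y z] z by (simp add: dist_norm norm_minus_commute)
    qed
    then have "(LINT y:ball z R|lborel. V y) \<le> (LINT y:ball 0 (M + R)|lborel. V y)"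
      by (rule set_integral_subset_mono[OF rh_integrable[OF rh] rh_nonneg[OF rh]]) simp
    then show ?thesis unfolding P_def psi_eq'[OF R] using R w by (intro divide_right_mono mult_left_mono) auto
  qed
  have P0: "P \<ge> 0" unfolding P_def using R w I0 by (intro divide_nonneg_pos mult_nonneg_nonneg) auto
  define Q where "Q = 2 ^ CARD('n) * w * (B * P) / (4 * T\<^sup>2)"
  have Q0: "Q \<ge> 0" using P0 B w by (simp add: Q_def)
  define N where "N = (real k * T * 2)\<^sup>2"
  have N0: "N \<ge> 0" by (simp add: N_def)
  \<comment> \<open>The powers of t cancel: t^(2k-2) from the speed of the path, t^(-2k) from
    dividing by \<sigma>^2, and t^2 from the decay of psi.\<close>
  have inner: "(t ^ (k - 1))\<^sup>2 * ((LINT y:ball z (2 * (t ^ k * T))|lborel. V y) / (t ^ k * T) ^ CARD('n)) \<le> Q"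
    if z: "norm z \<le> M" and t: "0 < t" "t \<le> 1" for z t
  proof -
    define \<sigma> where "\<sigma> = t ^ k * T"
    have s: "\<sigma> > 0" using t T by (simp add: \<sigma>_def)
    have "psi V z (2 * \<sigma>) \<le> B * t\<^sup>2 * psi V z R"
      using dec[OF t R, of z] by (simp add: \<sigma>_def R_def mult_ac)
    also have "\<dots> \<le> B * t\<^sup>2 * P" using P[OF z] B by (intro mult_left_mono) auto
    finally have ps: "psi V z (2 * \<sigma>) \<le> B * t\<^sup>2 * P" .
    have I: "(LINT y:ball z (2 * \<sigma>)|lborel. V y) / \<sigma> ^ CARD('n) = 2 ^ CARD('n) * w * psi V z (2 * \<sigma>) / (4 * \<sigma>\<^sup>2)"
      using psi_eq'[of "2 * \<sigma>" z] s w by (simp add: power_mult_distrib field_simps)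
    have tk: "t ^ k = t * t ^ (k - 1)" using k by (metis power_eq_if not_one_le_zero)
    have "(t ^ (k - 1))\<^sup>2 * (2 ^ CARD('n) * w * psi V z (2 * \<sigma>) / (4 * \<sigma>\<^sup>2)) = 2 ^ CARD('n) * w * psi V z (2 * \<sigma>) / (4 * T\<^sup>2 * t\<^sup>2)"
      using t T unfolding \<sigma>_def tk by (simp add: power_mult_distrib field_simps)
    also have "\<dots> \<le> 2 ^ CARD('n) * w * (B * t\<^sup>2 * P) / (4 * T\<^sup>2 * t\<^sup>2)"
      using ps w by (intro divide_right_mono mult_left_mono) auto
    also have "\<dots> = Q" using t by (simp add: Q_def)
    finally show ?thesis using I by (simp add: \<sigma>_def)
  qed
  have main: "(\<integral>\<^sup>+x. ennreal (V x * (f x)\<^sup>2) \<partial>lborel) \<le> ennreal (N * Q / w) * (\<integral>\<^sup>+x. ennreal ((norm (grad f x))\<^sup>2) \<partial>lborel)"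
    if tf: "test_function f" and z: "\<And>x. norm x \<ge> M \<Longrightarrow> f x = 0" "\<And>x. norm x \<ge> M \<Longrightarrow> grad f x = 0" for f :: "real^'n \<Rightarrow> real"
  proof -
    note s = test_function_smooth[OF tf]
    define G where "G = (\<lambda>z. ennreal ((norm (grad f z))\<^sup>2))"
    have [measurable]: "f \<in> borel_measurable borel" "grad f \<in> borel_measurable borel" "V \<in> borel_measurable borel"
      by (rule smooth_borel[OF s] smooth_grad_borel[OF s] rh_borel[OF rh])+
    have [measurable]: "G \<in> borel_measurable borel" unfolding G_def by measurable
    \<comment> \<open>The increment is averaged over all h in an annulus, whose volume (2^n - 1) w
      is at least w even for n = 1.\<close>
    define A where "A = {h::real^'n. 1 \<le> norm h \<and> norm h < 2}"
    have Am[measurable]: "A \<in> sets borel" unfolding A_def by measurable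
    have A_eq: "A = ball 0 2 - ball 0 1" by (auto simp: A_def)
    have "measure lborel A = measure lborel (ball (0::real^'n) 2) - measure lborel (ball (0::real^'n) 1)"
      unfolding A_eq by (rule measure_Diff) (use emeasure_lborel_ball_finite[of "0::real^'n" 2] in \<open>auto intro: subset_ball\<close>)
    also have "\<dots> = (2 ^ CARD('n) - 1) * w"
      unfolding w_def by (subst measure_ball_eq[of 2]) (auto simp: algebra_simps)
    also have "\<dots> \<ge> 1 * w"
    proof (rule mult_right_mono)
      have "(2::real) ^ 1 \<le> 2 ^ CARD('n)" by (intro power_increasing) (auto simp: Suc_leI)
      then show "1 \<le> (2::real) ^ CARD('n) - 1" by simp
    qed (use w in simp)
    finally have mA: "w \<le> measure lborel A" by simp
    have eA: "ennreal w \<le> emeasure lborel A"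
      using mA measure_bounded_finite[of A 0 2] by (subst emeasure_eq_ennreal_measure) (auto simp: A_eq intro: ennreal_leI)
    define \<Phi> where "\<Phi> = (\<lambda>(t::real) (h::real^'n) (y::real^'n). ennreal ((t ^ (k - 1))\<^sup>2) * indicator {0..1} t * indicator {..<2} (norm h)
       * (ennreal (V y) * G (y + (t ^ k * T) *\<^sub>R h)))"
    have pt: "ennreal (V y * (f y)\<^sup>2) * indicator A h \<le> ennreal N * (\<integral>\<^sup>+t. \<Phi> t h y \<partial>lborel)" for y h
    proof (cases "h \<in> A \<and> norm y < M")
      case True
      then have h: "1 \<le> norm h" "norm h < 2" by (auto simp: A_def)
      have "T * 1 \<le> T * norm h" using h T by (intro mult_left_mono) auto
      also have "\<dots> = norm (T *\<^sub>R h)" using T by simp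
      also have "\<dots> \<le> norm (y + T *\<^sub>R h) + norm y" using norm_triangle_ineq4[of "y + T *\<^sub>R h" y] by simp
      finally have "norm (y + T *\<^sub>R h) \<ge> M" using True by (simp add: T_def)
      then have "f (y + T *\<^sub>R h) = 0" by (rule z)
      then have "ennreal ((f y)\<^sup>2) \<le> (\<integral>\<^sup>+t. ennreal ((real k * T * norm h)\<^sup>2) *
        (ennreal ((t ^ (k - 1))\<^sup>2) * indicator {0..1} t * G (y + (t ^ k * T) *\<^sub>R h)) \<partial>lborel)"
        using power_path_increment[OF s k T, of y h] by (simp add: G_def)
      also have "\<dots> \<le> (\<integral>\<^sup>+t. ennreal N * (ennreal ((t ^ (k - 1))\<^sup>2) * indicator {0..1} t * G (y + (t ^ k * T) *\<^sub>R h)) \<partial>lborel)"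
      proof (intro nn_integral_mono mult_right_mono ennreal_leI)
        show "(real k * T * norm h)\<^sup>2 \<le> N" unfolding N_def using h T by (intro power_mono mult_left_mono) auto
      qed simp
      finally have 1: "ennreal ((f y)\<^sup>2) \<le> (\<integral>\<^sup>+t. ennreal N * (ennreal ((t ^ (k - 1))\<^sup>2) * indicator {0..1} t * G (y + (t ^ k * T) *\<^sub>R h)) \<partial>lborel)" .
      have "ennreal (V y * (f y)\<^sup>2) = ennreal (V y) * ennreal ((f y)\<^sup>2)" using rh_nonneg[OF rh, of y] by (intro ennreal_mult) auto
      also have "\<dots> \<le> ennreal (V y) * (\<integral>\<^sup>+t. ennreal N * (ennreal ((t ^ (k - 1))\<^sup>2) * indicator {0..1} t * G (y + (t ^ k * T) *\<^sub>R h)) \<partial>lborel)"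
        using 1 by (rule mult_left_mono) simp
      also have "\<dots> = (\<integral>\<^sup>+t. ennreal (V y) * (ennreal N * (ennreal ((t ^ (k - 1))\<^sup>2) * indicator {0..1} t * G (y + (t ^ k * T) *\<^sub>R h))) \<partial>lborel)"
        by (rule nn_integral_cmult[symmetric]) measurable
      also have "\<dots> = (\<integral>\<^sup>+t. ennreal N * \<Phi> t h y \<partial>lborel)"
        using h by (intro nn_integral_cong) (simp add: \<Phi>_def mult_ac)
      also have "\<dots> = ennreal N * (\<integral>\<^sup>+t. \<Phi> t h y \<partial>lborel)"
        unfolding \<Phi>_def by (rule nn_integral_cmult) measurable
      finally show ?thesis using True by simp
    next
      case False
      then have "ennreal (V y * (f y)\<^sup>2) * indicator A h = 0" using z(1)[of y] by (cases "h \<in> A") auto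
      show ?thesis unfolding \<open>ennreal (V y * (f y)\<^sup>2) * indicator A h = 0\<close> by (rule zero_le)
    qed
    have "ennreal w * (\<integral>\<^sup>+y. ennreal (V y * (f y)\<^sup>2) \<partial>lborel) \<le> emeasure lborel A * (\<integral>\<^sup>+y. ennreal (V y * (f y)\<^sup>2) \<partial>lborel)"
      using eA by (rule mult_right_mono) simp
    also have "\<dots> = (\<integral>\<^sup>+y. emeasure lborel A * ennreal (V y * (f y)\<^sup>2) \<partial>lborel)"
      by (rule nn_integral_cmult[symmetric]) measurable
    also have "\<dots> = (\<integral>\<^sup>+y. \<integral>\<^sup>+h. ennreal (V y * (f y)\<^sup>2) * indicator A h \<partial>lborel \<partial>lborel)"
      using Am by (intro nn_integral_cong, subst nn_integral_cmult_indicator) (auto simp: mult.commute)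
    also have "\<dots> \<le> (\<integral>\<^sup>+y. \<integral>\<^sup>+h. ennreal N * (\<integral>\<^sup>+t. \<Phi> t h y \<partial>lborel) \<partial>lborel \<partial>lborel)"
      by (intro nn_integral_mono pt)
    also have "\<dots> = ennreal N * (\<integral>\<^sup>+y. \<integral>\<^sup>+h. \<integral>\<^sup>+t. \<Phi> t h y \<partial>lborel \<partial>lborel \<partial>lborel)"
      unfolding \<Phi>_def by (simp add: nn_integral_cmult)
    also have "(\<integral>\<^sup>+y. \<integral>\<^sup>+h. \<integral>\<^sup>+t. \<Phi> t h y \<partial>lborel \<partial>lborel \<partial>lborel) = (\<integral>\<^sup>+y. \<integral>\<^sup>+t. \<integral>\<^sup>+h. \<Phi> t h y \<partial>lborel \<partial>lborel \<partial>lborel)"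
      unfolding \<Phi>_def by (intro nn_integral_cong lborel_pair.Fubini') measurable
    also have "\<dots> = (\<integral>\<^sup>+t. \<integral>\<^sup>+y. \<integral>\<^sup>+h. \<Phi> t h y \<partial>lborel \<partial>lborel \<partial>lborel)"
      unfolding \<Phi>_def by (rule lborel_pair.Fubini') measurable
    also have "\<dots> \<le> (\<integral>\<^sup>+t. (ennreal Q * (\<integral>\<^sup>+z. G z \<partial>lborel)) * indicator {0..1} t \<partial>(lborel :: real measure))"
    proof (rule nn_integral_mono_AE)
      \<comment> \<open>At t = 0 the scale \<sigma> = t^k T degenerates; a single parameter value is
        negligible.\<close>
      have "AE t in (lborel :: real measure). t \<noteq> 0" by (rule AE_lborel_singleton)
      then show "AE t in (lborel :: real measure). (\<integral>\<^sup>+y. \<integral>\<^sup>+h. \<Phi> t h y \<partial>lborel \<partial>lborel) \<le> (ennreal Q * (\<integral>\<^sup>+z. G z \<partial>lborel)) * indicator {0..1} t"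
      proof eventually_elim
        case (elim t)
        show ?case
        proof (cases "t \<in> {0..1}")
          case False
          then show ?thesis by (simp add: \<Phi>_def)
        next
          case True
          then have t: "0 < t" "t \<le> 1" using elim by auto
          define \<sigma> where "\<sigma> = t ^ k * T"
          have sg: "\<sigma> > 0" using t T by (simp add: \<sigma>_def)
          define a where "a = ennreal ((t ^ (k - 1))\<^sup>2)"
          define \<Psi> where "\<Psi> = (\<lambda>(h::real^'n) (y::real^'n). a * indicator {..<2} (norm h) * (ennreal (V y) * G (y + \<sigma> *\<^sub>R h)))"
          have "(\<integral>\<^sup>+y. \<integral>\<^sup>+h. \<Phi> t h y \<partial>lborel \<partial>lborel) = (\<integral>\<^sup>+y. \<integral>\<^sup>+h. \<Psi> h y \<partial>lborel \<partial>lborel)"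
            using True by (simp add: \<Phi>_def \<Psi>_def a_def \<sigma>_def)
          also have "\<dots> = (\<integral>\<^sup>+h. \<integral>\<^sup>+y. \<Psi> h y \<partial>lborel \<partial>lborel)"
            unfolding \<Psi>_def by (rule lborel_pair.Fubini') measurable
          \<comment> \<open>The substitution z = y + \<sigma> h puts the gradient at a point free of
            h and leaves V to be integrated over a ball around z.\<close>
          also have "\<dots> = (\<integral>\<^sup>+h. \<integral>\<^sup>+z. \<Psi> h (z + (- (\<sigma> *\<^sub>R h))) \<partial>lborel \<partial>lborel)"
          proof (rule nn_integral_cong)
            fix h :: "real^'n"
            have m: "\<Psi> h \<in> borel_measurable borel" unfolding \<Psi>_def by measurable
            show "(\<integral>\<^sup>+y. \<Psi> h y \<partial>lborel) = (\<integral>\<^sup>+z. \<Psi> h (z + (- (\<sigma> *\<^sub>R h))) \<partial>lborel)" by (rule nn_integral_shift[OF m, symmetric])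
          qed
          also have "\<dots> = (\<integral>\<^sup>+h. \<integral>\<^sup>+z. (a * G z) * (ennreal (V (z - \<sigma> *\<^sub>R h)) * indicator {..<2} (norm h)) \<partial>lborel \<partial>lborel)"
            by (simp add: \<Psi>_def mult_ac)
          also have "\<dots> = (\<integral>\<^sup>+z. \<integral>\<^sup>+h. (a * G z) * (ennreal (V (z - \<sigma> *\<^sub>R h)) * indicator {..<2} (norm h)) \<partial>lborel \<partial>lborel)"
            by (rule lborel_pair.Fubini') measurable
          also have "\<dots> \<le> (\<integral>\<^sup>+z. ennreal Q * G z \<partial>lborel)"
          proof (rule nn_integral_mono)
            fix z' :: "real^'n"
            show "(\<integral>\<^sup>+h. (a * G z') * (ennreal (V (z' - \<sigma> *\<^sub>R h)) * indicator {..<2} (norm h)) \<partial>lborel) \<le> ennreal Q * G z'"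
            proof (cases "norm z' \<ge> M")
              case True
              then show ?thesis using z(2)[OF True] by (simp add: G_def)
            next
              case False
              have "(\<integral>\<^sup>+h. (a * G z') * (ennreal (V (z' - \<sigma> *\<^sub>R h)) * indicator {..<2} (norm h)) \<partial>lborel)
                = (a * G z') * (\<integral>\<^sup>+h. ennreal (V (z' - \<sigma> *\<^sub>R h)) * indicator {..<2} (norm h) \<partial>lborel)"
                by (rule nn_integral_cmult) measurable
              also have "\<dots> = (a * ennreal ((LINT y:ball z' (2 * \<sigma>)|lborel. V y) / \<sigma> ^ CARD('n))) * G z'"
                unfolding nn_integral_scaled_ball[OF rh sg] by (simp add: mult_ac)
              also have "a * ennreal ((LINT y:ball z' (2 * \<sigma>)|lborel. V y) / \<sigma> ^ CARD('n)) \<le> ennreal Q"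
                unfolding a_def using inner[of z' t] t False I0[of z' "2 * \<sigma>"] sg
                by (subst ennreal_mult[symmetric]) (auto simp: \<sigma>_def intro: ennreal_leI)
              finally show ?thesis by (simp add: mult_right_mono)
            qed
          qed
          also have "\<dots> = ennreal Q * (\<integral>\<^sup>+z. G z \<partial>lborel)" by (rule nn_integral_cmult) measurable
          finally show ?thesis using True by simp
        qed
      qed
    qed
    also have "\<dots> = ennreal Q * (\<integral>\<^sup>+z. G z \<partial>lborel)" by (subst nn_integral_cmult_indicator) auto
    finally have fin: "ennreal w * (\<integral>\<^sup>+y. ennreal (V y * (f y)\<^sup>2) \<partial>lborel) \<le> ennreal N * (ennreal Q * (\<integral>\<^sup>+z. G z \<partial>lborel))"
      by (simp add: mult_left_mono)
    have "(\<integral>\<^sup>+y. ennreal (V y * (f y)\<^sup>2) \<partial>lborel) = ennreal (1 / w) * (ennreal w * (\<integral>\<^sup>+y. ennreal (V y * (f y)\<^sup>2) \<partial>lborel))"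
    proof -
      have "ennreal (1 / w) * ennreal w = 1" using w by (simp add: ennreal_mult[symmetric])
      then show ?thesis by (simp add: mult.assoc[symmetric])
    qed
    also have "\<dots> \<le> ennreal (1 / w) * (ennreal N * (ennreal Q * (\<integral>\<^sup>+z. G z \<partial>lborel)))"
      using fin by (rule mult_left_mono) simp
    also have "\<dots> = ennreal (N * Q / w) * (\<integral>\<^sup>+z. G z \<partial>lborel)"
    proof -
      have "ennreal (1 / w) * ennreal N * ennreal Q = ennreal (N * Q / w)"
        using w N0 Q0 by (simp add: ennreal_mult[symmetric])
      then show ?thesis by (simp add: mult.assoc[symmetric])
    qed
    finally show ?thesis by (simp add: G_def)
  qed
  have "N * Q / w \<ge> 0" using N0 Q0 w by simp
  then show ?thesis using that main by blast
qed

section \<open>Absolutely continuous paths\<close>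

lemma division_interval:
  fixes \<D> :: "real set set"
  assumes "\<D> division_of S" "I \<in> \<D>"
  shows "Inf I \<in> I" "Inf I \<le> Sup I" "Sup I \<in> I" "interior I = {Inf I<..<Sup I}"
proof -
  obtain a b where "I = cbox a b" using division_ofD(4)[OF assms] by blast
  then have I: "I = {a..b}" by simp
  have "I \<noteq> {}" using division_ofD(3)[OF assms] .
  then have "a \<le> b" using I by simp
  then show "Inf I \<in> I" "Inf I \<le> Sup I" "Sup I \<in> I" "interior I = {Inf I<..<Sup I}"
    unfolding I by simp_all
qed

lemma abs_continuous_lipschitz:
  fixes f :: "real \<Rightarrow> 'a::euclidean_space"
  assumes K: "K \<ge> 0" and lip: "\<And>s t. s \<in> {a..b} \<Longrightarrow> t \<in> {a..b} \<Longrightarrow> s \<le> t \<Longrightarrow> norm (f t - f s) \<le> K * (t - s)"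
  shows "abs_continuous_on_interval a b f"
  unfolding abs_continuous_on_interval_def
proof (intro allI impI)
  fix e :: real assume e: "e > 0"
  show "\<exists>d>0. \<forall>\<D>. \<D> division_of \<Union>\<D> \<and> \<Union>\<D> \<subseteq> {a..b} \<and> (\<Sum>I\<in>\<D>. Sup I - Inf I) < d \<longrightarrow>
        (\<Sum>I\<in>\<D>. norm (f (Sup I) - f (Inf I))) < e"
  proof (intro exI conjI allI impI)
    show "e / (K + 1) > 0" using e K by simp
    fix \<D> assume D: "\<D> division_of \<Union>\<D> \<and> \<Union>\<D> \<subseteq> {a..b} \<and> (\<Sum>I\<in>\<D>. Sup I - Inf I) < e / (K + 1)"
    have "(\<Sum>I\<in>\<D>. norm (f (Sup I) - f (Inf I))) \<le> (\<Sum>I\<in>\<D>. K * (Sup I - Inf I))"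
    proof (rule sum_mono)
      fix I assume I: "I \<in> \<D>"
      note i = division_interval[OF conjunct1[OF D] I]
      have "I \<subseteq> {a..b}" using I D by blast
      moreover have "Inf I \<in> I" "Sup I \<in> I" by (rule i)+
      ultimately have "Inf I \<in> {a..b}" "Sup I \<in> {a..b}" by blast+
      then show "norm (f (Sup I) - f (Inf I)) \<le> K * (Sup I - Inf I)" using i(2) by (intro lip)
    qed
    also have "\<dots> = K * (\<Sum>I\<in>\<D>. Sup I - Inf I)" by (simp add: sum_distrib_left)
    also have "\<dots> \<le> K * (e / (K + 1))" using D K by (intro mult_left_mono) auto
    also have "\<dots> < e" using e K by (simp add: field_simps)
    finally show "(\<Sum>I\<in>\<D>. norm (f (Sup I) - f (Inf I))) < e" .
  qed
qed

lemma abs_continuous_add: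
  fixes f g :: "real \<Rightarrow> 'a::euclidean_space"
  assumes f: "abs_continuous_on_interval a b f" and g: "abs_continuous_on_interval a b g"
  shows "abs_continuous_on_interval a b (\<lambda>t. f t + g t)"
  unfolding abs_continuous_on_interval_def
proof (intro allI impI)
  fix e :: real assume e: "e > 0"
  then have e2: "e / 2 > 0" by simp
  obtain d1 where d1: "d1 > 0" "\<forall>\<D>. \<D> division_of \<Union>\<D> \<and> \<Union>\<D> \<subseteq> {a..b} \<and> (\<Sum>I\<in>\<D>. Sup I - Inf I) < d1 \<longrightarrow>
        (\<Sum>I\<in>\<D>. norm (f (Sup I) - f (Inf I))) < e / 2"
    using f e2 unfolding abs_continuous_on_interval_def by blast
  obtain d2 where d2: "d2 > 0" "\<forall>\<D>. \<D> division_of \<Union>\<D> \<and> \<Union>\<D> \<subseteq> {a..b} \<and> (\<Sum>I\<in>\<D>. Sup I - Inf I) < d2 \<longrightarrow>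
        (\<Sum>I\<in>\<D>. norm (g (Sup I) - g (Inf I))) < e / 2"
    using g e2 unfolding abs_continuous_on_interval_def by blast
  show "\<exists>d>0. \<forall>\<D>. \<D> division_of \<Union>\<D> \<and> \<Union>\<D> \<subseteq> {a..b} \<and> (\<Sum>I\<in>\<D>. Sup I - Inf I) < d \<longrightarrow>
        (\<Sum>I\<in>\<D>. norm (f (Sup I) + g (Sup I) - (f (Inf I) + g (Inf I)))) < e"
  proof (intro exI conjI allI impI)
    show "min d1 d2 > 0" using d1 d2 by simp
    fix \<D> assume D: "\<D> division_of \<Union>\<D> \<and> \<Union>\<D> \<subseteq> {a..b} \<and> (\<Sum>I\<in>\<D>. Sup I - Inf I) < min d1 d2"
    have "(\<Sum>I\<in>\<D>. norm (f (Sup I) + g (Sup I) - (f (Inf I) + g (Inf I))))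
        \<le> (\<Sum>I\<in>\<D>. norm (f (Sup I) - f (Inf I)) + norm (g (Sup I) - g (Inf I)))"
      by (intro sum_mono) (simp add: add_diff_add norm_triangle_ineq)
    also have "\<dots> = (\<Sum>I\<in>\<D>. norm (f (Sup I) - f (Inf I))) + (\<Sum>I\<in>\<D>. norm (g (Sup I) - g (Inf I)))"
      by (rule sum.distrib)
    also have "\<dots> < e / 2 + e / 2" using d1(2) d2(2) D by (intro add_strict_mono) simp_all
    finally show "(\<Sum>I\<in>\<D>. norm (f (Sup I) + g (Sup I) - (f (Inf I) + g (Inf I)))) < e" by simp
  qed
qed

text \<open>A nondecreasing Lipschitz h carries non-overlapping intervals to non-overlapping
  intervals whose total length grows at most by the factor K.\<close>

lemma abs_continuous_compose_mono:
  fixes f :: "real \<Rightarrow> 'a::euclidean_space" and h :: "real \<Rightarrow> real"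
  assumes f: "abs_continuous_on_interval 0 1 f" and mono: "\<And>s t. s \<le> t \<Longrightarrow> h s \<le> h t"
    and K: "K > 0" and lip: "\<And>s t. s \<le> t \<Longrightarrow> h t - h s \<le> K * (t - s)" and h01: "\<And>t. t \<in> {0..1} \<Longrightarrow> h t \<in> {0..1}"
  shows "abs_continuous_on_interval 0 1 (\<lambda>t. f (h t))"
  unfolding abs_continuous_on_interval_def
proof (intro allI impI)
  fix e :: real assume e: "e > 0"
  obtain d where d: "d > 0" "\<forall>\<D>. \<D> division_of \<Union>\<D> \<and> \<Union>\<D> \<subseteq> {0..1} \<and> (\<Sum>I\<in>\<D>. Sup I - Inf I) < d \<longrightarrow>
        (\<Sum>I\<in>\<D>. norm (f (Sup I) - f (Inf I))) < e"
    using f e unfolding abs_continuous_on_interval_def by blast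
  show "\<exists>d>0. \<forall>\<D>. \<D> division_of \<Union>\<D> \<and> \<Union>\<D> \<subseteq> {0..1} \<and> (\<Sum>I\<in>\<D>. Sup I - Inf I) < d \<longrightarrow>
        (\<Sum>I\<in>\<D>. norm (f (h (Sup I)) - f (h (Inf I)))) < e"
  proof (intro exI conjI allI impI)
    show "d / K > 0" using d K by simp
    fix \<D> assume D: "\<D> division_of \<Union>\<D> \<and> \<Union>\<D> \<subseteq> {0..1} \<and> (\<Sum>I\<in>\<D>. Sup I - Inf I) < d / K"
    note div = conjunct1[OF D]
    note fin = division_ofD(1)[OF div]
    \<comment> \<open>Intervals on which h has equal end values contribute nothing and would
      collapse to points. The others have images with nonempty interior, so distinct intervals keep
      distinct images.\<close>
    define D0 where "D0 = {I \<in> \<D>. h (Inf I) < h (Sup I)}"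
    define F where "F = (\<lambda>I. {h (Inf I)..h (Sup I)})"
    have F: "Inf (F I) = h (Inf I)" "Sup (F I) = h (Sup I)" if "I \<in> D0" for I
      using that by (auto simp: F_def D0_def)
    have sep: "Sup I \<le> Inf J \<or> Sup J \<le> Inf I" if IJ: "I \<in> D0" "J \<in> D0" "I \<noteq> J" for I J
    proof (rule ccontr)
      assume n: "\<not> (Sup I \<le> Inf J \<or> Sup J \<le> Inf I)"
      have ID: "I \<in> \<D>" "J \<in> \<D>" using IJ by (auto simp: D0_def)
      note i = division_interval[OF div ID(1)] division_interval[OF div ID(2)]
      have lt: "Inf I < Sup I" "Inf J < Sup J"
        using IJ i(2,6) by (auto simp: D0_def order_less_le)
      \<comment> \<open>A common interior point of I and J, which the division excludes.\<close>
      define z where "z = (max (Inf I) (Inf J) + min (Sup I) (Sup J)) / 2"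
      have z: "Inf I < z" "z < Sup I" "Inf J < z" "z < Sup J" using n lt by (auto simp: z_def max_def min_def)
      have "z \<in> interior I \<inter> interior J" unfolding i(4,8) using z by simp
      then show False using division_ofD(5)[OF div ID IJ(3)] by blast
    qed
    have hsep: "h (Sup I) \<le> h (Inf J) \<or> h (Sup J) \<le> h (Inf I)" if "I \<in> D0" "J \<in> D0" "I \<noteq> J" for I J
      using sep[OF that] mono by blast
    have inj: "inj_on F D0"
    proof (rule inj_onI, rule ccontr)
      fix I J assume IJ: "I \<in> D0" "J \<in> D0" "F I = F J" "I \<noteq> J"
      have "h (Inf I) = h (Inf J)" "h (Sup I) = h (Sup J)" using F[OF IJ(1)] F[OF IJ(2)] IJ(3) by auto
      then show False using hsep[OF IJ(1,2,4)] IJ(1,2) by (auto simp: D0_def)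
    qed
    have div2: "F ` D0 division_of \<Union>(F ` D0)"
    proof (rule division_ofI)
      show "finite (F ` D0)" using fin by (simp add: D0_def)
      show "K \<noteq> {}" if "K \<in> F ` D0" for K using that by (auto simp: F_def D0_def)
      show "\<exists>a b. K = cbox a b" if "K \<in> F ` D0" for K using that by (auto simp: F_def)
      fix K1 K2 assume k: "K1 \<in> F ` D0" "K2 \<in> F ` D0" "K1 \<noteq> K2"
      then obtain I J where IJ: "I \<in> D0" "J \<in> D0" "K1 = F I" "K2 = F J" by blast
      then have "I \<noteq> J" using k by blast
      from hsep[OF IJ(1,2) this] show "interior K1 \<inter> interior K2 = {}" unfolding IJ F_def by auto
    qed auto
    have sub: "\<Union>(F ` D0) \<subseteq> {0..1}"
    proof
      fix y assume "y \<in> \<Union>(F ` D0)"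
      then obtain I where I: "I \<in> D0" "h (Inf I) \<le> y" "y \<le> h (Sup I)" by (auto simp: F_def)
      have ID: "I \<in> \<D>" using I by (simp add: D0_def)
      note i = division_interval[OF div ID]
      have "I \<subseteq> {0..1}" using ID D by blast
      moreover have "Inf I \<in> I" "Sup I \<in> I" by (rule i)+
      ultimately have "h (Inf I) \<in> {0..1}" "h (Sup I) \<in> {0..1}" by (blast intro: h01)+
      then show "y \<in> {0..1}" using I by auto
    qed
    have "(\<Sum>J\<in>F ` D0. Sup J - Inf J) = (\<Sum>I\<in>D0. h (Sup I) - h (Inf I))"
      by (subst sum.reindex[OF inj]) (simp add: F)
    also have "\<dots> \<le> (\<Sum>I\<in>\<D>. h (Sup I) - h (Inf I))"
    proof (rule sum_mono2[OF fin])
      show "0 \<le> h (Sup I) - h (Inf I)" if "I \<in> \<D> - D0" for I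
        using division_interval(2)[OF div, of I] that mono by simp
    qed (auto simp: D0_def)
    also have "\<dots> \<le> (\<Sum>I\<in>\<D>. K * (Sup I - Inf I))"
      using division_interval(2)[OF div] by (intro sum_mono lip) auto
    also have "\<dots> = K * (\<Sum>I\<in>\<D>. Sup I - Inf I)" by (simp add: sum_distrib_left)
    also have "\<dots> < K * (d / K)" using D K by (intro mult_strict_left_mono) auto
    also have "\<dots> = d" using K by simp
    finally have small: "(\<Sum>J\<in>F ` D0. Sup J - Inf J) < d" .
    have "(\<Sum>I\<in>\<D>. norm (f (h (Sup I)) - f (h (Inf I)))) = (\<Sum>I\<in>D0. norm (f (h (Sup I)) - f (h (Inf I))))"
    proof (rule sum.mono_neutral_right[OF fin])
      show "\<forall>I\<in>\<D> - D0. norm (f (h (Sup I)) - f (h (Inf I))) = 0"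
      proof
        fix I assume I: "I \<in> \<D> - D0"
        then have "h (Inf I) \<le> h (Sup I)" using division_interval(2)[OF div, of I] mono by simp
        then have "h (Inf I) = h (Sup I)" using I by (auto simp: D0_def)
        then show "norm (f (h (Sup I)) - f (h (Inf I))) = 0" by simp
      qed
    qed (auto simp: D0_def)
    also have "\<dots> = (\<Sum>J\<in>F ` D0. norm (f (Sup J) - f (Inf J)))"
      by (subst sum.reindex[OF inj]) (simp add: F)
    also have "\<dots> < e" using d(2) div2 sub small by blast
    finally show "(\<Sum>I\<in>\<D>. norm (f (h (Sup I)) - f (h (Inf I)))) < e" .
  qed
qed

section \<open>The Agmon distance\<close>

text \<open>Averages ignore null sets, so the Agmon weight of the given potential can be computed
  from its Borel representative, at every x and r.\<close>

lemma agmon_psi_eq: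
  fixes V :: "real^'n \<Rightarrow> real"
  assumes V: "V \<in> borel_measurable borel" and W: "W \<in> borel_measurable lebesgue" "AE x in lebesgue. W x = V x"
  shows "agmon_psi W x r = psi V x r"
proof -
  have "(LINT y:ball x r|lebesgue. W y) = (LINT y:ball x r|lebesgue. V y)"
    unfolding set_lebesgue_integral_def
  proof (rule integral_cong_AE)
    show "(\<lambda>y. indicator (ball x r) y *\<^sub>R W y) \<in> borel_measurable lebesgue"
      using W(1) by (intro borel_measurable_scaleR borel_measurable_indicator) auto
    show "(\<lambda>y. indicator (ball x r) y *\<^sub>R V y) \<in> borel_measurable lebesgue"
      using lebesgue_measurable_borel[OF V] by (intro borel_measurable_scaleR borel_measurable_indicator) auto
    show "AE y in lebesgue. indicator (ball x r) y *\<^sub>R W y = indicator (ball x r) y *\<^sub>R V y"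
      using W(2) by eventually_elim simp
  qed
  also have "\<dots> = (LINT y:ball x r|lborel. V y)"
    unfolding set_lebesgue_integral_def
    by (rule integral_completion) (use V in \<open>intro borel_measurable_scaleR borel_measurable_indicator; simp\<close>)
  finally show ?thesis by (simp add: agmon_psi_def psi_def average_def avg_def)
qed

lemma agmon_m_eq:
  fixes V :: "real^'n \<Rightarrow> real"
  assumes "V \<in> borel_measurable borel" "W \<in> borel_measurable lebesgue" "AE x in lebesgue. W x = V x"
  shows "agmon_m W x = 1 / crad V x"
  by (simp add: agmon_m_def crad_def agmon_psi_eq[OF assms])

section \<open>Splicing paths and comparing their lengths\<close>

definition agmon_paths :: "'a::euclidean_space \<Rightarrow> 'a \<Rightarrow> (real \<Rightarrow> 'a) set" where
  "agmon_paths x y = {\<sigma>. abs_continuous_on_interval 0 1 \<sigma> \<and> \<sigma> 0 = x \<and> \<sigma> 1 = y}"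

lemma agmon_dist_paths: "agmon_dist W x y = enn2real (INF \<sigma>\<in>agmon_paths x y. agmon_length W \<sigma>)"
  by (simp add: agmon_dist_def agmon_paths_def)

text \<open>An inequality rather than an equation because of points without derivative: there both
  sides contain the same arbitrary default vector v, and |v| \<le> 2 |v| is what remains. Elsewhere
  the chain rule gives equality.\<close>

lemma vector_derivative_double:
  fixes \<sigma> \<tau> :: "real \<Rightarrow> real^'n"
  assumes t: "1/2 < t" "t < 1" and eq: "\<And>s. 1/2 < s \<Longrightarrow> s < 1 \<Longrightarrow> \<tau> s = \<sigma> (2 * s - 1)"
  shows "norm (vector_derivative \<tau> (at t within {0..1})) \<le> 2 * norm (vector_derivative \<sigma> (at (2 * t - 1) within {0..1}))"
proof -
  have int: "at t within {0..1} = at t" "at (2 * t - 1) within {0..1} = at (2 * t - 1)"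
    using t by (auto intro!: at_within_interior simp: interior_atLeastAtMost_real)
  have fwd: "(\<tau> has_vector_derivative 2 *\<^sub>R v) (at t)" if "(\<sigma> has_vector_derivative v) (at (2 * t - 1))" for v
  proof -
    have "((\<lambda>s. 2 * s - 1) has_vector_derivative 2) (at t)" by (auto intro!: derivative_eq_intros)
    from vector_diff_chain_at[OF this that]
    have "((\<sigma> \<circ> (\<lambda>s. 2 * s - 1)) has_vector_derivative 2 *\<^sub>R v) (at t)" .
    then show ?thesis
      by (rule has_vector_derivative_transform_within_open[where S = "{1/2<..<1}"]) (use t eq in auto)
  qed
  have bwd: "(\<sigma> has_vector_derivative (1/2) *\<^sub>R v) (at (2 * t - 1))" if "(\<tau> has_vector_derivative v) (at t)" for v
  proof -
    have "((\<lambda>u. (u + 1) / 2) has_vector_derivative (1/2)) (at (2 * t - 1))" by (auto intro!: derivative_eq_intros)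
    moreover have "(\<tau> has_vector_derivative v) (at ((2 * t - 1 + 1) / 2))" using that by simp
    ultimately have "((\<tau> \<circ> (\<lambda>u. (u + 1) / 2)) has_vector_derivative (1/2) *\<^sub>R v) (at (2 * t - 1))"
      by (rule vector_diff_chain_at)
    then show ?thesis
    proof (rule has_vector_derivative_transform_within_open[where S = "{0<..<1}"])
      show "(\<tau> \<circ> (\<lambda>u. (u + 1) / 2)) y = \<sigma> y" if "y \<in> {0<..<1}" for y
        using that eq[of "(y + 1) / 2"] by (simp add: field_simps)
    qed (use t in auto)
  qed
  show ?thesis
  proof (cases "\<exists>v. (\<sigma> has_vector_derivative v) (at (2 * t - 1))")
    case True
    then obtain v where v: "(\<sigma> has_vector_derivative v) (at (2 * t - 1))" by blast
    show ?thesis unfolding int using vector_derivative_at[OF v] vector_derivative_at[OF fwd[OF v]] by simp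
  next
    case False
    then have "\<not> (\<tau> has_vector_derivative v) (at t)" for v using bwd by blast
    with False show ?thesis unfolding int vector_derivative_def by simp
  qed
qed

lemma AE_lebesgue_on_not_in_finite:
  assumes "finite (S :: real set)"
  shows "AE t in lebesgue_on {0..1}. t \<notin> S"
proof -
  have "AE t in lebesgue. t \<notin> S"
    by (intro AE_not_in) (use negligible_finite[OF assms] in \<open>simp add: negligible_iff_null_sets\<close>)
  then show ?thesis by (subst AE_restrict_space_iff) auto
qed

text \<open>Two lower integrals are compared through simple functions, since \<open>\<sigma>'\<close> is not known
to be measurable here.\<close>

lemma agmon_length_prepend:
  fixes \<sigma> \<tau> :: "real \<Rightarrow> real^'n"
  assumes seg: "\<And>t. 0 < t \<Longrightarrow> t < 1/2 \<Longrightarrow> agmon_m W (\<tau> t) * norm (vector_derivative \<tau> (at t within {0..1})) \<le> 2 * \<kappa>"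
    and k: "\<kappa> \<ge> 0" and m: "\<And>x. agmon_m W x \<ge> 0"
    and eq: "\<And>s. 1/2 < s \<Longrightarrow> s < 1 \<Longrightarrow> \<tau> s = \<sigma> (2 * s - 1)"
  shows "agmon_length W \<tau> \<le> agmon_length W \<sigma> + ennreal \<kappa>"
proof -
  define F where "F = (\<lambda>t. ennreal (agmon_m W (\<tau> t) * norm (vector_derivative \<tau> (at t within {0..1}))))"
  define H where "H = (\<lambda>t. ennreal (agmon_m W (\<sigma> t) * norm (vector_derivative \<sigma> (at t within {0..1}))))"
  let ?M = "lebesgue_on {0..1::real}"
  have F1: "F t \<le> ennreal (2 * \<kappa>)" if "0 < t" "t < 1/2" for t
    unfolding F_def using seg[OF that] by (rule ennreal_leI)
  have F2: "F t \<le> 2 * H (2 * t - 1)" if "1/2 < t" "t < 1" for t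
  proof -
    have "agmon_m W (\<tau> t) * norm (vector_derivative \<tau> (at t within {0..1}))
      \<le> agmon_m W (\<sigma> (2 * t - 1)) * (2 * norm (vector_derivative \<sigma> (at (2 * t - 1) within {0..1})))"
      using vector_derivative_double[OF that, of \<tau> \<sigma>] eq that m by (auto intro!: mult_left_mono)
    then have "F t \<le> ennreal (2 * (agmon_m W (\<sigma> (2 * t - 1)) * norm (vector_derivative \<sigma> (at (2 * t - 1) within {0..1}))))"
      unfolding F_def by (intro ennreal_leI) simp
    also have "\<dots> = 2 * H (2 * t - 1)" unfolding H_def using m by (subst ennreal_mult) auto
    finally show ?thesis .
  qed
  have "integral\<^sup>N ?M F \<le> integral\<^sup>N ?M H + ennreal \<kappa>"
    unfolding nn_integral_def[of ?M F]
  proof (rule SUP_least)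
    fix s assume "s \<in> {g. simple_function ?M g \<and> g \<le> F}"
    then have ss: "simple_function ?M s" and sF: "\<And>t. s t \<le> F t" by (auto simp: le_fun_def)
    define S where "S = (\<lambda>t. s t * indicator {0..1} t)"
    have Sm: "S \<in> borel_measurable lebesgue"
      using borel_measurable_simple_function[OF ss] unfolding S_def
      by (subst (asm) borel_measurable_restrict_space_iff_ennreal) auto
    define g where "g = (\<lambda>t. S t * indicator {1/2<..<1} t)"
    have gm: "g \<in> borel_measurable lebesgue" 
      unfolding g_def using Sm borel_measurable_indicator[of "{1/2<..<1::real}" lebesgue] by (rule borel_measurable_times_ennreal) simp
    have "integral\<^sup>S ?M s = integral\<^sup>N ?M s" using ss by (rule nn_integral_eq_simple_integral[symmetric])
    also have "\<dots> = (\<integral>\<^sup>+t. S t \<partial>lebesgue)" unfolding S_def by (rule nn_integral_restrict_space) simp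
    also have "\<dots> \<le> (\<integral>\<^sup>+t. ennreal (2 * \<kappa>) * indicator {0..1/2} t + g t \<partial>lebesgue)"
    proof (rule nn_integral_mono_AE)
      have "AE t in lebesgue. t \<notin> {0, 1/2, 1::real}"
        by (intro AE_not_in) (simp add: negligible_iff_null_sets[symmetric] negligible_finite)
      then show "AE t in lebesgue. S t \<le> ennreal (2 * \<kappa>) * indicator {0..1/2} t + g t"
      proof eventually_elim
        case (elim t)
        consider "t < 0 \<or> t > 1" | "0 < t \<and> t < 1/2" | "1/2 < t \<and> t < 1" using elim by fastforce
        then show ?case
        proof cases
          case 1 then show ?thesis by (auto simp: S_def)
        next
          case 2 then show ?thesis using order_trans[OF sF F1[of t]] by (simp add: S_def g_def)
        next
          case 3 then show ?thesis by (simp add: g_def)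
        qed
      qed
    qed
    also have "\<dots> = (\<integral>\<^sup>+t. ennreal (2 * \<kappa>) * indicator {0..1/2::real} t \<partial>lebesgue) + (\<integral>\<^sup>+t. g t \<partial>lebesgue)"
    proof (rule nn_integral_add[OF _ gm])
      show "(\<lambda>t. ennreal (2 * \<kappa>) * indicator {0..1/2::real} t) \<in> borel_measurable lebesgue"
        by (rule borel_measurable_times_ennreal[OF measurable_const borel_measurable_indicator]) simp_all
    qed
    also have "(\<integral>\<^sup>+t. ennreal (2 * \<kappa>) * indicator {0..1/2::real} t \<partial>lebesgue) = ennreal \<kappa>"
    proof -
      have "(\<integral>\<^sup>+t. ennreal (2 * \<kappa>) * indicator {0..1/2::real} t \<partial>lebesgue) = ennreal (2 * \<kappa>) * ennreal (1/2)"
        by (subst nn_integral_cmult_indicator) auto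
      also have "\<dots> = ennreal \<kappa>" using k by (subst ennreal_mult[symmetric]) auto
      finally show ?thesis .
    qed
    \<comment> \<open>The substitution t = 1/2 + u/2; its factor 1/2 cancels the doubled speed in
      \<open>F2\<close>.\<close>
    also have "(\<integral>\<^sup>+t. g t \<partial>lebesgue) = ennreal \<bar>1/2\<bar> * (\<integral>\<^sup>+u. g (1/2 + (1/2) * u) \<partial>lebesgue)"
      by (rule nn_integral_real_affine_lebesgue[OF gm]) simp
    also have "\<dots> = (\<integral>\<^sup>+u. ennreal \<bar>1/2\<bar> * g (1/2 + (1/2) * u) \<partial>lebesgue)"
    proof (rule nn_integral_cmult[symmetric])
      have "(\<lambda>u::real. 1/2 + (1/2) * u) \<in> lebesgue \<rightarrow>\<^sub>M lebesgue"
        using lebesgue_affine_measurable[of "\<lambda>_. 1/2" "1/2::real"] by simp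
      then show "(\<lambda>u. g (1/2 + (1/2) * u)) \<in> borel_measurable lebesgue" using gm by (rule measurable_compose)
    qed
    also have "\<dots> \<le> (\<integral>\<^sup>+u. H u * indicator {0..1} u \<partial>lebesgue)"
    proof (rule nn_integral_mono)
      fix u :: real
      show "ennreal \<bar>1/2\<bar> * g (1/2 + (1/2) * u) \<le> H u * indicator {0..1} u"
      proof (cases "0 < u \<and> u < 1")
        case True
        then have t: "1/2 < 1/2 + (1/2) * u" "1/2 + (1/2) * u < 1" by auto
        have "g (1/2 + (1/2) * u) \<le> 2 * H (2 * (1/2 + (1/2) * u) - 1)"
          using order_trans[OF sF F2[OF t]] t by (simp add: g_def S_def)
        then have "ennreal (1/2) * g (1/2 + (1/2) * u) \<le> ennreal (1/2) * (2 * H u)" by (intro mult_left_mono) (simp_all add: algebra_simps)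
        also have "\<dots> = (ennreal (1/2) * ennreal 2) * H u" by (simp add: mult.assoc)
        also have "ennreal (1/2) * ennreal 2 = 1" by (subst ennreal_mult[symmetric]) auto
        finally show ?thesis using True by simp
      next
        case False
        then show ?thesis by (auto simp: g_def)
      qed
    qed
    also have "\<dots> = integral\<^sup>N ?M H" by (rule nn_integral_restrict_space[symmetric]) simp
    finally show "integral\<^sup>S ?M s \<le> integral\<^sup>N ?M H + ennreal \<kappa>" by (simp add: add.commute)
  qed
  then show ?thesis by (simp add: agmon_length_def F_def H_def)
qed

lemma agmon_length_segment:
  fixes a b :: "real^'n"
  assumes m: "\<And>t. 0 \<le> t \<Longrightarrow> t \<le> 1 \<Longrightarrow> agmon_m W (b + (1 - t) *\<^sub>R (a - b)) \<le> K" and K: "K \<ge> 0"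
  shows "agmon_length W (\<lambda>t. b + (1 - t) *\<^sub>R (a - b)) \<le> ennreal (K * norm (a - b))"
    and "(\<lambda>t. b + (1 - t) *\<^sub>R (a - b)) \<in> agmon_paths a b"
proof -
  let ?\<sigma> = "\<lambda>t. b + (1 - t) *\<^sub>R (a - b)"
  have d: "(?\<sigma> has_vector_derivative (- (a - b))) (at t)" for t
    by (auto intro!: derivative_eq_intros)
  have "agmon_length W ?\<sigma> \<le> (\<integral>\<^sup>+t. ennreal (K * norm (a - b)) \<partial>lebesgue_on {0..1::real})"
    unfolding agmon_length_def
  proof (rule nn_integral_mono_AE)
    have "AE t in lebesgue_on {0..1::real}. t \<notin> {0, 1}" by (rule AE_lebesgue_on_not_in_finite) simp
    moreover have "AE t in lebesgue_on {0..1::real}. t \<in> {0..1}" by (rule AE_I2) simp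
    ultimately show "AE t in lebesgue_on {0..1}. ennreal (agmon_m W (?\<sigma> t) * norm (vector_derivative ?\<sigma> (at t within {0..1}))) \<le> ennreal (K * norm (a - b))"
    proof eventually_elim
      case (elim t)
      have "at t within {0..1} = at t" using elim by (auto intro!: at_within_interior simp: interior_atLeastAtMost_real)
      then have "norm (vector_derivative ?\<sigma> (at t within {0..1})) = norm (a - b)"
        using vector_derivative_at[OF d[of t]] by (simp add: norm_minus_commute)
      then show ?case using m[of t] elim by (auto intro!: ennreal_leI mult_right_mono)
    qed
  qed
  also have "\<dots> = ennreal (K * norm (a - b))" by (simp add: emeasure_restrict_space)
  finally show "agmon_length W ?\<sigma> \<le> ennreal (K * norm (a - b))" .
  have "abs_continuous_on_interval 0 1 ?\<sigma>"
  proof (rule abs_continuous_lipschitz[of "norm (a - b)"])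
    fix s t :: real assume "s \<le> t"
    have "?\<sigma> t - ?\<sigma> s = (s - t) *\<^sub>R (a - b)" by (simp add: algebra_simps)
    then show "norm (?\<sigma> t - ?\<sigma> s) \<le> norm (a - b) * (t - s)" using \<open>s \<le> t\<close> by simp
  qed simp
  then show "?\<sigma> \<in> agmon_paths a b" by (simp add: agmon_paths_def)
qed

lemma agmon_prepend_path:
  fixes a b y :: "real^'n"
  assumes \<sigma>: "\<sigma> \<in> agmon_paths b y" and K: "K \<ge> 0" and m0: "\<And>x. agmon_m W x \<ge> 0"
    and m: "\<And>t. 0 \<le> t \<Longrightarrow> t \<le> 1 \<Longrightarrow> agmon_m W (b + (1 - t) *\<^sub>R (a - b)) \<le> K"
  obtains \<tau> where "\<tau> \<in> agmon_paths a y" "agmon_length W \<tau> \<le> agmon_length W \<sigma> + ennreal (K * norm (a - b))"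
proof -
  \<comment> \<open>One formula for both halves: first \<sigma> rests at b while the second summand
    runs from a - b to 0, then \<sigma> runs at double speed. Being a sum of absolutely continuous
    paths, it requires no gluing argument.\<close>
  define \<tau> where "\<tau> = (\<lambda>t. \<sigma> (max (2 * t - 1) 0) + (1 - min (2 * t) 1) *\<^sub>R (a - b))"
  have s: "abs_continuous_on_interval 0 1 \<sigma>" "\<sigma> 0 = b" "\<sigma> 1 = y" using \<sigma> by (auto simp: agmon_paths_def)
  have ac: "abs_continuous_on_interval 0 1 \<tau>"
    unfolding \<tau>_def
  proof (rule abs_continuous_add)
    show "abs_continuous_on_interval 0 1 (\<lambda>t. \<sigma> (max (2 * t - 1) 0))"
      by (rule abs_continuous_compose_mono[OF s(1), of _ 2]) (auto simp: max_def)
    show "abs_continuous_on_interval 0 1 (\<lambda>t. (1 - min (2 * t) 1) *\<^sub>R (a - b))"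
    proof (rule abs_continuous_lipschitz[of "2 * norm (a - b)"])
      fix s t :: real assume st: "s \<le> t"
      have "(1 - min (2 * t) 1) *\<^sub>R (a - b) - (1 - min (2 * s) 1) *\<^sub>R (a - b) = (min (2 * s) 1 - min (2 * t) 1) *\<^sub>R (a - b)"
        by (simp add: scaleR_diff_left[symmetric])
      moreover have "\<bar>min (2 * s) 1 - min (2 * t) 1\<bar> \<le> 2 * (t - s)" using st by (auto simp: min_def)
      ultimately have "norm ((1 - min (2 * t) 1) *\<^sub>R (a - b) - (1 - min (2 * s) 1) *\<^sub>R (a - b)) \<le> (2 * (t - s)) * norm (a - b)"
        by (simp only: norm_scaleR) (rule mult_right_mono, assumption, simp)
      also have "\<dots> = 2 * norm (a - b) * (t - s)" by simp
      finally show "norm ((1 - min (2 * t) 1) *\<^sub>R (a - b) - (1 - min (2 * s) 1) *\<^sub>R (a - b)) \<le> 2 * norm (a - b) * (t - s)" .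
    qed simp
  qed
  have "\<tau> 0 = a" "\<tau> 1 = y" using s by (simp_all add: \<tau>_def)
  with ac have p: "\<tau> \<in> agmon_paths a y" by (simp add: agmon_paths_def)
  have "agmon_length W \<tau> \<le> agmon_length W \<sigma> + ennreal (K * norm (a - b))"
  proof (rule agmon_length_prepend)
    fix t :: real assume t: "0 < t" "t < 1/2"
    have eq: "\<tau> u = b + (1 - 2 * u) *\<^sub>R (a - b)" if "0 < u" "u < 1/2" for u
      using that s by (simp add: \<tau>_def max_def min_def)
    have "((\<lambda>u. b + (1 - 2 * u) *\<^sub>R (a - b)) has_vector_derivative (- 2) *\<^sub>R (a - b)) (at t)"
      by (auto intro!: derivative_eq_intros simp: algebra_simps)
    then have d: "(\<tau> has_vector_derivative (- 2) *\<^sub>R (a - b)) (at t)"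
      by (rule has_vector_derivative_transform_within_open[where S = "{0<..<1/2}"]) (use t eq in auto)
    have "at t within {0..1} = at t" using t by (auto intro!: at_within_interior simp: interior_atLeastAtMost_real)
    then have n: "norm (vector_derivative \<tau> (at t within {0..1})) = 2 * norm (a - b)"
      using vector_derivative_at[OF d] by simp
    have "agmon_m W (\<tau> t) \<le> K" using m[of "2 * t"] t by (simp add: eq)
    then have "agmon_m W (\<tau> t) * (2 * norm (a - b)) \<le> K * (2 * norm (a - b))" by (intro mult_right_mono) auto
    then show "agmon_m W (\<tau> t) * norm (vector_derivative \<tau> (at t within {0..1})) \<le> 2 * (K * norm (a - b))" by (simp add: n)
  next
    fix u :: real assume "1/2 < u" "u < 1"
    then show "\<tau> u = \<sigma> (2 * u - 1)" by (simp add: \<tau>_def max_def min_def)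
  qed (use K m0 in auto)
  then show ?thesis using that p by blast
qed

text \<open>\<open>enn2real\<close> maps infinity to 0; finiteness of the infimum excludes this
  default value. The segment to the origin has finite length because m_V is bounded on it.\<close>

lemma agmon_dist_finite:
  fixes V :: "real^'n \<Rightarrow> real"
  assumes rh: "rh_weight p C V" and np: "real CARD('n) \<le> 2 * p" and W: "\<And>x. agmon_m W x = 1 / crad V x"
  shows "(INF \<sigma>\<in>agmon_paths x 0. agmon_length W \<sigma>) < top"
proof -
  obtain b where b: "b > 0" "\<And>z. norm z \<le> norm x \<Longrightarrow> crad V z \<ge> b"
    using crad_locally_bounded_below[OF rh np, of "norm x"] by blast
  have m: "agmon_m W (0 + (1 - t) *\<^sub>R (x - 0)) \<le> 1 / b" if "0 \<le> t" "t \<le> 1" for t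
  proof -
    have "norm ((1 - t) *\<^sub>R x) \<le> norm x" using that by (simp add: mult_left_le_one_le)
    then have "crad V ((1 - t) *\<^sub>R x) \<ge> b" by (rule b)
    then show ?thesis using b(1) by (simp add: W frac_le)
  qed
  have K: "1 / b \<ge> 0" using b by simp
  have 1: "agmon_length W (\<lambda>t. 0 + (1 - t) *\<^sub>R (x - 0)) \<le> ennreal (1 / b * norm (x - 0))"
    by (rule agmon_length_segment(1)[OF m K])
  have 2: "(\<lambda>t. 0 + (1 - t) *\<^sub>R (x - 0)) \<in> agmon_paths x 0"
    by (rule agmon_length_segment(2)[OF m K])
  have "(INF \<sigma>\<in>agmon_paths x 0. agmon_length W \<sigma>) \<le> ennreal (1 / b * norm (x - 0))"
    by (rule INF_lower2[where f = "agmon_length W", OF 2 1])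
  then show ?thesis by (rule order_le_less_trans) simp
qed

text \<open>The segment from a to b is put in front of a nearly optimal path from b. It stays in the
  convex ball around x, where slow variation gives m_V \<le> \<Gamma> / r(x). Taking the constant at
  a third point x matches a gradient bound at x after mollification.\<close>

lemma agmon_dist_lipschitz:
  fixes V :: "real^'n \<Rightarrow> real"
  assumes rh: "rh_weight p C V" and np: "real CARD('n) \<le> 2 * p" and W: "\<And>x. agmon_m W x = 1 / crad V x"
    and sv: "\<And>z. dist x z \<le> s \<Longrightarrow> crad V x \<le> \<Gamma> * crad V z" and G: "\<Gamma> \<ge> 1"
    and ab: "dist x a \<le> s" "dist x b \<le> s"
  shows "\<bar>agmon_dist W a 0 - agmon_dist W b 0\<bar> \<le> \<Gamma> / crad V x * norm (a - b)"
proof -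
  define K where "K = \<Gamma> / crad V x"
  have K: "K \<ge> 0" using G crad_pos[OF rh np, of x] by (simp add: K_def)
  have m0: "agmon_m W z \<ge> 0" for z using crad_pos[OF rh np, of z] by (simp add: W)
  have half: "agmon_dist W a 0 \<le> agmon_dist W b 0 + K * norm (a - b)" if ab: "a \<in> cball x s" "b \<in> cball x s" for a b
  proof -
    have m: "agmon_m W (b + (1 - t) *\<^sub>R (a - b)) \<le> K" if "0 \<le> t" "t \<le> 1" for t
    proof -
      have "b + (1 - t) *\<^sub>R (a - b) = (1 - t) *\<^sub>R a + t *\<^sub>R b" by (simp add: algebra_simps)
      then have "b + (1 - t) *\<^sub>R (a - b) \<in> cball x s"
        using convexD[OF convex_cball ab, of "1 - t" t] that by simp
      then have "crad V x \<le> \<Gamma> * crad V (b + (1 - t) *\<^sub>R (a - b))" by (intro sv) simp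
      then show ?thesis using crad_pos[OF rh np] by (simp add: W K_def field_simps)
    qed
    let ?A = "INF \<sigma>\<in>agmon_paths a 0. agmon_length W \<sigma>" and ?B = "INF \<sigma>\<in>agmon_paths b 0. agmon_length W \<sigma>"
    have fin: "?A < top" "?B < top" using agmon_dist_finite[OF rh np W] by auto
    have "?A \<le> ?B + ennreal (K * norm (a - b))"
    proof (rule ennreal_le_epsilon)
      fix e :: real assume e: "e > 0"
      \<comment> \<open>The infimum need not be attained. A path within \<epsilon> of it exists
        because \<open>?B\<close> is finite and therefore strictly below \<open>?B\<close> plus
        \<epsilon>.\<close>
      have "?B \<noteq> top" using fin(2) by (rule less_imp_neq)
      moreover have "0 < ennreal e" using e by simp
      ultimately have "?B + 0 < ?B + ennreal e" unfolding ennreal_add_left_cancel_less infinity_ennreal_def by blast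
      then have "?B < ?B + ennreal e" by (simp only: add_0_right)
      then obtain \<sigma> where s: "\<sigma> \<in> agmon_paths b 0" "agmon_length W \<sigma> < ?B + ennreal e"
        unfolding INF_less_iff by blast
      obtain \<tau> where t: "\<tau> \<in> agmon_paths a 0" "agmon_length W \<tau> \<le> agmon_length W \<sigma> + ennreal (K * norm (a - b))"
        using agmon_prepend_path[OF s(1) K m0 m] by blast
      have "?A \<le> agmon_length W \<tau>" by (rule INF_lower[OF t(1)])
      also have "\<dots> \<le> (?B + ennreal e) + ennreal (K * norm (a - b))"
        using t(2) s(2) by (meson add_right_mono less_imp_le order_trans)
      finally show "?A \<le> ?B + ennreal (K * norm (a - b)) + ennreal e" by (simp add: add_ac)
    qed
    then have "enn2real ?A \<le> enn2real (?B + ennreal (K * norm (a - b)))"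
      by (rule enn2real_mono) (use fin in auto)
    also have "\<dots> = enn2real ?B + K * norm (a - b)" using fin K by (subst enn2real_plus) auto
    finally show ?thesis unfolding agmon_dist_paths .
  qed
  have "a \<in> cball x s" "b \<in> cball x s" using ab by auto
  then show ?thesis using half[of a b] half[of b a] by (simp add: K_def norm_minus_commute abs_le_iff)
qed

section \<open>Passing to Sobolev functions\<close>

text \<open>Fatou's lemma with vanishing error terms. It carries inequalities from test functions to
  Sobolev functions without prior knowledge that the limit is integrable.\<close>

lemma nn_integral_fatou_bound:
  fixes g :: "nat \<Rightarrow> 'a \<Rightarrow> ennreal"
  assumes m: "\<And>k. g k \<in> borel_measurable M" and lim: "AE x in M. (\<lambda>k. g k x) \<longlonglongrightarrow> h x"
    and b: "\<And>k. (\<integral>\<^sup>+x. g k x \<partial>M) \<le> B + ennreal (c / real (Suc k))" and c: "c \<ge> 0"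
  shows "(\<integral>\<^sup>+x. h x \<partial>M) \<le> B"
proof -
  have "(\<integral>\<^sup>+x. h x \<partial>M) = (\<integral>\<^sup>+x. liminf (\<lambda>k. g k x) \<partial>M)"
  proof (rule nn_integral_cong_AE)
    show "AE x in M. h x = liminf (\<lambda>k. g k x)"
      using lim by eventually_elim (simp add: lim_imp_Liminf)
  qed
  also have "\<dots> \<le> liminf (\<lambda>k. \<integral>\<^sup>+x. g k x \<partial>M)" by (rule nn_integral_liminf[OF m])
  also have "\<dots> \<le> B"
  proof (rule ennreal_le_epsilon)
    fix e :: real assume e: "e > 0"
    show "liminf (\<lambda>k. \<integral>\<^sup>+x. g k x \<partial>M) \<le> B + ennreal e"
    proof (rule Liminf_le)
      have "(\<lambda>k. c * inverse (real (Suc k))) \<longlonglongrightarrow> c * 0" by (intro tendsto_intros LIMSEQ_inverse_real_of_nat)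
      then have "eventually (\<lambda>k. c * inverse (real (Suc k)) < e) sequentially"
        using e by (intro order_tendstoD(2)[of _ "c * 0"]) auto
      then show "eventually (\<lambda>k. (\<integral>\<^sup>+x. g k x \<partial>M) \<le> B + ennreal e) sequentially"
      proof eventually_elim
        case (elim k)
        have "ennreal (c / real (Suc k)) \<le> ennreal e" using elim by (intro ennreal_leI) (simp add: divide_inverse)
        then show ?case using b[of k] by (meson add_left_mono order_trans)
      qed
    qed simp
  qed
  finally show ?thesis .
qed

text \<open>The rate 1/(k+1) survives the passage to an almost everywhere convergent subsequence,
  because the k-th index of the latter is at least k.\<close>

lemma sobolev_compact_sequence:
  fixes f :: "real^'n \<Rightarrow> real"
  assumes f: "sobolev_compact M f F"
  obtains \<phi> where "\<And>k. test_function (\<phi> k)" "\<And>k. sobolev_compact (M + 1) (\<phi> k) (grad (\<phi> k))"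
    "\<And>k. (LINT x|lborel. (norm (F x - grad (\<phi> k) x))\<^sup>2) \<le> 1 / real (Suc k)"
    "AE x in lborel. (\<lambda>k. \<phi> k x) \<longlonglongrightarrow> f x"
proof -
  have "\<exists>\<phi>. test_function \<phi> \<and> sobolev_compact (M + 1) \<phi> (grad \<phi>) \<and> (LINT x|lborel. (f x - \<phi> x)\<^sup>2) \<le> 1 / real (Suc k)
      \<and> (LINT x|lborel. (norm (F x - grad \<phi> x))\<^sup>2) \<le> 1 / real (Suc k)" for k
  proof -
    have "1 / real (Suc k) > 0" by simp
    from sobolev_compact_approx[OF f this] show ?thesis by blast
  qed
  then have "\<forall>k. \<exists>\<phi>. test_function \<phi> \<and> sobolev_compact (M + 1) \<phi> (grad \<phi>) \<and> (LINT x|lborel. (f x - \<phi> x)\<^sup>2) \<le> 1 / real (Suc k)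
      \<and> (LINT x|lborel. (norm (F x - grad \<phi> x))\<^sup>2) \<le> 1 / real (Suc k)" by (rule allI)
  from choice[OF this] obtain \<phi> where p: "\<forall>k. test_function (\<phi> k) \<and> sobolev_compact (M + 1) (\<phi> k) (grad (\<phi> k)) \<and> (LINT x|lborel. (f x - \<phi> k x)\<^sup>2) \<le> 1 / real (Suc k)
      \<and> (LINT x|lborel. (norm (F x - grad (\<phi> k) x))\<^sup>2) \<le> 1 / real (Suc k)" by (rule exE)
  have i: "integrable lborel (\<lambda>x. (f x - \<phi> k x)\<^sup>2)" for k
  proof -
    have "sobolev_compact (M + 1) (\<lambda>x. f x - \<phi> k x) (\<lambda>x. F x - grad (\<phi> k) x)"
      by (rule sobolev_compact_diff[OF sobolev_compact_mono[OF f]]) (use p in auto)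
    then show ?thesis by (simp add: sobolev_compact_def)
  qed
  have "(\<lambda>k. LINT x|lborel. norm ((f x - \<phi> k x)\<^sup>2)) \<longlonglongrightarrow> 0"
  proof (rule tendsto_sandwich[of "\<lambda>_. 0" _ _ "\<lambda>k. 1 / real (Suc k)"])
    show "(\<lambda>k. 1 / real (Suc k)) \<longlonglongrightarrow> 0" using LIMSEQ_inverse_real_of_nat by (simp add: divide_inverse)
    show "eventually (\<lambda>k. 0 \<le> (LINT x|lborel. norm ((f x - \<phi> k x)\<^sup>2))) sequentially" by simp
    show "eventually (\<lambda>k. (LINT x|lborel. norm ((f x - \<phi> k x)\<^sup>2)) \<le> 1 / real (Suc k)) sequentially"
      using p by (intro always_eventually allI) simp
  qed simp
  from tendsto_L1_AE_subseq[where u = "\<lambda>k x. (f x - \<phi> k x)\<^sup>2", OF i this] obtain r where r: "strict_mono r"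
    "AE x in lborel. (\<lambda>k. (f x - \<phi> (r k) x)\<^sup>2) \<longlonglongrightarrow> 0" by blast
  have lim: "AE x in lborel. (\<lambda>k. \<phi> (r k) x) \<longlonglongrightarrow> f x"
    using r(2)
  proof eventually_elim
    case (elim x)
    then have "(\<lambda>k. sqrt ((f x - \<phi> (r k) x)\<^sup>2)) \<longlonglongrightarrow> sqrt 0" by (rule tendsto_real_sqrt)
    then have "(\<lambda>k. \<bar>\<phi> (r k) x - f x\<bar>) \<longlonglongrightarrow> 0" by (simp add: abs_minus_commute)
    then have "(\<lambda>k. \<phi> (r k) x - f x) \<longlonglongrightarrow> 0" by (simp only: tendsto_rabs_zero_iff)
    then show ?case by (simp only: LIM_zero_iff)
  qed
  have e: "(LINT x|lborel. (norm (F x - grad (\<phi> (r k)) x))\<^sup>2) \<le> 1 / real (Suc k)" for k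
  proof -
    have "(LINT x|lborel. (norm (F x - grad (\<phi> (r k)) x))\<^sup>2) \<le> 1 / real (Suc (r k))" using p by blast
    also have "\<dots> \<le> 1 / real (Suc k)" using seq_suble[OF r(1), of k] by (intro divide_left_mono) auto
    finally show ?thesis .
  qed
  show ?thesis by (rule that[of "\<lambda>k. \<phi> (r k)"]) (use p e lim in auto)
qed

lemma sobolev_energy_nn:
  fixes f :: "real^'n \<Rightarrow> real"
  assumes "sobolev_compact M f F"
  shows "(\<integral>\<^sup>+x. ennreal ((norm (F x))\<^sup>2) \<partial>lborel) = ennreal (LINT x|lborel. (norm (F x))\<^sup>2)"
  using assms by (intro nn_integral_eq_integral) (auto simp: sobolev_compact_def)

lemma ennreal_double: "0 \<le> a \<Longrightarrow> 0 \<le> b \<Longrightarrow> c \<le> 2 * a + 2 * b \<Longrightarrow> ennreal c \<le> 2 * ennreal a + 2 * ennreal b"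
proof -
  assume a: "0 \<le> a" "0 \<le> b" "c \<le> 2 * a + 2 * b"
  have "ennreal c \<le> ennreal (2 * a + 2 * b)" using a(3) by (rule ennreal_leI)
  also have "\<dots> = ennreal (2 * a) + ennreal (2 * b)" using a by (intro ennreal_plus) auto
  also have "\<dots> = 2 * ennreal a + 2 * ennreal b" using a by (simp add: ennreal_mult)
  finally show ?thesis .
qed

lemma sobolev_approx_gradient:
  fixes f :: "real^'n \<Rightarrow> real"
  assumes f: "sobolev_compact M f F" and p: "sobolev_compact (M + 1) \<phi> (grad \<phi>)"
    "(LINT x|lborel. (norm (F x - grad \<phi> x))\<^sup>2) \<le> e"
  shows "(\<integral>\<^sup>+x. ennreal ((norm (grad \<phi> x))\<^sup>2) \<partial>lborel) \<le> 2 * (\<integral>\<^sup>+x. ennreal ((norm (F x))\<^sup>2) \<partial>lborel) + ennreal (2 * e)"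
proof -
  have d: "sobolev_compact (M + 1) (\<lambda>x. f x - \<phi> x) (\<lambda>x. F x - grad \<phi> x)"
    by (rule sobolev_compact_diff[OF sobolev_compact_mono[OF f] p(1)]) simp
  have [measurable]: "F \<in> borel_measurable borel" "grad \<phi> \<in> borel_measurable borel"
    using f p by (auto simp: sobolev_compact_def)
  have e: "e \<ge> 0" using p(2) by (rule order_trans[rotated]) simp
  have "(\<integral>\<^sup>+x. ennreal ((norm (grad \<phi> x))\<^sup>2) \<partial>lborel)
    \<le> (\<integral>\<^sup>+x. 2 * ennreal ((norm (F x))\<^sup>2) + 2 * ennreal ((norm (F x - grad \<phi> x))\<^sup>2) \<partial>lborel)"
  proof (intro nn_integral_mono ennreal_double)
    fix x
    show "(norm (grad \<phi> x))\<^sup>2 \<le> 2 * (norm (F x))\<^sup>2 + 2 * (norm (F x - grad \<phi> x))\<^sup>2"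
      using norm_add_square_le[of "F x" "- (F x - grad \<phi> x)"] by (simp add: norm_minus_commute)
  qed auto
  also have "\<dots> = 2 * (\<integral>\<^sup>+x. ennreal ((norm (F x))\<^sup>2) \<partial>lborel) + 2 * (\<integral>\<^sup>+x. ennreal ((norm (F x - grad \<phi> x))\<^sup>2) \<partial>lborel)"
    by (subst nn_integral_add) (auto simp: nn_integral_cmult)
  also have "(\<integral>\<^sup>+x. ennreal ((norm (F x - grad \<phi> x))\<^sup>2) \<partial>lborel) \<le> ennreal e"
    unfolding sobolev_energy_nn[OF d] using p(2) by (rule ennreal_leI)
  also have "2 * ennreal e = ennreal (2 * e)" using e by (simp add: ennreal_mult)
  finally show ?thesis by (simp add: add_left_mono mult_left_mono)
qed

text \<open>The constant may depend on V and M: it serves to show that potential energies are finite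
  and that those of approximation errors vanish.\<close>

lemma sobolev_trace:
  fixes V :: "real^'n \<Rightarrow> real"
  assumes rh: "rh_weight p C V" and np: "real CARD('n) \<le> 2 * p" and M: "M > 0"
  obtains K where "K \<ge> 0" "\<And>f F. sobolev_compact M f F \<Longrightarrow>
    (\<integral>\<^sup>+x. ennreal (V x * (f x)\<^sup>2) \<partial>lborel) \<le> ennreal K * (\<integral>\<^sup>+x. ennreal ((norm (F x))\<^sup>2) \<partial>lborel)"
proof -
  \<comment> \<open>Approximants vanish for |x| > M + 1, whereas \<open>trace_inequality\<close>
    asks for vanishing on |x| \<ge> its radius; M + 2 bridges the strictness.\<close>
  have "M + 2 > 0" using M by simp
  then obtain K0 where K0: "K0 \<ge> 0" "\<And>f. test_function f \<Longrightarrow> (\<And>x. norm x \<ge> M + 2 \<Longrightarrow> f x = 0) \<Longrightarrow> (\<And>x. norm x \<ge> M + 2 \<Longrightarrow> grad f x = 0) \<Longrightarrow>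
    (\<integral>\<^sup>+x. ennreal (V x * (f x)\<^sup>2) \<partial>lborel) \<le> ennreal K0 * (\<integral>\<^sup>+x. ennreal ((norm (grad f x))\<^sup>2) \<partial>lborel)"
    using trace_inequality[OF rh np, of "M + 2"] by blast
  have "(\<integral>\<^sup>+x. ennreal (V x * (f x)\<^sup>2) \<partial>lborel) \<le> ennreal (2 * K0) * (\<integral>\<^sup>+x. ennreal ((norm (F x))\<^sup>2) \<partial>lborel)"
    if f: "sobolev_compact M f F" for f F
  proof -
    have [measurable]: "V \<in> borel_measurable borel" by (rule rh_borel[OF rh])
    obtain \<phi> where p: "\<And>k. test_function (\<phi> k)" "\<And>k. sobolev_compact (M + 1) (\<phi> k) (grad (\<phi> k))"
      "\<And>k. (LINT x|lborel. (norm (F x - grad (\<phi> k) x))\<^sup>2) \<le> 1 / real (Suc k)"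
      "AE x in lborel. (\<lambda>k. \<phi> k x) \<longlonglongrightarrow> f x"
      using sobolev_compact_sequence[OF f] by blast
    have pm: "\<phi> k \<in> borel_measurable borel" for k using p(2)[of k] by (simp add: sobolev_compact_def)
    show ?thesis
    proof (rule nn_integral_fatou_bound)
      show "(\<lambda>x. ennreal (V x * (\<phi> k x)\<^sup>2)) \<in> borel_measurable lborel" for k using pm[of k] by simp
      show "AE x in lborel. (\<lambda>k. ennreal (V x * (\<phi> k x)\<^sup>2)) \<longlonglongrightarrow> ennreal (V x * (f x)\<^sup>2)"
        using p(4) by eventually_elim (intro tendsto_ennrealI tendsto_intros)
      show "0 \<le> K0 * 2" using K0 by simp
      fix k
      have "(\<integral>\<^sup>+x. ennreal (V x * (\<phi> k x)\<^sup>2) \<partial>lborel) \<le> ennreal K0 * (\<integral>\<^sup>+x. ennreal ((norm (grad (\<phi> k) x))\<^sup>2) \<partial>lborel)"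
        by (rule K0(2)[OF p(1)]) (use p(2)[of k] in \<open>auto simp: sobolev_compact_def\<close>)
      also have "\<dots> \<le> ennreal K0 * (2 * (\<integral>\<^sup>+x. ennreal ((norm (F x))\<^sup>2) \<partial>lborel) + ennreal (2 * (1 / real (Suc k))))"
        by (intro mult_left_mono sobolev_approx_gradient[OF f p(2,3)]) simp
      also have "\<dots> = ennreal (2 * K0) * (\<integral>\<^sup>+x. ennreal ((norm (F x))\<^sup>2) \<partial>lborel) + ennreal (K0 * 2 / real (Suc k))"
      proof -
        have "ennreal K0 * ennreal (2 * (1 / real (Suc k))) = ennreal (K0 * 2 / real (Suc k))"
          using K0(1) by (subst ennreal_mult[symmetric]) auto
        moreover have "ennreal K0 * (2 * X) = ennreal (2 * K0) * X" for X
          using K0(1) by (simp add: ennreal_mult mult_ac)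
        ultimately show ?thesis by (simp only: distrib_left)
      qed
      finally show "(\<integral>\<^sup>+x. ennreal (V x * (\<phi> k x)\<^sup>2) \<partial>lborel) \<le> ennreal (2 * K0) * (\<integral>\<^sup>+x. ennreal ((norm (F x))\<^sup>2) \<partial>lborel) + ennreal (K0 * 2 / real (Suc k))" .
    qed
  qed
  moreover have "2 * K0 \<ge> 0" using K0 by simp
  ultimately show ?thesis using that by blast
qed

text \<open>The approximants converge in H^1; the trace bound applied to f - \<phi> makes the
  potential terms converge as well. Its constant L multiplies only the vanishing error, so the
  result keeps a constant that depends on K alone.\<close>

lemma sobolev_fefferman_phong:
  fixes V :: "real^'n \<Rightarrow> real"
  assumes rh: "rh_weight p C V" and np: "real CARD('n) \<le> 2 * p" and M: "M > 0" and f: "sobolev_compact M f F" and K: "K \<ge> 0"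
    and fp: "\<And>f. test_function f \<Longrightarrow>
      (\<integral>\<^sup>+x. ennreal ((f x)\<^sup>2 / (crad V x)\<^sup>2) \<partial>lborel)
        \<le> ennreal K * ((\<integral>\<^sup>+x. ennreal ((norm (grad f x))\<^sup>2) \<partial>lborel) + (\<integral>\<^sup>+x. ennreal (V x * (f x)\<^sup>2) \<partial>lborel))"
  shows "(\<integral>\<^sup>+x. ennreal ((f x)\<^sup>2 / (crad V x)\<^sup>2) \<partial>lborel)
        \<le> ennreal (2 * K) * ((\<integral>\<^sup>+x. ennreal ((norm (F x))\<^sup>2) \<partial>lborel) + (\<integral>\<^sup>+x. ennreal (V x * (f x)\<^sup>2) \<partial>lborel))"
proof -
  have [measurable]: "V \<in> borel_measurable borel" "crad V \<in> borel_measurable borel" "f \<in> borel_measurable borel" "F \<in> borel_measurable borel"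
    using rh_borel[OF rh] crad_borel[OF rh np] f by (auto simp: sobolev_compact_def)
  have "M + 1 > 0" using M by simp
  then obtain L where L: "L \<ge> 0" "\<And>f F. sobolev_compact (M + 1) f F \<Longrightarrow>
    (\<integral>\<^sup>+x. ennreal (V x * (f x)\<^sup>2) \<partial>lborel) \<le> ennreal L * (\<integral>\<^sup>+x. ennreal ((norm (F x))\<^sup>2) \<partial>lborel)"
    using sobolev_trace[OF rh np, of "M + 1"] by blast
  obtain \<phi> where p: "\<And>k. test_function (\<phi> k)" "\<And>k. sobolev_compact (M + 1) (\<phi> k) (grad (\<phi> k))"
    "\<And>k. (LINT x|lborel. (norm (F x - grad (\<phi> k) x))\<^sup>2) \<le> 1 / real (Suc k)"
    "AE x in lborel. (\<lambda>k. \<phi> k x) \<longlonglongrightarrow> f x"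
    using sobolev_compact_sequence[OF f] by blast
  have pm[measurable]: "\<phi> k \<in> borel_measurable borel" for k using p(2)[of k] by (simp add: sobolev_compact_def)
  let ?g = "\<integral>\<^sup>+x. ennreal ((norm (F x))\<^sup>2) \<partial>lborel" and ?q = "\<integral>\<^sup>+x. ennreal (V x * (f x)\<^sup>2) \<partial>lborel"
  show ?thesis
  proof (rule nn_integral_fatou_bound)
    show "(\<lambda>x. ennreal ((\<phi> k x)\<^sup>2 / (crad V x)\<^sup>2)) \<in> borel_measurable lborel" for k by simp
    show "AE x in lborel. (\<lambda>k. ennreal ((\<phi> k x)\<^sup>2 / (crad V x)\<^sup>2)) \<longlonglongrightarrow> ennreal ((f x)\<^sup>2 / (crad V x)\<^sup>2)"
      using p(4)
    proof eventually_elim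
      case (elim x)
      have "crad V x \<noteq> 0" using crad_pos[OF rh np, of x] by simp
      then show ?case by (intro tendsto_ennrealI tendsto_intros elim) simp
    qed
    show "0 \<le> K * (2 + 2 * L)" using K L by simp
    fix k
    define e where "e = 1 / real (Suc k)"
    have e: "e \<ge> 0" by (simp add: e_def)
    have d: "sobolev_compact (M + 1) (\<lambda>x. f x - \<phi> k x) (\<lambda>x. F x - grad (\<phi> k) x)"
      by (rule sobolev_compact_diff[OF sobolev_compact_mono[OF f] p(2)]) simp
    have "(\<integral>\<^sup>+x. ennreal (V x * (\<phi> k x)\<^sup>2) \<partial>lborel)
      \<le> (\<integral>\<^sup>+x. 2 * ennreal (V x * (f x)\<^sup>2) + 2 * ennreal (V x * (f x - \<phi> k x)\<^sup>2) \<partial>lborel)"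
    proof (intro nn_integral_mono ennreal_double)
      fix x
      have "(\<phi> k x)\<^sup>2 \<le> 2 * (f x)\<^sup>2 + 2 * (f x - \<phi> k x)\<^sup>2"
        using square_add_le[of "f x" "- (f x - \<phi> k x)"] by (simp add: power2_commute)
      then have "V x * (\<phi> k x)\<^sup>2 \<le> V x * (2 * (f x)\<^sup>2 + 2 * (f x - \<phi> k x)\<^sup>2)"
        using rh_nonneg[OF rh, of x] by (rule mult_left_mono)
      then show "V x * (\<phi> k x)\<^sup>2 \<le> 2 * (V x * (f x)\<^sup>2) + 2 * (V x * (f x - \<phi> k x)\<^sup>2)" by (simp add: algebra_simps)
    qed (use rh_nonneg[OF rh] in auto)
    also have "\<dots> = 2 * ?q + 2 * (\<integral>\<^sup>+x. ennreal (V x * (f x - \<phi> k x)\<^sup>2) \<partial>lborel)"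
      by (subst nn_integral_add) (auto simp: nn_integral_cmult)
    also have "(\<integral>\<^sup>+x. ennreal (V x * (f x - \<phi> k x)\<^sup>2) \<partial>lborel) \<le> ennreal L * ennreal e"
    proof -
      have "(\<integral>\<^sup>+x. ennreal (V x * (f x - \<phi> k x)\<^sup>2) \<partial>lborel) \<le> ennreal L * (\<integral>\<^sup>+x. ennreal ((norm (F x - grad (\<phi> k) x))\<^sup>2) \<partial>lborel)"
        by (rule L(2)[OF d])
      also have "(\<integral>\<^sup>+x. ennreal ((norm (F x - grad (\<phi> k) x))\<^sup>2) \<partial>lborel) \<le> ennreal e"
        unfolding sobolev_energy_nn[OF d] e_def by (rule ennreal_leI[OF p(3)])
      finally show ?thesis by (simp add: mult_left_mono)
    qed
    finally have q: "(\<integral>\<^sup>+x. ennreal (V x * (\<phi> k x)\<^sup>2) \<partial>lborel) \<le> 2 * ?q + 2 * (ennreal L * ennreal e)"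
      by (simp add: add_left_mono mult_left_mono)
    have g: "(\<integral>\<^sup>+x. ennreal ((norm (grad (\<phi> k) x))\<^sup>2) \<partial>lborel) \<le> 2 * ?g + ennreal (2 * e)"
      unfolding e_def by (rule sobolev_approx_gradient[OF f p(2,3)])
    have "(\<integral>\<^sup>+x. ennreal ((\<phi> k x)\<^sup>2 / (crad V x)\<^sup>2) \<partial>lborel) \<le> ennreal K * ((2 * ?g + ennreal (2 * e)) + (2 * ?q + 2 * (ennreal L * ennreal e)))"
      by (rule order_trans[OF fp[OF p(1)]]) (intro mult_left_mono add_mono g q, simp)
    also have "\<dots> = ennreal (2 * K) * (?g + ?q) + ennreal (K * (2 + 2 * L) / real (Suc k))"
    proof -
      have 1: "ennreal (2 * e) + 2 * (ennreal L * ennreal e) = ennreal ((2 + 2 * L) * e)"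
      proof -
        have "2 * (ennreal L * ennreal e) = ennreal (2 * L * e)" using L e by (simp add: ennreal_mult mult.assoc)
        then show ?thesis using L e by (simp add: ennreal_plus[symmetric] distrib_right del: ennreal_plus)
      qed
      have 2: "ennreal K * ennreal ((2 + 2 * L) * e) = ennreal (K * (2 + 2 * L) / real (Suc k))"
        using K L e by (subst ennreal_mult[symmetric]) (auto simp: e_def mult_ac)
      have 3: "ennreal K * (2 * ?g + 2 * ?q) = ennreal (2 * K) * (?g + ?q)"
        using K by (simp add: ennreal_mult distrib_left mult_ac)
      have "ennreal K * ((2 * ?g + ennreal (2 * e)) + (2 * ?q + 2 * (ennreal L * ennreal e)))
        = ennreal K * ((2 * ?g + 2 * ?q) + (ennreal (2 * e) + 2 * (ennreal L * ennreal e)))" by (simp only: add_ac)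
      also have "\<dots> = ennreal (2 * K) * (?g + ?q) + ennreal (K * (2 + 2 * L) / real (Suc k))"
        unfolding 1 by (subst distrib_left) (simp only: 2 3)
      finally show ?thesis .
    qed
    finally show "(\<integral>\<^sup>+x. ennreal ((\<phi> k x)\<^sup>2 / (crad V x)\<^sup>2) \<partial>lborel) \<le> ennreal (2 * K) * (?g + ?q) + ennreal (K * (2 + 2 * L) / real (Suc k))" .
  qed
qed

section \<open>The energy inequality\<close>

text \<open>For a = \<psi> grad u and b = u grad \<psi> the right side is the form tested with
  \<psi>^2 u. The mixed term is estimated through the upper bound of the matrix, not through
  symmetry, and absorbed into the ellipticity.\<close>

lemma elliptic_form_lower:
  fixes B :: "real^'n^'n" and a b :: "real^'n"
  assumes l: "lam > 0" and e: "\<And>\<xi> \<zeta>. \<bar>(B *v \<xi>) \<bullet> \<zeta>\<bar> \<le> Lam * norm \<xi> * norm \<zeta>" "\<And>\<xi>. (B *v \<xi>) \<bullet> \<xi> \<ge> lam * (norm \<xi>)\<^sup>2"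
  shows "lam / 4 * (norm (a + b))\<^sup>2 - (2 * Lam\<^sup>2 / lam + lam / 2) * (norm b)\<^sup>2 \<le> (B *v a) \<bullet> a + 2 * ((B *v a) \<bullet> b)"
proof -
  have "(norm (a + b))\<^sup>2 \<le> 2 * (norm a)\<^sup>2 + 2 * (norm b)\<^sup>2" by (rule norm_add_square_le)
  then have 1: "lam / 4 * (norm (a + b))\<^sup>2 \<le> lam / 4 * (2 * (norm a)\<^sup>2 + 2 * (norm b)\<^sup>2)" using l by (intro mult_left_mono) auto
  have 2: "(B *v a) \<bullet> b \<ge> - (Lam * norm a * norm b)" using e(1)[of a b] by (simp add: abs_le_iff)
  \<comment> \<open>Young's inequality weighted so as to spend lam/2 of the ellipticity; the other
    lam/2 pays for the term in a + b.\<close>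
  have "0 \<le> lam / 2 * (norm a - 2 * Lam / lam * norm b)\<^sup>2" using l by simp
  also have "\<dots> = lam / 2 * (norm a)\<^sup>2 - 2 * (Lam * norm a * norm b) + 2 * Lam\<^sup>2 / lam * (norm b)\<^sup>2"
    using l by (simp add: power2_eq_square field_simps)
  finally have 3: "0 \<le> lam / 2 * (norm a)\<^sup>2 - 2 * (Lam * norm a * norm b) + 2 * Lam\<^sup>2 / lam * (norm b)\<^sup>2" .
  show ?thesis using 1 2 3 e(2)[of a] by (simp add: algebra_simps)
qed

text \<open>A Caccioppoli inequality: the right side contains u but not its gradient, because
  ellipticity absorbs the mixed term.\<close>

lemma energy_inequality:
  fixes A :: "real^'n \<Rightarrow> real^'n^'n" and V W :: "real^'n \<Rightarrow> real"
  assumes l: "0 < lam" "lam \<le> 1" and ell: "bounded_elliptic lam Lam A" and sol: "weak_solution A W u"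
    and W: "W \<in> borel_measurable lebesgue" "AE x in lebesgue. W x = V x"
    and rh: "rh_weight p C V" and np: "real CARD('n) \<le> 2 * p"
    and v: "sobolev_loc v G" "AE x in lebesgue. u x = v x" "AE x in lebesgue. weak_grad u x = G x"
    "weak_grad u \<in> borel_measurable lebesgue"
    and t: "test_function \<psi>" and M: "M > 0" "\<And>x. norm x > M \<Longrightarrow> \<psi> x = 0" "\<And>x. norm x > M \<Longrightarrow> grad \<psi> x = 0"
  shows "(\<integral>\<^sup>+x. ennreal ((norm (\<psi> x *\<^sub>R G x + v x *\<^sub>R grad \<psi> x))\<^sup>2) \<partial>lborel) + (\<integral>\<^sup>+x. ennreal (V x * (\<psi> x * v x)\<^sup>2) \<partial>lborel)
    \<le> ennreal (4 / lam * (2 * Lam\<^sup>2 / lam + lam / 2)) * (\<integral>\<^sup>+x. ennreal ((v x)\<^sup>2 * (norm (grad \<psi> x))\<^sup>2) \<partial>lborel)"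
proof -
  note s = test_function_smooth[OF t]
  define F where "F = (\<lambda>x. \<psi> x *\<^sub>R G x + v x *\<^sub>R grad \<psi> x)"
  define f where "f = (\<lambda>x. \<psi> x * v x)"
  have sc: "sobolev_compact M f F" unfolding f_def F_def by (rule sobolev_loc_mult[OF v(1) t M(2,3)])
  have bm: "v \<in> borel_measurable borel" "G \<in> borel_measurable borel" "\<psi> \<in> borel_measurable borel" "grad \<psi> \<in> borel_measurable borel"
      "V \<in> borel_measurable borel" "f \<in> borel_measurable borel" "F \<in> borel_measurable borel"
    using v(1) smooth_borel[OF s] smooth_grad_borel[OF s] rh_borel[OF rh] sc by (auto simp: sobolev_loc_def sobolev_compact_def)
  have Am: "A \<in> borel_measurable lebesgue" using ell by (simp add: bounded_elliptic_def)
  define b where "b = (\<lambda>x. v x *\<^sub>R grad \<psi> x)"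
  define a where "a = (\<lambda>x. \<psi> x *\<^sub>R G x)"
  have Fab: "F x = a x + b x" for x by (simp add: F_def a_def b_def)
  have ab_m: "a \<in> borel_measurable borel" "b \<in> borel_measurable borel"
    unfolding a_def b_def using bm by (auto intro!: borel_measurable_scaleR)
  obtain Bd where Bd: "Bd > 0" "\<And>x. \<bar>\<psi> x\<bar> \<le> Bd" "\<And>x. norm (grad \<psi> x) \<le> Bd" using test_function_bounded[OF t] by blast
  have ib: "integrable lborel (\<lambda>x. (norm (b x))\<^sup>2)"
  proof (rule Bochner_Integration.integrable_bound)
    show "integrable lborel (\<lambda>x. Bd\<^sup>2 * (indicator (cball 0 M) x *\<^sub>R (v x)\<^sup>2))"
      using v(1) by (intro integrable_mult_right) (simp add: sobolev_loc_def set_integrable_def)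
    show "(\<lambda>x. (norm (b x))\<^sup>2) \<in> borel_measurable lborel" using ab_m by simp
    show "AE x in lborel. norm ((norm (b x))\<^sup>2) \<le> norm (Bd\<^sup>2 * (indicator (cball 0 M) x *\<^sub>R (v x)\<^sup>2))"
    proof (rule AE_I2)
      fix x
      have "(norm (grad \<psi> x))\<^sup>2 \<le> Bd\<^sup>2" using Bd(1) Bd(3)[of x] by (intro power_mono) auto
      then have "(v x)\<^sup>2 * (norm (grad \<psi> x))\<^sup>2 \<le> Bd\<^sup>2 * (v x)\<^sup>2"
        by (subst mult.commute) (rule mult_right_mono, auto)
      then show "norm ((norm (b x))\<^sup>2) \<le> norm (Bd\<^sup>2 * (indicator (cball 0 M) x *\<^sub>R (v x)\<^sup>2))"
        using M(3)[of x] by (cases "norm x \<le> M") (auto simp: b_def power_mult_distrib)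
    qed
  qed
  have iF: "integrable lborel (\<lambda>x. (norm (F x))\<^sup>2)" using sc by (simp add: sobolev_compact_def)
  have ia: "integrable lborel (\<lambda>x. (norm (a x))\<^sup>2)"
    using integrable_square_norm_diff[OF _ _ iF ib] bm ab_m by (simp add: Fab)
  have q0: "0 \<le> V x * (f x)\<^sup>2" for x using rh_nonneg[OF rh, of x] by simp
  obtain K where K: "K \<ge> 0" "\<And>f F. sobolev_compact M f F \<Longrightarrow>
    (\<integral>\<^sup>+x. ennreal (V x * (f x)\<^sup>2) \<partial>lborel) \<le> ennreal K * (\<integral>\<^sup>+x. ennreal ((norm (F x))\<^sup>2) \<partial>lborel)"
    using sobolev_trace[OF rh np M(1)] by blast
  \<comment> \<open>This integrability is what allows the vanishing integral of E + V f^2 to be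
    split into two.\<close>
  have iq: "integrable lborel (\<lambda>x. V x * (f x)\<^sup>2)"
  proof (rule integrableI_nonneg)
    show "(\<lambda>x. V x * (f x)\<^sup>2) \<in> borel_measurable lborel" using bm by simp
    have "(\<integral>\<^sup>+x. ennreal (V x * (f x)\<^sup>2) \<partial>lborel) \<le> ennreal K * (\<integral>\<^sup>+x. ennreal ((norm (F x))\<^sup>2) \<partial>lborel)" by (rule K(2)[OF sc])
    also have "\<dots> < \<infinity>" unfolding sobolev_energy_nn[OF sc] by (simp add: ennreal_mult_less_top)
    finally show "(\<integral>\<^sup>+x. ennreal (V x * (f x)\<^sup>2) \<partial>lborel) < \<infinity>" .
  qed (use q0 in simp)
  define E where "E = (\<lambda>x. (A x *v a x) \<bullet> a x + 2 * ((A x *v a x) \<bullet> b x))"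
  have Em: "E \<in> borel_measurable lebesgue"
    unfolding E_def using ab_m
    by (intro borel_measurable_add borel_measurable_times borel_measurable_const lebesgue_matrix_form Am lebesgue_measurable_borel)
  have ellAE: "AE x in lebesgue. (\<forall>\<xi> \<zeta>. \<bar>(A x *v \<xi>) \<bullet> \<zeta>\<bar> \<le> Lam * norm \<xi> * norm \<zeta> \<and> (A x *v \<xi>) \<bullet> \<xi> \<ge> lam * (norm \<xi>)\<^sup>2)"
    using ell by (simp add: bounded_elliptic_def)
  have leb: "integrable lebesgue g \<and> (LINT x|lebesgue. g x) = (LINT x|lborel. g x)" if "integrable lborel g" for g :: "real^'n \<Rightarrow> real"
    using that integrable_completion[of g lborel] integral_completion[of g lborel] by auto
  have iE: "integrable lebesgue E"
  proof (rule Bochner_Integration.integrable_bound[OF _ Em])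
    have "integrable lborel (\<lambda>x. 2 * \<bar>Lam\<bar> * (norm (a x))\<^sup>2 + \<bar>Lam\<bar> * (norm (b x))\<^sup>2)" using ia ib by simp
    then show "integrable lebesgue (\<lambda>x. 2 * \<bar>Lam\<bar> * (norm (a x))\<^sup>2 + \<bar>Lam\<bar> * (norm (b x))\<^sup>2)" using leb by blast
    show "AE x in lebesgue. norm (E x) \<le> norm (2 * \<bar>Lam\<bar> * (norm (a x))\<^sup>2 + \<bar>Lam\<bar> * (norm (b x))\<^sup>2)"
      using ellAE
    proof eventually_elim
      case (elim x)
      have L: "Lam * c \<le> \<bar>Lam\<bar> * c" if "c \<ge> 0" for c using that by (intro mult_right_mono) auto
      have 1: "\<bar>(A x *v a x) \<bullet> a x\<bar> \<le> \<bar>Lam\<bar> * (norm (a x))\<^sup>2"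
        using elim[rule_format, of "a x" "a x"] L[of "(norm (a x))\<^sup>2"] by (simp add: power2_eq_square mult.assoc)
      have "\<bar>(A x *v a x) \<bullet> b x\<bar> \<le> \<bar>Lam\<bar> * (norm (a x) * norm (b x))"
        using elim[rule_format, of "a x" "b x"] L[of "norm (a x) * norm (b x)"] by (simp add: mult.assoc)
      moreover have "2 * (norm (a x) * norm (b x)) \<le> (norm (a x))\<^sup>2 + (norm (b x))\<^sup>2"
        using zero_le_power2[of "norm (a x) - norm (b x)"] by (simp add: power2_eq_square algebra_simps)
      then have "\<bar>Lam\<bar> * (2 * (norm (a x) * norm (b x))) \<le> \<bar>Lam\<bar> * ((norm (a x))\<^sup>2 + (norm (b x))\<^sup>2)" by (intro mult_left_mono) auto
      ultimately have 2: "2 * \<bar>(A x *v a x) \<bullet> b x\<bar> \<le> \<bar>Lam\<bar> * (norm (a x))\<^sup>2 + \<bar>Lam\<bar> * (norm (b x))\<^sup>2"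
        by (simp add: algebra_simps)
      have "\<bar>E x\<bar> \<le> \<bar>(A x *v a x) \<bullet> a x\<bar> + 2 * \<bar>(A x *v a x) \<bullet> b x\<bar>" unfolding E_def by linarith
      also have "\<dots> \<le> 2 * \<bar>Lam\<bar> * (norm (a x))\<^sup>2 + \<bar>Lam\<bar> * (norm (b x))\<^sup>2" using 1 2 by linarith
      finally show ?case by simp
    qed
  qed
  have zero: "(LINT x|lebesgue. E x + V x * (f x)\<^sup>2) = 0"
  proof -
    have "(LINT x|lebesgue. E x + V x * (f x)\<^sup>2)
       = (LINT x|lebesgue. (A x *v G x) \<bullet> ((\<psi> x)\<^sup>2 *\<^sub>R G x + (2 * \<psi> x * v x) *\<^sub>R grad \<psi> x) + W x * (\<psi> x * v x)\<^sup>2)"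
    proof (rule integral_cong_AE)
      show "(\<lambda>x. E x + V x * (f x)\<^sup>2) \<in> borel_measurable lebesgue"
        using bm by (intro borel_measurable_add Em lebesgue_measurable_borel) simp
      have B1: "(\<lambda>x. (\<psi> x)\<^sup>2 *\<^sub>R G x + (2 * \<psi> x * v x) *\<^sub>R grad \<psi> x) \<in> borel_measurable borel"
        using bm by (intro borel_measurable_add borel_measurable_scaleR borel_measurable_power borel_measurable_times borel_measurable_const) auto
      have B2: "(\<lambda>x. (\<psi> x * v x)\<^sup>2) \<in> borel_measurable borel" using bm by simp
      show "(\<lambda>x. (A x *v G x) \<bullet> ((\<psi> x)\<^sup>2 *\<^sub>R G x + (2 * \<psi> x * v x) *\<^sub>R grad \<psi> x) + W x * (\<psi> x * v x)\<^sup>2) \<in> borel_measurable lebesgue"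
        using bm by (intro borel_measurable_add[OF lebesgue_matrix_form[OF Am _ lebesgue_measurable_borel[OF B1]]]
          borel_measurable_times[OF W(1) lebesgue_measurable_borel[OF B2]] lebesgue_measurable_borel) auto
      show "AE x in lebesgue. E x + V x * (f x)\<^sup>2 = (A x *v G x) \<bullet> ((\<psi> x)\<^sup>2 *\<^sub>R G x + (2 * \<psi> x * v x) *\<^sub>R grad \<psi> x) + W x * (\<psi> x * v x)\<^sup>2"
        using W(2)
      proof eventually_elim
        case (elim x)
        have "A x *v (\<psi> x *\<^sub>R G x) = \<psi> x *\<^sub>R (A x *v G x)" by (rule matrix_vector_mult_scaleR)
        then show ?case using elim
          by (simp add: E_def a_def b_def f_def inner_add_right power2_eq_square algebra_simps)
      qed
    qed
    also have "\<dots> = 0" by (rule weak_solution_localized[OF sol Am W(1) v t])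
    finally show ?thesis .
  qed
  define c1 where "c1 = 2 * Lam\<^sup>2 / lam + lam / 2"
  have c1: "c1 \<ge> 0" using l by (simp add: c1_def)
  have "(LINT x|lborel. lam / 4 * (norm (F x))\<^sup>2 - c1 * (norm (b x))\<^sup>2) + (LINT x|lborel. V x * (f x)\<^sup>2) \<le> 0"
  proof -
    have i1: "integrable lborel (\<lambda>x. lam / 4 * (norm (F x))\<^sup>2 - c1 * (norm (b x))\<^sup>2)" using iF ib by simp
    have "(LINT x|lborel. lam / 4 * (norm (F x))\<^sup>2 - c1 * (norm (b x))\<^sup>2) = (LINT x|lebesgue. lam / 4 * (norm (F x))\<^sup>2 - c1 * (norm (b x))\<^sup>2)"
      using leb[OF i1] by simp
    also have "\<dots> \<le> (LINT x|lebesgue. E x)"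
    proof (rule integral_mono_AE)
      show "integrable lebesgue (\<lambda>x. lam / 4 * (norm (F x))\<^sup>2 - c1 * (norm (b x))\<^sup>2)" using leb[OF i1] by simp
      show "AE x in lebesgue. lam / 4 * (norm (F x))\<^sup>2 - c1 * (norm (b x))\<^sup>2 \<le> E x"
        using ellAE
      proof eventually_elim
        case (elim x)
        show ?case unfolding Fab c1_def E_def using elim by (intro elliptic_form_lower[OF l(1)]) blast+
      qed
    qed (rule iE)
    finally have "(LINT x|lborel. lam / 4 * (norm (F x))\<^sup>2 - c1 * (norm (b x))\<^sup>2) \<le> (LINT x|lebesgue. E x)" .
    moreover have "(LINT x|lebesgue. E x) + (LINT x|lborel. V x * (f x)\<^sup>2) = 0"
      using zero iE leb[OF iq] by simp
    ultimately show ?thesis by linarith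
  qed
  then have r1: "lam / 4 * (LINT x|lborel. (norm (F x))\<^sup>2) + (LINT x|lborel. V x * (f x)\<^sup>2) \<le> c1 * (LINT x|lborel. (norm (b x))\<^sup>2)"
    using iF ib by simp
  \<comment> \<open>Here lam \<le> 1 enters: lam/4 \<le> 1 lets the potential term take the
    coefficient of the gradient term.\<close>
  have q1: "lam / 4 * (LINT x|lborel. V x * (f x)\<^sup>2) \<le> 1 * (LINT x|lborel. V x * (f x)\<^sup>2)"
    using l q0 by (intro mult_right_mono Bochner_Integration.integral_nonneg) auto
  have "lam / 4 * ((LINT x|lborel. (norm (F x))\<^sup>2) + (LINT x|lborel. V x * (f x)\<^sup>2)) \<le> c1 * (LINT x|lborel. (norm (b x))\<^sup>2)"
    using r1 q1 by (simp add: algebra_simps)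
  then have r2: "(LINT x|lborel. (norm (F x))\<^sup>2) + (LINT x|lborel. V x * (f x)\<^sup>2) \<le> 4 / lam * c1 * (LINT x|lborel. (norm (b x))\<^sup>2)"
    using l by (simp add: field_simps)
  have "(\<integral>\<^sup>+x. ennreal ((norm (F x))\<^sup>2) \<partial>lborel) + (\<integral>\<^sup>+x. ennreal (V x * (f x)\<^sup>2) \<partial>lborel)
     = ennreal ((LINT x|lborel. (norm (F x))\<^sup>2) + (LINT x|lborel. V x * (f x)\<^sup>2))"
    unfolding sobolev_energy_nn[OF sc]
    using q0 by (subst nn_integral_eq_integral[OF iq]) (auto intro!: ennreal_plus[symmetric] Bochner_Integration.integral_nonneg)
  also have "\<dots> \<le> ennreal (4 / lam * c1 * (LINT x|lborel. (norm (b x))\<^sup>2))" using r2 by (rule ennreal_leI)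
  also have "\<dots> = ennreal (4 / lam * c1) * ennreal (LINT x|lborel. (norm (b x))\<^sup>2)"
    using l c1 by (intro ennreal_mult) auto
  also have "ennreal (LINT x|lborel. (norm (b x))\<^sup>2) = (\<integral>\<^sup>+x. ennreal ((norm (b x))\<^sup>2) \<partial>lborel)"
    by (rule nn_integral_eq_integral[OF ib, symmetric]) simp
  also have "\<dots> = (\<integral>\<^sup>+x. ennreal ((v x)\<^sup>2 * (norm (grad \<psi> x))\<^sup>2) \<partial>lborel)" by (simp add: b_def power_mult_distrib)
  finally show ?thesis by (simp add: F_def f_def c1_def)
qed

section \<open>From the class \<open>RH\<^sub>p\<close> to Borel weights\<close>

text \<open>An RH_infinity weight satisfies the inequality for every finite exponent with the same
  constant; n + 1 is an exponent above both 1 and n/2.\<close>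

definition rh_exponent :: "'n::finite itself \<Rightarrow> ereal \<Rightarrow> real" where
  "rh_exponent _ p = (if p = \<infinity> then real CARD('n) + 1 else real_of_ereal p)"

lemma rh_exponent:
  assumes "p \<ge> ereal (real CARD('n::finite) / 2)" "p > 1"
  shows "rh_exponent TYPE('n) p > 1" "real CARD('n) \<le> 2 * rh_exponent TYPE('n) p"
proof -
  have n: "real CARD('n) \<ge> 1" using zero_less_card_finite[where 'a = 'n] by linarith
  show "rh_exponent TYPE('n) p > 1" "real CARD('n) \<le> 2 * rh_exponent TYPE('n) p"
    using assms n by (cases p; auto simp: rh_exponent_def one_ereal_def)+
qed

text \<open>The averages in \<open>reverse_holder\<close> are genuine integrals, since W is locally
  integrable by p > 1, and they are positive since W > 0 almost everywhere. Raising C_V to at least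
  1 then only weakens the inequality.\<close>

lemma reverse_holder_weight:
  fixes W :: "real^'n \<Rightarrow> real"
  assumes p: "p \<ge> ereal (real CARD('n) / 2)" "p > 1" and W: "reverse_holder p C_V W"
  obtains V where "rh_weight (rh_exponent TYPE('n) p) (max 1 C_V) V"
    "W \<in> borel_measurable lebesgue" "AE x in lebesgue. W x = V x"
proof -
  define q where "q = rh_exponent TYPE('n) p"
  have q: "q > 1" using rh_exponent[OF p] by (simp add: q_def)
  define C where "C = max 1 C_V"
  have loc: "Lp_loc p W" and pos: "AE x in lebesgue. W x > 0"
    and rh: "\<And>x r. r > 0 \<Longrightarrow> Lp_average p (ball x r) W \<le> ereal (C_V * average (ball x r) W)"
    using W by (auto simp: reverse_holder_def)
  have Wm: "W \<in> borel_measurable lebesgue"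
    using loc by (intro lebesgue_measurable_local) (auto simp: Lp_loc_def Lp_on_def)
  obtain V0 where V0: "V0 \<in> borel_measurable borel" "AE x in lebesgue. W x = V0 x" using borel_representative[OF Wm] by blast
  \<comment> \<open>The absolute value makes the representative nonnegative everywhere; as W > 0
    almost everywhere, it still agrees with W there.\<close>
  define V where "V = (\<lambda>x. \<bar>V0 x\<bar>)"
  have Vb: "V \<in> borel_measurable borel" using V0 by (simp add: V_def)
  have WV: "AE x in lebesgue. W x = V x" using V0(2) pos by eventually_elim (simp add: V_def)
  have Vpos: "AE x in lborel. V x > 0"
  proof -
    have "AE x in lebesgue. V x > 0" using WV pos by eventually_elim simp
    then show ?thesis by (simp only: AE_completion_iff)
  qed
  have Vn: "V x \<ge> 0" for x by (simp add: V_def)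
  have mind: "(\<lambda>y. indicator (ball x r) y *\<^sub>R g y) \<in> borel_measurable lborel" if "g \<in> borel_measurable borel" for g :: "real^'n \<Rightarrow> real" and x r
    using that by (intro borel_measurable_scaleR borel_measurable_indicator) auto
  have Vqb: "(\<lambda>y. V y powr q) \<in> borel_measurable borel" using Vb by simp
  have tr: "(LINT y:ball x r|lebesgue. h y) = (LINT y:ball x r|lborel. g y)"
    if "g \<in> borel_measurable borel" "h \<in> borel_measurable lebesgue" "AE y in lebesgue. h y = g y" for g h :: "real^'n \<Rightarrow> real" and x r
  proof -
    have "(LINT y:ball x r|lebesgue. h y) = (LINT y:ball x r|lebesgue. g y)"
      unfolding set_lebesgue_integral_def
    proof (rule integral_cong_AE)
      show "(\<lambda>y. indicator (ball x r) y *\<^sub>R h y) \<in> borel_measurable lebesgue"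
        using that(2) by (intro borel_measurable_scaleR borel_measurable_indicator) auto
      show "(\<lambda>y. indicator (ball x r) y *\<^sub>R g y) \<in> borel_measurable lebesgue" by (rule lebesgue_measurable_borel) (use mind[OF that(1)] in simp)
      show "AE y in lebesgue. indicator (ball x r) y *\<^sub>R h y = indicator (ball x r) y *\<^sub>R g y"
        using that(3) by eventually_elim simp
    qed
    also have "\<dots> = (LINT y:ball x r|lborel. g y)"
      unfolding set_lebesgue_integral_def by (rule integral_completion) (rule mind[OF that(1)])
    finally show ?thesis .
  qed
  have av: "average (ball x r) W = avg V x r" for x r
    by (simp add: average_def avg_def tr[OF Vb Wm WV])
  have bnd: "AE y in lborel. y \<in> ball x r \<longrightarrow> V y \<le> C_V * avg V x r" if inf: "p = \<infinity>" and r: "r > 0" for x r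
  proof -
    have "esssup (lebesgue_on (ball x r)) (\<lambda>y. ereal \<bar>W y\<bar>) \<le> ereal (C_V * avg V x r)"
      using rh[OF r, of x] inf by (simp add: Lp_average_def av)
    from order_trans[OF _ this] have "AE y in lebesgue_on (ball x r). ereal \<bar>W y\<bar> \<le> ereal (C_V * avg V x r)"
      by (rule eventually_mono[OF esssup_AE])
    then have "AE y in lebesgue_on (ball x r). \<bar>W y\<bar> \<le> C_V * avg V x r" by simp
    then have "AE y in lebesgue. y \<in> ball x r \<longrightarrow> \<bar>W y\<bar> \<le> C_V * avg V x r"
      by (subst (asm) AE_restrict_space_iff) auto
    then have "AE y in lebesgue. y \<in> ball x r \<longrightarrow> V y \<le> C_V * avg V x r"
      using WV by eventually_elim auto
    then show ?thesis by (simp only: AE_completion_iff)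
  qed
  have cint: "integrable lborel (\<lambda>y. indicator (ball x r) y * c)" for x :: "real^'n" and r c :: real
    using set_integral_const_bounded(1)[of "ball x r" x r c] by (simp add: set_integrable_def)
  have Vq: "set_integrable lborel (ball x r) (\<lambda>y. V y powr q)" if r: "r > 0" for x r
  proof (cases "p = \<infinity>")
    case True
    show ?thesis unfolding set_integrable_def
    proof (rule Bochner_Integration.integrable_bound)
      show "integrable lborel (\<lambda>y. indicator (ball x r) y * (C_V * avg V x r) powr q)" by (rule cint)
      show "AE y in lborel. norm (indicator (ball x r) y *\<^sub>R V y powr q) \<le> norm (indicator (ball x r) y * (C_V * avg V x r) powr q)"
        using bnd[OF True r, of x] by eventually_elim (use q Vn in \<open>auto simp: indicator_def intro: powr_mono2\<close>)
    qed (rule mind[OF Vqb])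
  next
    case False
    then have pq: "p = ereal q" using p(2) by (cases p) (auto simp: q_def rh_exponent_def)
    have sub: "ball x r \<subseteq> cball 0 (norm x + r)"
    proof
      fix y assume "y \<in> ball x r"
      then show "y \<in> cball 0 (norm x + r)" using norm_triangle_sub[of y x] by (simp add: dist_norm norm_minus_commute)
    qed
    have "Lp_loc (ereal q) W" using loc by (simp only: pq)
    then have "set_integrable lebesgue (cball 0 (norm x + r)) (\<lambda>y. norm (W y) powr q)"
      by (simp only: Lp_loc_ereal_iff)
    then have "set_integrable lebesgue (ball x r) (\<lambda>y. norm (W y) powr q)"
      by (rule set_integrable_subset[OF _ _ sub]) simp
    then have "integrable lebesgue (\<lambda>y. indicator (ball x r) y *\<^sub>R norm (W y) powr q)" by (simp only: set_integrable_def)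
    then have "integrable lebesgue (\<lambda>y. indicator (ball x r) y *\<^sub>R V y powr q)"
    proof (rule integrable_cong_AE_imp)
      show "(\<lambda>y. indicator (ball x r) y *\<^sub>R V y powr q) \<in> borel_measurable lebesgue"
        by (rule lebesgue_measurable_borel) (use mind[OF Vqb] in simp)
      show "AE y in lebesgue. indicator (ball x r) y *\<^sub>R norm (W y) powr q = indicator (ball x r) y *\<^sub>R V y powr q"
        using WV by eventually_elim (simp add: Vn)
    qed
    then show ?thesis unfolding set_integrable_def by (simp only: integrable_completion[OF mind[OF Vqb]])
  qed
  have V1: "set_integrable lborel (ball x r) V" if r: "r > 0" for x r
    unfolding set_integrable_def
  proof (rule Bochner_Integration.integrable_bound)
    show "integrable lborel (\<lambda>y. indicator (ball x r) y * 1 + indicator (ball x r) y *\<^sub>R V y powr q)"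
      using cint[of x r 1] Vq[OF r, of x] by (intro Bochner_Integration.integrable_add) (simp_all add: set_integrable_def)
    have "V y \<le> 1 + V y powr q" for y using truncation_bound[OF Vn, of 1 q y] q by simp
    then show "AE y in lborel. norm (indicator (ball x r) y *\<^sub>R V y) \<le> norm (indicator (ball x r) y * 1 + indicator (ball x r) y *\<^sub>R V y powr q)"
      using Vn by (intro AE_I2) (auto simp: indicator_def)
  qed (rule mind[OF Vb])
  have avpos: "avg V x r > 0" if r: "r > 0" for x r
  proof -
    have n: "0 \<le> (LINT y:ball x r|lborel. V y)"
      unfolding set_lebesgue_integral_def using Vn by (intro Bochner_Integration.integral_nonneg) (simp add: indicator_def)
    have "(LINT y:ball x r|lborel. V y) \<noteq> 0"
    proof
      assume "(LINT y:ball x r|lborel. V y) = 0"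
      then have "AE y in lborel. indicator (ball x r) y *\<^sub>R V y = 0"
        unfolding set_lebesgue_integral_def using V1[OF r, of x] Vn
        by (subst (asm) integral_nonneg_eq_0_iff_AE) (auto simp: set_integrable_def indicator_def)
      then have "AE y in lborel. y \<notin> ball x r" using Vpos by eventually_elim (auto simp: indicator_def split: if_splits)
      moreover have "{y \<in> space lborel. \<not> y \<notin> ball x r} = ball x r" by auto
      ultimately have "emeasure lborel (ball x r) = 0" by (simp only: AE_iff_measurable[of "ball x r"] sets_lborel borel_open[OF open_ball])
      then show False using measure_ball_pos[OF r, of x] by (simp add: measure_def)
    qed
    then show ?thesis using n measure_ball_pos[OF r, of x] by (simp add: avg_def order_less_le)
  qed
  have ineq: "(LINT y:ball x r|lborel. V y powr q) \<le> measure lborel (ball x r) * (C * avg V x r) powr q" if r: "r > 0" for x r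
  proof (cases "p = \<infinity>")
    case True
    have cv: "V y \<le> C * avg V x r" if "V y \<le> C_V * avg V x r" for y
      by (rule order_trans[OF that mult_right_mono]) (use avpos[OF r, of x] in \<open>simp_all add: C_def\<close>)
    have "(LINT y:ball x r|lborel. V y powr q) \<le> (LINT y|lborel. indicator (ball x r) y * (C * avg V x r) powr q)"
      unfolding set_lebesgue_integral_def
    proof (rule integral_mono_AE)
      show "integrable lborel (\<lambda>y. indicator (ball x r) y *\<^sub>R V y powr q)" using Vq[OF r, of x] by (simp only: set_integrable_def)
      show "AE y in lborel. indicator (ball x r) y *\<^sub>R V y powr q \<le> indicator (ball x r) y * (C * avg V x r) powr q"
        using bnd[OF True r, of x] by eventually_elim (use q Vn cv in \<open>auto simp: indicator_def intro: powr_mono2\<close>)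
    qed (rule cint)
    also have "\<dots> = measure lborel (ball x r) * (C * avg V x r) powr q" by simp
    finally show ?thesis .
  next
    case False
    then have pq: "p = ereal q" using p(2) by (cases p) (auto simp: q_def rh_exponent_def)
    define S where "S = (LINT y:ball x r|lborel. V y powr q)"
    have S: "S \<ge> 0" unfolding S_def set_lebesgue_integral_def by (intro Bochner_Integration.integral_nonneg) (simp add: indicator_def)
    have m: "measure lborel (ball x r) > 0" by (rule measure_ball_pos[OF r])
    have "(\<lambda>y. \<bar>W y\<bar> powr q) \<in> borel_measurable lebesgue" using Wm by simp
    moreover have "AE y in lebesgue. \<bar>W y\<bar> powr q = V y powr q" using WV by eventually_elim (simp add: V_def)
    ultimately have "average (ball x r) (\<lambda>y. \<bar>W y\<bar> powr q) = S / measure lborel (ball x r)"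
      using tr[OF Vqb, of "\<lambda>y. \<bar>W y\<bar> powr q" x r] by (simp add: average_def S_def)
    then have "(S / measure lborel (ball x r)) powr (1 / q) \<le> C_V * avg V x r"
      using rh[OF r, of x] by (simp add: Lp_average_def pq av)
    also have "\<dots> \<le> C * avg V x r" using avpos[OF r, of x] by (intro mult_right_mono) (auto simp: C_def)
    finally have "((S / measure lborel (ball x r)) powr (1 / q)) powr q \<le> (C * avg V x r) powr q"
      using q by (intro powr_mono2) auto
    then have "S / measure lborel (ball x r) \<le> (C * avg V x r) powr q"
      using q S m by (simp add: powr_powr)
    then show ?thesis using m by (simp add: S_def field_simps)
  qed
  have "rh_weight q C V"
    unfolding rh_weight_def
  proof (intro conjI allI impI)
    show "set_integrable lborel (ball x r) (\<lambda>y. V y powr q)" for x r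
      using Vq[of r x] by (cases "r > 0") (auto simp: set_integrable_def ball_empty)
  qed (use q Vb Vn avpos ineq in \<open>auto simp: C_def\<close>)
  then show ?thesis using that Wm WV by (simp add: q_def C_def)
qed

section \<open>Regularization of the Agmon distance\<close>

text \<open>The difference quotient in the direction of the gradient itself tends to |grad g|^2 and
  is at most K |grad g|.\<close>

lemma grad_norm_le:
  fixes g :: "real^'n \<Rightarrow> real"
  assumes g: "smooth g" and d: "d > 0" and lip: "\<And>h. norm h < d \<Longrightarrow> \<bar>g (x + h) - g x\<bar> \<le> K * norm h"
  shows "norm (grad g x) \<le> K"
proof -
  define G where "G = grad g x"
  have "((\<lambda>t::real. x + t *\<^sub>R G) has_derivative (\<lambda>t. t *\<^sub>R G)) (at 0)"
    by (auto intro!: derivative_eq_intros)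
  moreover have "(g has_derivative (\<lambda>h. G \<bullet> h)) (at (x + 0 *\<^sub>R G))"
    using smooth_has_derivative[OF g, of x] by (simp add: G_def)
  ultimately have "((\<lambda>t::real. g (x + t *\<^sub>R G)) has_derivative (\<lambda>t. G \<bullet> (t *\<^sub>R G))) (at 0)"
    by (rule has_derivative_compose)
  then have "((\<lambda>t::real. g (x + t *\<^sub>R G)) has_field_derivative (G \<bullet> G)) (at 0)"
    by (simp add: has_field_derivative_def mult.commute[of _ "G \<bullet> G"])
  then have lim: "((\<lambda>t::real. (g (x + t *\<^sub>R G) - g x) / t) \<longlongrightarrow> G \<bullet> G) (at 0)"
    by (simp add: DERIV_def)
  have ev: "eventually (\<lambda>t::real. (g (x + t *\<^sub>R G) - g x) / t \<le> K * norm G) (at 0)"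
    unfolding eventually_at
  proof (intro exI conjI ballI impI)
    show "d / (norm G + 1) > 0" using d by (simp add: add_nonneg_pos)
    fix t :: real assume t: "t \<noteq> 0 \<and> dist t 0 < d / (norm G + 1)"
    have "\<bar>t\<bar> * norm G \<le> \<bar>t\<bar> * (norm G + 1)" by (intro mult_left_mono) auto
    also have "\<dots> < d" using t by (simp add: pos_less_divide_eq add_nonneg_pos)
    finally have "\<bar>g (x + t *\<^sub>R G) - g x\<bar> \<le> K * (\<bar>t\<bar> * norm G)" using lip[of "t *\<^sub>R G"] by simp
    then have "\<bar>(g (x + t *\<^sub>R G) - g x) / t\<bar> \<le> K * norm G"
      using t by (simp add: abs_divide pos_divide_le_eq mult_ac)
    then show "(g (x + t *\<^sub>R G) - g x) / t \<le> K * norm G" by linarith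
  qed
  have "G \<bullet> G \<le> K * norm G" by (rule tendsto_upperbound[OF lim ev]) simp
  then have le: "norm G * norm G \<le> K * norm G" by (simp add: dot_square_norm power2_eq_square)
  show ?thesis
  proof (cases "G = 0")
    case True
    \<comment> \<open>If the gradient vanishes, K \<ge> 0 still has to be read off from the
      Lipschitz bound, at some h of length d/2.\<close>
    obtain h :: "real^'n" where h: "norm h = d / 2" using vector_choose_size[of "d / 2"] d by auto
    have "0 \<le> K * norm h" by (rule order_trans[OF abs_ge_zero lip]) (use h d in simp)
    then have "K \<ge> 0" using h d by (simp add: zero_le_mult_iff)
    then show ?thesis using True by (simp add: G_def)
  next
    case False
    then show ?thesis using le by (simp add: G_def)
  qed
qed

section \<open>Mollifying functions with local Lipschitz bounds\<close>

lemma mollify_translate: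
  fixes \<rho> w :: "real^'n \<Rightarrow> real"
  assumes r: "\<rho> \<in> borel_measurable borel" and w: "w \<in> borel_measurable borel"
  shows "mollify \<rho> w (x + h) = mollify \<rho> (\<lambda>y. w (y + h)) x"
proof -
  have r': "(\<lambda>y. \<rho> (z - y)) \<in> borel_measurable borel" for z by (rule measurable_compose[OF _ r]) simp
  have w': "(\<lambda>y. w (y + h)) \<in> borel_measurable borel" by (rule measurable_compose[OF _ w]) simp
  have "mollify \<rho> w (x + h) = (LINT y|lborel. \<rho> (x + h - (x + h - y)) * w (x + h - y))"
    unfolding mollify_def using r' w
    by (intro integral_reflect[of "\<lambda>y. \<rho> (x + h - y) * w y" "x + h", symmetric] borel_measurable_times)
  also have "\<dots> = (LINT y|lborel. \<rho> (x - (x - y)) * w ((x - y) + h))"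
    by (simp add: algebra_simps)
  also have "\<dots> = mollify \<rho> (\<lambda>y. w (y + h)) x"
    unfolding mollify_def using r' w'
    by (intro integral_reflect[of "\<lambda>y. \<rho> (x - y) * w (y + h)" x] borel_measurable_times)
  finally show ?thesis .
qed

text \<open>A difference of mollifications is the mollification of w(y + h) - w(y), so a Lipschitz
  bound near x becomes a gradient bound at x with the same constant. Locality matters because
  \<Gamma> / r(x) varies with x.\<close>

lemma grad_mollify_le:
  fixes \<rho> w :: "real^'n \<Rightarrow> real"
  assumes m: "mollifier e \<rho>" and w: "integrable lborel w" and d: "d > 0"
    and lip: "\<And>y h. norm (x - y) < e \<Longrightarrow> norm h < d \<Longrightarrow> \<bar>w (y + h) - w y\<bar> \<le> K * norm h"
  shows "norm (grad (mollify \<rho> w) x) \<le> K"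
proof (rule grad_norm_le[OF smooth_mollify[OF mollifier_test_function[OF m] w] d])
  fix h :: "real^'n" assume h: "norm h < d"
  have "integrable lborel (\<lambda>y. w (h - (0 - y)))" by (intro integrable_reflect[of "\<lambda>y. w (h - y)"] integrable_reflect w)
  then have wh: "integrable lborel (\<lambda>y. w (y + h))" by (simp add: add.commute)
  have "mollify \<rho> w (x + h) - mollify \<rho> w x = mollify \<rho> (\<lambda>y. w (y + h) - w y) x"
    unfolding mollify_diff[OF mollifier_test_function[OF m] wh w]
    using mollify_translate[of \<rho> w x h] m w smooth_borel[of \<rho>] by (simp add: mollifier_def)
  moreover have "- (K * norm h) \<le> mollify \<rho> (\<lambda>y. w (y + h) - w y) x" "mollify \<rho> (\<lambda>y. w (y + h) - w y) x \<le> K * norm h"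
    using mollify_bounds[OF m Bochner_Integration.integrable_diff[OF wh w], of x "- (K * norm h)" "K * norm h"] lip h
    by (force simp: abs_le_iff)+
  ultimately show "\<bar>mollify \<rho> w (x + h) - mollify \<rho> w x\<bar> \<le> K * norm h" by (simp add: abs_le_iff)
qed

lemma cutoff_exists:
  assumes R: "R > 0"
  obtains \<eta> :: "real^'n \<Rightarrow> real" where "test_function \<eta>" "\<And>x. 0 \<le> \<eta> x" "\<And>x. \<eta> x \<le> 1"
    "\<And>x. norm x \<le> R \<Longrightarrow> \<eta> x = 1" "\<And>x. norm x \<ge> R + 1 \<Longrightarrow> \<eta> x = 0" "\<And>x. norm (grad \<eta> x) \<le> 2"
    "\<And>x. norm x \<le> R \<or> norm x \<ge> R + 1 \<Longrightarrow> grad \<eta> x = 0"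
proof -
  \<comment> \<open>Mollification radius 1/8 and a ramp of slope 2 from R + 1/4 to R + 3/4: for |x|
    \<le> R or |x| \<ge> R + 1, points within 1/8 + 1/8 of x stay on a constant piece.\<close>
  obtain \<rho> :: "real^'n \<Rightarrow> real" where m: "mollifier (1/8) \<rho>" using mollifier_exists[of "1/8"] by auto
  define w :: "real^'n \<Rightarrow> real" where "w = (\<lambda>y. max 0 (min 1 (2 * (R + 3/4 - norm y))))"
  have w01: "0 \<le> w y" "w y \<le> 1" for y by (auto simp: w_def)
  have w1: "w y = 1" if "norm y \<le> R + 1/4" for y using that by (simp add: w_def)
  have w0: "w y = 0" if "norm y \<ge> R + 3/4" for y using that by (simp add: w_def)
  have wi: "integrable lborel w"
    by (rule continuous_compact_support_integrable[of _ "R + 3/4"]) (use w0 in \<open>auto simp: w_def intro!: continuous_intros\<close>)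
  have nb: "norm x - norm y \<le> norm (x - y)" "norm y - norm x \<le> norm (x - y)" for x y :: "real^'n"
    using norm_triangle_ineq2[of x y] norm_triangle_ineq2[of y x] by (simp_all add: norm_minus_commute)
  have nh: "norm y - norm h \<le> norm (y + h)" "norm (y + h) \<le> norm y + norm h" for y h :: "real^'n"
    using norm_diff_ineq[of y h] norm_triangle_ineq[of y h] by simp_all
  have e1: "mollify \<rho> w x = 1" if "norm x \<le> R" for x
  proof -
    have "w y = 1" if "norm (x - y) < 1/8" for y using nb(2)[of y x] that \<open>norm x \<le> R\<close> by (intro w1) simp
    then show ?thesis using mollify_bounds[OF m wi, of x 1 1] by fastforce
  qed
  have e0: "mollify \<rho> w x = 0" if "norm x \<ge> R + 1" for x
  proof -
    have "w y = 0" if "norm (x - y) < 1/8" for y using nb(1)[of x y] that \<open>norm x \<ge> R + 1\<close> by (intro w0) simp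
    then show ?thesis using mollify_bounds[OF m wi, of x 0 0] by fastforce
  qed
  have g2: "norm (grad (mollify \<rho> w) x) \<le> 2" for x
  proof (rule grad_mollify_le[OF m wi, of 1])
    fix y h :: "real^'n"
    show "\<bar>w (y + h) - w y\<bar> \<le> 2 * norm h" using nh[of y h] by (simp add: w_def abs_le_iff max_def min_def)
  qed simp
  have g0: "grad (mollify \<rho> w) x = 0" if x: "norm x \<le> R \<or> norm x \<ge> R + 1" for x
  proof -
    have "norm (grad (mollify \<rho> w) x) \<le> 0"
    proof (rule grad_mollify_le[OF m wi, of "1/8"])
      fix y h :: "real^'n" assume y: "norm (x - y) < 1/8" and h: "norm h < 1/8"
      from x have "w (y + h) = w y"
      proof
        assume "norm x \<le> R"
        then have "norm y \<le> R + 1/4" "norm (y + h) \<le> R + 1/4" using y h nb(2)[of y x] nh(2)[of y h] by linarith+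
        then show ?thesis by (simp add: w1)
      next
        assume "norm x \<ge> R + 1"
        then have "norm y \<ge> R + 3/4" "norm (y + h) \<ge> R + 3/4" using y h nb(1)[of x y] nh(1)[of y h] by linarith+
        then show ?thesis by (simp add: w0)
      qed
      then show "\<bar>w (y + h) - w y\<bar> \<le> 0 * norm h" by simp
    qed simp
    then show ?thesis by simp
  qed
  have "test_function (mollify \<rho> w)"
    by (rule test_function_mollify[OF m wi, of "R + 3/4"]) (simp add: w0)
  moreover have "0 \<le> mollify \<rho> w x" "mollify \<rho> w x \<le> 1" for x
    using mollify_bounds[OF m wi, of x 0 1] w01 by auto
  ultimately show ?thesis using that[of "mollify \<rho> w"] e1 e0 g2 g0 by blast
qed

lemma agmon_dist_continuous:
  fixes V :: "real^'n \<Rightarrow> real"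
  assumes rh: "rh_weight p C V" and np: "real CARD('n) \<le> 2 * p" and W: "\<And>x. agmon_m W x = 1 / crad V x"
    and sv: "\<And>x z. dist x z \<le> c * crad V x \<Longrightarrow> crad V x \<le> \<Gamma> * crad V z" and G: "\<Gamma> \<ge> 1" and c: "c > 0"
  shows "continuous_on UNIV (\<lambda>x. agmon_dist W x 0)"
  unfolding continuous_on_def
proof
  fix x :: "real^'n"
  have s: "c * crad V x > 0" using c crad_pos[OF rh np] by simp
  have "((\<lambda>y. agmon_dist W y 0 - agmon_dist W x 0) \<longlongrightarrow> 0) (at x)"
  proof (rule Lim_null_comparison)
    show "eventually (\<lambda>y. norm (agmon_dist W y 0 - agmon_dist W x 0) \<le> \<Gamma> / crad V x * norm (y - x)) (at x)"
      unfolding eventually_at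
    proof (intro exI[of _ "c * crad V x"] conjI ballI impI s)
      fix y assume "y \<noteq> x \<and> dist y x < c * crad V x"
      then show "norm (agmon_dist W y 0 - agmon_dist W x 0) \<le> \<Gamma> / crad V x * norm (y - x)"
        using agmon_dist_lipschitz[OF rh np W sv G, of x "c * crad V x" y x] s by (simp add: dist_commute)
    qed
    have "((\<lambda>y. \<Gamma> / crad V x * norm (y - x)) \<longlongrightarrow> \<Gamma> / crad V x * norm (x - x)) (at x)" by (intro tendsto_intros)
    then show "((\<lambda>y. \<Gamma> / crad V x * norm (y - x)) \<longlongrightarrow> 0) (at x)" by simp
  qed
  then show "((\<lambda>x. agmon_dist W x 0) \<longlongrightarrow> agmon_dist W x 0) (at x within UNIV)" by (simp add: LIM_zero_cancel)
qed

text \<open>One mollification radius works on the whole ball because \<open>crad\<close> is bounded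
  below there, yet the gradient bound keeps the local radius at x.\<close>

lemma agmon_dist_regularization:
  fixes V :: "real^'n \<Rightarrow> real"
  assumes rh: "rh_weight p C V" and np: "real CARD('n) \<le> 2 * p" and W: "\<And>x. agmon_m W x = 1 / crad V x"
    and sv: "\<And>x z. dist x z \<le> c * crad V x \<Longrightarrow> crad V x \<le> \<Gamma> * crad V z" and G: "\<Gamma> \<ge> 1" and c: "c > 0"
    and L: "L > 0"
  obtains g where "smooth g" "\<And>x. norm x \<le> R + 1 \<Longrightarrow> \<bar>g x - agmon_dist W x 0\<bar> \<le> L"
    "\<And>x. norm x \<le> R + 1 \<Longrightarrow> norm (grad g x) \<le> \<Gamma> / crad V x"
proof -
  obtain b where b: "b > 0" "\<And>x. norm x \<le> R + 2 \<Longrightarrow> crad V x \<ge> b"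
    using crad_locally_bounded_below[OF rh np, where M = "R + 2"] by blast
  \<comment> \<open>1/4 keeps all points inside the ball of radius R + 2, c b / 2 keeps them where
    slow variation holds, and L b / \<Gamma> bounds the oscillation by L.\<close>
  define e where "e = min (1/4) (min (c * b / 2) (L * b / \<Gamma>))"
  have e: "e > 0" "e \<le> 1/4" "2 * e \<le> c * b" using b(1) c L G min.cobounded1[of "1/4" "min (c * b / 2) (L * b / \<Gamma>)"] by (simp_all add: e_def del: min.cobounded1)
  have "e \<le> L * b / \<Gamma>" by (simp add: e_def)
  then have e4: "\<Gamma> / b * e \<le> L" using b G by (simp add: field_simps)
  obtain \<rho> :: "real^'n \<Rightarrow> real" where m: "mollifier e \<rho>" using mollifier_exists[OF e(1)] by blast
  define D where "D = (\<lambda>x. agmon_dist W x 0)"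
  have Dc: "continuous_on UNIV D" unfolding D_def by (rule agmon_dist_continuous[OF rh np W sv G c])
  \<comment> \<open>Truncation supplies the integrability that mollification asks for; near the
    points considered it changes nothing.\<close>
  define w where "w = (\<lambda>y. indicator (cball 0 (R + 2)) y *\<^sub>R D y)"
  have wi: "integrable lborel w"
    unfolding w_def by (rule borel_integrable_compact) (auto intro: continuous_on_subset[OF Dc])
  have near: "dist x y \<le> c * crad V x" "w y = D y" if "norm x \<le> R + 1" "norm (x - y) \<le> 2 * e" for x y
  proof -
    have "2 * e \<le> c * crad V x" by (rule order_trans[OF e(3) mult_left_mono]) (use b(2)[of x] c that(1) in simp_all)
    then show "dist x y \<le> c * crad V x" using that(2) by (simp add: dist_norm)
    have "norm y \<le> norm x + norm (x - y)" using norm_triangle_sub[of y x] by (simp add: norm_minus_commute)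
    then show "w y = D y" using that e(2) by (simp add: w_def)
  qed
  have lip: "\<bar>D y - D z\<bar> \<le> \<Gamma> / crad V x * norm (y - z)"
    if "norm x \<le> R + 1" "norm (x - y) \<le> 2 * e" "norm (x - z) \<le> 2 * e" for x y z
    unfolding D_def by (rule agmon_dist_lipschitz[OF rh np W sv G near(1)[OF that(1,2)] near(1)[OF that(1,3)]])
  have close: "\<bar>mollify \<rho> w x - D x\<bar> \<le> L" if x: "norm x \<le> R + 1" for x
  proof -
    have wb: "\<bar>w y - D x\<bar> \<le> L" if y: "norm (x - y) < e" for y
    proof -
      have "\<bar>w y - D x\<bar> \<le> \<Gamma> / crad V x * norm (y - x)" using near(2)[OF x, of y] lip[OF x, of y x] y e(1) by simp
      also have "\<dots> \<le> \<Gamma> / b * e"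
        using b(1) b(2)[of x] x y G crad_pos[OF rh np, of x] e(1)
        by (intro mult_mono divide_left_mono) (auto simp: norm_minus_commute)
      finally show ?thesis using e4 by linarith
    qed
    have "D x - L \<le> w y" "w y \<le> D x + L" if "norm (x - y) < e" for y using wb[OF that] by linarith+
    then have "D x - L \<le> mollify \<rho> w x" "mollify \<rho> w x \<le> D x + L"
      using mollify_bounds[OF m wi, of x "D x - L" "D x + L"] by blast+
    then show ?thesis by linarith
  qed
  have gr: "norm (grad (mollify \<rho> w) x) \<le> \<Gamma> / crad V x" if x: "norm x \<le> R + 1" for x
  proof (rule grad_mollify_le[OF m wi e(1)])
    fix y h :: "real^'n" assume y: "norm (x - y) < e" and h: "norm h < e"
    have "norm (x - (y + h)) \<le> norm (x - y) + norm h"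
      using norm_triangle_ineq4[of "x - y" h] by (simp add: algebra_simps)
    then have 2: "norm (x - (y + h)) \<le> 2 * e" "norm (x - y) \<le> 2 * e" using y h e(1) by linarith+
    show "\<bar>w (y + h) - w y\<bar> \<le> \<Gamma> / crad V x * norm h"
      using lip[OF x 2] near(2)[OF x 2(1)] near(2)[OF x 2(2)] by simp
  qed
  have "smooth (mollify \<rho> w)" by (rule smooth_mollify[OF mollifier_test_function[OF m] wi])
  then show ?thesis using that[of "mollify \<rho> w"] close gr unfolding D_def by blast
qed

section \<open>Exponential decay of the energy\<close>

lemma grad_cmult:
  assumes "smooth f"
  shows "grad (\<lambda>x. c * f x) x = c *\<^sub>R grad f x"
proof (rule grad_unique)
  show "((\<lambda>x. c * f x) has_derivative (\<bullet>) (c *\<^sub>R grad f x)) (at x)"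
    using has_derivative_mult_right[OF smooth_has_derivative[OF assms], of c x]
    by (rule has_derivative_eq_rhs) (simp add: fun_eq_iff)
qed

text \<open>Finiteness of X is essential: for infinite X the second assumption says nothing.\<close>

lemma ennreal_absorb:
  fixes X S :: ennreal
  assumes "X < top" "X \<le> S + ennreal (1/2) * X"
  shows "X \<le> 2 * S"
proof (cases S)
  case (real s)
  obtain x where x: "x \<ge> 0" "X = ennreal x" using assms(1) by (cases X) auto
  have "ennreal (s + 1/2 * x) = ennreal s + ennreal (1/2) * ennreal x"
    using x real by (subst ennreal_plus) (auto simp only: ennreal_mult' zero_le_mult_iff)
  then have "ennreal x \<le> ennreal (s + 1/2 * x)" using assms(2) x real by simp
  moreover have "s + 1/2 * x \<ge> 0" using x real by simp
  ultimately have "x \<le> s + 1/2 * x" by (simp only: ennreal_le_iff)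
  then have "ennreal x \<le> ennreal (2 * s)" by (intro ennreal_leI) simp
  then show ?thesis using x real by (simp add: ennreal_mult)
next
  case top
  then show ?thesis by (simp add: ennreal_mult_top)
qed

text \<open>The gradient of \<eta> lives in the annulus and has norm at most 2, whence 8 as twice 4;
  exchanging g for D in the squared exponential costs exp 2. The gradient of g produces the term
  with \<gamma>^2 \<Gamma>^2 / r^2.\<close>

lemma weighted_gradient_bound:
  fixes \<eta> g v D r :: "real^'n \<Rightarrow> real"
  assumes e: "smooth \<eta>" and g: "smooth g" and gam: "\<gamma> \<ge> 0"
    and eg: "norm (grad \<eta> x) \<le> 2" and e0: "norm x \<le> R \<or> norm x \<ge> R + 1 \<Longrightarrow> grad \<eta> x = 0"
    and e1: "norm x \<ge> R + 1 \<Longrightarrow> \<eta> x = 0"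
    and gD: "norm x \<le> R + 1 \<Longrightarrow> \<gamma> * \<bar>g x - D x\<bar> \<le> 1" and gg: "norm x \<le> R + 1 \<Longrightarrow> norm (grad g x) \<le> \<Gamma> / r x"
  shows "(v x)\<^sup>2 * (norm (grad (\<lambda>x. \<eta> x * exp (- \<gamma> * g x)) x))\<^sup>2
    \<le> 8 * exp 2 * (indicator {x. R < norm x \<and> norm x < R + 1} x * ((v x)\<^sup>2 * exp (- 2 * \<gamma> * D x)))
      + 2 * \<gamma>\<^sup>2 * \<Gamma>\<^sup>2 * ((\<eta> x * exp (- \<gamma> * g x) * v x)\<^sup>2 / (r x)\<^sup>2)"
proof -
  define a where "a = exp (- \<gamma> * g x)"
  define I where "I = (indicator {x. R < norm x \<and> norm x < R + 1} x :: real)"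
  have sg: "smooth (\<lambda>x. - \<gamma> * g x)" by (intro smooth_mult smooth_const g)
  have G: "grad (\<lambda>x. \<eta> x * exp (- \<gamma> * g x)) x = (\<eta> x * a * - \<gamma>) *\<^sub>R grad g x + a *\<^sub>R grad \<eta> x"
    unfolding grad_mult[OF e smooth_exp[OF sg]] grad_exp[OF sg] grad_cmult[OF g] a_def by simp
  have "(norm (grad (\<lambda>x. \<eta> x * exp (- \<gamma> * g x)) x))\<^sup>2 \<le> 2 * (norm ((\<eta> x * a * - \<gamma>) *\<^sub>R grad g x))\<^sup>2 + 2 * (norm (a *\<^sub>R grad \<eta> x))\<^sup>2"
    unfolding G by (rule norm_add_square_le)
  also have "\<dots> = 2 * \<gamma>\<^sup>2 * ((\<eta> x * a)\<^sup>2 * (norm (grad g x))\<^sup>2) + 2 * (a\<^sup>2 * (norm (grad \<eta> x))\<^sup>2)"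
    by (simp add: power_mult_distrib)
  also have "\<dots> \<le> 2 * \<gamma>\<^sup>2 * ((\<eta> x * a)\<^sup>2 * (\<Gamma>\<^sup>2 / (r x)\<^sup>2)) + 2 * (exp 2 * exp (- 2 * \<gamma> * D x) * (4 * I))"
  proof (rule add_mono; rule mult_left_mono)
    show "(\<eta> x * a)\<^sup>2 * (norm (grad g x))\<^sup>2 \<le> (\<eta> x * a)\<^sup>2 * (\<Gamma>\<^sup>2 / (r x)\<^sup>2)"
    proof (cases "norm x \<le> R + 1")
      case True
      then have "(norm (grad g x))\<^sup>2 \<le> (\<Gamma> / r x)\<^sup>2" using gg by (intro power_mono) auto
      then show ?thesis by (intro mult_left_mono) (simp_all add: power_divide)
    qed (simp add: e1)
    show "a\<^sup>2 * (norm (grad \<eta> x))\<^sup>2 \<le> exp 2 * exp (- 2 * \<gamma> * D x) * (4 * I)"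
    proof (cases "R < norm x \<and> norm x < R + 1")
      case True
      then have "\<gamma> * D x - \<gamma> * g x \<le> \<gamma> * \<bar>g x - D x\<bar>"
        using gam by (simp add: right_diff_distrib[symmetric] mult_left_mono)
      then have "- 2 * \<gamma> * g x \<le> 2 + - 2 * \<gamma> * D x" using gD True by simp
      then have "exp (- 2 * \<gamma> * g x) \<le> exp (2 + - 2 * \<gamma> * D x)" by (simp only: exp_le_cancel_iff)
      moreover have "a\<^sup>2 = exp (- 2 * \<gamma> * g x)" by (simp add: a_def power2_eq_square exp_add[symmetric])
      ultimately have A: "a\<^sup>2 \<le> exp 2 * exp (- 2 * \<gamma> * D x)" by (simp only: exp_add)
      have "(norm (grad \<eta> x))\<^sup>2 \<le> 2\<^sup>2" using eg by (intro power_mono) auto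
      then have "a\<^sup>2 * (norm (grad \<eta> x))\<^sup>2 \<le> exp 2 * exp (- 2 * \<gamma> * D x) * 4" using A by (intro mult_mono) auto
      then show ?thesis using True by (simp add: I_def)
    next
      case False
      then show ?thesis using e0 by (simp add: I_def not_less)
    qed
  qed auto
  finally have "(v x)\<^sup>2 * (norm (grad (\<lambda>x. \<eta> x * exp (- \<gamma> * g x)) x))\<^sup>2
    \<le> (v x)\<^sup>2 * (2 * \<gamma>\<^sup>2 * ((\<eta> x * a)\<^sup>2 * (\<Gamma>\<^sup>2 / (r x)\<^sup>2)) + 2 * (exp 2 * exp (- 2 * \<gamma> * D x) * (4 * I)))"
    by (intro mult_left_mono) auto
  also have "\<dots> = 8 * exp 2 * (I * ((v x)\<^sup>2 * exp (- 2 * \<gamma> * D x))) + 2 * \<gamma>\<^sup>2 * \<Gamma>\<^sup>2 * ((\<eta> x * a * v x)\<^sup>2 / (r x)\<^sup>2)"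
    by (simp add: power_mult_distrib algebra_simps)
  finally show ?thesis by (simp only: a_def I_def)
qed

text \<open>The cutoff term brings 8 exp 2, absorption doubles it, and the outer exp 2 is the price
  of returning from g to the distance inside B_R. The factor 1/r^2 stays on the left; being
  positive, it does no harm to the conclusion u = 0.\<close>

lemma exponential_decay:
  fixes A :: "real^'n \<Rightarrow> real^'n^'n" and V W :: "real^'n \<Rightarrow> real"
  assumes l: "0 < lam" "lam \<le> 1" and ell: "bounded_elliptic lam Lam A" and sol: "weak_solution A W u"
    and W: "W \<in> borel_measurable lebesgue" "AE x in lebesgue. W x = V x"
    and rh: "rh_weight p C V" and np: "real CARD('n) \<le> 2 * p"
    and v: "sobolev_loc v G" "AE x in lebesgue. u x = v x" "AE x in lebesgue. weak_grad u x = G x"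
    "weak_grad u \<in> borel_measurable lebesgue"
    and sv: "\<And>x z. dist x z \<le> c * crad V x \<Longrightarrow> crad V x \<le> \<Gamma> * crad V z" and G: "\<Gamma> \<ge> 1" and c: "c > 0"
    and K: "K \<ge> 0"
    and fp: "\<And>f. test_function f \<Longrightarrow>
      (\<integral>\<^sup>+x. ennreal ((f x)\<^sup>2 / (crad V x)\<^sup>2) \<partial>lborel)
        \<le> ennreal K * ((\<integral>\<^sup>+x. ennreal ((norm (grad f x))\<^sup>2) \<partial>lborel) + (\<integral>\<^sup>+x. ennreal (V x * (f x)\<^sup>2) \<partial>lborel))"
    and Q: "Q = 2 * K * (4 / lam * (2 * Lam\<^sup>2 / lam + lam / 2))"
    and gam: "\<gamma> \<ge> 0" "Q * (2 * \<gamma>\<^sup>2 * \<Gamma>\<^sup>2) \<le> 1/2" and R: "R > 0"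
  shows "(\<integral>\<^sup>+x. ennreal (indicator (ball 0 R) x * ((v x)\<^sup>2 * exp (- 2 * \<gamma> * agmon_dist W x 0) / (crad V x)\<^sup>2)) \<partial>lborel)
    \<le> ennreal (exp 2 * (16 * Q * exp 2)) *
      (\<integral>\<^sup>+x. ennreal (indicator {x. R < norm x \<and> norm x < R + 1} x * ((v x)\<^sup>2 * exp (- 2 * \<gamma> * agmon_dist W x 0))) \<partial>lborel)"
    (is "?L \<le> _ * ?A")
proof -
  have vm: "v \<in> borel_measurable borel" and Gm: "G \<in> borel_measurable borel" using v(1) by (simp_all add: sobolev_loc_def)
  have Vb: "V \<in> borel_measurable borel" by (rule rh_borel[OF rh])
  have am: "agmon_m W x = 1 / crad V x" for x by (rule agmon_m_eq[OF Vb W])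
  have cp: "crad V x > 0" for x by (rule crad_pos[OF rh np])
  have cb: "crad V \<in> borel_measurable borel" by (rule crad_borel[OF rh np])
  define D where "D = (\<lambda>x. agmon_dist W x 0)"
  have "continuous_on UNIV D" unfolding D_def by (rule agmon_dist_continuous[OF rh np am sv G c])
  then have Db: "D \<in> borel_measurable borel" by (rule borel_measurable_continuous_onI)
  \<comment> \<open>The tolerance 1 / (\<gamma> + 1) gives \<gamma> |g - D| \<le> 1 and is still
    finite at \<gamma> = 0.\<close>
  obtain g where g: "smooth g" "\<And>x. norm x \<le> R + 1 \<Longrightarrow> \<bar>g x - D x\<bar> \<le> 1 / (\<gamma> + 1)"
    "\<And>x. norm x \<le> R + 1 \<Longrightarrow> norm (grad g x) \<le> \<Gamma> / crad V x"
    unfolding D_def by (rule agmon_dist_regularization[OF rh np am sv G c, of "1 / (\<gamma> + 1)" R]) (use gam in auto)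
  have gD: "\<gamma> * \<bar>g x - D x\<bar> \<le> 1" if "norm x \<le> R + 1" for x
  proof -
    have "\<gamma> * \<bar>g x - D x\<bar> \<le> \<gamma> * (1 / (\<gamma> + 1))" using g(2)[OF that] gam(1) by (rule mult_left_mono)
    also have "\<dots> \<le> 1" using gam(1) by simp
    finally show ?thesis .
  qed
  obtain \<eta> :: "real^'n \<Rightarrow> real" where e: "test_function \<eta>" "\<And>x. 0 \<le> \<eta> x" "\<And>x. \<eta> x \<le> 1"
    "\<And>x. norm x \<le> R \<Longrightarrow> \<eta> x = 1" "\<And>x. norm x \<ge> R + 1 \<Longrightarrow> \<eta> x = 0" "\<And>x. norm (grad \<eta> x) \<le> 2"
    "\<And>x. norm x \<le> R \<or> norm x \<ge> R + 1 \<Longrightarrow> grad \<eta> x = 0"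
    using cutoff_exists[OF R, where 'n = 'n] by blast
  have sm: "smooth (\<lambda>x. exp (- \<gamma> * g x))" by (intro smooth_exp smooth_mult smooth_const g)
  define \<psi> where "\<psi> = (\<lambda>x. \<eta> x * exp (- \<gamma> * g x))"
  have t: "test_function \<psi>" unfolding \<psi>_def by (rule test_function_mult[OF e(1) sm])
  have z: "\<psi> x = 0" "grad \<psi> x = 0" if "norm x > R + 1" for x
    using that e(5,7)[of x] unfolding \<psi>_def grad_mult[OF test_function_smooth[OF e(1)] sm] by simp_all
  have \<psi>b: "\<psi> \<in> borel_measurable borel" "grad \<psi> \<in> borel_measurable borel"
    using test_function_smooth[OF t] by (simp_all add: smooth_borel smooth_grad_borel)
  have sc: "sobolev_compact (R + 1) (\<lambda>x. \<psi> x * v x) (\<lambda>x. \<psi> x *\<^sub>R G x + v x *\<^sub>R grad \<psi> x)"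
    by (rule sobolev_loc_mult[OF v(1) t z])
  have R1: "R + 1 > 0" using R by simp
  define X where "X = (\<integral>\<^sup>+x. ennreal ((\<psi> x * v x)\<^sup>2 / (crad V x)\<^sup>2) \<partial>lborel)"
  define K1 where "K1 = 4 / lam * (2 * Lam\<^sup>2 / lam + lam / 2)"
  have K1: "K1 \<ge> 0" using l by (simp add: K1_def)
  have Q1: "Q = 2 * K * K1" by (simp only: Q K1_def)
  then have Q0: "Q \<ge> 0" using K K1 by simp
  have "X \<le> ennreal (2 * K) * ((\<integral>\<^sup>+x. ennreal ((norm (\<psi> x *\<^sub>R G x + v x *\<^sub>R grad \<psi> x))\<^sup>2) \<partial>lborel) + (\<integral>\<^sup>+x. ennreal (V x * (\<psi> x * v x)\<^sup>2) \<partial>lborel))"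
    unfolding X_def by (rule sobolev_fefferman_phong[OF rh np R1 sc K fp])
  also have "\<dots> \<le> ennreal (2 * K) * (ennreal K1 * (\<integral>\<^sup>+x. ennreal ((v x)\<^sup>2 * (norm (grad \<psi> x))\<^sup>2) \<partial>lborel))"
    unfolding K1_def by (intro mult_left_mono energy_inequality[OF l ell sol W rh np v t R1 z]) auto
  also have "\<dots> = ennreal Q * (\<integral>\<^sup>+x. ennreal ((v x)\<^sup>2 * (norm (grad \<psi> x))\<^sup>2) \<partial>lborel)"
    using K K1 by (simp add: Q1 ennreal_mult mult.assoc)
  also have "(\<integral>\<^sup>+x. ennreal ((v x)\<^sup>2 * (norm (grad \<psi> x))\<^sup>2) \<partial>lborel) \<le> ennreal (8 * exp 2) * ?A + ennreal (2 * \<gamma>\<^sup>2 * \<Gamma>\<^sup>2) * X"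
  proof -
    have i: "(indicator {x::real^'n. R < norm x \<and> norm x < R + 1} :: _ \<Rightarrow> real) \<in> borel_measurable borel"
      by (intro borel_measurable_indicator borel_open open_Collect_conj open_Collect_less continuous_intros)
    have m1: "(\<lambda>x. indicator {x. R < norm x \<and> norm x < R + 1} x * ((v x)\<^sup>2 * exp (- 2 * \<gamma> * D x))) \<in> borel_measurable lborel"
      using i vm Db by simp
    have m2: "(\<lambda>x. (\<psi> x * v x)\<^sup>2 / (crad V x)\<^sup>2) \<in> borel_measurable lborel" using \<psi>b vm cb by simp
    have "(\<integral>\<^sup>+x. ennreal ((v x)\<^sup>2 * (norm (grad \<psi> x))\<^sup>2) \<partial>lborel)
      \<le> (\<integral>\<^sup>+x. ennreal (8 * exp 2) * ennreal (indicator {x. R < norm x \<and> norm x < R + 1} x * ((v x)\<^sup>2 * exp (- 2 * \<gamma> * D x)))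
          + ennreal (2 * \<gamma>\<^sup>2 * \<Gamma>\<^sup>2) * ennreal ((\<psi> x * v x)\<^sup>2 / (crad V x)\<^sup>2) \<partial>lborel)"
    proof (rule nn_integral_mono)
      fix x
      have "(v x)\<^sup>2 * (norm (grad \<psi> x))\<^sup>2
        \<le> 8 * exp 2 * (indicator {x. R < norm x \<and> norm x < R + 1} x * ((v x)\<^sup>2 * exp (- 2 * \<gamma> * D x)))
          + 2 * \<gamma>\<^sup>2 * \<Gamma>\<^sup>2 * ((\<psi> x * v x)\<^sup>2 / (crad V x)\<^sup>2)"
        unfolding \<psi>_def
        by (rule weighted_gradient_bound[OF test_function_smooth[OF e(1)] g(1) gam(1) e(6) e(7) e(5) gD g(3)])
      then show "ennreal ((v x)\<^sup>2 * (norm (grad \<psi> x))\<^sup>2)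
        \<le> ennreal (8 * exp 2) * ennreal (indicator {x. R < norm x \<and> norm x < R + 1} x * ((v x)\<^sup>2 * exp (- 2 * \<gamma> * D x)))
          + ennreal (2 * \<gamma>\<^sup>2 * \<Gamma>\<^sup>2) * ennreal ((\<psi> x * v x)\<^sup>2 / (crad V x)\<^sup>2)"
        by (simp add: ennreal_mult'[symmetric] ennreal_plus[symmetric] ennreal_leI del: ennreal_plus)
    qed
    also have "\<dots> = ennreal (8 * exp 2) * (\<integral>\<^sup>+x. ennreal (indicator {x. R < norm x \<and> norm x < R + 1} x * ((v x)\<^sup>2 * exp (- 2 * \<gamma> * D x))) \<partial>lborel)
      + ennreal (2 * \<gamma>\<^sup>2 * \<Gamma>\<^sup>2) * X"
      unfolding X_def using m1 m2 by (subst nn_integral_add) (auto simp: nn_integral_cmult)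
    finally show ?thesis by (simp only: D_def)
  qed
  finally have "X \<le> ennreal Q * (ennreal (8 * exp 2) * ?A + ennreal (2 * \<gamma>\<^sup>2 * \<Gamma>\<^sup>2) * X)"
    by (simp add: mult_left_mono)
  also have "\<dots> = ennreal (8 * Q * exp 2) * ?A + ennreal (Q * (2 * \<gamma>\<^sup>2 * \<Gamma>\<^sup>2)) * X"
    using Q0 by (simp add: distrib_left ennreal_mult mult_ac)
  also have "\<dots> \<le> ennreal (8 * Q * exp 2) * ?A + ennreal (1/2) * X"
    by (intro add_left_mono mult_right_mono ennreal_leI gam(2)) auto
  finally have X1: "X \<le> ennreal (8 * Q * exp 2) * ?A + ennreal (1/2) * X" .
  \<comment> \<open>X is finite because \<psi> v is square integrable and r is bounded below on its
    support. The absorption rests on this.\<close>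
  have "X < top"
  proof -
    obtain b where b: "b > 0" "\<And>x. norm x \<le> R + 1 \<Longrightarrow> crad V x \<ge> b"
      using crad_locally_bounded_below[OF rh np, where M = "R + 1"] by blast
    have "X \<le> (\<integral>\<^sup>+x. ennreal (1 / b\<^sup>2 * (\<psi> x * v x)\<^sup>2) \<partial>lborel)"
      unfolding X_def
    proof (intro nn_integral_mono ennreal_leI)
      fix x
      show "(\<psi> x * v x)\<^sup>2 / (crad V x)\<^sup>2 \<le> 1 / b\<^sup>2 * (\<psi> x * v x)\<^sup>2"
      proof (cases "norm x \<le> R + 1")
        case True
        then have "b\<^sup>2 \<le> (crad V x)\<^sup>2" using b by (intro power_mono) auto
        then have "(\<psi> x * v x)\<^sup>2 / (crad V x)\<^sup>2 \<le> (\<psi> x * v x)\<^sup>2 / b\<^sup>2" using b(1) cp[of x] by (intro divide_left_mono) auto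
        then show ?thesis by simp
      qed (simp add: z)
    qed
    also have "\<dots> = ennreal (LINT x|lborel. 1 / b\<^sup>2 * (\<psi> x * v x)\<^sup>2)"
      using sc by (intro nn_integral_eq_integral integrable_mult_right) (simp_all add: sobolev_compact_def)
    finally show ?thesis using ennreal_less_top by (rule le_less_trans)
  qed
  from ennreal_absorb[OF this X1] have X2: "X \<le> 2 * (ennreal (8 * Q * exp 2) * ?A)" .
  have "?L \<le> (\<integral>\<^sup>+x. ennreal (exp 2) * ennreal ((\<psi> x * v x)\<^sup>2 / (crad V x)\<^sup>2) \<partial>lborel)"
  proof (rule nn_integral_mono)
    fix x
    have "indicator (ball 0 R) x * ((v x)\<^sup>2 * exp (- 2 * \<gamma> * D x) / (crad V x)\<^sup>2) \<le> exp 2 * ((\<psi> x * v x)\<^sup>2 / (crad V x)\<^sup>2)"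
    proof (cases "x \<in> ball 0 R")
      case True
      then have n: "norm x \<le> R" by simp
      have "\<gamma> * g x - \<gamma> * D x \<le> \<gamma> * \<bar>g x - D x\<bar>"
        using gam(1) by (simp add: right_diff_distrib[symmetric] mult_left_mono)
      then have "- 2 * \<gamma> * D x \<le> 2 + - 2 * \<gamma> * g x" using gD[of x] n by simp
      then have "exp (- 2 * \<gamma> * D x) \<le> exp (2 + - 2 * \<gamma> * g x)" by (simp only: exp_le_cancel_iff)
      moreover have "(\<psi> x)\<^sup>2 = exp (- 2 * \<gamma> * g x)" using e(4)[OF n] by (simp add: \<psi>_def power2_eq_square exp_add[symmetric])
      ultimately have "exp (- 2 * \<gamma> * D x) \<le> exp 2 * (\<psi> x)\<^sup>2" by (simp only: exp_add)
      then have "(v x)\<^sup>2 * exp (- 2 * \<gamma> * D x) / (crad V x)\<^sup>2 \<le> (v x)\<^sup>2 * (exp 2 * (\<psi> x)\<^sup>2) / (crad V x)\<^sup>2"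
        by (intro divide_right_mono mult_left_mono) auto
      then show ?thesis using True by (simp add: power_mult_distrib mult_ac)
    qed simp
    then show "ennreal (indicator (ball 0 R) x * ((v x)\<^sup>2 * exp (- 2 * \<gamma> * agmon_dist W x 0) / (crad V x)\<^sup>2))
        \<le> ennreal (exp 2) * ennreal ((\<psi> x * v x)\<^sup>2 / (crad V x)\<^sup>2)"
      by (simp add: D_def ennreal_mult'[symmetric] ennreal_leI)
  qed
  also have "\<dots> = ennreal (exp 2) * X"
    unfolding X_def using \<psi>b vm cb by (intro nn_integral_cmult) simp
  also have "\<dots> \<le> ennreal (exp 2) * (2 * (ennreal (8 * Q * exp 2) * ?A))" by (intro mult_left_mono X2) simp
  also have "\<dots> = ennreal (exp 2 * (16 * Q * exp 2)) * ?A"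
  proof -
    have "ennreal (exp 2 * (16 * Q * exp 2)) = ennreal (exp 2 * (2 * (8 * Q * exp 2)))" by (simp add: mult.assoc)
    also have "\<dots> = ennreal (exp 2) * (ennreal 2 * ennreal (8 * Q * exp 2))"
      using Q0 by (simp only: ennreal_mult' exp_ge_zero zero_le_numeral)
    finally have "ennreal (exp 2 * (16 * Q * exp 2)) = ennreal (exp 2) * (2 * ennreal (8 * Q * exp 2))" by simp
    then show ?thesis by (simp only: mult.assoc)
  qed
  finally show ?thesis .
qed

section \<open>From the annulus condition to vanishing\<close>

lemma annulus_norm: "R > 0 \<Longrightarrow> annulus R S = {x::real^'n. R < norm x \<and> norm x < S}"
  by (auto simp: annulus_def)

text \<open>Since the distance is nonnegative, raising a negative \<gamma> to 0 only lowers the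
  weight. The integral on the right is genuine, because u^2 times a continuous weight is integrable
  on a bounded annulus; a default value 0 would carry no information.\<close>

lemma weighted_annulus_integral:
  fixes u v :: "real^'n \<Rightarrow> real"
  assumes u: "H1_loc u" and v: "sobolev_loc v G" "AE x in lebesgue. u x = v x"
    and D: "continuous_on UNIV D" "\<And>x. D x \<ge> 0" and R: "R > 0"
  shows "(\<integral>\<^sup>+x. ennreal (indicator {x. R < norm x \<and> norm x < R + 1} x * ((v x)\<^sup>2 * exp (- 2 * max \<gamma> 0 * D x))) \<partial>lborel)
    \<le> ennreal (LINT x:annulus R (R + 1)|lebesgue. \<bar>u x\<bar>\<^sup>2 * exp (- 2 * \<gamma> * D x))"
proof -
  define S where "S = {x::real^'n. R < norm x \<and> norm x < R + 1}"
  have Sb: "S \<in> sets borel"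
    unfolding S_def by (intro borel_open open_Collect_conj open_Collect_less continuous_intros)
  have vm: "v \<in> borel_measurable borel" and vi: "\<And>M. set_integrable lborel (cball 0 M) (\<lambda>x. (v x)\<^sup>2)"
    using v(1) by (simp_all add: sobolev_loc_def)
  have um: "u \<in> borel_measurable lebesgue" using u unfolding H1_loc_def Lp_loc_2_iff by blast
  have Db: "D \<in> borel_measurable borel" using D(1) by (rule borel_measurable_continuous_onI)
  have im: "(\<lambda>x. indicator S x *\<^sub>R ((v x)\<^sup>2 * exp (- 2 * \<gamma> * D x))) \<in> borel_measurable lborel"
    using Sb vm Db by simp
  have "compact ((\<lambda>x. exp (- 2 * \<gamma> * D x)) ` cball 0 (R + 1))"
    by (intro compact_continuous_image compact_cball continuous_intros continuous_on_subset[OF D(1)]) simp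
  from compact_imp_bounded[OF this] obtain B where "\<forall>y\<in>(\<lambda>x. exp (- 2 * \<gamma> * D x)) ` cball 0 (R + 1). \<bar>y\<bar> \<le> B"
    unfolding bounded_real by blast
  then have B: "exp (- 2 * \<gamma> * D x) \<le> B" if "x \<in> cball 0 (R + 1)" for x
    using that by (force simp: abs_le_iff)
  have i: "integrable lborel (\<lambda>x. indicator S x *\<^sub>R ((v x)\<^sup>2 * exp (- 2 * \<gamma> * D x)))"
  proof (rule Bochner_Integration.integrable_bound)
    show "integrable lborel (\<lambda>x. B * (indicator (cball 0 (R + 1)) x *\<^sub>R (v x)\<^sup>2))"
      using vi[of "R + 1"] by (intro integrable_mult_right) (simp add: set_integrable_def)
    show "AE x in lborel. norm (indicator S x *\<^sub>R ((v x)\<^sup>2 * exp (- 2 * \<gamma> * D x))) \<le> norm (B * (indicator (cball 0 (R + 1)) x *\<^sub>R (v x)\<^sup>2))"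
    proof (rule AE_I2)
      fix x
      show "norm (indicator S x *\<^sub>R ((v x)\<^sup>2 * exp (- 2 * \<gamma> * D x))) \<le> norm (B * (indicator (cball 0 (R + 1)) x *\<^sub>R (v x)\<^sup>2))"
      proof (cases "x \<in> S")
        case True
        then have x: "x \<in> cball 0 (R + 1)" by (simp add: S_def)
        have "(v x)\<^sup>2 * exp (- 2 * \<gamma> * D x) \<le> (v x)\<^sup>2 * \<bar>B\<bar>" using B[OF x] by (intro mult_left_mono) auto
        then show ?thesis using True x by (simp add: abs_mult mult.commute)
      qed simp
    qed
  qed (rule im)
  have "(\<integral>\<^sup>+x. ennreal (indicator {x. R < norm x \<and> norm x < R + 1} x * ((v x)\<^sup>2 * exp (- 2 * max \<gamma> 0 * D x))) \<partial>lborel)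
    \<le> (\<integral>\<^sup>+x. ennreal (indicator S x *\<^sub>R ((v x)\<^sup>2 * exp (- 2 * \<gamma> * D x))) \<partial>lborel)"
  proof (intro nn_integral_mono ennreal_leI)
    fix x
    have "\<gamma> * D x \<le> max \<gamma> 0 * D x" using D(2) by (intro mult_right_mono) auto
    then show "indicator {x. R < norm x \<and> norm x < R + 1} x * ((v x)\<^sup>2 * exp (- 2 * max \<gamma> 0 * D x)) \<le> indicator S x *\<^sub>R ((v x)\<^sup>2 * exp (- 2 * \<gamma> * D x))"
      unfolding S_def real_scaleR_def by (intro mult_left_mono) auto
  qed
  also have "\<dots> = ennreal (LINT x|lborel. indicator S x *\<^sub>R ((v x)\<^sup>2 * exp (- 2 * \<gamma> * D x)))"
    by (rule nn_integral_eq_integral[OF i]) simp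
  also have "(LINT x|lborel. indicator S x *\<^sub>R ((v x)\<^sup>2 * exp (- 2 * \<gamma> * D x)))
    = (LINT x|lebesgue. indicator S x *\<^sub>R ((v x)\<^sup>2 * exp (- 2 * \<gamma> * D x)))"
    by (rule integral_completion[OF im, symmetric])
  also have "\<dots> = (LINT x|lebesgue. indicator S x *\<^sub>R (\<bar>u x\<bar>\<^sup>2 * exp (- 2 * \<gamma> * D x)))"
  proof (rule integral_cong_AE)
    have Dl: "D \<in> borel_measurable lebesgue" by (rule lebesgue_measurable_borel[OF Db])
    show "(\<lambda>x. indicator S x *\<^sub>R ((v x)\<^sup>2 * exp (- 2 * \<gamma> * D x))) \<in> borel_measurable lebesgue"
      using im by (intro lebesgue_measurable_borel) simp
    have "(indicator S :: _ \<Rightarrow> real) \<in> borel_measurable lebesgue" using Sb by (intro borel_measurable_indicator) simp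
    then show "(\<lambda>x. indicator S x *\<^sub>R (\<bar>u x\<bar>\<^sup>2 * exp (- 2 * \<gamma> * D x))) \<in> borel_measurable lebesgue"
      using um Dl by simp
    show "AE x in lebesgue. indicator S x *\<^sub>R ((v x)\<^sup>2 * exp (- 2 * \<gamma> * D x)) = indicator S x *\<^sub>R (\<bar>u x\<bar>\<^sup>2 * exp (- 2 * \<gamma> * D x))"
      using v(2) by eventually_elim simp
  qed
  finally show ?thesis by (simp only: set_lebesgue_integral_def annulus_norm[OF R] S_def)
qed

theorem theorem1p1:
  fixes lam Lam C_V :: real and p :: ereal
  assumes "0 < lam" and "lam \<le> 1" and "1 \<le> Lam"
    and "p \<ge> ereal (real CARD('n::finite) / 2)" and "p > 1"
  shows "\<exists>\<gamma>0>0. \<forall>(A :: real^'n \<Rightarrow> real^'n^'n) (V :: real^'n \<Rightarrow> real) (u :: real^'n \<Rightarrow> real)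
            (R :: nat \<Rightarrow> real) (\<gamma> :: real).
           bounded_elliptic lam Lam A \<and> reverse_holder p C_V V \<and> weak_solution A V u \<and>
           incseq R \<and> \<not> bdd_above (range R) \<and> (\<forall>j. R j > 0) \<and> \<gamma> < \<gamma>0 \<and>
           (\<lambda>j. LINT x:annulus (R j) (R j + 1)|lebesgue.
                   \<bar>u x\<bar>\<^sup>2 * exp (- 2 * \<gamma> * agmon_dist V x 0)) \<longlonglongrightarrow> 0
           \<longrightarrow> (AE x in lebesgue. u x = 0)"
proof -
  \<comment> \<open>Everything up to \<open>\<gamma>0\<close> is determined by n, p, C_V and the
    ellipticity constants; A, the potential and u appear only afterwards.\<close>
  define q where "q = rh_exponent TYPE('n) p"
  define C where "C = max 1 C_V"
  have q: "q > 1" and np: "real CARD('n) \<le> 2 * q" using rh_exponent[OF assms(4,5)] by (simp_all add: q_def)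
  have C: "C \<ge> 1" by (simp add: C_def)
  define c where "c = shell TYPE('n) q C"
  have c: "c > 0" using shell_bounds(1)[OF q C, where 'n = 'n] by (simp add: c_def)
  obtain \<Gamma> where G: "\<Gamma> \<ge> 1" and sv: "\<And>V x z. rh_weight q C (V :: real^'n \<Rightarrow> real) \<Longrightarrow> dist x z \<le> shell TYPE('n) q C * crad V x \<Longrightarrow>
       crad V z \<le> \<Gamma> * crad V x \<and> crad V x \<le> \<Gamma> * crad V z"
    using crad_slow_variation[OF q C np] by blast
  obtain K where K: "K \<ge> 1" and fp: "\<And>V f. rh_weight q C (V :: real^'n \<Rightarrow> real) \<Longrightarrow> test_function f \<Longrightarrow>
      (\<integral>\<^sup>+x. ennreal ((f x)\<^sup>2 / (crad V x)\<^sup>2) \<partial>lborel)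
        \<le> ennreal K * ((\<integral>\<^sup>+x. ennreal ((norm (grad f x))\<^sup>2) \<partial>lborel) + (\<integral>\<^sup>+x. ennreal (V x * (f x)\<^sup>2) \<partial>lborel))"
    using fefferman_phong[OF q C np] by blast
  define Q where "Q = 2 * K * (4 / lam * (2 * Lam\<^sup>2 / lam + lam / 2))"
  have Q: "Q > 0" unfolding Q_def using K assms(1) by (intro mult_pos_pos add_nonneg_pos) auto
  \<comment> \<open>Chosen so that \<open>Q * (2 * \<gamma>0\<^sup>2 * \<Gamma>\<^sup>2)\<close> is
    exactly 1/2, the share that can be absorbed.\<close>
  define \<gamma>0 where "\<gamma>0 = 1 / (2 * \<Gamma> * sqrt Q)"
  have g0: "\<gamma>0 > 0" using G Q by (simp add: \<gamma>0_def)
  have g0Q: "Q * (2 * \<gamma>\<^sup>2 * \<Gamma>\<^sup>2) \<le> 1/2" if "0 \<le> \<gamma>" "\<gamma> \<le> \<gamma>0" for \<gamma>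
  proof -
    have "\<gamma>\<^sup>2 \<le> \<gamma>0\<^sup>2" using that by (intro power_mono)
    then have "Q * (2 * \<gamma>\<^sup>2 * \<Gamma>\<^sup>2) \<le> Q * (2 * \<gamma>0\<^sup>2 * \<Gamma>\<^sup>2)" using Q by (intro mult_left_mono mult_right_mono) auto
    also have "\<dots> = 1/2" using Q G by (simp add: \<gamma>0_def power_divide power_mult_distrib field_simps)
    finally show ?thesis .
  qed
  have main: "AE x in lebesgue. u x = 0"
    if ell: "bounded_elliptic lam Lam A" and rW: "reverse_holder p C_V W" and sol: "weak_solution A W u"
      and R: "incseq R" "\<not> bdd_above (range R)" "\<And>j. R j > 0" and g: "\<gamma> < \<gamma>0"
      and lim: "(\<lambda>j. LINT x:annulus (R j) (R j + 1)|lebesgue. \<bar>u x\<bar>\<^sup>2 * exp (- 2 * \<gamma> * agmon_dist W x 0)) \<longlonglongrightarrow> 0"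
    for A :: "real^'n \<Rightarrow> real^'n^'n" and W u :: "real^'n \<Rightarrow> real" and R :: "nat \<Rightarrow> real" and \<gamma> :: real
  proof -
    obtain V where rh: "rh_weight q C V" and WV: "W \<in> borel_measurable lebesgue" "AE x in lebesgue. W x = V x"
      using reverse_holder_weight[OF assms(4,5) rW] unfolding q_def C_def by blast
    have u: "H1_loc u" using sol by (simp add: weak_solution_def)
    obtain v G where v: "sobolev_loc v G" "AE x in lebesgue. u x = v x" "AE x in lebesgue. weak_grad u x = G x"
      "weak_grad u \<in> borel_measurable lebesgue"
      using H1_loc_representative[OF u] by blast
    have svV: "crad V x \<le> \<Gamma> * crad V z" if "dist x z \<le> c * crad V x" for x z
      using sv[OF rh] that by (simp add: c_def)
    have am: "agmon_m W x = 1 / crad V x" for x by (rule agmon_m_eq[OF rh_borel[OF rh] WV])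
    define D where "D = (\<lambda>x. agmon_dist W x 0)"
    have D: "continuous_on UNIV D" "D x \<ge> 0" for x
      unfolding D_def by (rule agmon_dist_continuous[OF rh np am svV \<open>\<Gamma> \<ge> 1\<close> c]) (simp_all add: agmon_dist_def)
    \<comment> \<open>The weight multiplying v^2 is strictly positive, so h = 0 forces v =
      0.\<close>
    define h where "h = (\<lambda>x. (v x)\<^sup>2 * exp (- 2 * max \<gamma> 0 * D x) / (crad V x)\<^sup>2)"
    define I where "I = (\<lambda>j. LINT x:annulus (R j) (R j + 1)|lebesgue. \<bar>u x\<bar>\<^sup>2 * exp (- 2 * \<gamma> * D x))"
    define B where "B = exp 2 * (16 * Q * exp 2)"
    have B: "B \<ge> 0" using Q by (simp add: B_def)
    have bound: "(\<integral>\<^sup>+x. ennreal (indicator (ball 0 (R j)) x * h x) \<partial>lborel) \<le> ennreal (B * I j)" for j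
    proof -
      have "(\<integral>\<^sup>+x. ennreal (indicator (ball 0 (R j)) x * h x) \<partial>lborel)
        \<le> ennreal B * (\<integral>\<^sup>+x. ennreal (indicator {x. R j < norm x \<and> norm x < R j + 1} x * ((v x)\<^sup>2 * exp (- 2 * max \<gamma> 0 * D x))) \<partial>lborel)"
        unfolding h_def D_def B_def
        using K g g0 by (intro exponential_decay[OF assms(1,2) ell sol WV rh np v svV \<open>\<Gamma> \<ge> 1\<close> c _ fp[OF rh] Q_def _ g0Q R(3)]) auto
      also have "\<dots> \<le> ennreal B * ennreal (I j)"
        unfolding I_def by (intro mult_left_mono weighted_annulus_integral[OF u v(1,2) D R(3)]) simp
      finally show ?thesis using B by (simp add: ennreal_mult')
    qed
    have "(\<lambda>j. B * I j) \<longlonglongrightarrow> B * 0" unfolding I_def D_def by (intro tendsto_intros lim)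
    then have Bl: "(\<lambda>j. ennreal (B * I j)) \<longlonglongrightarrow> 0" using tendsto_ennrealI by fastforce
    have vm: "v \<in> borel_measurable borel" using v(1) by (simp add: sobolev_loc_def)
    have hm: "h \<in> borel_measurable borel"
      unfolding h_def using vm borel_measurable_continuous_onI[OF D(1)] crad_borel[OF rh np] by simp
    have h0: "h x \<ge> 0" for x by (simp add: h_def)
    have "AE x in lborel. \<forall>n::nat. ennreal (indicator (ball 0 (real n)) x * h x) = 0"
      unfolding AE_all_countable
    proof
      fix n :: nat
      \<comment> \<open>For a fixed ball the integral of h is independent of j, while R j eventually
        exceeds its radius; the integral is therefore at most the limit 0 of the bounds.\<close>
      obtain j0 where j0: "real n \<le> R j0" using R(2) by (meson bdd_above.I2 linear)
      have "eventually (\<lambda>j. (\<integral>\<^sup>+x. ennreal (indicator (ball 0 (real n)) x * h x) \<partial>lborel) \<le> ennreal (B * I j)) sequentially"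
        unfolding eventually_sequentially
      proof (intro exI allI impI)
        fix j assume "j0 \<le> j"
        then have n: "real n \<le> R j" using j0 incseqD[OF R(1)] by (meson order_trans)
        have "(\<integral>\<^sup>+x. ennreal (indicator (ball 0 (real n)) x * h x) \<partial>lborel) \<le> (\<integral>\<^sup>+x. ennreal (indicator (ball 0 (R j)) x * h x) \<partial>lborel)"
          using n h0 by (intro nn_integral_mono ennreal_leI mult_right_mono) (auto simp: indicator_def)
        also note bound
        finally show "(\<integral>\<^sup>+x. ennreal (indicator (ball 0 (real n)) x * h x) \<partial>lborel) \<le> ennreal (B * I j)" .
      qed
      then have "(\<integral>\<^sup>+x. ennreal (indicator (ball 0 (real n)) x * h x) \<partial>lborel) \<le> 0"
        by (rule tendsto_lowerbound[OF Bl]) simp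
      then show "AE x in lborel. ennreal (indicator (ball 0 (real n)) x * h x) = 0"
        using hm by (subst nn_integral_0_iff_AE[symmetric]) (auto intro!: measurable_compose[OF _ measurable_ennreal] borel_measurable_times borel_measurable_indicator)
    qed
    then have "AE x in lborel. v x = 0"
    proof eventually_elim
      case (elim x)
      obtain n :: nat where "norm x < real n" using reals_Archimedean2 by blast
      then have "h x = 0" using elim[rule_format, of n] h0[of x] by (simp add: ennreal_eq_0_iff)
      then show ?case using crad_pos[OF rh np, of x] by (simp add: h_def)
    qed
    then have "AE x in lebesgue. v x = 0" by (simp only: AE_completion_iff)
    then show ?thesis using v(2) by eventually_elim simp
  qed
  show ?thesis
    by (intro exI[of _ \<gamma>0] conjI g0 allI impI; (elim conjE)?; rule main) (assumption | erule spec)+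
qed

end
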